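(* There exists a universal constant $C>0$ such that the following holds. Let $a\in(0,1)$ and let $f:[0,1]^d\to\mathbb{R}$ be Lipschitz with $1-a\le f\le1+a$ and $\int_{[0,1]^d}f\,dx=1$. Define the probability measures $d\mu=f\,dx$ and $d\mu^*=f^*\,dx$ on $[0,1]^d$. Then \[ W_2^2(\mu\to\mu^* )\le\frac{C(1+a)^2}{(1-a)^3}\int_{[0,1]^d}|\nabla^-f|^2\,dx. \]
   Context: Let $I=(0,1)$. For $w\in L^2(I)$, $\mathcal{R}(w)$ is the set of $(w_1,w_2)\in L^2(I)\times H^1(I)$ with $w_1$ nondecreasing, $w_2$ nonincreasing (having such representatives), $\int_Iw_2=0$ and $w=w_1+w_2$ a.e.; $\mathcal{U}=\{w:\mathcal{R}(w)\ne\emptyset\}$; for $w\in\mathcal{U}$, $(w^\uparrow,w^\downarrow)$ is the unique element of $\mathcal{R}(w)$ minimizing $\frac12\int_I(\partial_xw_2)^2$. $\mathcal{E}^-(w)=\frac12\int_I(\partial_xw^\downarrow)^2$ for $w\in\mathcal{U}$, $+\infty$ otherwise. $(P_t)$ is the nonexpansive semigroup on $L^2(I)$ generated by $-\partial\mathcal{E}^-$ (subdifferential), and $P_\infty w=\lim_{t\to\infty}P_tw$ in $L^2(I)$. For Lipschitz $w$, $P_\infty w$ has a unique continuous representative, which is used. For Lipschitz $g:[0,1]^d\to\mathbb{R}$ and $k\in[d]$, $(\mathcal{M}_kg)(x_{-k},x_k)=(P_\infty g(x_{-k},\cdot))(x_k)$ ($x_{-k}$ is $x$ with coordinate $k$ removed),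 and $f^*=\mathcal{M}_d\cdots\mathcal{M}_1f$. $\nabla^-f=(\min\{0,\partial_1f\},\dots,\min\{0,\partial_df\})$ (defined a.e.). $x\preceq y$ means $x_i\le y_i$ for all $i$; $W_2^2(\mu\to\nu)=\inf\int|x-y|^2d\gamma(x,y)$ over couplings $\gamma$ of $\mu,\nu$ with $\gamma(\{x\not\preceq y\})=0$. *)

theory Defs
  imports "HOL-Analysis.Analysis"
begin

section \<open>The space \<open>L\<^sup>2(0,1)\<close> and weak derivatives\<close>

text \<open>Elements of \<open>L\<^sup>2(0,1)\<close> are represented by functions on the reals whose values outside
  \<open>(0,1)\<close> are irrelevant. Two representatives of one class are at distance 0, i.e. they agree almost
  everywhere. All choices made below with \<open>SOME\<close> are choices of a representative of a unique class.\<close>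

abbreviation unit_ivl :: "real measure" where
  "unit_ivl \<equiv> lebesgue_on {0<..<1}"

definition L2 :: "(real \<Rightarrow> real) set" where
  "L2 = {w. w \<in> borel_measurable unit_ivl \<and> integrable unit_ivl (\<lambda>x. (w x)\<^sup>2)}"

definition l2_inner :: "(real \<Rightarrow> real) \<Rightarrow> (real \<Rightarrow> real) \<Rightarrow> real" where
  "l2_inner v w = (\<integral>x. v x * w x \<partial>unit_ivl)"

definition l2_norm :: "(real \<Rightarrow> real) \<Rightarrow> real" where
  "l2_norm w = sqrt (l2_inner w w)"

definition l2_dist :: "(real \<Rightarrow> real) \<Rightarrow> (real \<Rightarrow> real) \<Rightarrow> real" where
  "l2_dist v w = l2_norm (\<lambda>x. v x - w x)"

definition test_function :: "(real \<Rightarrow> real) \<Rightarrow> bool" where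
  "test_function \<phi> \<longleftrightarrow>
     (\<forall>n x. (deriv ^^ n) \<phi> field_differentiable (at x)) \<and>
     (\<exists>a b. 0 < a \<and> b < 1 \<and> (\<forall>x. x \<notin> {a..b} \<longrightarrow> \<phi> x = 0))"

definition has_weak_deriv :: "(real \<Rightarrow> real) \<Rightarrow> (real \<Rightarrow> real) \<Rightarrow> bool" where
  "has_weak_deriv w v \<longleftrightarrow>
     (\<forall>\<phi>. test_function \<phi> \<longrightarrow>
        (\<integral>x. w x * deriv \<phi> x \<partial>unit_ivl) = - (\<integral>x. v x * \<phi> x \<partial>unit_ivl))"

definition H1 :: "(real \<Rightarrow> real) set" where
  "H1 = {w \<in> L2. \<exists>v\<in>L2. has_weak_deriv w v}"

definition weak_deriv :: "(real \<Rightarrow> real) \<Rightarrow> real \<Rightarrow> real" where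
  "weak_deriv w = (SOME v. v \<in> L2 \<and> has_weak_deriv w v)"

definition nondecreasing_ae :: "(real \<Rightarrow> real) \<Rightarrow> bool" where
  "nondecreasing_ae w \<longleftrightarrow> (\<exists>r. mono_on {0<..<1} r \<and> (AE x in unit_ivl. w x = r x))"

definition nonincreasing_ae :: "(real \<Rightarrow> real) \<Rightarrow> bool" where
  "nonincreasing_ae w \<longleftrightarrow> (\<exists>r. antimono_on {0<..<1} r \<and> (AE x in unit_ivl. w x = r x))"

section \<open>The energy\<close>

definition decomps :: "(real \<Rightarrow> real) \<Rightarrow> ((real \<Rightarrow> real) \<times> (real \<Rightarrow> real)) set" where
  "decomps w = {(w1, w2). w1 \<in> L2 \<and> w2 \<in> H1 \<and> nondecreasing_ae w1 \<and> nonincreasing_ae w2 \<and>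
     (\<integral>x. w2 x \<partial>unit_ivl) = 0 \<and> (AE x in unit_ivl. w x = w1 x + w2 x)}"

definition decomposable :: "(real \<Rightarrow> real) set" where
  "decomposable = {w \<in> L2. decomps w \<noteq> {}}"

definition dirichlet :: "(real \<Rightarrow> real) \<Rightarrow> real" where
  "dirichlet v = 1 / 2 * (\<integral>x. (weak_deriv v x)\<^sup>2 \<partial>unit_ivl)"

text \<open>The pair \<open>(w\<^sup>\<up>, w\<^sup>\<down>)\<close>.\<close>

definition opt_decomp :: "(real \<Rightarrow> real) \<Rightarrow> (real \<Rightarrow> real) \<times> (real \<Rightarrow> real)" where
  "opt_decomp w = arg_min (\<lambda>(w1, w2). dirichlet w2) (\<lambda>p. p \<in> decomps w)"

definition energy_minus :: "(real \<Rightarrow> real) \<Rightarrow> ereal" where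
  "energy_minus w = (if w \<in> decomposable then ereal (dirichlet (snd (opt_decomp w))) else \<infinity>)"

section \<open>Subdifferentials and the generated semigroup\<close>

definition subdifferential :: "((real \<Rightarrow> real) \<Rightarrow> ereal) \<Rightarrow> (real \<Rightarrow> real) \<Rightarrow> (real \<Rightarrow> real) set" where
  "subdifferential E w = {p \<in> L2. w \<in> L2 \<and> \<bar>E w\<bar> \<noteq> \<infinity> \<and>
     (\<forall>v\<in>L2. E w + ereal (l2_inner p (\<lambda>x. v x - w x)) \<le> E v)}"

definition has_l2_deriv :: "(real \<Rightarrow> real \<Rightarrow> real) \<Rightarrow> (real \<Rightarrow> real) \<Rightarrow> real \<Rightarrow> bool" where
  "has_l2_deriv u p t \<longleftrightarrow> p \<in> L2 \<and>
     ((\<lambda>h. l2_dist (\<lambda>x. (u (t + h) x - u t x) / h) p) \<longlongrightarrow> 0) (at 0)"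

text \<open>Characterisation of the semigroup generated by \<open>- \<partial>E\<close> on the closure of the domain of
  \<open>\<partial>E\<close> (here all of \<open>L\<^sup>2\<close>): from an initial value in that domain, the orbit is the Lipschitz
  strong solution of \<open>- u' \<in> \<partial>E(u)\<close>; elsewhere it is determined by nonexpansiveness.\<close>

definition generated_semigroup ::
    "((real \<Rightarrow> real) \<Rightarrow> ereal) \<Rightarrow> (real \<Rightarrow> (real \<Rightarrow> real) \<Rightarrow> (real \<Rightarrow> real)) \<Rightarrow> bool" where
  "generated_semigroup E S \<longleftrightarrow>
     (\<forall>t\<ge>0. \<forall>w\<in>L2. S t w \<in> L2) \<and>
     (\<forall>t\<ge>0. \<forall>v\<in>L2. \<forall>w\<in>L2. l2_dist (S t v) (S t w) \<le> l2_dist v w) \<and>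
     (\<forall>w\<in>L2. AE x in unit_ivl. S 0 w x = w x) \<and>
     (\<forall>s\<ge>0. \<forall>t\<ge>0. \<forall>w\<in>L2. AE x in unit_ivl. S (s + t) w x = S s (S t w) x) \<and>
     (\<forall>w\<in>L2. \<forall>t\<ge>0. ((\<lambda>s. l2_dist (S s w) (S t w)) \<longlongrightarrow> 0) (at t within {0..})) \<and>
     (\<forall>w\<in>L2. subdifferential E w \<noteq> {} \<longrightarrow>
        (\<exists>L. \<forall>s\<ge>0. \<forall>t\<ge>0. l2_dist (S s w) (S t w) \<le> L * \<bar>s - t\<bar>) \<and>
        (AE t in lebesgue. t > 0 \<longrightarrow>
           (\<exists>p. has_l2_deriv (\<lambda>s. S s w) p t \<and> (\<lambda>x. - p x) \<in> subdifferential E (S t w))))"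

definition flow :: "real \<Rightarrow> (real \<Rightarrow> real) \<Rightarrow> (real \<Rightarrow> real)" where
  "flow = (SOME S. generated_semigroup energy_minus S)"

definition flow_limit :: "(real \<Rightarrow> real) \<Rightarrow> (real \<Rightarrow> real)" where
  "flow_limit w = (SOME v. v \<in> L2 \<and> ((\<lambda>t. l2_dist (flow t w) v) \<longlongrightarrow> 0) at_top)"

text \<open>The representative is continuous up to the boundary, since it gets evaluated on \<open>[0,1]\<close>.\<close>

definition flow_limit_cont :: "(real \<Rightarrow> real) \<Rightarrow> (real \<Rightarrow> real)" where
  "flow_limit_cont w =
     (SOME c. continuous_on {0..1} c \<and> (AE x in unit_ivl. c x = flow_limit w x))"

section \<open>The cube\<close>

text \<open>As the dimension \<open>d\<close> is a quantified number, points of \<open>[0,1]\<^sup>d\<close> are extensional functions on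
  \<open>{1..d}\<close>. The metric of the type \<open>nat \<Rightarrow> real\<close> is not the Euclidean one and is not used.\<close>

definition cube :: "nat \<Rightarrow> (nat \<Rightarrow> real) set" where
  "cube d = {1..d} \<rightarrow>\<^sub>E {0..1}"

definition cube_measure :: "nat \<Rightarrow> (nat \<Rightarrow> real) measure" where
  "cube_measure d = PiM {1..d} (\<lambda>_. restrict_space lborel {0..1})"

definition euclid_dist :: "nat \<Rightarrow> (nat \<Rightarrow> real) \<Rightarrow> (nat \<Rightarrow> real) \<Rightarrow> real" where
  "euclid_dist d x y = L2_set (\<lambda>i. x i - y i) {1..d}"

definition lipschitz_cube :: "nat \<Rightarrow> ((nat \<Rightarrow> real) \<Rightarrow> real) \<Rightarrow> bool" where
  "lipschitz_cube d f \<longleftrightarrow>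
     (\<exists>L. \<forall>x\<in>cube d. \<forall>y\<in>cube d. \<bar>f x - f y\<bar> \<le> L * euclid_dist d x y)"

definition mono_step :: "nat \<Rightarrow> ((nat \<Rightarrow> real) \<Rightarrow> real) \<Rightarrow> ((nat \<Rightarrow> real) \<Rightarrow> real)" where
  "mono_step k g x = flow_limit_cont (\<lambda>s. g (x(k := s))) (x k)"

text \<open>\<open>mono_rearr d f\<close> is \<open>f\<^sup>*\<close>.\<close>

primrec mono_rearr :: "nat \<Rightarrow> ((nat \<Rightarrow> real) \<Rightarrow> real) \<Rightarrow> ((nat \<Rightarrow> real) \<Rightarrow> real)" where
  "mono_rearr 0 f = f"
| "mono_rearr (Suc k) f = mono_step (Suc k) (mono_rearr k f)"

text \<open>The derivative is taken within \<open>[0,1]\<close> so that values of \<open>f\<close> off the cube play no role.\<close>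

definition partial_deriv :: "nat \<Rightarrow> ((nat \<Rightarrow> real) \<Rightarrow> real) \<Rightarrow> (nat \<Rightarrow> real) \<Rightarrow> real" where
  "partial_deriv i f x = vector_derivative (\<lambda>s. f (x(i := s))) (at (x i) within {0..1})"

definition neg_grad :: "((nat \<Rightarrow> real) \<Rightarrow> real) \<Rightarrow> (nat \<Rightarrow> real) \<Rightarrow> nat \<Rightarrow> real" where
  "neg_grad f x i = min 0 (partial_deriv i f x)"

section \<open>Directed transport cost\<close>

definition coord_le :: "nat \<Rightarrow> (nat \<Rightarrow> real) \<Rightarrow> (nat \<Rightarrow> real) \<Rightarrow> bool" where
  "coord_le d x y \<longleftrightarrow> (\<forall>i\<in>{1..d}. x i \<le> y i)"

definition couplings :: "'a measure \<Rightarrow> 'b measure \<Rightarrow> ('a \<times> 'b) measure set" where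
  "couplings \<mu> \<nu> = {\<gamma>. sets \<gamma> = sets (\<mu> \<Otimes>\<^sub>M \<nu>) \<and> distr \<gamma> \<mu> fst = \<mu> \<and> distr \<gamma> \<nu> snd = \<nu>}"

definition directed_W2_sq ::
    "nat \<Rightarrow> (nat \<Rightarrow> real) measure \<Rightarrow> (nat \<Rightarrow> real) measure \<Rightarrow> ennreal" where
  "directed_W2_sq d \<mu> \<nu> =
     (INF \<gamma>\<in>{\<gamma> \<in> couplings \<mu> \<nu>. {(x, y) \<in> space \<gamma>. \<not> coord_le d x y} \<in> null_sets \<gamma>}.
        \<integral>\<^sup>+ (x, y). ennreal ((euclid_dist d x y)\<^sup>2) \<partial>\<gamma>)"

end

theory Submission
  imports Defs
begin

text \<open>On the line, \<open>P\<^sub>\<infinity> w\<close> is the isotonic regression of \<open>w\<close>, that is, its \<open>L\<^sup>2\<close> projection onto the cone of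
  nondecreasing functions. Indeed the subdifferential of \<open>\<E>\<^sup>-\<close> is contained in an explicit m-accretive relation,
  whose semigroup is built from resolvents, and the orbits of that semigroup converge to the projection of
  their initial value. The projection is an order preserving \<open>L\<^sup>2\<close> contraction which contracts positive parts
  of differences, and keeps Lipschitz constants and bounds.

  If \<open>w \<ge> 1 - a\<close> on the line, the monotone map \<open>T\<close> carrying \<open>w dx\<close> to \<open>P\<^sub>\<infinity> w dx\<close> satisfies
  \<open>0 \<le> T x - x \<le> \<Phi> x / (1 - a)\<close>, where \<open>\<Phi> x\<close> is the integral of \<open>w - P\<^sub>\<infinity> w\<close> over \<open>[0,x]\<close>. Testing the
  projection with \<open>w\<close> corrected by a primitive of the negative part of \<open>w'\<close> bounds the \<open>L\<^sup>2\<close> norm of \<open>\<Phi>\<close> by that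
  of the negative part of \<open>w'\<close>. On the cube these maps are composed coordinate by coordinate. The \<open>k\<close>-th map
  moves the \<open>k\<close>-th coordinate only, so the squared displacements add up, and the directional energies
  do not grow under rearrangement in the other directions.\<close>

section \<open>Nearest points of closed convex sets\<close>

text \<open>\<open>flow\<close> is a mere choice among the semigroups generated by the energy, so
  nothing is known of it until existence and uniqueness are shown; both rest on identifying the
  subdifferential with \<open>gen\<close>. That pairs of \<open>gen\<close> are subgradients is a
  short computation with integration by parts, and maximality then yields equality. The resolvent
  equation of \<open>gen\<close> is solved by a fixed point whose only ingredients are
  \<open>vol\<close>, integration from 0, and the projection; the decay towards the projection uses
  that \<open>vol\<close> does not increase norms. On the cube the obstacle is that rearrangement in
  one direction must respect the negative slopes in the others, while partial derivatives exist only
  almost everywhere. A slope is therefore replaced by the difference of the values on two parallel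
  lines, and both lines are rearranged by the same contraction; the gradient of \<open>f\<close>
  enters only at the end, through limits of difference quotients. The bound obtained is (1 + a)/(1 -
  a)^2 times the energy.\<close>

lemma hilbert_nearest_point:
  fixes x :: "'a::{real_inner, banach}"
  assumes "closed S" "convex S" "S \<noteq> {}"
  obtains p where "p \<in> S" "\<And>q. q \<in> S \<Longrightarrow> inner (x - p) (q - p) \<le> 0"
proof -
  define d where "d = (INF q\<in>S. (norm (x - q))\<^sup>2)"
  have bdd: "bdd_below ((\<lambda>q. (norm (x - q))\<^sup>2) ` S)"
    by (rule bdd_belowI[of _ 0]) auto
  have lower: "d \<le> (norm (x - q))\<^sup>2" if "q \<in> S" for q
    unfolding d_def using bdd that by (rule cINF_lower)
  have "\<exists>q\<in>S. (norm (x - q))\<^sup>2 < d + 1 / real (Suc n)" for n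
  proof (rule ccontr)
    assume "\<not> (\<exists>q\<in>S. (norm (x - q))\<^sup>2 < d + 1 / real (Suc n))"
    then have "d + 1 / real (Suc n) \<le> d"
      unfolding d_def by (intro cINF_greatest) (use assms in \<open>auto simp: not_less d_def\<close>)
    then show False by simp
  qed
  then obtain q where q: "\<And>n. q n \<in> S" "\<And>n. (norm (x - q n))\<^sup>2 < d + 1 / real (Suc n)"
    by metis
  \<comment> \<open>The parallelogram law at the midpoint of y and z, which belongs to
    \<open>S\<close>: almost minimality becomes closeness, so the minimizing sequence is
    Cauchy.\<close>
  have mid: "(norm (y - z))\<^sup>2 \<le> 2 * ((norm (x - y))\<^sup>2 - d) + 2 * ((norm (x - z))\<^sup>2 - d)"
    if "y \<in> S" "z \<in> S" for y z
  proof -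
    have "(1 / 2) *\<^sub>R y + (1 / 2) *\<^sub>R z \<in> S"
      using assms that by (intro convexD) auto
    from lower[OF this] have "4 * d \<le> 4 * (norm (x - ((1 / 2) *\<^sub>R y + (1 / 2) *\<^sub>R z)))\<^sup>2"
      by simp
    also have "\<dots> = 2 * (norm (x - y))\<^sup>2 + 2 * (norm (x - z))\<^sup>2 - (norm (y - z))\<^sup>2"
      unfolding power2_norm_eq_inner by (simp add: inner_simps inner_commute algebra_simps)
    finally show ?thesis by simp
  qed
  have "Cauchy q"
  proof (rule metric_CauchyI)
    fix e :: real assume "e > 0"
    obtain N :: nat where N: "4 / e\<^sup>2 < real N" using reals_Archimedean2 by blast
    then have "0 < real N" by (meson divide_nonneg_nonneg less_le_trans not_less zero_le_numeral zero_le_power2)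
    have "dist (q m) (q n) < e" if "m \<ge> N" "n \<ge> N" for m n
    proof -
      have *: "1 / real (Suc k) < e\<^sup>2 / 4" if "k \<ge> N" for k
      proof -
        have "4 / e\<^sup>2 < real (Suc k)" using N that by linarith
        then show ?thesis using \<open>e > 0\<close> by (simp add: field_simps)
      qed
      have "(norm (q m - q n))\<^sup>2 < e\<^sup>2"
      proof -
        have "A < E" if "A \<le> 2 * (a - d) + 2 * (b - d)" "a < d + i" "b < d + j" "i < E / 4" "j < E / 4"
          for A E a b i j :: real using that by argo
        from this[OF mid[OF q(1) q(1)] q(2) q(2) * *, OF that] show ?thesis .
      qed
      then show ?thesis using \<open>e > 0\<close> by (simp add: dist_norm power_less_imp_less_base)
    qed
    then show "\<exists>M. \<forall>m\<ge>M. \<forall>n\<ge>M. dist (q m) (q n) < e" by blast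
  qed
  then obtain p where p: "q \<longlonglongrightarrow> p" by (meson Cauchy_convergent_iff convergent_def)
  have "p \<in> S" using closed_sequentially[OF \<open>closed S\<close> _ p] q by blast
  have "(\<lambda>n. (norm (x - q n))\<^sup>2) \<longlonglongrightarrow> (norm (x - p))\<^sup>2" by (intro tendsto_intros p)
  moreover have "(\<lambda>n. d + 1 / real (Suc n)) \<longlonglongrightarrow> d + 0"
    by (intro tendsto_intros LIMSEQ_Suc[OF lim_1_over_n])
  ultimately have "(norm (x - p))\<^sup>2 \<le> d"
    using q(2) by (intro LIMSEQ_le[of _ _ "\<lambda>n. d + 1 / real (Suc n)"]) (auto intro!: exI[of _ 0] less_imp_le)
  have "inner (x - p) (r - p) \<le> 0" if "r \<in> S" for r
  proof (rule ccontr)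
    assume neg: "\<not> ?thesis"
    define i where "i = inner (x - p) (r - p)"
    define n where "n = (norm (r - p))\<^sup>2"
    have "i > 0" using neg by (simp add: i_def)
    have "n \<ge> 0" by (simp add: n_def)
    \<comment> \<open>Moving from p towards r by a fraction t cannot decrease the distance to x. The
      first-order term is -2ti, so a positive i would beat the quadratic term for small t.\<close>
    have ineq: "2 * t * i \<le> t\<^sup>2 * n" if "0 < t" "t \<le> 1" for t
    proof -
      have "(1 - t) *\<^sub>R p + t *\<^sub>R r \<in> S"
        using assms(2) \<open>p \<in> S\<close> \<open>r \<in> S\<close> that by (intro convexD) auto
      from lower[OF this] \<open>(norm (x - p))\<^sup>2 \<le> d\<close>
      have "(norm (x - p))\<^sup>2 \<le> (norm (x - ((1 - t) *\<^sub>R p + t *\<^sub>R r)))\<^sup>2" by linarith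
      also have "x - ((1 - t) *\<^sub>R p + t *\<^sub>R r) = (x - p) - t *\<^sub>R (r - p)" by (simp add: algebra_simps)
      also have "(norm \<dots>)\<^sup>2 = (norm (x - p))\<^sup>2 - 2 * t * i + t\<^sup>2 * n"
        unfolding i_def n_def power2_norm_eq_inner
        by (simp add: inner_diff_left inner_diff_right inner_commute algebra_simps power2_eq_square)
      finally show ?thesis by simp
    qed
    \<comment> \<open>At i/(n + 1) the term t n stays below i, against the required 2i; the minimum
      with 1 keeps the point on the segment.\<close>
    define t where "t = min 1 (i / (n + 1))"
    have t: "0 < t" "t \<le> 1" using \<open>i > 0\<close> \<open>n \<ge> 0\<close> by (auto simp: t_def)
    have "2 * i \<le> t * n" using ineq[OF t] t by (simp add: power2_eq_square)
    also have "t * n \<le> i / (n + 1) * n" using \<open>n \<ge> 0\<close> by (intro mult_right_mono) (auto simp: t_def)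
    also have "\<dots> \<le> i" using \<open>n \<ge> 0\<close> \<open>i > 0\<close> by (simp add: field_simps)
    finally show False using \<open>i > 0\<close> by simp
  qed
  with \<open>p \<in> S\<close> show ?thesis using that by blast
qed

section \<open>Lipschitz functions with nonpositive derivative almost everywhere\<close>

lemma negligible_lipschitz_image_real:
  fixes f :: "real \<Rightarrow> real"
  assumes "negligible N" "\<And>x y. x \<in> N \<Longrightarrow> y \<in> N \<Longrightarrow> \<bar>f x - f y\<bar> \<le> L * \<bar>x - y\<bar>"
  shows "negligible (f ` N)"
  by (rule negligible_locally_Lipschitz_image)
     (use assms in \<open>auto intro!: exI[of _ UNIV] exI[of _ L] simp: dist_norm\<close>)

text \<open>A level outside the null image of the exceptional set is crossed upwards for the last time at a point
  where the derivative is negative.\<close>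

lemma lipschitz_nonincreasing_if_deriv_nonpos:
  fixes f :: "real \<Rightarrow> real"
  assumes "a \<le> b" and lip: "\<And>x y. x \<in> {a..b} \<Longrightarrow> y \<in> {a..b} \<Longrightarrow> \<bar>f x - f y\<bar> \<le> L * \<bar>x - y\<bar>"
    and N: "negligible N"
    and deriv: "\<And>t. t \<in> {a<..<b} - N \<Longrightarrow> \<exists>D\<le>0. (f has_real_derivative D) (at t)"
  shows "f b \<le> f a"
proof (rule field_le_epsilon)
  fix e :: real assume "e > 0"
  define c where "c = e / (b - a + 1)"
  have "c > 0" using \<open>e > 0\<close> \<open>a \<le> b\<close> by (simp add: c_def)
  \<comment> \<open>The tilt by c makes the derivative strictly negative off N; over the whole
    interval it costs c (b - a), at most e.\<close>
  define g where "g t = f t - c * t" for t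
  have glip: "\<bar>g x - g y\<bar> \<le> (L + c) * \<bar>x - y\<bar>" if "x \<in> {a..b}" "y \<in> {a..b}" for x y
  proof -
    have "\<bar>g x - g y\<bar> = \<bar>(f x - f y) - c * (x - y)\<bar>" by (simp add: g_def algebra_simps)
    also have "\<dots> \<le> \<bar>f x - f y\<bar> + \<bar>c * (x - y)\<bar>" by (rule abs_triangle_ineq4)
    also have "\<dots> \<le> L * \<bar>x - y\<bar> + c * \<bar>x - y\<bar>" using lip[OF that] \<open>c > 0\<close> by (simp add: abs_mult)
    finally show ?thesis by (simp add: algebra_simps)
  qed
  have "(L + c)-lipschitz_on {a..b} g \<or> L + c < 0"
    using glip by (auto simp: lipschitz_on_def dist_norm)
  then have cont: "continuous_on {a..b} g"
  proof
    assume "L + c < 0"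
    have "a = b"
    proof (rule ccontr)
      assume "a \<noteq> b"
      with \<open>a \<le> b\<close> have "a < b" by simp
      then have "(L + c) * \<bar>a - b\<bar> < 0" using \<open>L + c < 0\<close> by (intro mult_neg_pos) auto
      moreover have "0 \<le> (L + c) * \<bar>a - b\<bar>" using glip[of a b] \<open>a \<le> b\<close> by (smt (verit) atLeastAtMost_iff)
      ultimately show False by simp
    qed
    then show ?thesis by simp
  qed (rule lipschitz_on_continuous_on)
  have "g b \<le> g a"
  proof (rule ccontr)
    assume "\<not> g b \<le> g a"
    then have gab: "g a < g b" by simp
    have "negligible (g ` (N \<inter> {a..b}))"
      by (rule negligible_lipschitz_image_real[where L = "L + c"])
         (use N glip in \<open>auto intro: negligible_subset\<close>)
    moreover have "\<not> negligible {g a<..<g b}"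
      using gab by (metis negligible_interval(2) box_real(1) greaterThanLessThan_empty_iff not_le)
    ultimately obtain y where y: "y \<in> {g a<..<g b}" "y \<notin> g ` (N \<inter> {a..b})"
      by (meson negligible_subset subsetI)
    define T where "T = {t \<in> {a..b}. g t \<le> y}"
    have "closed T"
      unfolding T_def using continuous_closed_preimage[OF cont closed_atLeastAtMost closed_atMost, of y]
      by (simp add: vimage_def Int_def)
    have "a \<in> T" using y \<open>a \<le> b\<close> by (auto simp: T_def)
    have bdd: "bdd_above T" by (rule bdd_aboveI[of _ b]) (auto simp: T_def)
    define s where "s = Sup T"
    have "s \<in> T" unfolding s_def using \<open>closed T\<close> \<open>a \<in> T\<close> bdd by (intro closed_contains_Sup) auto
    have above: "g t > y" if "t \<in> {a..b}" "t > s" for t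
      using that cSup_upper[OF _ bdd, of t] by (force simp: T_def s_def)
    have "s < b" using \<open>s \<in> T\<close> y by (force simp: T_def less_le)
    have "g s = y"
    proof (rule ccontr)
      assume "g s \<noteq> y"
      with \<open>s \<in> T\<close> have "g s < y" by (simp add: T_def)
      have "continuous_on {s..b} g" using cont \<open>s \<in> T\<close> by (auto simp: T_def intro: continuous_on_subset)
      then obtain r where "s \<le> r" "r \<le> b" "g r = y"
        using IVT'[of g s y b] \<open>g s < y\<close> y \<open>s < b\<close> by auto
      with \<open>g s \<noteq> y\<close> above[of r] \<open>s \<in> T\<close> show False by (force simp: T_def less_le)
    qed
    with y have "s \<noteq> a" by auto
    with \<open>s \<in> T\<close> have "a < s" by (simp add: T_def)
    have "s \<notin> N" using y(2) \<open>g s = y\<close> \<open>s \<in> T\<close> by (auto simp: T_def)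
    then obtain D where D: "D \<le> 0" "(f has_real_derivative D) (at s)"
      using deriv \<open>a < s\<close> \<open>s < b\<close> by auto
    have "(g has_real_derivative D - c) (at s)"
      unfolding g_def by (auto intro!: derivative_eq_intros D)
    moreover have "D - c < 0" using D \<open>c > 0\<close> by simp
    ultimately obtain \<delta> where \<delta>: "\<delta> > 0" "\<And>h. h > 0 \<Longrightarrow> h < \<delta> \<Longrightarrow> g (s + h) < g s"
      using DERIV_neg_dec_right by blast
    define h where "h = min (\<delta> / 2) (b - s)"
    have "h > 0" "h < \<delta>" using \<delta>(1) \<open>s < b\<close> by (auto simp: h_def)
    moreover have "s + h \<in> {a..b}" using \<open>h > 0\<close> \<open>a < s\<close> by (auto simp: h_def min_def)
    ultimately show False using above[of "s + h"] \<delta>(2)[of h] \<open>g s = y\<close> by auto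
  qed
  then have "f b \<le> f a + c * (b - a)" by (simp add: g_def algebra_simps)
  also have "c * (b - a) \<le> e"
    using \<open>a \<le> b\<close> \<open>e > 0\<close> unfolding c_def by (simp add: divide_simps algebra_simps)
  finally show "f b \<le> f a + e" by simp
qed

section \<open>Semigroups generated by m-accretive relations\<close>

lemma norm_scaleR_inverse_le_iff:
  fixes x :: "'a::real_normed_vector"
  assumes "h > 0"
  shows "norm ((1 / h) *\<^sub>R x) \<le> c \<longleftrightarrow> norm x \<le> h * c"
  using assms by (simp add: divide_le_eq mult.commute)

lemma floor_mult2_cases:
  fixes x :: real
  shows "\<lfloor>2 * x\<rfloor> = 2 * \<lfloor>x\<rfloor> \<or> \<lfloor>2 * x\<rfloor> = 2 * \<lfloor>x\<rfloor> + 1"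
  by linarith

text \<open>Surjectivity of I + hA is asked for one h only, since the concrete relation is handled
  at h = 2; \<open>range_all\<close> extends it to every positive step. By \<open>maximal\<close>
  such a relation is maximal monotone.\<close>

locale m_accretive =
  fixes A :: "('a::{real_inner, banach} \<times> 'a) set"
  assumes accretive: "(u, p) \<in> A \<Longrightarrow> (v, q) \<in> A \<Longrightarrow> 0 \<le> inner (p - q) (u - v)"
    and range_one: "\<exists>h>0. \<forall>w. \<exists>u p. (u, p) \<in> A \<and> u + h *\<^sub>R p = w"
begin

lemma resolvent_nonexpansive:
  assumes "(u, p) \<in> A" "(v, q) \<in> A" "h \<ge> 0"
  shows "norm (u - v) \<le> norm ((u + h *\<^sub>R p) - (v + h *\<^sub>R q))"
proof -
  have "(norm (u - v))\<^sup>2 \<le> (norm (u - v))\<^sup>2 + 2 * h * inner (p - q) (u - v) + (norm (h *\<^sub>R (p - q)))\<^sup>2"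
    using accretive[OF assms(1,2)] assms(3) by simp
  also have "\<dots> = (norm ((u - v) + h *\<^sub>R (p - q)))\<^sup>2"
    unfolding power2_norm_eq_inner by (simp add: inner_simps inner_commute algebra_simps)
  also have "(u - v) + h *\<^sub>R (p - q) = (u + h *\<^sub>R p) - (v + h *\<^sub>R q)" by (simp add: algebra_simps)
  finally show ?thesis by (rule power2_le_imp_le) simp
qed

text \<open>The equation at step h is equivalent to u = J((h0/h) w + (1 - h0/h) u) with the
  resolvent J at step h0. The right side contracts in u with factor |1 - h0/h|, which is below 1
  when h > h0/2.\<close>

lemma range_step:
  assumes "h0 > 0" "\<forall>w. \<exists>u p. (u, p) \<in> A \<and> u + h0 *\<^sub>R p = w" "h0 / 2 < h"
  shows "\<exists>u p. (u, p) \<in> A \<and> u + h *\<^sub>R p = w"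
proof -
  obtain J where J: "\<And>w. \<exists>p. (J w, p) \<in> A \<and> J w + h0 *\<^sub>R p = w" using assms(2) by metis
  have J_contr: "norm (J x - J y) \<le> norm (x - y)" for x y
  proof -
    obtain p q where "(J x, p) \<in> A" "J x + h0 *\<^sub>R p = x" "(J y, q) \<in> A" "J y + h0 *\<^sub>R q = y"
      using J by metis
    with resolvent_nonexpansive[of "J x" p "J y" q h0] assms(1) show ?thesis by simp
  qed
  have "h > 0" using assms by simp
  define c where "c = \<bar>1 - h0 / h\<bar>"
  have c: "0 \<le> c" "c < 1" using assms \<open>h > 0\<close> by (auto simp: c_def abs_if field_simps)
  define f where "f v = J ((h0 / h) *\<^sub>R w + (1 - h0 / h) *\<^sub>R v)" for v
  have lip: "dist (f x) (f y) \<le> c * dist x y" for x y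
  proof -
    have "norm (f x - f y) \<le> norm (((h0 / h) *\<^sub>R w + (1 - h0 / h) *\<^sub>R x) - ((h0 / h) *\<^sub>R w + (1 - h0 / h) *\<^sub>R y))"
      unfolding f_def by (rule J_contr)
    also have "\<dots> = norm ((1 - h0 / h) *\<^sub>R (x - y))" by (simp add: algebra_simps)
    finally show ?thesis by (simp add: dist_norm c_def)
  qed
  have "\<exists>!v. f v = v"
    by (rule banach_fix_type[OF c]) (use lip in blast)
  then obtain v where v: "f v = v" by blast
  obtain p where p: "(f v, p) \<in> A" "f v + h0 *\<^sub>R p = (h0 / h) *\<^sub>R w + (1 - h0 / h) *\<^sub>R v"
    using J unfolding f_def by metis
  have "(h0 / h) *\<^sub>R (v + h *\<^sub>R p) = (h0 / h) *\<^sub>R w"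
    using p(2) v \<open>h > 0\<close> by (simp add: algebra_simps)
  then have "v + h *\<^sub>R p = w" using assms(1) \<open>h > 0\<close> by simp
  with p(1) v show ?thesis by auto
qed

lemma range_all:
  assumes "h > 0"
  shows "\<exists>u p. (u, p) \<in> A \<and> u + h *\<^sub>R p = w"
proof -
  obtain h0 where h0: "h0 > 0" "\<forall>w. \<exists>u p. (u, p) \<in> A \<and> u + h0 *\<^sub>R p = w" using range_one by blast
  \<comment> \<open>\<open>range_step\<close> needs the new step strictly above half of the old one,
    hence the ratio 3/4 instead of 1/2.\<close>
  have iter: "\<forall>w. \<exists>u p. (u, p) \<in> A \<and> u + (h0 * (3 / 4) ^ n) *\<^sub>R p = w" for n
  proof (induction n)
    case (Suc n)
    show ?case
      using range_step[OF _ Suc.IH, of "h0 * (3 / 4) ^ Suc n"] h0(1) by simp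
  qed (use h0 in simp)
  obtain n where "(3 / 4 :: real) ^ n < h / h0"
    using real_arch_pow_inv[of "h / h0" "3 / 4"] h0 assms by auto
  then have "h0 * (3 / 4) ^ n < h" using h0(1) assms by (simp add: field_simps)
  then have "h0 * (3 / 4) ^ n / 2 < h" using assms by linarith
  from range_step[OF _ iter this] h0(1) show ?thesis by simp
qed

definition J :: "real \<Rightarrow> 'a \<Rightarrow> 'a" where
  "J h w = (SOME u. \<exists>p. (u, p) \<in> A \<and> u + h *\<^sub>R p = w)"

definition yosida :: "real \<Rightarrow> 'a \<Rightarrow> 'a" where
  "yosida h w = (1 / h) *\<^sub>R (w - J h w)"

lemma J_yosida:
  assumes "h > 0"
  shows "(J h w, yosida h w) \<in> A"
proof -
  have "\<exists>p. (J h w, p) \<in> A \<and> J h w + h *\<^sub>R p = w"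
    unfolding J_def by (rule someI_ex) (use range_all[OF assms] in blast)
  then obtain p where p: "(J h w, p) \<in> A" "J h w + h *\<^sub>R p = w" by blast
  have "yosida h w = (1 / h) *\<^sub>R (h *\<^sub>R p)" unfolding yosida_def using p(2) by (metis add_diff_cancel_left')
  with p assms show ?thesis by simp
qed

lemma J_add_yosida: "h > 0 \<Longrightarrow> J h w + h *\<^sub>R yosida h w = w"
  by (simp add: yosida_def)

lemma J_eq_diff_yosida: "h > 0 \<Longrightarrow> J h w = w - h *\<^sub>R yosida h w"
  by (simp add: yosida_def)

lemma J_nonexpansive:
  assumes "h > 0"
  shows "norm (J h x - J h y) \<le> norm (x - y)"
  using resolvent_nonexpansive[OF J_yosida[OF assms, of x] J_yosida[OF assms, of y], of h] assms
  by (simp add: J_add_yosida)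

text \<open>Minty's argument: solve v + q = u + p within the relation; then p - q = -(u - v), and
  the hypothesis forces u = v and p = q.\<close>

lemma maximal:
  assumes "\<And>v q. (v, q) \<in> A \<Longrightarrow> 0 \<le> inner (p - q) (u - v)"
  shows "(u, p) \<in> A"
proof -
  define v where "v = J 1 (u + p)"
  define q where "q = yosida 1 (u + p)"
  have vq: "(v, q) \<in> A" "v + q = u + p"
    using J_yosida[of 1 "u + p"] J_add_yosida[of 1 "u + p"] by (auto simp: v_def q_def)
  then have "p - q = - (u - v)" by (simp add: algebra_simps)
  with assms[OF vq(1)] have "inner (u - v) (u - v) \<le> 0" by (metis inner_minus_left minus_diff_eq neg_0_le_iff_le)
  then have "u = v" by (metis inner_ge_zero inner_eq_zero_iff eq_iff_diff_eq_0 order_antisym)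
  with vq show ?thesis by simp
qed

lemma graph_closed:
  assumes "\<And>n. (u n, p n) \<in> A" "u \<longlonglongrightarrow> u'" "p \<longlonglongrightarrow> p'"
  shows "(u', p') \<in> A"
proof (rule maximal)
  fix v q assume "(v, q) \<in> A"
  have "(\<lambda>n. inner (p n - q) (u n - v)) \<longlonglongrightarrow> inner (p' - q) (u' - v)"
    by (intro tendsto_intros assms)
  then show "0 \<le> inner (p' - q) (u' - v)"
    by (rule LIMSEQ_le_const) (use accretive[OF assms(1) \<open>(v, q) \<in> A\<close>] in auto)
qed

section \<open>Yosida approximations and the element of least norm\<close>

lemma yosida_bound:
  assumes "h > 0" "(w, p) \<in> A"
  shows "norm (yosida h w) \<le> norm p"
proof -
  have "norm (w - J h w) \<le> norm ((w + h *\<^sub>R p) - w)"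
    using resolvent_nonexpansive[OF assms(2) J_yosida[OF assms(1), of w], of h] assms(1) by (simp add: J_add_yosida)
  then show ?thesis using assms(1) unfolding yosida_def
    by (subst norm_scaleR_inverse_le_iff) (auto simp: norm_minus_commute)
qed

lemma J_dist: "h > 0 \<Longrightarrow> (w, p) \<in> A \<Longrightarrow> norm (w - J h w) \<le> h * norm p"
  using yosida_bound[of h w p] unfolding yosida_def by (simp only: norm_scaleR_inverse_le_iff)

text \<open>With a, b the two approximations the claim amounts to |a|^2 <= <a,b>. Accretivity at the
  two resolvents, whose difference is k b - h a, gives h |a|^2 + k |b|^2 <= (h + k) <a,b>, and k |a
  - b|^2 >= 0 reduces this to the claim times h - k. One inequality thus shows both that the norms
  grow as the step shrinks and that bounded norms force a Cauchy sequence.\<close>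

lemma yosida_diff:
  assumes "0 < k" "k \<le> h"
  shows "(norm (yosida h u - yosida k u))\<^sup>2 \<le> (norm (yosida k u))\<^sup>2 - (norm (yosida h u))\<^sup>2"
proof (cases "k = h")
  case False
  define a where "a = yosida h u"
  define b where "b = yosida k u"
  have "0 \<le> inner (a - b) (J h u - J k u)"
    unfolding a_def b_def using assms by (intro accretive J_yosida) auto
  also have "J h u - J k u = k *\<^sub>R b - h *\<^sub>R a"
    using assms J_eq_diff_yosida[of h u] J_eq_diff_yosida[of k u] unfolding a_def b_def by simp
  finally have 1: "h * inner a a + k * inner b b \<le> (h + k) * inner a b"
    by (simp add: inner_simps inner_commute algebra_simps)
  have "(h - k) * (inner a a - 2 * inner a b + inner b b) \<le> (h - k) * (inner b b - inner a a)"
  proof (cases "inner a b \<le> 0")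
    case True
    then have "h * inner a a + k * inner b b \<le> 0"
      using 1 assms by (smt (verit) mult_nonneg_nonpos)
    then have "a = 0 \<and> b = 0"
      using assms by (smt (verit) False inner_ge_zero inner_eq_zero_iff mult_nonneg_nonneg mult_pos_pos)
    then show ?thesis by simp
  next
    case pos: False
    have ba: "inner a a \<le> inner a b"
    proof -
      have "0 \<le> k * inner (a - b) (a - b)" using assms by simp
      then have "2 * k * inner a b \<le> k * inner a a + k * inner b b"
        by (simp add: inner_simps inner_commute algebra_simps)
      with 1 have "(h - k) * inner a a \<le> (h - k) * inner a b" by (simp add: algebra_simps)
      then show ?thesis using assms False by simp
    qed
    then show ?thesis using assms by (intro mult_left_mono) auto
  qed
  then have "inner a a - 2 * inner a b + inner b b \<le> inner b b - inner a a"
    using assms False by simp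
  then show ?thesis unfolding power2_norm_eq_inner a_def[symmetric] b_def[symmetric]
    by (simp add: inner_simps inner_commute algebra_simps)
qed simp

lemma yosida_antimono:
  assumes "0 < k" "k \<le> h"
  shows "norm (yosida h u) \<le> norm (yosida k u)"
proof (rule power2_le_imp_le)
  have "0 \<le> (norm (yosida h u - yosida k u))\<^sup>2" by (rule zero_le_power2)
  with yosida_diff[OF assms] show "(norm (yosida h u))\<^sup>2 \<le> (norm (yosida k u))\<^sup>2" by (smt (verit))
qed (rule norm_ge_zero)

text \<open>As \<open>h\<close> tends to 0 the Yosida approximations converge strongly, which replaces weak compactness below;
  the limit is the element of least norm.\<close>

lemma yosida_limit:
  assumes bound: "\<And>h. h > 0 \<Longrightarrow> norm (yosida h u) \<le> M"
  obtains p where "(u, p) \<in> A" "norm p \<le> M" "(\<lambda>n. yosida (1 / real (Suc n)) u) \<longlonglongrightarrow> p"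
proof -
  define a where "a n = yosida (1 / real (Suc n)) u" for n
  define r where "r n = (norm (a n))\<^sup>2" for n
  have mono: "norm (a m) \<le> norm (a n)" if "m \<le> n" for m n
    unfolding a_def by (rule yosida_antimono) (use that in \<open>auto simp: field_simps\<close>)
  have diff: "(norm (a m - a n))\<^sup>2 \<le> r n - r m" if "m \<le> n" for m n
    unfolding a_def r_def by (rule yosida_diff) (use that in \<open>auto simp: field_simps\<close>)
  have M: "norm (a n) \<le> M" for n unfolding a_def by (rule bound) simp
  have "convergent r"
  proof (rule Bseq_mono_convergent)
    show "Bseq r" using M by (intro BseqI'[of _ "M\<^sup>2"]) (simp add: r_def power_mono)
    show "\<forall>m n. m \<le> n \<longrightarrow> r m \<le> r n" using mono by (simp add: r_def power_mono)
  qed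
  then have "Cauchy r" by (rule convergent_Cauchy)
  have "Cauchy a"
  proof (rule metric_CauchyI)
    fix e :: real assume "e > 0"
    then obtain N where N: "\<forall>m\<ge>N. \<forall>n\<ge>N. dist (r m) (r n) < e\<^sup>2"
      using metric_CauchyD[OF \<open>Cauchy r\<close>, of "e\<^sup>2"] by auto
    have *: "dist (a m) (a n) < e" if "N \<le> m" "m \<le> n" for m n
    proof -
      have "(norm (a m - a n))\<^sup>2 < e\<^sup>2"
        using diff[OF that(2)] N that by (smt (verit) dist_real_def le_trans)
      then show ?thesis using \<open>e > 0\<close> by (simp add: dist_norm power_less_imp_less_base)
    qed
    show "\<exists>M. \<forall>m\<ge>M. \<forall>n\<ge>M. dist (a m) (a n) < e"
      by (metis * dist_commute nle_le)
  qed
  then obtain p where p: "a \<longlonglongrightarrow> p" by (meson Cauchy_convergent_iff convergent_def)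
  have "(\<lambda>n. u - (1 / real (Suc n)) *\<^sub>R a n) \<longlonglongrightarrow> u - 0 *\<^sub>R p"
    by (intro tendsto_intros p LIMSEQ_Suc[OF lim_1_over_n])
  moreover have "u - (1 / real (Suc n)) *\<^sub>R a n = J (1 / real (Suc n)) u" for n
    unfolding a_def by (subst J_eq_diff_yosida) auto
  ultimately have conv: "(\<lambda>n. J (1 / real (Suc n)) u) \<longlonglongrightarrow> u" by simp
  have "(J (1 / real (Suc n)) u, a n) \<in> A" for n
    unfolding a_def by (rule J_yosida) simp
  from graph_closed[OF this conv p] have "(u, p) \<in> A" .
  moreover have "norm p \<le> M"
    by (rule LIMSEQ_le_const2[OF tendsto_norm[OF p]]) (use M in auto)
  ultimately show ?thesis using that p unfolding a_def by blast
qed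

text \<open>The minimal section of the relation, that is the element of least norm among all p with
  (u, p) in \<open>A\<close>; outside the domain the value is arbitrary.\<close>

definition least :: "'a \<Rightarrow> 'a" where
  "least u = lim (\<lambda>n. yosida (1 / real (Suc n)) u)"

lemma least_props:
  assumes "(u, q) \<in> A"
  shows "(u, least u) \<in> A" "norm (least u) \<le> norm q" "(\<lambda>n. yosida (1 / real (Suc n)) u) \<longlonglongrightarrow> least u"
proof -
  from yosida_limit[OF yosida_bound, OF _ assms] obtain p
    where p: "(u, p) \<in> A" "norm p \<le> norm q" "(\<lambda>n. yosida (1 / real (Suc n)) u) \<longlonglongrightarrow> p" by blast
  have "least u = p" unfolding least_def using p(3) by (rule limI)
  with p show "(u, least u) \<in> A" "norm (least u) \<le> norm q" "(\<lambda>n. yosida (1 / real (Suc n)) u) \<longlonglongrightarrow> least u"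
    by auto
qed

text \<open>This is \<open>yosida_diff\<close> with the smaller step sent to 0. Convergence of norms
  thereby becomes convergence of vectors with an explicit modulus.\<close>

lemma least_close:
  assumes "(u, q) \<in> A" "0 < h"
  shows "(norm (yosida h u - least u))\<^sup>2 \<le> (norm (least u))\<^sup>2 - (norm (yosida h u))\<^sup>2"
proof -
  note lim = least_props(3)[OF assms(1)]
  have "(\<lambda>n. (norm (yosida h u - yosida (1 / real (Suc n)) u))\<^sup>2) \<longlonglongrightarrow> (norm (yosida h u - least u))\<^sup>2"
    by (intro tendsto_intros lim)
  moreover have "(\<lambda>n. (norm (yosida (1 / real (Suc n)) u))\<^sup>2 - (norm (yosida h u))\<^sup>2)
      \<longlonglongrightarrow> (norm (least u))\<^sup>2 - (norm (yosida h u))\<^sup>2"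
    by (intro tendsto_intros lim)
  moreover obtain N where N: "1 / real (Suc N) < h" using nat_approx_posE[OF assms(2)] by metis
  have "1 / real (Suc n) \<le> h" if "n \<ge> N" for n
    using N that by (smt (verit) frac_le of_nat_0_less_iff of_nat_le_iff zero_less_Suc Suc_le_mono)
  ultimately show ?thesis
    by (intro LIMSEQ_le) (auto intro!: exI[of _ N] yosida_diff)
qed

subsection \<open>Implicit Euler scheme\<close>

lemma funpow_J_nonexpansive:
  assumes "h > 0"
  shows "norm ((J h ^^ n) x - (J h ^^ n) y) \<le> norm (x - y)"
proof (induction n)
  case (Suc n)
  then show ?case
    using J_nonexpansive[OF assms, of "(J h ^^ n) x" "(J h ^^ n) y"] by simp
qed simp

text \<open>Resolvents do not expand increments, so the first increment, which the slope at
  \<open>w\<close> controls, bounds all later ones.\<close>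

lemma euler_step:
  assumes "h > 0" "(w, p) \<in> A"
  shows "norm ((J h ^^ n) w - (J h ^^ Suc n) w) \<le> h * norm p"
proof -
  have "norm ((J h ^^ n) w - (J h ^^ n) (J h w)) \<le> norm (w - J h w)"
    by (rule funpow_J_nonexpansive[OF assms(1)])
  with J_dist[OF assms] show ?thesis unfolding funpow_Suc_right o_apply by linarith
qed

lemma euler_lipschitz_aux:
  assumes "h > 0" "(w, p) \<in> A"
  shows "norm ((J h ^^ n) w - (J h ^^ (n + m)) w) \<le> real m * h * norm p"
proof (induction m)
  case (Suc m)
  have "norm ((J h ^^ n) w - (J h ^^ (n + Suc m)) w)
      \<le> norm ((J h ^^ n) w - (J h ^^ (n + m)) w) + norm ((J h ^^ (n + m)) w - (J h ^^ Suc (n + m)) w)"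
    using norm_triangle_ineq[of "(J h ^^ n) w - (J h ^^ (n + m)) w" "(J h ^^ (n + m)) w - (J h ^^ Suc (n + m)) w"]
    by simp
  also have "\<dots> \<le> real m * h * norm p + h * norm p"
    using Suc euler_step[OF assms] by (intro add_mono)
  finally show ?case by (simp add: algebra_simps)
qed simp

lemma euler_lipschitz:
  assumes "h > 0" "(w, p) \<in> A"
  shows "norm ((J h ^^ n) w - (J h ^^ m) w) \<le> \<bar>real m - real n\<bar> * h * norm p"
proof (cases "n \<le> m")
  case True
  then show ?thesis using euler_lipschitz_aux[OF assms, of n "m - n"] by (simp add: of_nat_diff)
next
  case False
  then have "norm ((J h ^^ m) w - (J h ^^ n) w) \<le> \<bar>real m - real n\<bar> * h * norm p"
    using euler_lipschitz_aux[OF assms, of m "n - m"] by (simp add: of_nat_diff)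
  then show ?thesis by (subst norm_minus_commute)
qed

lemma euler_slope:
  assumes "h > 0" "(w, p) \<in> A"
  shows "((J h ^^ Suc n) w, (1 / h) *\<^sub>R ((J h ^^ n) w - (J h ^^ Suc n) w)) \<in> A"
    and "norm ((1 / h) *\<^sub>R ((J h ^^ n) w - (J h ^^ Suc n) w)) \<le> norm p"
  subgoal using J_yosida[OF assms(1), of "(J h ^^ n) w"] unfolding yosida_def funpow.simps o_apply .
  subgoal unfolding norm_scaleR_inverse_le_iff[OF assms(1)] by (rule euler_step[OF assms])
  done

text \<open>One step of length 2h is compared with two of length h, pairing the slopes by
  accretivity. Only the pairing with the first half step is evaluated at the wrong point, off by h
  q2, which costs at most 4 h^2 |p|^2 in the squared distance. With the time 2nh fixed, the distance
  is of order sqrt h.\<close>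

lemma euler_halving:
  assumes h: "h > 0" and w: "(w, p) \<in> A"
  shows "(norm ((J (2 * h) ^^ n) w - (J h ^^ (2 * n)) w))\<^sup>2 \<le> 4 * real n * h\<^sup>2 * (norm p)\<^sup>2"
proof (induction n)
  case (Suc n)
  define u0 where "u0 = (J (2 * h) ^^ n) w"
  define u where "u = (J (2 * h) ^^ Suc n) w"
  define p1 where "p1 = (1 / (2 * h)) *\<^sub>R (u0 - u)"
  define w0 where "w0 = (J h ^^ (2 * n)) w"
  define w1 where "w1 = (J h ^^ Suc (2 * n)) w"
  define w2 where "w2 = (J h ^^ Suc (Suc (2 * n))) w"
  define q1 where "q1 = (1 / h) *\<^sub>R (w0 - w1)"
  define q2 where "q2 = (1 / h) *\<^sub>R (w1 - w2)"
  have p1: "(u, p1) \<in> A" "norm p1 \<le> norm p"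
    unfolding u_def p1_def u0_def using euler_slope[OF _ w, of "2 * h" n] h by auto
  have q1: "(w1, q1) \<in> A" "norm q1 \<le> norm p"
    unfolding w1_def q1_def w0_def using euler_slope[OF h w, of "2 * n"] by auto
  have q2: "(w2, q2) \<in> A" "norm q2 \<le> norm p"
    unfolding w1_def q2_def w2_def using euler_slope[OF h w, of "Suc (2 * n)"] by auto
  have two: "(2 * h) *\<^sub>R p1 = h *\<^sub>R p1 + h *\<^sub>R p1"
    by (metis mult_2 scaleR_left_distrib)
  have u0: "u0 = u + (h *\<^sub>R p1 + h *\<^sub>R p1)" unfolding two[symmetric] using h by (simp add: p1_def)
  have w12: "w1 = w2 + h *\<^sub>R q2" using h by (simp add: q2_def)
  have "w0 = w1 + h *\<^sub>R q1" using h by (simp add: q1_def)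
  with w12 have w0: "w0 = w2 + h *\<^sub>R q2 + h *\<^sub>R q1" by simp
  have m1: "0 \<le> h * inner (p1 - q2) (u - w2)" and m2: "0 \<le> h * inner (p1 - q1) (u - w1)"
    using accretive[OF p1(1) q2(1)] accretive[OF p1(1) q1(1)] h by simp_all
  define z where "z = h *\<^sub>R (p1 - q2) + h *\<^sub>R (p1 - q1)"
  have uw: "u0 - w0 = (u - w2) + z"
    unfolding z_def u0 w0 by (simp add: scaleR_right_diff_distrib)
  have "inner (u - w2) (u - w2) - inner (u0 - w0) (u0 - w0) = - 2 * inner (u - w2) z - inner z z"
    unfolding uw by (simp add: inner_add_left inner_add_right inner_commute)
  also have "\<dots> \<le> - 2 * inner (u - w2) z" by simp
  also have "\<dots> = - 2 * (h * inner (p1 - q2) (u - w2)) - 2 * (h * inner (p1 - q1) (u - w2))"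
    unfolding z_def by (simp add: inner_add_right inner_commute)
  also have "inner (p1 - q1) (u - w2) = inner (p1 - q1) (u - w1) + h * inner (p1 - q1) q2"
  proof -
    have "u - w2 = (u - w1) + h *\<^sub>R q2" by (simp add: w12)
    then show ?thesis by (simp only: inner_add_right inner_scaleR_right)
  qed
  also have "- 2 * (h * inner (p1 - q2) (u - w2)) - 2 * (h * (inner (p1 - q1) (u - w1) + h * inner (p1 - q1) q2))
      = - 2 * (h * inner (p1 - q2) (u - w2)) - 2 * (h * inner (p1 - q1) (u - w1)) - 2 * h\<^sup>2 * inner (p1 - q1) q2"
    by (simp only: power2_eq_square distrib_left mult.assoc)
  also have "\<dots> \<le> 2 * h\<^sup>2 * \<bar>inner (p1 - q1) q2\<bar>"
  proof -
    have "- (2 * h\<^sup>2 * inner (p1 - q1) q2) \<le> 2 * h\<^sup>2 * \<bar>inner (p1 - q1) q2\<bar>"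
      unfolding mult_minus_right[symmetric] by (intro mult_left_mono) auto
    with m1 m2 show ?thesis by linarith
  qed
  also have "\<dots> \<le> 2 * h\<^sup>2 * (2 * (norm p)\<^sup>2)"
  proof (rule mult_left_mono)
    have "\<bar>inner (p1 - q1) q2\<bar> \<le> norm (p1 - q1) * norm q2" by (rule Cauchy_Schwarz_ineq2)
    also have "\<dots> \<le> (norm p + norm p) * norm p"
      using norm_triangle_ineq4[of p1 q1] p1(2) q1(2) q2(2) by (intro mult_mono) auto
    finally show "\<bar>inner (p1 - q1) q2\<bar> \<le> 2 * (norm p)\<^sup>2" by (simp add: power2_eq_square)
  qed simp
  finally have "(norm (u - w2))\<^sup>2 \<le> (norm (u0 - w0))\<^sup>2 + 4 * h\<^sup>2 * (norm p)\<^sup>2"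
    unfolding power2_norm_eq_inner by simp
  also have "\<dots> \<le> 4 * real n * h\<^sup>2 * (norm p)\<^sup>2 + 4 * h\<^sup>2 * (norm p)\<^sup>2"
    using Suc unfolding u0_def w0_def by simp
  finally show ?case unfolding u_def w2_def by (simp add: algebra_simps)
qed simp

text \<open>Steps of length 2^-k, so that passing to the next level halves the step; the incomplete
  last step is dropped.\<close>

definition euler :: "nat \<Rightarrow> real \<Rightarrow> 'a \<Rightarrow> 'a" where
  "euler k t w = (J ((1 / 2) ^ k) ^^ nat \<lfloor>t * 2 ^ k\<rfloor>) w"

definition S :: "real \<Rightarrow> 'a \<Rightarrow> 'a" where
  "S t w = lim (\<lambda>k. euler k t w)"

lemma euler_nonexpansive: "norm (euler k t x - euler k t y) \<le> norm (x - y)"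
  unfolding euler_def by (rule funpow_J_nonexpansive) simp

text \<open>\<open>euler_halving\<close> contributes sqrt t times 2^(-k/2). Rounding t down on the
  finer grid gives 2n or 2n + 1 steps, so at most one small step is added. The sum is geometric with
  ratio 1/sqrt 2, hence summable in k.\<close>

lemma euler_succ_dist:
  assumes "t \<ge> 0" "(w, p) \<in> A"
  shows "norm (euler k t w - euler (Suc k) t w) \<le> (sqrt t + 1) * norm p * (1 / sqrt 2) ^ k"
proof -
  define h :: real where "h = (1 / 2) ^ Suc k"
  define n where "n = nat \<lfloor>t * 2 ^ k\<rfloor>"
  define m where "m = nat \<lfloor>t * 2 ^ Suc k\<rfloor>"
  have h: "h > 0" "2 * h = (1 / 2) ^ k" by (simp_all add: h_def)
  have n_le: "real n \<le> t * 2 ^ k" unfolding n_def using assms(1) by (simp add: of_nat_nat)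
  have fl: "\<lfloor>t * 2 ^ Suc k\<rfloor> = 2 * \<lfloor>t * 2 ^ k\<rfloor> \<or> \<lfloor>t * 2 ^ Suc k\<rfloor> = 2 * \<lfloor>t * 2 ^ k\<rfloor> + 1"
    using floor_mult2_cases[of "t * 2 ^ k"] by (simp add: mult_ac)
  have mn: "\<bar>real m - real (2 * n)\<bar> \<le> 1"
    using fl assms(1) unfolding m_def n_def
    by (auto simp: nat_mult_distrib nat_add_distrib of_nat_nat)
  have "norm (euler k t w - euler (Suc k) t w) = norm ((J (2 * h) ^^ n) w - (J h ^^ m) w)"
    unfolding euler_def n_def m_def h(2) by (simp add: h_def)
  also have "\<dots> \<le> norm ((J (2 * h) ^^ n) w - (J h ^^ (2 * n)) w) + norm ((J h ^^ (2 * n)) w - (J h ^^ m) w)"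
    using norm_triangle_ineq[of "(J (2 * h) ^^ n) w - (J h ^^ (2 * n)) w" "(J h ^^ (2 * n)) w - (J h ^^ m) w"]
    by simp
  also have "norm ((J (2 * h) ^^ n) w - (J h ^^ (2 * n)) w) \<le> sqrt t * norm p * (1 / sqrt 2) ^ k"
  proof (rule power2_le_imp_le)
    have "(norm ((J (2 * h) ^^ n) w - (J h ^^ (2 * n)) w))\<^sup>2 \<le> 4 * real n * h\<^sup>2 * (norm p)\<^sup>2"
      by (rule euler_halving[OF h(1) assms(2)])
    also have "\<dots> \<le> 4 * (t * 2 ^ k) * h\<^sup>2 * (norm p)\<^sup>2"
      using n_le by (intro mult_right_mono mult_left_mono) auto
    also have "4 * h\<^sup>2 = (1 / 2) ^ k * (1 / 2) ^ k" by (simp add: h(2)[symmetric] power2_eq_square)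
    then have "4 * (t * 2 ^ k) * h\<^sup>2 * (norm p)\<^sup>2 = t * (2 ^ k * ((1 / 2) ^ k * (1 / 2) ^ k)) * (norm p)\<^sup>2"
      by (simp add: mult_ac)
    also have "2 ^ k * ((1 / 2) ^ k * (1 / 2) ^ k) = (1 / 2 :: real) ^ k"
      by (simp add: mult.assoc[symmetric] power_mult_distrib[symmetric])
    also have "t * (1 / 2) ^ k * (norm p)\<^sup>2 = (sqrt t * norm p * (1 / sqrt 2) ^ k)\<^sup>2"
    proof -
      have "((1 / sqrt 2) ^ k)\<^sup>2 = ((1 / sqrt 2)\<^sup>2) ^ k"
        by (simp only: power_mult[symmetric] mult.commute)
      also have "(1 / sqrt 2)\<^sup>2 = (1 / 2 :: real)" by (simp add: power_divide)
      finally have "((1 / sqrt 2) ^ k)\<^sup>2 = (1 / 2 :: real) ^ k" .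
      then show ?thesis using assms(1) by (simp only: power_mult_distrib real_sqrt_pow2 mult_ac)
    qed
    finally show "(norm ((J (2 * h) ^^ n) w - (J h ^^ (2 * n)) w))\<^sup>2 \<le> (sqrt t * norm p * (1 / sqrt 2) ^ k)\<^sup>2" .
  qed (use assms(1) in simp)
  also have "norm ((J h ^^ (2 * n)) w - (J h ^^ m) w) \<le> norm p * (1 / sqrt 2) ^ k"
  proof -
    have "norm ((J h ^^ (2 * n)) w - (J h ^^ m) w) \<le> \<bar>real m - real (2 * n)\<bar> * h * norm p"
      by (rule euler_lipschitz[OF h(1) assms(2)])
    also have "\<dots> \<le> 1 * h * norm p" using mn h(1) by (intro mult_right_mono) auto
    also have "h \<le> (1 / sqrt 2) ^ k"
    proof -
      have "h \<le> (1 / 2) ^ k" by (simp add: h_def)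
      also have "\<dots> \<le> (1 / sqrt 2) ^ k"
        by (intro power_mono frac_le) (auto simp: sqrt_le_D real_le_lsqrt)
      finally show ?thesis .
    qed
    then have "1 * h * norm p \<le> 1 * (1 / sqrt 2) ^ k * norm p" by (intro mult_right_mono) auto
    finally show ?thesis by (simp add: mult.commute)
  qed
  finally show ?thesis by (simp add: algebra_simps)
qed

lemma euler_Cauchy_domain:
  assumes "t \<ge> 0" "(w, p) \<in> A"
  shows "convergent (\<lambda>k. euler k t w)"
proof -
  have "summable (\<lambda>k. euler k t w - euler (Suc k) t w)"
  proof (rule summable_comparison_test')
    show "norm (euler k t w - euler (Suc k) t w) \<le> (sqrt t + 1) * norm p * (1 / sqrt 2) ^ k" for k
      by (rule euler_succ_dist[OF assms])
    show "summable (\<lambda>k. (sqrt t + 1) * norm p * (1 / sqrt 2) ^ k)"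
      by (intro summable_mult summable_geometric) auto
  qed
  then obtain l where "(\<lambda>n. \<Sum>k<n. euler k t w - euler (Suc k) t w) \<longlonglongrightarrow> l"
    by (auto simp: summable_def sums_def)
  then have "(\<lambda>n. euler 0 t w - (\<Sum>k<n. euler k t w - euler (Suc k) t w)) \<longlonglongrightarrow> euler 0 t w - l"
    by (intro tendsto_intros)
  moreover have "euler 0 t w - (\<Sum>k<n. euler k t w - euler (Suc k) t w) = euler n t w" for n
    using sum_lessThan_telescope'[of "\<lambda>k. euler k t w" n] by simp
  ultimately show ?thesis unfolding convergent_def by auto
qed

end

text \<open>The scheme converges on the domain; density and nonexpansiveness extend the limit to the
  whole space.\<close>

locale dense_m_accretive = m_accretive +
  assumes dense_domain: "closure (fst ` A) = UNIV"
begin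

lemma S_tendsto:
  assumes "t \<ge> 0"
  shows "(\<lambda>k. euler k t w) \<longlonglongrightarrow> S t w"
proof -
  have "Cauchy (\<lambda>k. euler k t w)"
  proof (rule metric_CauchyI)
    fix e :: real assume "e > 0"
    have "w \<in> closure (fst ` A)" using dense_domain by simp
    then obtain v p where v: "(v, p) \<in> A" "dist v w < e / 3"
      using closure_approachable[of w] \<open>e > 0\<close> by (auto dest: spec[of _ "e / 3"])
    obtain N where N: "\<And>m n. m \<ge> N \<Longrightarrow> n \<ge> N \<Longrightarrow> dist (euler m t v) (euler n t v) < e / 3"
      using metric_CauchyD[OF convergent_Cauchy[OF euler_Cauchy_domain[OF assms v(1)]], of "e / 3"] \<open>e > 0\<close>
      by auto
    have "dist (euler m t w) (euler n t w) < e" if "m \<ge> N" "n \<ge> N" for m n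
    proof -
      have "dist (euler k t w) (euler k t v) < e / 3" for k
        using euler_nonexpansive[of k t w v] v(2) by (simp add: dist_norm norm_minus_commute)
      from this[of m] this[of n] N[OF that] show ?thesis
        using dist_triangle_third[of "euler m t w" "euler m t v" e "euler n t v" "euler n t w"]
        by (simp add: dist_commute)
    qed
    then show "\<exists>M. \<forall>m\<ge>M. \<forall>n\<ge>M. dist (euler m t w) (euler n t w) < e" by blast
  qed
  then have "convergent (\<lambda>k. euler k t w)" by (simp add: Cauchy_convergent_iff)
  then show ?thesis unfolding S_def by (simp add: convergent_LIMSEQ_iff)
qed

lemma S_nonexpansive:
  assumes "t \<ge> 0"
  shows "norm (S t x - S t y) \<le> norm (x - y)"
  by (rule LIMSEQ_le_const2[OF tendsto_norm[OF tendsto_diff[OF S_tendsto S_tendsto]]])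
     (use euler_nonexpansive assms in auto)

lemma S_0: "S 0 w = w"
  using S_tendsto[of 0 w] by (simp add: euler_def LIMSEQ_const_iff)

lemma dyadic_floor_tendsto:
  assumes "t \<ge> 0"
  shows "(\<lambda>k. real (nat \<lfloor>t * 2 ^ k\<rfloor>) * (1 / 2) ^ k) \<longlonglongrightarrow> t"
proof -
  have *: "\<bar>real (nat \<lfloor>t * 2 ^ k\<rfloor>) * (1 / 2) ^ k - t\<bar> \<le> (1 / 2) ^ k" for k
  proof -
    have "\<bar>real (nat \<lfloor>t * 2 ^ k\<rfloor>) - t * 2 ^ k\<bar> \<le> 1" using assms by (simp add: of_nat_nat) linarith
    then have "\<bar>real (nat \<lfloor>t * 2 ^ k\<rfloor>) - t * 2 ^ k\<bar> * (1 / 2) ^ k \<le> 1 * (1 / 2) ^ k"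
      by (intro mult_right_mono) auto
    moreover have "\<bar>real (nat \<lfloor>t * 2 ^ k\<rfloor>) - t * 2 ^ k\<bar> * (1 / 2) ^ k
        = \<bar>(real (nat \<lfloor>t * 2 ^ k\<rfloor>) - t * 2 ^ k) * (1 / 2) ^ k\<bar>" by (simp add: abs_mult)
    moreover have "(real (nat \<lfloor>t * 2 ^ k\<rfloor>) - t * 2 ^ k) * (1 / 2) ^ k = real (nat \<lfloor>t * 2 ^ k\<rfloor>) * (1 / 2) ^ k - t"
      by (simp add: algebra_simps power_divide)
    ultimately show ?thesis by simp
  qed
  have "(\<lambda>k. real (nat \<lfloor>t * 2 ^ k\<rfloor>) * (1 / 2) ^ k - t) \<longlonglongrightarrow> 0"
    by (rule Lim_null_comparison[of _ "\<lambda>k. (1 / 2) ^ k"]) (use * in \<open>auto intro!: LIMSEQ_power_zero\<close>)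
  then show ?thesis by (simp add: LIM_zero_iff)
qed

lemma S_lipschitz:
  assumes "(w, p) \<in> A" "s \<ge> 0" "t \<ge> 0"
  shows "norm (S s w - S t w) \<le> norm p * \<bar>s - t\<bar>"
proof (rule LIMSEQ_le[OF tendsto_norm[OF tendsto_diff[OF S_tendsto[OF assms(2)] S_tendsto[OF assms(3)]]]])
  show "(\<lambda>k. \<bar>real (nat \<lfloor>t * 2 ^ k\<rfloor>) * (1 / 2) ^ k - real (nat \<lfloor>s * 2 ^ k\<rfloor>) * (1 / 2) ^ k\<bar> * norm p)
      \<longlonglongrightarrow> norm p * \<bar>s - t\<bar>"
    by (subst abs_minus_commute[of s t], subst mult.commute) (intro tendsto_intros dyadic_floor_tendsto assms)
  show "\<exists>N. \<forall>k\<ge>N. norm (euler k s w - euler k t w)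
      \<le> \<bar>real (nat \<lfloor>t * 2 ^ k\<rfloor>) * (1 / 2) ^ k - real (nat \<lfloor>s * 2 ^ k\<rfloor>) * (1 / 2) ^ k\<bar> * norm p"
  proof (intro exI[of _ 0] allI impI)
    fix k
    have "norm (euler k s w - euler k t w)
        \<le> \<bar>real (nat \<lfloor>t * 2 ^ k\<rfloor>) - real (nat \<lfloor>s * 2 ^ k\<rfloor>)\<bar> * (1 / 2) ^ k * norm p"
      unfolding euler_def by (rule euler_lipschitz[OF _ assms(1)]) simp
    also have "\<bar>real (nat \<lfloor>t * 2 ^ k\<rfloor>) - real (nat \<lfloor>s * 2 ^ k\<rfloor>)\<bar> * (1 / 2) ^ k
        = \<bar>real (nat \<lfloor>t * 2 ^ k\<rfloor>) * (1 / 2) ^ k - real (nat \<lfloor>s * 2 ^ k\<rfloor>) * (1 / 2) ^ k\<bar>"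
      by (simp add: abs_mult flip: left_diff_distrib)
    finally show "norm (euler k s w - euler k t w)
      \<le> \<bar>real (nat \<lfloor>t * 2 ^ k\<rfloor>) * (1 / 2) ^ k - real (nat \<lfloor>s * 2 ^ k\<rfloor>) * (1 / 2) ^ k\<bar> * norm p" .
  qed
qed

end

lemma dyadic_floor_add_cases:
  fixes s t :: real
  assumes "s \<ge> 0" "t \<ge> 0"
  shows "\<bar>real (nat \<lfloor>s + t\<rfloor>) - real (nat \<lfloor>s\<rfloor> + nat \<lfloor>t\<rfloor>)\<bar> \<le> 1"
proof -
  have "\<lfloor>s\<rfloor> + \<lfloor>t\<rfloor> \<le> \<lfloor>s + t\<rfloor>" by (rule le_floor_add)
  moreover have "\<lfloor>s + t\<rfloor> \<le> \<lfloor>s\<rfloor> + \<lfloor>t\<rfloor> + 1" by linarith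
  moreover have "0 \<le> \<lfloor>s\<rfloor>" "0 \<le> \<lfloor>t\<rfloor>" using assms by auto
  ultimately have "nat \<lfloor>s + t\<rfloor> = nat \<lfloor>s\<rfloor> + nat \<lfloor>t\<rfloor> \<or> nat \<lfloor>s + t\<rfloor> = Suc (nat \<lfloor>s\<rfloor> + nat \<lfloor>t\<rfloor>)"
    by linarith
  then show ?thesis by auto
qed

context dense_m_accretive
begin

text \<open>The numbers of dyadic steps in s, t and s + t add up to within one step, whose length
  tends to 0; the remaining error passes through nonexpansive resolvents.\<close>

lemma S_add_domain:
  assumes w: "(w, p) \<in> A" and "s \<ge> 0" "t \<ge> 0"
  shows "S (s + t) w = S s (S t w)"
proof -
  have "(\<lambda>k. norm (euler k (s + t) w - euler k s (S t w))) \<longlonglongrightarrow> 0"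
  proof (rule Lim_null_comparison)
    show "\<forall>\<^sub>F k in sequentially. norm (norm (euler k (s + t) w - euler k s (S t w)))
        \<le> (1 / 2) ^ k * norm p + norm (euler k t w - S t w)"
    proof (intro always_eventually allI)
      fix k
      define h :: real where "h = (1 / 2) ^ k"
      define m where "m = nat \<lfloor>s * 2 ^ k\<rfloor>"
      define n where "n = nat \<lfloor>t * 2 ^ k\<rfloor>"
      define l where "l = nat \<lfloor>(s + t) * 2 ^ k\<rfloor>"
      have "h > 0" by (simp add: h_def)
      have "\<bar>real l - real (m + n)\<bar> \<le> 1"
        using dyadic_floor_add_cases[of "s * 2 ^ k" "t * 2 ^ k"] assms
        unfolding l_def m_def n_def by (simp add: distrib_right)
      then have "\<bar>real (m + n) - real l\<bar> \<le> 1" by linarith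
      have "norm ((J h ^^ l) w - (J h ^^ (m + n)) w) \<le> \<bar>real (m + n) - real l\<bar> * h * norm p"
        by (rule euler_lipschitz[OF \<open>h > 0\<close> w])
      also have "\<dots> \<le> 1 * h * norm p"
        using \<open>\<bar>real (m + n) - real l\<bar> \<le> 1\<close> \<open>h > 0\<close> by (intro mult_right_mono) auto
      finally have 1: "norm (euler k (s + t) w - (J h ^^ m) (euler k t w)) \<le> h * norm p"
        by (simp add: euler_def h_def l_def m_def n_def funpow_add)
      have 2: "norm ((J h ^^ m) (euler k t w) - (J h ^^ m) (S t w)) \<le> norm (euler k t w - S t w)"
        by (rule funpow_J_nonexpansive[OF \<open>h > 0\<close>])
      have "euler k s (S t w) = (J h ^^ m) (S t w)" by (simp add: euler_def h_def m_def)
      with 1 2 show "norm (norm (euler k (s + t) w - euler k s (S t w)))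
          \<le> (1 / 2) ^ k * norm p + norm (euler k t w - S t w)"
        using norm_triangle_ineq[of "euler k (s + t) w - (J h ^^ m) (euler k t w)"
            "(J h ^^ m) (euler k t w) - (J h ^^ m) (S t w)"]
        unfolding h_def by simp
    qed
    have "(\<lambda>k. (1 / 2) ^ k * norm p + norm (euler k t w - S t w)) \<longlonglongrightarrow> 0 * norm p + norm (S t w - S t w)"
      by (intro tendsto_intros S_tendsto assms LIMSEQ_power_zero) simp
    then show "(\<lambda>k. (1 / 2) ^ k * norm p + norm (euler k t w - S t w)) \<longlonglongrightarrow> 0" by simp
  qed
  moreover have "(\<lambda>k. norm (euler k (s + t) w - euler k s (S t w))) \<longlonglongrightarrow> norm (S (s + t) w - S s (S t w))"
    using assms by (intro tendsto_intros S_tendsto) auto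
  ultimately have "norm (S (s + t) w - S s (S t w)) = 0" by (metis LIMSEQ_unique)
  then show ?thesis by simp
qed

lemma domain_approx:
  assumes "e > 0"
  obtains v p where "(v, p) \<in> A" "norm (v - w) < e"
proof -
  have "w \<in> closure (fst ` A)" using dense_domain by simp
  then obtain v where "v \<in> fst ` A" "dist v w < e" using assms unfolding closure_approachable by blast
  then show ?thesis using that by (auto simp: dist_norm)
qed

lemma S_add:
  assumes "s \<ge> 0" "t \<ge> 0"
  shows "S (s + t) w = S s (S t w)"
proof -
  have "norm (S (s + t) w - S s (S t w)) \<le> 0 + e" if "e > 0" for e
  proof -
    have "e / 2 > 0" using that by simp
    then obtain v p where v: "(v, p) \<in> A" "norm (v - w) < e / 2" by (rule domain_approx)
    have "norm (S (s + t) w - S (s + t) v) \<le> norm (w - v)"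
      using assms by (intro S_nonexpansive) auto
    moreover have "norm (S s (S t v) - S s (S t w)) \<le> norm (v - w)"
      using S_nonexpansive[OF assms(1)] S_nonexpansive[OF assms(2)] order_trans by blast
    ultimately have "norm ((S (s + t) w - S (s + t) v) + (S s (S t v) - S s (S t w))) \<le> e"
      using v(2) norm_triangle_ineq[of "S (s + t) w - S (s + t) v" "S s (S t v) - S s (S t w)"]
        norm_minus_commute[of v w] by linarith
    then show ?thesis using S_add_domain[OF v(1) assms] by simp
  qed
  then have "norm (S (s + t) w - S s (S t w)) \<le> 0" by (rule field_le_epsilon)
  then show ?thesis by simp
qed

lemma S_continuous:
  assumes "t \<ge> 0"
  shows "((\<lambda>s. norm (S s w - S t w)) \<longlongrightarrow> 0) (at t within {0..})"
proof (rule tendstoI)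
  fix e :: real assume "e > 0"
  then have "e / 4 > 0" by simp
  then obtain v p where v: "(v, p) \<in> A" "norm (v - w) < e / 4" by (rule domain_approx)
  have "\<forall>\<^sub>F s in at t within {0..}. dist s t < e / (4 * (norm p + 1)) \<and> s \<in> {0..}"
    using \<open>e > 0\<close> unfolding eventually_at
    by (intro exI[of _ "e / (4 * (norm p + 1))"]) (auto simp: add_nonneg_pos)
  then show "\<forall>\<^sub>F s in at t within {0..}. dist (norm (S s w - S t w)) 0 < e"
  proof eventually_elim
    case (elim s)
    then have "s \<ge> 0" and st: "\<bar>s - t\<bar> < e / (4 * (norm p + 1))" by (auto simp: dist_real_def)
    have "norm (S s v - S t v) \<le> norm p * \<bar>s - t\<bar>" by (rule S_lipschitz[OF v(1) \<open>s \<ge> 0\<close> assms])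
    also have "\<dots> \<le> (norm p + 1) * \<bar>s - t\<bar>" by (intro mult_right_mono) auto
    also have "\<dots> \<le> (norm p + 1) * (e / (4 * (norm p + 1)))" using st by (intro mult_left_mono) auto
    also have "\<dots> = e / 4" by (simp add: add_nonneg_pos[THEN less_imp_neq, symmetric] field_simps add_nonneg_eq_0_iff)
    finally have 1: "norm (S s v - S t v) \<le> e / 4" .
    have 2: "norm (S s w - S s v) \<le> norm (w - v)" by (rule S_nonexpansive[OF \<open>s \<ge> 0\<close>])
    have 3: "norm (S t v - S t w) \<le> norm (v - w)" by (rule S_nonexpansive[OF assms])
    have "norm (S s w - S t w) \<le> norm (S s w - S s v) + norm (S s v - S t v) + norm (S t v - S t w)"
      using norm_triangle_ineq[of "S s w - S s v" "S s v - S t v"]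
        norm_triangle_ineq[of "S s w - S t v" "S t v - S t w"] by simp
    with 1 2 3 v(2) \<open>e > 0\<close> show ?case using norm_minus_commute[of v w] by simp
  qed
qed

subsection \<open>Differentiability of orbits\<close>

lemma J_tendsto:
  assumes "h > 0" "x \<longlonglongrightarrow> y"
  shows "(\<lambda>k. J h (x k)) \<longlonglongrightarrow> J h y"
proof -
  have "(\<lambda>k. norm (x k - y)) \<longlonglongrightarrow> 0" using assms(2) by (simp add: LIM_zero_iff tendsto_norm_zero_iff)
  then have "(\<lambda>k. J h (x k) - J h y) \<longlonglongrightarrow> 0"
    by (rule Lim_null_comparison[rotated]) (use J_nonexpansive[OF assms(1)] in auto)
  then show ?thesis by (simp add: LIM_zero_iff)
qed

text \<open>The slopes along the scheme need not converge strongly. What passes to the limit is the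
  closed condition |w - J_h w| <= h |p|; holding for all h, it bounds the Yosida approximations of
  the limit point and so puts it in the domain.\<close>

lemma S_domain:
  assumes "(w, p) \<in> A" "t \<ge> 0"
  shows "(S t w, least (S t w)) \<in> A" "norm (least (S t w)) \<le> norm p"
proof -
  have bound: "norm (yosida h (S t w)) \<le> norm p" if "h > 0" for h
  proof -
    have "norm (S t w - J h (S t w)) \<le> h * norm p"
    proof (rule LIMSEQ_le_const2)
      show "(\<lambda>k. norm (euler k t w - J h (euler k t w))) \<longlonglongrightarrow> norm (S t w - J h (S t w))"
        by (intro tendsto_intros J_tendsto S_tendsto assms that)
      have "norm (euler k t w - J h (euler k t w)) \<le> h * norm p" for k
      proof -
        have "\<exists>q. ((J ((1 / 2) ^ k) ^^ n) w, q) \<in> A \<and> norm q \<le> norm p" for n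
        proof (cases n)
          case 0
          then show ?thesis using assms(1) by auto
        next
          case (Suc m)
          then show ?thesis using euler_slope[OF _ assms(1), of "(1 / 2) ^ k" m] by force
        qed
        then obtain q where "(euler k t w, q) \<in> A" "norm q \<le> norm p" unfolding euler_def by blast
        with J_dist[OF that] that show ?thesis
          by (meson mult_left_mono less_imp_le order_trans)
      qed
      then show "\<exists>N. \<forall>k\<ge>N. norm (euler k t w - J h (euler k t w)) \<le> h * norm p" by blast
    qed
    then show ?thesis unfolding yosida_def by (simp only: norm_scaleR_inverse_le_iff[OF that])
  qed
  obtain q where q: "(S t w, q) \<in> A" "norm q \<le> norm p" using yosida_limit[OF bound] by blast
  show "(S t w, least (S t w)) \<in> A" by (rule least_props(1)[OF q(1)])
  show "norm (least (S t w)) \<le> norm p" using least_props(2)[OF q(1)] q(2) by simp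
qed

text \<open>Each Euler slope q is paired with one fixed element (v, a) of the relation. Since u = v
  + l a, accretivity reads l <q,a> >= l |a|^2 minus an error governed by the distance d of the
  iterates to u; summation over the steps telescopes.\<close>

lemma euler_slope_inner:
  assumes w: "(w, p) \<in> A" and h: "h > 0" and v: "(v, a) \<in> A" and u: "u = v + l *\<^sub>R a"
    and a: "norm a \<le> norm p" and n: "n \<le> k" "k \<le> m"
  defines "d \<equiv> real (m - n) * h * norm p + norm ((J h ^^ k) w - u)"
  shows "real (m - n) * h * (l * (norm a)\<^sup>2 - 2 * norm p * d) \<le> l * inner ((J h ^^ n) w - (J h ^^ m) w) a"
proof -
  define x where "x i = (J h ^^ i) w" for i
  have step: "h * (l * (norm a)\<^sup>2 - 2 * norm p * d) \<le> l * inner (x i) a - l * inner (x (Suc i)) a"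
    if "i \<in> {n..<m}" for i
  proof -
    define q where "q = (1 / h) *\<^sub>R (x i - x (Suc i))"
    have q: "(x (Suc i), q) \<in> A" "norm q \<le> norm p"
      unfolding q_def x_def by (rule euler_slope[OF h w])+
    have hq: "x i - x (Suc i) = h *\<^sub>R q" using h by (simp add: q_def)
    have "norm (x k - x (Suc i)) \<le> \<bar>real (Suc i) - real k\<bar> * h * norm p"
      unfolding x_def by (rule euler_lipschitz[OF h w])
    also have "\<dots> \<le> real (m - n) * h * norm p"
      using that n h by (intro mult_right_mono) (auto simp: of_nat_diff)
    finally have "norm (x (Suc i) - u) \<le> d"
      using norm_triangle_ineq[of "x (Suc i) - x k" "x k - u"]
      unfolding d_def x_def by (simp add: norm_minus_commute)
    have "\<bar>inner (q - a) (x (Suc i) - u)\<bar> \<le> norm (q - a) * norm (x (Suc i) - u)"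
      by (rule Cauchy_Schwarz_ineq2)
    also have "\<dots> \<le> (norm p + norm p) * d"
      using norm_triangle_ineq4[of q a] q(2) a \<open>norm (x (Suc i) - u) \<le> d\<close>
      by (intro mult_mono) auto
    finally have 1: "inner (q - a) (x (Suc i) - u) \<le> 2 * norm p * d" by simp
    have "0 \<le> inner (q - a) (x (Suc i) - v)" by (rule accretive[OF q(1) v])
    also have "x (Suc i) - v = (x (Suc i) - u) + l *\<^sub>R a" using u by simp
    also have "inner (q - a) \<dots> = inner (q - a) (x (Suc i) - u) + l * inner q a - l * (norm a)\<^sup>2"
      by (simp add: inner_add_right inner_diff_left power2_norm_eq_inner right_diff_distrib)
    finally have "l * (norm a)\<^sup>2 - 2 * norm p * d \<le> l * inner q a" using 1 by simp
    then have "h * (l * (norm a)\<^sup>2 - 2 * norm p * d) \<le> h * (l * inner q a)"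
      using h by (intro mult_left_mono) auto
    also have "\<dots> = l * inner (x i - x (Suc i)) a" unfolding hq by simp
    finally show ?thesis by (simp add: inner_diff_left right_diff_distrib)
  qed
  have "real (m - n) * (h * (l * (norm a)\<^sup>2 - 2 * norm p * d))
      = (\<Sum>i\<in>{n..<m}. h * (l * (norm a)\<^sup>2 - 2 * norm p * d))" by simp
  also have "\<dots> \<le> (\<Sum>i\<in>{n..<m}. l * inner (x i) a - l * inner (x (Suc i)) a)"
    by (rule sum_mono) (rule step)
  also have "\<dots> = l * inner (x n) a - l * inner (x m) a"
    using sum_Suc_diff'[of n m "\<lambda>i. - (l * inner (x i) a)"] n by simp
  finally show ?thesis unfolding x_def by (simp add: inner_diff_left right_diff_distrib mult.assoc)
qed

text \<open>The limit of \<open>euler_slope_inner\<close> along the dyadic scheme, with the fixed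
  element taken from the resolvent of the orbit at time r. As r may be either end of [s, t], left
  and right difference quotients are covered at once.\<close>

lemma orbit_slope_inner:
  assumes w: "(w, p) \<in> A" and st: "0 \<le> s" "s < t" and r: "r = s \<or> r = t" and l: "l > 0"
  defines "a \<equiv> yosida l (S r w)"
  shows "(t - s) * (l * (norm a)\<^sup>2 - 2 * norm p * ((t - s) * norm p)) \<le> l * inner (S s w - S t w) a"
proof (rule LIMSEQ_le)
  define fl where "fl k r = nat \<lfloor>r * 2 ^ k\<rfloor>" for k and r :: real
  define d where "d k = real (fl k t - fl k s) * (1 / 2) ^ k" for k
  have "r \<ge> 0" using st r by auto
  have fl_mono: "fl k s \<le> fl k t" "fl k s \<le> fl k r" "fl k r \<le> fl k t" for k
    using st r by (auto simp: fl_def intro!: nat_mono floor_mono)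
  have d_lim: "d \<longlonglongrightarrow> t - s"
  proof -
    have "d = (\<lambda>k. real (fl k t) * (1 / 2) ^ k - real (fl k s) * (1 / 2) ^ k)"
      using fl_mono(1) by (auto simp: d_def of_nat_diff left_diff_distrib)
    moreover have "(\<lambda>k. real (fl k t) * (1 / 2) ^ k - real (fl k s) * (1 / 2) ^ k) \<longlonglongrightarrow> t - s"
      unfolding fl_def using st by (intro tendsto_diff dyadic_floor_tendsto) auto
    ultimately show ?thesis by simp
  qed
  show "(\<lambda>k. d k * (l * (norm a)\<^sup>2 - 2 * norm p * (d k * norm p + norm (euler k r w - S r w))))
      \<longlonglongrightarrow> (t - s) * (l * (norm a)\<^sup>2 - 2 * norm p * ((t - s) * norm p))"
  proof -
    have "(\<lambda>k. d k * (l * (norm a)\<^sup>2 - 2 * norm p * (d k * norm p + norm (euler k r w - S r w))))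
      \<longlonglongrightarrow> (t - s) * (l * (norm a)\<^sup>2 - 2 * norm p * ((t - s) * norm p + norm (S r w - S r w)))"
      by (intro tendsto_intros d_lim S_tendsto \<open>r \<ge> 0\<close>)
    then show ?thesis by simp
  qed
  show "(\<lambda>k. l * inner (euler k s w - euler k t w) a) \<longlonglongrightarrow> l * inner (S s w - S t w) a"
    using st by (intro tendsto_intros S_tendsto) auto
  have a: "(J l (S r w), a) \<in> A" "S r w = J l (S r w) + l *\<^sub>R a"
    unfolding a_def using J_yosida[OF l] J_add_yosida[OF l] by auto
  have "norm a \<le> norm p"
    unfolding a_def using yosida_bound[OF l S_domain(1)[OF w \<open>r \<ge> 0\<close>]] S_domain(2)[OF w \<open>r \<ge> 0\<close>] by simp
  have "d k * (l * (norm a)\<^sup>2 - 2 * norm p * (d k * norm p + norm (euler k r w - S r w)))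
      \<le> l * inner (euler k s w - euler k t w) a" for k
    unfolding d_def euler_def fl_def[symmetric]
    by (rule euler_slope_inner[OF w _ a \<open>norm a \<le> norm p\<close> fl_mono(2,3)]) simp
  then show "\<exists>N. \<forall>k\<ge>N. d k * (l * (norm a)\<^sup>2 - 2 * norm p * (d k * norm p + norm (euler k r w - S r w)))
      \<le> l * inner (euler k s w - euler k t w) a" by blast
qed

text \<open>The slope q is no longer than the least element at s, and its inner product with a is
  nearly at least |a|^2; expanding the square of q - a then leaves little room if |a| is close to
  the least norm.\<close>

lemma orbit_slope_close:
  assumes w: "(w, p) \<in> A" and st: "0 \<le> s" "s < t" and r: "r = s \<or> r = t" and l: "l > 0"
  defines "a \<equiv> yosida l (S r w)"
  defines "q \<equiv> (1 / (t - s)) *\<^sub>R (S s w - S t w)"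
  shows "(norm (q - a))\<^sup>2 \<le> (norm (least (S s w)))\<^sup>2 - (norm a)\<^sup>2 + 4 * (norm p)\<^sup>2 / l * (t - s)"
proof -
  have "norm (S 0 (S s w) - S (t - s) (S s w)) \<le> norm (least (S s w)) * \<bar>0 - (t - s)\<bar>"
    using st by (intro S_lipschitz S_domain(1)[OF w]) auto
  also have "S (t - s) (S s w) = S t w" using S_add[of "t - s" s w] st by simp
  finally have "norm (S s w - S t w) \<le> (t - s) * norm (least (S s w))" using st by (simp add: S_0 mult.commute)
  then have "norm q \<le> norm (least (S s w))"
    unfolding q_def using st norm_scaleR_inverse_le_iff[of "t - s" "S s w - S t w"] by simp
  then have 1: "(norm q)\<^sup>2 \<le> (norm (least (S s w)))\<^sup>2" by (simp add: power_mono)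
  have "(t - s) * (l * (norm a)\<^sup>2 - 2 * norm p * ((t - s) * norm p)) \<le> l * inner (S s w - S t w) a"
    unfolding a_def by (rule orbit_slope_inner[OF w st r l])
  also have "S s w - S t w = (t - s) *\<^sub>R q" using st by (simp add: q_def)
  also have "l * inner \<dots> a = (t - s) * (l * inner q a)" by simp
  finally have "l * (norm a)\<^sup>2 - 2 * norm p * ((t - s) * norm p) \<le> l * inner q a" using st by simp
  then have "l * (norm a)\<^sup>2 \<le> l * (inner q a + 2 * (norm p)\<^sup>2 / l * (t - s))"
    using l by (simp add: distrib_left power2_eq_square mult_ac)
  then have 2: "(norm a)\<^sup>2 \<le> inner q a + 2 * (norm p)\<^sup>2 / l * (t - s)" using l by simp
  have "(norm (q - a))\<^sup>2 = (norm q)\<^sup>2 - 2 * inner q a + (norm a)\<^sup>2"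
    unfolding power2_norm_eq_inner by (simp add: inner_diff_left inner_diff_right inner_commute)
  moreover have "4 * (norm p)\<^sup>2 / l * (t - s) = 2 * (2 * (norm p)\<^sup>2 / l * (t - s))" by simp
  ultimately show ?thesis using 1 2 by linarith
qed

text \<open>The norm of the least element does not increase along the orbit, hence is continuous off
  a countable set. At a continuity point a Yosida approximation with small parameter is close both
  to the difference quotients, by \<open>orbit_slope_close\<close>, and to the least element, by
  \<open>least_close\<close>.\<close>

lemma S_differentiable:
  assumes w: "(w, p) \<in> A"
  obtains N where "countable N"
    "\<And>t. t > 0 \<Longrightarrow> t \<notin> N \<Longrightarrow> ((\<lambda>h. (1 / h) *\<^sub>R (S (t + h) w - S t w)) \<longlongrightarrow> - least (S t w)) (at 0)"
proof
  \<comment> \<open>Negated to be nondecreasing and extended constantly to negative times, so that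
    the countability of discontinuities applies on the whole line.\<close>
  define g where "g t = - norm (least (S (max 0 t) w))" for t
  have "mono g"
  proof (rule monoI)
    fix s t :: real assume "s \<le> t"
    have "norm (least (S (max 0 t - max 0 s) (S (max 0 s) w))) \<le> norm (least (S (max 0 s) w))"
      using \<open>s \<le> t\<close> by (intro S_domain(2) S_domain(1)[OF w]) auto
    also have "S (max 0 t - max 0 s) (S (max 0 s) w) = S (max 0 t) w"
      using S_add[of "max 0 t - max 0 s" "max 0 s" w] \<open>s \<le> t\<close> by simp
    finally show "g s \<le> g t" by (simp add: g_def)
  qed
  then show "countable {t. \<not> isCont g t}" by (rule mono_ctble_discont)
  fix t :: real assume "t > 0" "t \<notin> {t. \<not> isCont g t}"
  then have "isCont g t" by simp
  define P where "P = least (S t w)"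
  have P: "g t = - norm P" using \<open>t > 0\<close> by (simp add: g_def P_def)
  show "((\<lambda>h. (1 / h) *\<^sub>R (S (t + h) w - S t w)) \<longlongrightarrow> - least (S t w)) (at 0)"
  proof (rule tendstoI)
    fix e :: real assume "e > 0"
    \<comment> \<open>A third of (e/2)^2 for each of three errors: the Yosida approximation against
      the least norm, the variation of the least norm between s and t, and the term linear in the
      increment.\<close>
    define \<eta> where "\<eta> = (e / 2)\<^sup>2 / 3"
    have "\<eta> > 0" using \<open>e > 0\<close> by (simp add: \<eta>_def)
    have lim: "(\<lambda>n. (norm (yosida (1 / real (Suc n)) (S t w)))\<^sup>2) \<longlonglongrightarrow> (norm P)\<^sup>2"
      unfolding P_def using least_props(3)[OF S_domain(1)[OF w]] \<open>t > 0\<close> by (intro tendsto_intros) auto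
    have "\<forall>\<^sub>F n in sequentially. (norm P)\<^sup>2 - \<eta> < (norm (yosida (1 / real (Suc n)) (S t w)))\<^sup>2"
      by (rule order_tendstoD(1)[OF lim]) (use \<open>\<eta> > 0\<close> in simp)
    then obtain n where n: "(norm P)\<^sup>2 - \<eta> < (norm (yosida (1 / real (Suc n)) (S t w)))\<^sup>2"
      by (meson eventually_happens sequentially_bot)
    define l where "l = 1 / real (Suc n)"
    have "l > 0" by (simp add: l_def)
    define a where "a = yosida l (S t w)"
    have a: "(norm P)\<^sup>2 - (norm a)\<^sup>2 < \<eta>" using n by (simp add: a_def l_def)
    have "(norm (a - P))\<^sup>2 \<le> (norm P)\<^sup>2 - (norm a)\<^sup>2"
      unfolding a_def P_def using \<open>t > 0\<close> by (intro least_close[OF S_domain(1)[OF w] \<open>l > 0\<close>]) auto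
    also have "\<dots> < \<eta> + \<eta> + \<eta>" using a \<open>\<eta> > 0\<close> by linarith
    also have "\<dots> = (e / 2)\<^sup>2" by (simp add: \<eta>_def)
    finally have aP: "norm (a - P) < e / 2"
      by (rule power_less_imp_less_base) (use \<open>e > 0\<close> in simp)
    have "((\<lambda>h. (g (min t (t + h)))\<^sup>2) \<longlongrightarrow> (g t)\<^sup>2) (at 0)"
    proof (intro tendsto_power isCont_tendsto_compose[OF \<open>isCont g t\<close>])
      have "((\<lambda>h. min t (t + h)) \<longlongrightarrow> min t (t + 0)) (at 0)" by (intro tendsto_intros)
      then show "((\<lambda>h. min t (t + h)) \<longlongrightarrow> t) (at 0)" by simp
    qed
    then have ev1: "\<forall>\<^sub>F h in at 0. (g (min t (t + h)))\<^sup>2 < (g t)\<^sup>2 + \<eta>"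
      by (rule order_tendstoD) (use \<open>\<eta> > 0\<close> in simp)
    have "((\<lambda>h. 4 * (norm p)\<^sup>2 / l * \<bar>h\<bar>) \<longlongrightarrow> 4 * (norm p)\<^sup>2 / l * \<bar>0\<bar>) (at 0)" by (intro tendsto_intros)
    then have ev2: "\<forall>\<^sub>F h in at 0. 4 * (norm p)\<^sup>2 / l * \<bar>h\<bar> < \<eta>"
      by (rule order_tendstoD) (use \<open>\<eta> > 0\<close> in simp)
    have "((\<lambda>h. \<bar>h\<bar>) \<longlongrightarrow> \<bar>0 :: real\<bar>) (at 0)" by (intro tendsto_intros)
    then have ev3: "\<forall>\<^sub>F h in at 0. \<bar>h\<bar> < t"
      by (rule order_tendstoD) (use \<open>t > 0\<close> in simp)
    have ev4: "\<forall>\<^sub>F h in at 0. h \<noteq> (0 :: real)" by (simp add: eventually_at_filter)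
    show "\<forall>\<^sub>F h in at 0. dist ((1 / h) *\<^sub>R (S (t + h) w - S t w)) (- least (S t w)) < e"
      using ev1 ev2 ev3 ev4
    proof eventually_elim
      case (elim h)
      define s where "s = min t (t + h)"
      define r where "r = max t (t + h)"
      have sr: "0 \<le> s" "s < r" "t = s \<or> t = r" "r - s = \<bar>h\<bar>"
        using elim by (auto simp: s_def r_def min_def max_def)
      define q where "q = (1 / (r - s)) *\<^sub>R (S s w - S r w)"
      have q: "(1 / h) *\<^sub>R (S (t + h) w - S t w) = - q"
        using elim(4) unfolding q_def s_def r_def min_def max_def
        by (auto simp: scaleR_right_diff_distrib)
      have "(norm (q - a))\<^sup>2 \<le> (norm (least (S s w)))\<^sup>2 - (norm a)\<^sup>2 + 4 * (norm p)\<^sup>2 / l * (r - s)"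
        unfolding q_def a_def by (rule orbit_slope_close[OF w sr(1,2,3) \<open>l > 0\<close>])
      also have "(norm (least (S s w)))\<^sup>2 < (norm P)\<^sup>2 + \<eta>"
        using elim(1) sr(1) P unfolding s_def[symmetric] by (simp add: g_def max_absorb2)
      finally have "(norm (q - a))\<^sup>2 < 3 * \<eta>"
        using a elim(2) sr(4) by simp
      then have "(norm (q - a))\<^sup>2 < (e / 2)\<^sup>2" by (simp add: \<eta>_def)
      then have "norm (q - a) < e / 2"
        by (rule power_less_imp_less_base) (use \<open>e > 0\<close> in simp)
      with aP have "norm (q - P) < e"
        using norm_triangle_ineq[of "q - a" "a - P"] by simp
      then show ?case unfolding q P_def[symmetric] by (simp add: dist_norm norm_minus_commute)
    qed
  qed
qed

subsection \<open>Uniqueness\<close>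

lemma inner_self_diff: "inner a a - inner b b = inner (a - b) (a + (b :: 'a))"
  by (simp add: inner_diff_left inner_add_right inner_commute[of b a])

text \<open>The squared distance of the two curves is Lipschitz. At almost every time both are
  differentiable with derivatives given by the relation, and accretivity makes the derivative of the
  squared distance nonpositive.\<close>

lemma S_unique_domain:
  assumes w: "(w, p) \<in> A"
    and T0: "T 0 = w"
    and T_lip: "\<And>s t. s \<ge> 0 \<Longrightarrow> t \<ge> 0 \<Longrightarrow> norm (T s - T t) \<le> L * \<bar>s - t\<bar>"
    and T_deriv: "AE t in lebesgue. t > 0 \<longrightarrow>
      (\<exists>q. ((\<lambda>h. (1 / h) *\<^sub>R (T (t + h) - T t)) \<longlongrightarrow> - q) (at 0) \<and> (T t, q) \<in> A)"
    and "b \<ge> 0"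
  shows "T b = S b w"
proof -
  obtain N1 where N1: "N1 \<in> null_sets lebesgue" "\<And>t. t \<notin> N1 \<Longrightarrow> t > 0 \<Longrightarrow>
      \<exists>q. ((\<lambda>h. (1 / h) *\<^sub>R (T (t + h) - T t)) \<longlongrightarrow> - q) (at 0) \<and> (T t, q) \<in> A"
    using AE_E3[OF T_deriv] by auto
  obtain N2 where N2: "countable N2"
    "\<And>t. t > 0 \<Longrightarrow> t \<notin> N2 \<Longrightarrow> ((\<lambda>h. (1 / h) *\<^sub>R (S (t + h) w - S t w)) \<longlongrightarrow> - least (S t w)) (at 0)"
    using S_differentiable[OF w] by blast
  define x where "x t = T t - S t w" for t
  define c where "c = \<bar>L\<bar> + norm p"
  have "c \<ge> 0" by (simp add: c_def)
  have x_lip: "norm (x s - x t) \<le> c * \<bar>s - t\<bar>" if "s \<ge> 0" "t \<ge> 0" for s t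
  proof -
    have "norm (x s - x t) = norm ((T s - T t) - (S s w - S t w))" by (simp add: x_def algebra_simps)
    also have "\<dots> \<le> norm (T s - T t) + norm (S s w - S t w)" by (rule norm_triangle_ineq4)
    also have "\<dots> \<le> \<bar>L\<bar> * \<bar>s - t\<bar> + norm p * \<bar>s - t\<bar>"
      using order_trans[OF T_lip[OF that] mult_right_mono[OF abs_ge_self abs_ge_zero]]
      by (intro add_mono S_lipschitz[OF w] that) auto
    finally show ?thesis by (simp add: c_def distrib_right)
  qed
  have x0: "x 0 = 0" by (simp add: x_def T0 S_0)
  define f where "f t = inner (x t) (x t)" for t
  have "f b \<le> f 0"
  proof (rule lipschitz_nonincreasing_if_deriv_nonpos[OF \<open>b \<ge> 0\<close>])
    show "negligible (N1 \<union> N2)"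
      using N1(1) countable_imp_null_set_lborel[OF N2(1)]
      by (intro negligible_Un) (auto simp: negligible_iff_null_sets intro: null_sets_completionI)
    fix s t assume st: "s \<in> {0..b}" "t \<in> {0..b}"
    have bound: "norm (x s) \<le> c * b" if "s \<in> {0..b}" for s
    proof -
      have "norm (x s) \<le> c * s" using x_lip[of s 0] x0 that by simp
      also have "\<dots> \<le> c * b" using that \<open>c \<ge> 0\<close> by (intro mult_left_mono) auto
      finally show ?thesis .
    qed
    have "f s - f t = inner (x s - x t) (x s + x t)"
      unfolding f_def by (rule inner_self_diff)
    then have "\<bar>f s - f t\<bar> \<le> norm (x s - x t) * norm (x s + x t)"
      using Cauchy_Schwarz_ineq2 by simp
    also have "\<dots> \<le> (c * \<bar>s - t\<bar>) * (c * b + c * b)"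
    proof (rule mult_mono)
      show "norm (x s - x t) \<le> c * \<bar>s - t\<bar>" using st by (intro x_lip) auto
      show "norm (x s + x t) \<le> c * b + c * b"
        using bound[OF st(1)] bound[OF st(2)] norm_triangle_ineq[of "x s" "x t"] by linarith
    qed (use \<open>c \<ge> 0\<close> in auto)
    finally show "\<bar>f s - f t\<bar> \<le> (c * (c * b + c * b)) * \<bar>s - t\<bar>" by (simp add: mult_ac)
  next
    fix t assume "t \<in> {0<..<b} - (N1 \<union> N2)"
    then have t: "t > 0" "t \<notin> N1" "t \<notin> N2" by auto
    obtain q where q: "((\<lambda>h. (1 / h) *\<^sub>R (T (t + h) - T t)) \<longlongrightarrow> - q) (at 0)" "(T t, q) \<in> A"
      using N1(2)[OF t(2,1)] by blast
    define r where "r = least (S t w)"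
    have lim: "((\<lambda>h. (1 / h) *\<^sub>R (x (t + h) - x t)) \<longlongrightarrow> - q - - r) (at 0)"
    proof -
      have "(1 / h) *\<^sub>R (x (t + h) - x t)
          = (1 / h) *\<^sub>R (T (t + h) - T t) - (1 / h) *\<^sub>R (S (t + h) w - S t w)" for h
        by (simp add: x_def scaleR_right_diff_distrib)
      then show ?thesis unfolding r_def using tendsto_diff[OF q(1) N2(2)[OF t(1,3)]] by simp
    qed
    have "((\<lambda>h. norm (x (t + h) - x t)) \<longlongrightarrow> 0) (at 0)"
    proof (rule Lim_null_comparison)
      have "((\<lambda>h. \<bar>h\<bar>) \<longlongrightarrow> \<bar>0 :: real\<bar>) (at 0)" by (intro tendsto_intros)
      then have "\<forall>\<^sub>F h in at 0. \<bar>h\<bar> < t"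
        by (rule order_tendstoD) (use t in simp)
      then show "\<forall>\<^sub>F h in at 0. norm (norm (x (t + h) - x t)) \<le> c * \<bar>h\<bar>"
      proof eventually_elim
        case (elim h)
        then show ?case using x_lip[of "t + h" t] t by simp
      qed
      have "((\<lambda>h. c * \<bar>h\<bar>) \<longlongrightarrow> c * \<bar>0\<bar>) (at 0)" by (intro tendsto_intros)
      then show "((\<lambda>h. c * \<bar>h\<bar>) \<longlongrightarrow> 0) (at 0)" by simp
    qed
    then have "((\<lambda>h. x (t + h)) \<longlongrightarrow> x t) (at 0)" by (simp add: tendsto_norm_zero_iff LIM_zero_iff)
    then have "((\<lambda>h. inner ((1 / h) *\<^sub>R (x (t + h) - x t)) (x (t + h) + x t)) \<longlongrightarrow> inner (- q - - r) (x t + x t)) (at 0)"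
      by (intro tendsto_intros lim)
    moreover have "inner (x (t + h) - x t) (x (t + h) + x t) = f (t + h) - f t" for h
      unfolding f_def inner_self_diff by simp
    ultimately have "(f has_real_derivative inner (- q - - r) (x t + x t)) (at t)"
      by (simp add: DERIV_def)
    moreover have "inner (- q - - r) (x t + x t) \<le> 0"
    proof -
      have "0 \<le> inner (q - r) (x t)"
        unfolding x_def r_def using t by (intro accretive q(2) S_domain(1)[OF w]) auto
      then show ?thesis by (simp add: inner_add_right inner_diff_left)
    qed
    ultimately show "\<exists>D\<le>0. (f has_real_derivative D) (at t)" by blast
  qed
  then have "inner (x b) (x b) \<le> 0" by (simp add: f_def x0)
  then have "x b = 0" by (meson inner_eq_zero_iff inner_ge_zero order_antisym)
  then show ?thesis by (simp add: x_def)
qed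

lemma S_unique:
  assumes nonexp: "\<And>t x y. t \<ge> 0 \<Longrightarrow> norm (T t x - T t y) \<le> norm (x - y)"
    and T0: "\<And>w. T 0 w = w"
    and T_lip: "\<And>w p. (w, p) \<in> A \<Longrightarrow> \<exists>L. \<forall>s\<ge>0. \<forall>t\<ge>0. norm (T s w - T t w) \<le> L * \<bar>s - t\<bar>"
    and T_deriv: "\<And>w p. (w, p) \<in> A \<Longrightarrow> AE t in lebesgue. t > 0 \<longrightarrow>
      (\<exists>q. ((\<lambda>h. (1 / h) *\<^sub>R (T (t + h) w - T t w)) \<longlongrightarrow> - q) (at 0) \<and> (T t w, q) \<in> A)"
    and "t \<ge> 0"
  shows "T t w = S t w"
proof -
  have "norm (T t w - S t w) \<le> 0 + e" if "e > 0" for e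
  proof -
    have "e / 2 > 0" using that by simp
    then obtain v p where v: "(v, p) \<in> A" "norm (v - w) < e / 2" by (rule domain_approx)
    obtain L where L: "\<And>s t. s \<ge> 0 \<Longrightarrow> t \<ge> 0 \<Longrightarrow> norm (T s v - T t v) \<le> L * \<bar>s - t\<bar>"
      using T_lip[OF v(1)] by blast
    have "T t v = S t v"
      by (rule S_unique_domain[where T = "\<lambda>t. T t v", OF v(1) T0 L T_deriv[OF v(1)] assms(5)])
    moreover have "norm (T t w - T t v) \<le> norm (w - v)" by (rule nonexp[OF assms(5)])
    moreover have "norm (S t v - S t w) \<le> norm (v - w)" by (rule S_nonexpansive[OF assms(5)])
    ultimately show ?thesis
      using v(2) norm_triangle_ineq[of "T t w - T t v" "S t v - S t w"] norm_minus_commute[of v w] by simp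
  qed
  then have "norm (T t w - S t w) \<le> 0" by (rule field_le_epsilon)
  then show ?thesis by simp
qed

end

section \<open>The Hilbert space of square integrable functions on the unit interval\<close>

lemma emeasure_unit_ivl: "emeasure unit_ivl {0<..<1} = 1"
  by (simp add: emeasure_restrict_space)

interpretation unit_ivl: finite_measure unit_ivl
  by (rule finite_measureI) (simp add: emeasure_unit_ivl)

lemma measure_unit_ivl: "measure unit_ivl {0<..<1} = 1"
  by (simp add: measure_def emeasure_unit_ivl)

lemma L2_measurable: "w \<in> L2 \<Longrightarrow> w \<in> borel_measurable unit_ivl"
  by (simp add: L2_def)

lemma L2_square_integrable: "w \<in> L2 \<Longrightarrow> integrable unit_ivl (\<lambda>x. (w x)\<^sup>2)"
  by (simp add: L2_def)

lemma L2_mult_integrable: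
  assumes "v \<in> L2" "w \<in> L2"
  shows "integrable unit_ivl (\<lambda>x. v x * w x)"
proof (rule Bochner_Integration.integrable_bound[where f = "\<lambda>x. (v x)\<^sup>2 + (w x)\<^sup>2"])
  show "integrable unit_ivl (\<lambda>x. (v x)\<^sup>2 + (w x)\<^sup>2)"
    using assms by (simp add: L2_square_integrable)
  show "(\<lambda>x. v x * w x) \<in> borel_measurable unit_ivl"
    using assms by (simp add: L2_measurable borel_measurable_times)
  have "\<bar>a * b\<bar> \<le> a\<^sup>2 + b\<^sup>2" for a b :: real
  proof -
    have "2 * (\<bar>a\<bar> * \<bar>b\<bar>) \<le> \<bar>a\<bar>\<^sup>2 + \<bar>b\<bar>\<^sup>2" using sum_squares_bound[of "\<bar>a\<bar>" "\<bar>b\<bar>"] by (simp add: mult.assoc)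
    moreover have "0 \<le> \<bar>a\<bar> * \<bar>b\<bar>" by simp
    ultimately have "\<bar>a\<bar> * \<bar>b\<bar> \<le> \<bar>a\<bar>\<^sup>2 + \<bar>b\<bar>\<^sup>2" by linarith
    then show ?thesis by (simp add: abs_mult)
  qed
  then show "AE x in unit_ivl. norm (v x * w x) \<le> norm ((v x)\<^sup>2 + (w x)\<^sup>2)"
    by (intro always_eventually allI) (simp add: abs_of_nonneg[OF add_nonneg_nonneg])
qed

lemma L2_const: "(\<lambda>_. c) \<in> L2"
  by (simp add: L2_def)

lemma L2_integrable: "w \<in> L2 \<Longrightarrow> integrable unit_ivl w"
  using L2_mult_integrable[OF _ L2_const[of 1]] by simp

lemma L2_add: "v \<in> L2 \<Longrightarrow> w \<in> L2 \<Longrightarrow> (\<lambda>x. v x + w x) \<in> L2"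
  using L2_mult_integrable[of v w] unfolding L2_def
  by (auto simp: power2_sum borel_measurable_add mult.assoc)

lemma L2_scale: "w \<in> L2 \<Longrightarrow> (\<lambda>x. c * w x) \<in> L2"
  unfolding L2_def by (auto simp: power_mult_distrib borel_measurable_times)

lemma L2_uminus: "w \<in> L2 \<Longrightarrow> (\<lambda>x. - w x) \<in> L2"
  using L2_scale[of w "-1"] by simp

lemma L2_diff: "v \<in> L2 \<Longrightarrow> w \<in> L2 \<Longrightarrow> (\<lambda>x. v x - w x) \<in> L2"
  using L2_add[OF _ L2_uminus] by simp

lemma L2_bound:
  assumes "f \<in> borel_measurable unit_ivl" "g \<in> L2" "AE x in unit_ivl. \<bar>f x\<bar> \<le> \<bar>g x\<bar>"
  shows "f \<in> L2"
proof -
  have "integrable unit_ivl (\<lambda>x. (f x)\<^sup>2)"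
  proof (rule Bochner_Integration.integrable_bound[OF L2_square_integrable[OF assms(2)]])
    show "AE x in unit_ivl. norm ((f x)\<^sup>2) \<le> norm ((g x)\<^sup>2)"
      using assms(3) by eventually_elim (simp add: abs_le_square_iff)
  qed (use assms(1) in measurable)
  with assms(1) show ?thesis by (simp add: L2_def)
qed

lemma L2_bounded:
  assumes "f \<in> borel_measurable unit_ivl" "\<And>x. x \<in> {0<..<1} \<Longrightarrow> \<bar>f x\<bar> \<le> B"
  shows "f \<in> L2"
  by (rule L2_bound[OF assms(1) L2_const[of B]]) (use assms(2) in force)

lemma L2_abs: "w \<in> L2 \<Longrightarrow> (\<lambda>x. \<bar>w x\<bar>) \<in> L2"
  by (rule L2_bound[of _ w]) (auto dest: L2_measurable)

lemma L2_max: "v \<in> L2 \<Longrightarrow> w \<in> L2 \<Longrightarrow> (\<lambda>x. max (v x) (w x)) \<in> L2"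
proof (rule L2_bound[where g = "\<lambda>x. \<bar>v x\<bar> + \<bar>w x\<bar>"])
  assume "v \<in> L2" "w \<in> L2"
  then show "(\<lambda>x. \<bar>v x\<bar> + \<bar>w x\<bar>) \<in> L2" by (intro L2_add L2_abs)
  show "(\<lambda>x. max (v x) (w x)) \<in> borel_measurable unit_ivl"
    using \<open>v \<in> L2\<close> \<open>w \<in> L2\<close> by (intro borel_measurable_max L2_measurable)
  show "AE x in unit_ivl. \<bar>max (v x) (w x)\<bar> \<le> \<bar>\<bar>v x\<bar> + \<bar>w x\<bar>\<bar>" by (intro always_eventually allI) linarith
qed

\<comment> \<open>The results above are stated for type classes, so the classes of functions have to
  form a type. The quotient is partial because functions outside \<open>L2\<close> have no class;
  \<open>l2_fun\<close> returns some representative, hence statements about values hold only almost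
  everywhere.\<close>
quotient_type l2 = "real \<Rightarrow> real" / partial: "\<lambda>f g. f \<in> L2 \<and> g \<in> L2 \<and> (AE x in unit_ivl. f x = g x)"
  morphisms l2_fun l2_of
proof (rule part_equivpI)
  show "\<exists>f. f \<in> L2 \<and> f \<in> L2 \<and> (AE x in unit_ivl. f x = f x)" using L2_const by auto
  show "symp (\<lambda>f g. f \<in> L2 \<and> g \<in> L2 \<and> (AE x in unit_ivl. f x = g x))"
    by (auto simp: symp_def elim: eventually_mono)
  show "transp (\<lambda>f g. f \<in> L2 \<and> g \<in> L2 \<and> (AE x in unit_ivl. f x = g x))"
  proof (rule transpI)
    fix f g h :: "real \<Rightarrow> real"
    assume *: "f \<in> L2 \<and> g \<in> L2 \<and> (AE x in unit_ivl. f x = g x)" "g \<in> L2 \<and> h \<in> L2 \<and> (AE x in unit_ivl. g x = h x)"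
    then have "AE x in unit_ivl. f x = g x" "AE x in unit_ivl. g x = h x" by auto
    then have "AE x in unit_ivl. f x = h x" by eventually_elim simp
    with * show "f \<in> L2 \<and> h \<in> L2 \<and> (AE x in unit_ivl. f x = h x)" by simp
  qed
qed

lemma l2_fun_L2: "l2_fun u \<in> L2"
  using Quotient3_rep_reflp[OF Quotient3_l2, of u] by simp

lemma l2_of_fun: "l2_of (l2_fun u) = u"
  by (rule Quotient3_abs_rep[OF Quotient3_l2])

lemma l2_fun_of: "f \<in> L2 \<Longrightarrow> AE x in unit_ivl. l2_fun (l2_of f) x = f x"
  using rep_abs_rsp_left[OF Quotient3_l2, of f f] by simp

lemma l2_of_eq_iff: "f \<in> L2 \<Longrightarrow> g \<in> L2 \<Longrightarrow> l2_of f = l2_of g \<longleftrightarrow> (AE x in unit_ivl. f x = g x)"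
  using Quotient3_rel[OF Quotient3_l2, of f g] by simp

lemma l2_eq_iff: "u = v \<longleftrightarrow> (AE x in unit_ivl. l2_fun u x = l2_fun v x)"
  using l2_of_eq_iff[OF l2_fun_L2 l2_fun_L2, of u v] by (simp add: l2_of_fun)

lemma l2_fun_measurable [measurable]: "l2_fun u \<in> borel_measurable unit_ivl"
  by (rule L2_measurable[OF l2_fun_L2])

instantiation l2 :: real_vector
begin
definition "0 = l2_of (\<lambda>_. 0)"
definition "u + v = l2_of (\<lambda>x. l2_fun u x + l2_fun v x)"
definition "- u = l2_of (\<lambda>x. - l2_fun u x)"
definition "u - v = l2_of (\<lambda>x. l2_fun u x - l2_fun v x)"
definition "c *\<^sub>R u = l2_of (\<lambda>x. c * l2_fun u x)"

lemma l2_fun_zero: "AE x in unit_ivl. l2_fun 0 x = 0"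
  unfolding zero_l2_def by (intro l2_fun_of L2_const)
lemma l2_fun_add: "AE x in unit_ivl. l2_fun (u + v) x = l2_fun u x + l2_fun v x"
  unfolding plus_l2_def by (intro l2_fun_of L2_add l2_fun_L2)
lemma l2_fun_uminus: "AE x in unit_ivl. l2_fun (- u) x = - l2_fun u x"
  unfolding uminus_l2_def by (intro l2_fun_of L2_uminus l2_fun_L2)
lemma l2_fun_diff: "AE x in unit_ivl. l2_fun (u - v) x = l2_fun u x - l2_fun v x"
  unfolding minus_l2_def by (intro l2_fun_of L2_diff l2_fun_L2)
lemma l2_fun_scaleR: "AE x in unit_ivl. l2_fun (c *\<^sub>R u) x = c * l2_fun u x"
  unfolding scaleR_l2_def by (intro l2_fun_of L2_scale l2_fun_L2)

instance
proof
  fix a b c :: l2 and r s :: real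
  show "a + b + c = a + (b + c)" unfolding l2_eq_iff
    using l2_fun_add[of "a + b" c] l2_fun_add[of a b] l2_fun_add[of a "b + c"] l2_fun_add[of b c]
    by eventually_elim simp
  show "a + b = b + a" unfolding l2_eq_iff
    using l2_fun_add[of a b] l2_fun_add[of b a] by eventually_elim simp
  show "0 + a = a" unfolding l2_eq_iff
    using l2_fun_add[of 0 a] l2_fun_zero by eventually_elim simp
  show "- a + a = 0" unfolding l2_eq_iff
    using l2_fun_add[of "- a" a] l2_fun_zero l2_fun_uminus[of a] by eventually_elim simp
  show "a - b = a + - b" unfolding l2_eq_iff
    using l2_fun_add[of a "- b"] l2_fun_diff[of a b] l2_fun_uminus[of b] by eventually_elim simp
  show "r *\<^sub>R (a + b) = r *\<^sub>R a + r *\<^sub>R b" unfolding l2_eq_iff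
    using l2_fun_scaleR[of r "a + b"] l2_fun_add[of a b] l2_fun_add[of "r *\<^sub>R a" "r *\<^sub>R b"]
      l2_fun_scaleR[of r a] l2_fun_scaleR[of r b]
    by eventually_elim (simp add: algebra_simps)
  show "(r + s) *\<^sub>R a = r *\<^sub>R a + s *\<^sub>R a" unfolding l2_eq_iff
    using l2_fun_scaleR[of "r + s" a] l2_fun_add[of "r *\<^sub>R a" "s *\<^sub>R a"] l2_fun_scaleR[of r a] l2_fun_scaleR[of s a]
    by eventually_elim (simp add: algebra_simps)
  show "r *\<^sub>R s *\<^sub>R a = (r * s) *\<^sub>R a" unfolding l2_eq_iff
    using l2_fun_scaleR[of "r * s" a] l2_fun_scaleR[of r "s *\<^sub>R a"] l2_fun_scaleR[of s a]
    by eventually_elim simp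
  show "1 *\<^sub>R a = a" unfolding l2_eq_iff using l2_fun_scaleR[of 1 a] by simp
qed
end

instantiation l2 :: real_inner
begin
definition "inner u v = (\<integral>x. l2_fun u x * l2_fun v x \<partial>unit_ivl)"
definition "norm (u :: l2) = sqrt (inner u u)"
definition "dist (u :: l2) v = norm (u - v)"
definition "sgn (u :: l2) = u /\<^sub>R norm u"
definition "uniformity = (INF e\<in>{0 <..}. principal {(x :: l2, y). dist x y < e})"
definition "open (U :: l2 set) \<longleftrightarrow> (\<forall>x\<in>U. eventually (\<lambda>(x', y). x' = x \<longrightarrow> y \<in> U) uniformity)"

lemma inner_l2_AE:
  assumes "AE x in unit_ivl. l2_fun u x = f x" "AE x in unit_ivl. l2_fun v x = g x"
    "f \<in> borel_measurable unit_ivl" "g \<in> borel_measurable unit_ivl"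
  shows "inner u v = (\<integral>x. f x * g x \<partial>unit_ivl)"
  unfolding inner_l2_def
proof (rule integral_cong_AE)
  show "AE x in unit_ivl. l2_fun u x * l2_fun v x = f x * g x"
    using assms(1,2) by eventually_elim simp
qed (use assms(3,4) in measurable)

instance
proof
  fix x y z :: l2 and r :: real
  note int = L2_mult_integrable[OF l2_fun_L2 l2_fun_L2]
  show "inner x y = inner y x" by (simp add: inner_l2_def mult.commute)
  have "inner (x + y) z = (\<integral>t. (l2_fun x t + l2_fun y t) * l2_fun z t \<partial>unit_ivl)"
    by (rule inner_l2_AE[OF l2_fun_add]) auto
  then show "inner (x + y) z = inner x z + inner y z"
    by (simp add: inner_l2_def distrib_right Bochner_Integration.integral_add[OF int int])
  have "inner (r *\<^sub>R x) y = (\<integral>t. (r * l2_fun x t) * l2_fun y t \<partial>unit_ivl)"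
    by (rule inner_l2_AE[OF l2_fun_scaleR]) auto
  then show "inner (r *\<^sub>R x) y = r * inner x y"
    by (simp add: inner_l2_def mult.assoc)
  show "0 \<le> inner x x" by (simp add: inner_l2_def)
  show "inner x x = 0 \<longleftrightarrow> x = 0"
  proof
    assume "inner x x = 0"
    then have "AE t in unit_ivl. l2_fun x t * l2_fun x t = 0"
      unfolding inner_l2_def by (subst (asm) integral_nonneg_eq_0_iff_AE[OF int]) auto
    then show "x = 0" unfolding l2_eq_iff using l2_fun_zero by eventually_elim simp
  next
    assume "x = 0"
    moreover have "inner (0 :: l2) 0 = (\<integral>t. 0 * 0 \<partial>unit_ivl)"
      by (rule inner_l2_AE[OF l2_fun_zero l2_fun_zero]) auto
    ultimately show "inner x x = 0" by simp
  qed
qed (simp_all add: dist_l2_def norm_l2_def sgn_l2_def uniformity_l2_def open_l2_def)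
end

lemma inner_l2_of: "f \<in> L2 \<Longrightarrow> g \<in> L2 \<Longrightarrow> inner (l2_of f) (l2_of g) = l2_inner f g"
  unfolding l2_inner_def by (intro inner_l2_AE l2_fun_of L2_measurable)

lemma inner_l2_of_right: "f \<in> L2 \<Longrightarrow> inner u (l2_of f) = (\<integral>x. l2_fun u x * f x \<partial>unit_ivl)"
  by (intro inner_l2_AE l2_fun_of L2_measurable l2_fun_L2) auto

lemma l2_of_add:
  assumes "f \<in> L2" "g \<in> L2"
  shows "l2_of (\<lambda>x. f x + g x) = l2_of f + l2_of g"
  unfolding l2_eq_iff
  using l2_fun_of[OF L2_add[OF assms]] l2_fun_add[of "l2_of f" "l2_of g"] assms[THEN l2_fun_of]
  by eventually_elim simp

lemma l2_of_diff:
  assumes "f \<in> L2" "g \<in> L2"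
  shows "l2_of (\<lambda>x. f x - g x) = l2_of f - l2_of g"
  unfolding l2_eq_iff
  using l2_fun_of[OF L2_diff[OF assms]] l2_fun_diff[of "l2_of f" "l2_of g"] assms[THEN l2_fun_of]
  by eventually_elim simp

lemma l2_of_scaleR:
  assumes "f \<in> L2"
  shows "l2_of (\<lambda>x. c * f x) = c *\<^sub>R l2_of f"
  unfolding l2_eq_iff
  using l2_fun_of[OF L2_scale[OF assms, of c]] l2_fun_scaleR[of c "l2_of f"] assms[THEN l2_fun_of]
  by eventually_elim simp

lemma norm_l2_of: "f \<in> L2 \<Longrightarrow> norm (l2_of f) = l2_norm f"
  by (simp add: norm_l2_def l2_norm_def inner_l2_of)

lemma l2_dist_eq: "f \<in> L2 \<Longrightarrow> g \<in> L2 \<Longrightarrow> l2_dist f g = norm (l2_of f - l2_of g)"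
  by (simp add: l2_dist_def norm_l2_of L2_diff flip: l2_of_diff)

lemma norm_l2_sq: "(norm u)\<^sup>2 = (\<integral>x. (l2_fun u x)\<^sup>2 \<partial>unit_ivl)"
  unfolding power2_norm_eq_inner unfolding inner_l2_def power2_eq_square ..

lemma l2_L1_bound: "(\<integral>x. \<bar>l2_fun u x\<bar> \<partial>unit_ivl) \<le> norm u"
proof -
  have abs: "(\<lambda>x. \<bar>l2_fun u x\<bar>) \<in> L2"
    by (rule L2_bound[OF _ l2_fun_L2[of u]]) auto
  have "inner (l2_of (\<lambda>x. \<bar>l2_fun u x\<bar>)) (l2_of (\<lambda>_. 1)) \<le> norm (l2_of (\<lambda>x. \<bar>l2_fun u x\<bar>)) * norm (l2_of (\<lambda>_. 1))"
    by (rule norm_cauchy_schwarz)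
  also have "norm (l2_of (\<lambda>_. 1)) = 1"
    by (simp add: norm_l2_of L2_const l2_norm_def l2_inner_def measure_unit_ivl)
  also have "norm (l2_of (\<lambda>x. \<bar>l2_fun u x\<bar>)) = norm u"
    unfolding norm_l2_of[OF abs] by (simp add: l2_norm_def l2_inner_def norm_l2_def inner_l2_def)
  finally show ?thesis by (simp add: inner_l2_of[OF abs L2_const] l2_inner_def)
qed

text \<open>Riesz and Fischer: along a subsequence with increments at most 2^-k in norm, the sum of
  the absolute increments has finite integral, since L1 norms are dominated by L2 norms on a set of
  measure 1. The series then converges almost everywhere.\<close>

lemma l2_Cauchy_subseq_AE:
  assumes "Cauchy (u :: nat \<Rightarrow> l2)"
  obtains r where "strict_mono (r :: nat \<Rightarrow> nat)" "AE x in unit_ivl. convergent (\<lambda>n. l2_fun (u (r n)) x)"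
proof -
  have "\<exists>N. \<forall>m\<ge>N. \<forall>n\<ge>N. dist (u m) (u n) < (1 / 2) ^ k" for k
    using assms unfolding Cauchy_def by simp
  then obtain N where N: "\<And>k m n. m \<ge> N k \<Longrightarrow> n \<ge> N k \<Longrightarrow> dist (u m) (u n) < (1 / 2) ^ k" by metis
  have "\<exists>r. \<forall>k. r k \<ge> N k \<and> r (Suc k) > r k"
  proof (rule dependent_nat_choice)
    show "\<exists>x. N 0 \<le> x" by blast
    show "\<exists>y. N (Suc n) \<le> y \<and> x < y" for x n by (rule exI[of _ "N (Suc n) + Suc x"]) simp
  qed
  then obtain r where r: "\<And>k. r k \<ge> N k" "\<And>k. r (Suc k) > r k" by blast
  have "strict_mono r" using r(2) by (simp add: strict_mono_Suc_iff)
  define d where "d k = u (r (Suc k)) - u (r k)" for k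
  have d: "norm (d k) \<le> (1 / 2) ^ k" for k
    using N[of k "r (Suc k)" "r k"] r(1)[of k] r(2)[of k] by (simp add: d_def dist_norm)
  have "(\<integral>\<^sup>+ x. (\<Sum>k. ennreal \<bar>l2_fun (d k) x\<bar>) \<partial>unit_ivl) = (\<Sum>k. \<integral>\<^sup>+ x. ennreal \<bar>l2_fun (d k) x\<bar> \<partial>unit_ivl)"
    by (rule nn_integral_suminf) measurable
  also have "\<dots> = (\<Sum>k. ennreal (\<integral>x. \<bar>l2_fun (d k) x\<bar> \<partial>unit_ivl))"
    using L2_integrable[OF l2_fun_L2] by (intro suminf_cong nn_integral_eq_integral) auto
  also have "\<dots> \<le> (\<Sum>k. ennreal ((1 / 2) ^ k))"
    using d l2_L1_bound order_trans by (intro suminf_le ennreal_leI) (blast | simp)+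
  also have "\<dots> = ennreal (\<Sum>k. (1 / 2) ^ k)"
    by (intro suminf_ennreal2) (auto intro: summable_geometric)
  finally have "(\<integral>\<^sup>+ x. (\<Sum>k. ennreal \<bar>l2_fun (d k) x\<bar>) \<partial>unit_ivl) \<noteq> \<infinity>"
    by (auto simp: top_unique)
  then have "AE x in unit_ivl. (\<Sum>k. ennreal \<bar>l2_fun (d k) x\<bar>) \<noteq> \<infinity>"
    by (intro nn_integral_PInf_AE) auto
  moreover have "AE x in unit_ivl. \<forall>k. l2_fun (d k) x = l2_fun (u (r (Suc k))) x - l2_fun (u (r k)) x"
    unfolding d_def AE_all_countable using l2_fun_diff by blast
  ultimately have "AE x in unit_ivl. convergent (\<lambda>n. l2_fun (u (r n)) x)"
  proof eventually_elim
    case (elim x)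
    have "summable (\<lambda>k. \<bar>l2_fun (d k) x\<bar>)"
      using elim(1) by (intro summable_suminf_not_top) (auto simp: top_unique)
    then have "summable (\<lambda>k. l2_fun (u (r (Suc k))) x - l2_fun (u (r k)) x)"
      using elim(2) summable_rabs_cancel by simp
    then obtain l where "(\<lambda>n. \<Sum>k<n. l2_fun (u (r (Suc k))) x - l2_fun (u (r k)) x) \<longlonglongrightarrow> l"
      by (auto simp: summable_def sums_def)
    then have "(\<lambda>n. l2_fun (u (r n)) x - l2_fun (u (r 0)) x) \<longlonglongrightarrow> l"
      by (simp add: sum_lessThan_telescope[of "\<lambda>k. l2_fun (u (r k)) x"])
    then have "(\<lambda>n. l2_fun (u (r n)) x - l2_fun (u (r 0)) x + l2_fun (u (r 0)) x) \<longlonglongrightarrow> l + l2_fun (u (r 0)) x"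
      by (intro tendsto_intros)
    then show ?case by (auto simp: convergent_def)
  qed
  with \<open>strict_mono r\<close> show ?thesis using that by blast
qed

instance l2 :: banach
proof
  fix u :: "nat \<Rightarrow> l2" assume "Cauchy u"
  obtain r where r: "strict_mono r" and conv: "AE x in unit_ivl. convergent (\<lambda>n. l2_fun (u (r n)) x)"
    using l2_Cauchy_subseq_AE[OF \<open>Cauchy u\<close>] by blast
  define f where "f x = lim (\<lambda>n. l2_fun (u (r n)) x)" for x
  have f_meas: "f \<in> borel_measurable unit_ivl"
    unfolding f_def by (rule borel_measurable_lim_metric) measurable
  have lim: "AE x in unit_ivl. (\<lambda>n. l2_fun (u (r n)) x) \<longlonglongrightarrow> f x"
    using conv by eventually_elim (simp add: f_def convergent_LIMSEQ_iff)
  \<comment> \<open>So far f is just a pointwise limit; Fatou's lemma carries the Cauchy bound over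
    to it, which gives both membership in \<open>L2\<close> and convergence in norm.\<close>
  have fatou: "(\<integral>\<^sup>+ x. ennreal ((f x - l2_fun (u m) x)\<^sup>2) \<partial>unit_ivl) \<le> ennreal (e\<^sup>2)"
    if e: "e > 0" and N: "\<And>n. n \<ge> N \<Longrightarrow> norm (u n - u m) \<le> e" for e m N
  proof -
    have "(\<integral>\<^sup>+ x. ennreal ((f x - l2_fun (u m) x)\<^sup>2) \<partial>unit_ivl)
        = (\<integral>\<^sup>+ x. liminf (\<lambda>n. ennreal ((l2_fun (u (r n)) x - l2_fun (u m) x)\<^sup>2)) \<partial>unit_ivl)"
    proof (rule nn_integral_cong_AE)
      show "AE x in unit_ivl. ennreal ((f x - l2_fun (u m) x)\<^sup>2)
          = liminf (\<lambda>n. ennreal ((l2_fun (u (r n)) x - l2_fun (u m) x)\<^sup>2))"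
        using lim
      proof eventually_elim
        case (elim x)
        have "(\<lambda>n. ennreal ((l2_fun (u (r n)) x - l2_fun (u m) x)\<^sup>2)) \<longlonglongrightarrow> ennreal ((f x - l2_fun (u m) x)\<^sup>2)"
          by (intro tendsto_intros tendsto_ennrealI elim)
        then show ?case using lim_imp_Liminf by force
      qed
    qed
    also have "\<dots> \<le> liminf (\<lambda>n. \<integral>\<^sup>+ x. ennreal ((l2_fun (u (r n)) x - l2_fun (u m) x)\<^sup>2) \<partial>unit_ivl)"
      by (rule nn_integral_liminf) measurable
    also have "\<dots> \<le> ennreal (e\<^sup>2)"
    proof (rule Liminf_le)
      have "(\<integral>\<^sup>+ x. ennreal ((l2_fun (u (r n)) x - l2_fun (u m) x)\<^sup>2) \<partial>unit_ivl) \<le> ennreal (e\<^sup>2)" if "n \<ge> N" for n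
      proof -
        have "r n \<ge> N" using seq_suble[OF r, of n] that by linarith
        have "(\<integral>\<^sup>+ x. ennreal ((l2_fun (u (r n)) x - l2_fun (u m) x)\<^sup>2) \<partial>unit_ivl)
            = (\<integral>\<^sup>+ x. ennreal ((l2_fun (u (r n) - u m) x)\<^sup>2) \<partial>unit_ivl)"
          using l2_fun_diff[of "u (r n)" "u m"] by (intro nn_integral_cong_AE) (auto elim!: eventually_mono)
        also have "\<dots> = ennreal ((norm (u (r n) - u m))\<^sup>2)"
          unfolding norm_l2_sq by (rule nn_integral_eq_integral[OF L2_square_integrable[OF l2_fun_L2]]) simp
        also have "\<dots> \<le> ennreal (e\<^sup>2)"
          using N[OF \<open>r n \<ge> N\<close>] by (intro ennreal_leI power_mono) auto
        finally show ?thesis .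
      qed
      then show "\<forall>\<^sub>F n in sequentially. (\<integral>\<^sup>+ x. ennreal ((l2_fun (u (r n)) x - l2_fun (u m) x)\<^sup>2) \<partial>unit_ivl) \<le> ennreal (e\<^sup>2)"
        by (auto simp: eventually_sequentially)
    qed simp
    finally show ?thesis .
  qed
  have close: "(\<lambda>x. f x - l2_fun (u m) x) \<in> L2 \<and> l2_norm (\<lambda>x. f x - l2_fun (u m) x) \<le> e"
    if e: "e > 0" and N: "\<And>n. n \<ge> N \<Longrightarrow> norm (u n - u m) \<le> e" for e m N
  proof
    have meas: "(\<lambda>x. f x - l2_fun (u m) x) \<in> borel_measurable unit_ivl" using f_meas by measurable
    have "integrable unit_ivl (\<lambda>x. (f x - l2_fun (u m) x)\<^sup>2)"
    proof (rule integrableI_bounded)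
      show "(\<integral>\<^sup>+ x. ennreal (norm ((f x - l2_fun (u m) x)\<^sup>2)) \<partial>unit_ivl) < \<infinity>"
        using le_less_trans[OF fatou[OF e N] ennreal_less_top] by simp
    qed (use meas in measurable)
    with meas show L2: "(\<lambda>x. f x - l2_fun (u m) x) \<in> L2" by (simp add: L2_def)
    have "ennreal (\<integral>x. (f x - l2_fun (u m) x)\<^sup>2 \<partial>unit_ivl) \<le> ennreal (e\<^sup>2)"
      using fatou[OF e N] nn_integral_eq_integral[OF L2_square_integrable[OF L2]] by simp
    then have "(\<integral>x. (f x - l2_fun (u m) x)\<^sup>2 \<partial>unit_ivl) \<le> e\<^sup>2" by simp
    then show "l2_norm (\<lambda>x. f x - l2_fun (u m) x) \<le> e"
      unfolding l2_norm_def l2_inner_def power2_eq_square[symmetric]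
      using real_sqrt_le_mono[of _ "e\<^sup>2"] e by simp
  qed
  have cauchy: "\<exists>N. \<forall>m\<ge>N. \<forall>n\<ge>N. norm (u n - u m) \<le> e" if e: "e > 0" for e
  proof -
    obtain N where "\<forall>m\<ge>N. \<forall>n\<ge>N. dist (u m) (u n) < e"
      using \<open>Cauchy u\<close> e unfolding Cauchy_def by blast
    then have "\<forall>m\<ge>N. \<forall>n\<ge>N. norm (u n - u m) \<le> e" by (auto simp: dist_norm intro: less_imp_le)
    then show ?thesis ..
  qed
  have "f \<in> L2"
  proof -
    obtain N where N: "\<forall>m\<ge>N. \<forall>n\<ge>N. norm (u n - u m) \<le> 1" using cauchy[OF zero_less_one] by blast
    have "norm (u n - u N) \<le> 1" if "n \<ge> N" for n using N that by simp
    then have "(\<lambda>x. f x - l2_fun (u N) x) \<in> L2" using close[OF zero_less_one] by blast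
    from L2_add[OF this l2_fun_L2[of "u N"]] show ?thesis by simp
  qed
  have "u \<longlonglongrightarrow> l2_of f"
  proof (rule LIMSEQ_I)
    fix e :: real assume "e > 0"
    then have "e / 2 > 0" by simp
    from cauchy[OF this] obtain N where N: "\<forall>m\<ge>N. \<forall>n\<ge>N. norm (u n - u m) \<le> e / 2" by blast
    have "norm (u m - l2_of f) < e" if "m \<ge> N" for m
    proof -
      have "norm (u n - u m) \<le> e / 2" if "n \<ge> N" for n using N \<open>m \<ge> N\<close> that by simp
      then have "l2_norm (\<lambda>x. f x - l2_fun (u m) x) \<le> e / 2" using close[OF \<open>e / 2 > 0\<close>] by blast
      also have "l2_norm (\<lambda>x. f x - l2_fun (u m) x) = norm (l2_of f - u m)"
        using l2_dist_eq[OF \<open>f \<in> L2\<close> l2_fun_L2, of "u m"] by (simp add: l2_dist_def l2_of_fun)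
      finally show ?thesis using \<open>e > 0\<close> by (simp add: norm_minus_commute)
    qed
    then show "\<exists>no. \<forall>n\<ge>no. norm (u n - l2_of f) < e" by blast
  qed
  then show "convergent u" by (auto simp: convergent_def)
qed

lemma l2_tendsto_subseq_AE:
  assumes "u \<longlonglongrightarrow> (v :: l2)"
  obtains r where "strict_mono (r :: nat \<Rightarrow> nat)" "AE x in unit_ivl. (\<lambda>n. l2_fun (u (r n)) x) \<longlonglongrightarrow> l2_fun v x"
proof -
  have lim: "(\<lambda>n. norm (u n - v)) \<longlonglongrightarrow> 0"
    using tendsto_norm[OF tendsto_diff[OF assms tendsto_const[of v]]] by simp
  have "(\<lambda>n. \<integral>x. norm (l2_fun (u n - v) x) \<partial>unit_ivl) \<longlonglongrightarrow> 0"
  proof (rule Lim_null_comparison[OF always_eventually lim], rule allI)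
    fix n
    have "0 \<le> (\<integral>x. norm (l2_fun (u n - v) x) \<partial>unit_ivl)" by (rule Bochner_Integration.integral_nonneg) simp
    with l2_L1_bound[of "u n - v"]
    show "norm (\<integral>x. norm (l2_fun (u n - v) x) \<partial>unit_ivl) \<le> norm (u n - v)" by simp
  qed
  from tendsto_L1_AE_subseq[OF L2_integrable[OF l2_fun_L2] this]
  obtain r where r: "strict_mono r" "AE x in unit_ivl. (\<lambda>n. l2_fun (u (r n) - v) x) \<longlonglongrightarrow> 0" by blast
  have "AE x in unit_ivl. \<forall>n. l2_fun (u (r n) - v) x = l2_fun (u (r n)) x - l2_fun v x"
    unfolding AE_all_countable using l2_fun_diff by blast
  with r(2) have "AE x in unit_ivl. (\<lambda>n. l2_fun (u (r n)) x) \<longlonglongrightarrow> l2_fun v x"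
    by eventually_elim (simp add: LIM_zero_iff)
  with r(1) show ?thesis using that by blast
qed

section \<open>Primitives and the cone of nondecreasing functions\<close>

lemma AE_unit_ivl_iff: "(AE x in unit_ivl. P x) \<longleftrightarrow> (AE x in lebesgue. x \<in> {0<..<1} \<longrightarrow> P x)"
  by (rule AE_restrict_space_iff) simp

lemma AE_unit_ivl_I: "(\<And>x. 0 < x \<Longrightarrow> x < 1 \<Longrightarrow> P x) \<Longrightarrow> AE x in unit_ivl. P x"
  by (rule AE_I2) auto

lemma AE_unit_ivl_neq: "AE x in unit_ivl. x \<noteq> a"
  unfolding AE_unit_ivl_iff
  by (rule AE_I'[of "{a}"]) (auto simp: negligible_iff_null_sets[symmetric])

lemma borel_measurable_unit_ivl [measurable (raw)]: "f \<in> borel_measurable borel \<Longrightarrow> f \<in> borel_measurable unit_ivl"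
  by (rule measurable_restrict_space1) (rule borel_measurable_subalgebra[where N = borel], auto)

lemma measure_unit_ivl_Ioc:
  assumes "0 \<le> a" "a \<le> b" "b \<le> 1"
  shows "(\<integral>x. indicator {a<..b} x \<partial>unit_ivl) = b - a"
proof -
  have "(\<integral>x. indicator {a<..b} x \<partial>unit_ivl) = (\<integral>x. indicator {a<..<b} x \<partial>unit_ivl)"
    using AE_unit_ivl_neq[of b] by (intro integral_cong_AE) (auto elim: eventually_mono simp: indicator_def)
  also have "\<dots> = measure unit_ivl {a<..<b}"
    using assms by (subst Bochner_Integration.integral_indicator) (auto intro!: arg_cong[where f = "measure unit_ivl"])
  also have "\<dots> = measure lebesgue {a<..<b}" using assms by (intro measure_restrict_space) auto
  finally show ?thesis using assms by simp
qed

lemma measure_unit_ivl_Int_Ioc: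
  assumes "0 \<le> a" "a \<le> b" "b \<le> 1"
  shows "measure unit_ivl ({a<..b} \<inter> {0<..<1}) = b - a"
  using measure_unit_ivl_Ioc[OF assms] by simp

definition step :: "real \<Rightarrow> l2" where
  "step x = l2_of (indicator {..x})"

definition one :: l2 where
  "one = l2_of (\<lambda>_. 1)"

text \<open>Writing the integral over (0, x) as an inner product gives linearity, bounds and
  continuity of primitives by Hilbert space rules.\<close>

definition prim :: "l2 \<Rightarrow> real \<Rightarrow> real" where
  "prim u x = inner u (step x)"

text \<open>The Volterra operator. Together with the constants its range is the Sobolev space
  \<open>H1\<close>, see \<open>weak_deriv_characterization\<close>.\<close>

definition vol :: "l2 \<Rightarrow> l2" where
  "vol u = l2_of (prim u)"

lemma indicator_L2: "A \<in> sets borel \<Longrightarrow> indicator A \<in> L2"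
  by (rule L2_bounded[where B = 1]) (auto simp: indicator_def)

lemma l2_fun_one: "AE x in unit_ivl. l2_fun one x = 1"
  unfolding one_def by (rule l2_fun_of[OF L2_const])

lemma norm_one: "norm one = 1"
  by (simp add: one_def norm_l2_of L2_const l2_norm_def l2_inner_def measure_unit_ivl)

lemma step_1: "step 1 = one"
  unfolding step_def one_def by (subst l2_of_eq_iff) (auto intro!: indicator_L2 L2_const AE_unit_ivl_I)

lemma step_0: "step 0 = 0"
  unfolding step_def zero_l2_def by (subst l2_of_eq_iff) (auto intro!: indicator_L2 L2_const AE_unit_ivl_I)

lemma prim_0: "prim u 0 = 0" and prim_1: "prim u 1 = inner u one"
  by (simp_all add: prim_def step_0 step_1)

lemma prim_add: "prim (u + v) x = prim u x + prim v x"
  and prim_diff: "prim (u - v) x = prim u x - prim v x"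
  and prim_scaleR: "prim (c *\<^sub>R u) x = c * prim u x"
  by (simp_all add: prim_def inner_add_left inner_diff_left)

lemma prim_step:
  assumes "0 \<le> a" "a \<le> 1" "0 \<le> x" "x \<le> 1"
  shows "prim (step a) x = min a x"
proof -
  have "prim (step a) x = (\<integral>t. indicator {..a} t * indicator {..x} t \<partial>unit_ivl)"
    unfolding prim_def step_def by (subst inner_l2_of) (auto simp: l2_inner_def intro!: indicator_L2)
  also have "\<dots> = (\<integral>t. indicator {0<..min a x} t \<partial>unit_ivl)"
    by (intro Bochner_Integration.integral_cong) (auto simp: indicator_def)
  finally show ?thesis using assms by (simp add: measure_unit_ivl_Int_Ioc)
qed

lemma prim_eq_integral: "prim u x = (\<integral>t. l2_fun u t * indicator {..x} t \<partial>unit_ivl)"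
  unfolding prim_def step_def by (rule inner_l2_of_right) (auto intro: indicator_L2)

lemma prim_diff_eq_integral:
  assumes "a \<le> b"
  shows "prim u b - prim u a = (\<integral>t. l2_fun u t * indicator {a<..b} t \<partial>unit_ivl)"
proof -
  have "integrable unit_ivl (\<lambda>t. l2_fun u t * indicator {..x} t)" for x
    by (intro L2_mult_integrable l2_fun_L2 indicator_L2) auto
  then have "prim u b - prim u a = (\<integral>t. l2_fun u t * indicator {..b} t - l2_fun u t * indicator {..a} t \<partial>unit_ivl)"
    unfolding prim_eq_integral by (simp add: Bochner_Integration.integral_diff)
  also have "\<dots> = (\<integral>t. l2_fun u t * indicator {a<..b} t \<partial>unit_ivl)"
    using assms by (intro Bochner_Integration.integral_cong) (auto simp: indicator_def)
  finally show ?thesis .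
qed

lemma prim_diff_le:
  assumes "0 \<le> a" "a \<le> b" "b \<le> 1" "AE x in unit_ivl. a < x \<and> x < b \<longrightarrow> l2_fun u x \<le> M"
  shows "prim u b - prim u a \<le> M * (b - a)"
proof -
  have "(\<integral>t. l2_fun u t * indicator {a<..b} t \<partial>unit_ivl) \<le> (\<integral>t. M * indicator {a<..b} t \<partial>unit_ivl)"
  proof (rule integral_mono_AE)
    show "integrable unit_ivl (\<lambda>t. l2_fun u t * indicator {a<..b} t)"
      by (intro L2_mult_integrable l2_fun_L2 indicator_L2) auto
    show "integrable unit_ivl (\<lambda>t. M * indicator {a<..b} t)"
      by (intro L2_mult_integrable L2_const indicator_L2) auto
    show "AE t in unit_ivl. l2_fun u t * indicator {a<..b} t \<le> M * indicator {a<..b} t"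
      using assms(4) AE_unit_ivl_neq[of b] by eventually_elim (auto simp: indicator_def)
  qed
  then show ?thesis using assms by (simp add: prim_diff_eq_integral measure_unit_ivl_Int_Ioc)
qed

lemma prim_diff_ge:
  assumes "0 \<le> a" "a \<le> b" "b \<le> 1" "AE x in unit_ivl. a < x \<and> x < b \<longrightarrow> M \<le> l2_fun u x"
  shows "M * (b - a) \<le> prim u b - prim u a"
proof -
  have "AE x in unit_ivl. a < x \<and> x < b \<longrightarrow> l2_fun (- u) x \<le> - M"
    using assms(4) l2_fun_uminus[of u] by eventually_elim auto
  from prim_diff_le[OF assms(1-3) this] show ?thesis by (simp add: prim_def)
qed

text \<open>By Cauchy-Schwarz this makes every primitive Hoelder continuous with exponent
  1/2.\<close>

lemma norm_step_diff:
  assumes "0 \<le> a" "a \<le> b" "b \<le> 1"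
  shows "(norm (step b - step a))\<^sup>2 = b - a"
proof -
  have "(norm (step b - step a))\<^sup>2 = inner (step b) (step b) - 2 * inner (step b) (step a) + inner (step a) (step a)"
    by (simp add: power2_norm_eq_inner inner_diff_left inner_diff_right inner_commute)
  then show ?thesis using prim_step[of b b] prim_step[of b a] prim_step[of a a] assms by (simp add: prim_def)
qed

lemma prim_bound:
  assumes "0 \<le> x" "x \<le> 1"
  shows "\<bar>prim u x\<bar> \<le> norm u"
proof -
  have "(norm (step x))\<^sup>2 \<le> 1\<^sup>2" using norm_step_diff[of 0 x] assms by (simp add: step_0)
  then have "norm (step x) \<le> 1" using power2_le_imp_le zero_le_one by blast
  have "\<bar>prim u x\<bar> \<le> norm u * norm (step x)" unfolding prim_def by (rule Cauchy_Schwarz_ineq2)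
  also have "\<dots> \<le> norm u * 1" using \<open>norm (step x) \<le> 1\<close> by (intro mult_left_mono) auto
  finally show ?thesis by simp
qed

lemma prim_continuous: "continuous_on {0..1} (prim u)"
  unfolding continuous_on_iff
proof (intro ballI allI impI)
  fix x e :: real assume x: "x \<in> {0..1}" and "e > 0"
  define d where "d = (e / (norm u + 1))\<^sup>2"
  have n: "norm u + 1 > 0" by (simp add: add_nonneg_pos)
  then have "d > 0" using \<open>e > 0\<close> by (simp add: d_def)
  have *: "\<bar>prim u b - prim u a\<bar> < e" if "0 \<le> a" "a \<le> b" "b \<le> 1" "b - a < d" for a b
  proof -
    have "(norm (step b - step a))\<^sup>2 < (e / (norm u + 1))\<^sup>2"
      using norm_step_diff[OF that(1-3)] that(4) by (simp add: d_def)
    then have "norm (step b - step a) < e / (norm u + 1)"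
      by (rule power_less_imp_less_base) (use n \<open>e > 0\<close> in simp)
    then have "(norm u + 1) * norm (step b - step a) < e" using n by (simp add: field_simps)
    moreover have "\<bar>prim u b - prim u a\<bar> \<le> norm u * norm (step b - step a)"
      unfolding prim_def inner_diff_right[symmetric] by (rule Cauchy_Schwarz_ineq2)
    moreover have "norm u * norm (step b - step a) \<le> (norm u + 1) * norm (step b - step a)"
      by (intro mult_right_mono) auto
    ultimately show ?thesis by linarith
  qed
  show "\<exists>d>0. \<forall>x'\<in>{0..1}. dist x' x < d \<longrightarrow> dist (prim u x') (prim u x) < e"
  proof (intro exI[of _ d] conjI ballI impI)
    fix y assume y: "y \<in> {0..1::real}" "dist y x < d"
    show "dist (prim u y) (prim u x) < e"
      using *[of x y] *[of y x] x y by (cases "x \<le> y") (auto simp: dist_real_def abs_minus_commute)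
  qed (rule \<open>d > 0\<close>)
qed

lemma measurable_unit_ivl_if_restrict:
  fixes f :: "real \<Rightarrow> real"
  assumes "f \<in> borel_measurable (restrict_space borel {0<..<1})"
  shows "f \<in> borel_measurable unit_ivl"
proof -
  have "(\<lambda>x. indicator {0<..<1} x *\<^sub>R f x) \<in> borel_measurable borel"
    using assms by (subst (asm) borel_measurable_restrict_space_iff) auto
  then have "(\<lambda>x. indicator {0<..<1} x *\<^sub>R f x) \<in> borel_measurable unit_ivl" by measurable
  then show ?thesis by (rule measurable_cong[THEN iffD1, rotated]) auto
qed

lemma continuous_on_unit_measurable:
  fixes f :: "real \<Rightarrow> real"
  assumes "continuous_on {0..1} f"
  shows "f \<in> borel_measurable unit_ivl"
proof -
  have "continuous_on {0<..<1} f" using assms by (rule continuous_on_subset) auto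
  then show ?thesis
    by (intro measurable_unit_ivl_if_restrict borel_measurable_continuous_on_restrict)
qed

lemma mono_on_unit_measurable:
  fixes f :: "real \<Rightarrow> real"
  assumes "mono_on {0<..<1} f"
  shows "f \<in> borel_measurable unit_ivl"
  by (intro measurable_unit_ivl_if_restrict borel_measurable_mono_on_fnc assms)

lemma continuous_on_unit_L2:
  assumes "continuous_on {0..1} f"
  shows "f \<in> L2"
proof -
  have "bounded (f ` {0..1})" using compact_continuous_image[OF assms] compact_imp_bounded by blast
  then obtain B where "\<forall>x\<in>{0..1}. \<bar>f x\<bar> \<le> B" by (auto simp: bounded_iff)
  then show ?thesis by (intro L2_bounded[OF continuous_on_unit_measurable[OF assms], of B]) auto
qed

lemma prim_L2: "prim u \<in> L2"
  by (rule continuous_on_unit_L2[OF prim_continuous])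

lemma l2_fun_vol: "AE x in unit_ivl. l2_fun (vol u) x = prim u x"
  unfolding vol_def by (rule l2_fun_of[OF prim_L2])

text \<open>The operator norm bound 1 is the constant behind the contraction factor in
  \<open>gen_range\<close> and the decay rate towards the projection.\<close>

lemma norm_vol_le: "norm (vol u) \<le> norm u"
proof -
  have "(norm (vol u))\<^sup>2 = (\<integral>x. (l2_fun (vol u) x)\<^sup>2 \<partial>unit_ivl)" by (rule norm_l2_sq)
  also have "\<dots> \<le> (\<integral>x. (norm u)\<^sup>2 \<partial>unit_ivl)"
  proof (rule integral_mono_AE[OF L2_square_integrable[OF l2_fun_L2]])
    have "AE x in unit_ivl. \<bar>prim u x\<bar> \<le> norm u" by (rule AE_unit_ivl_I) (simp add: prim_bound)
    then show "AE x in unit_ivl. (l2_fun (vol u) x)\<^sup>2 \<le> (norm u)\<^sup>2"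
      using l2_fun_vol[of u] by eventually_elim (simp add: abs_le_square_iff[symmetric])
  qed simp
  also have "\<dots> = (norm u)\<^sup>2" by (simp add: measure_unit_ivl)
  finally show ?thesis by (rule power2_le_imp_le) simp
qed

lemma vol_add: "vol (u + v) = vol u + vol v"
  unfolding vol_def prim_add by (rule l2_of_add[OF prim_L2 prim_L2])

lemma vol_diff: "vol (u - v) = vol u - vol v"
  unfolding vol_def prim_diff by (rule l2_of_diff[OF prim_L2 prim_L2])

lemma vol_scaleR: "vol (c *\<^sub>R u) = c *\<^sub>R vol u"
  unfolding vol_def prim_scaleR by (rule l2_of_scaleR[OF prim_L2])

interpretation unit_sq: pair_sigma_finite unit_ivl unit_ivl ..

text \<open>Fubini on the unit square: the two inner products are the integrals of v(x) p(y) over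
  the triangles y <= x and x <= y, which overlap in the null diagonal.\<close>

lemma integration_by_parts: "inner (vol p) v + inner p (vol v) = prim p 1 * prim v 1"
proof -
  define F where "F x y = l2_fun v x * l2_fun p y * indicator {x..} y" for x y :: real
  note int_p = L2_integrable[OF l2_fun_L2[of p]]
  note int_v = L2_integrable[OF l2_fun_L2[of v]]
  have int1: "integrable unit_ivl (\<lambda>y. l2_fun p y * indicator A y)" if "A \<in> sets borel" for A
    by (intro L2_mult_integrable l2_fun_L2 indicator_L2 that)
  have int2: "integrable unit_ivl (\<lambda>y. l2_fun v y * indicator A y)" if "A \<in> sets borel" for A
    by (intro L2_mult_integrable l2_fun_L2 indicator_L2 that)
  have F_meas: "(\<lambda>(x, y). F x y) \<in> borel_measurable (unit_ivl \<Otimes>\<^sub>M unit_ivl)"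
  proof -
    have id: "(\<lambda>x. x) \<in> measurable unit_ivl borel" by (rule borel_measurable_unit_ivl) auto
    have "(\<lambda>z. fst z) \<in> borel_measurable (unit_ivl \<Otimes>\<^sub>M unit_ivl)" "(\<lambda>z. snd z) \<in> borel_measurable (unit_ivl \<Otimes>\<^sub>M unit_ivl)"
      using measurable_compose[OF measurable_fst id] measurable_compose[OF measurable_snd id] by auto
    then have "Measurable.pred (unit_ivl \<Otimes>\<^sub>M unit_ivl) (\<lambda>z. fst z \<le> (snd z :: real))" by measurable
    moreover have "(\<lambda>z. l2_fun v (fst z)) \<in> borel_measurable (unit_ivl \<Otimes>\<^sub>M unit_ivl)"
      "(\<lambda>z. l2_fun p (snd z)) \<in> borel_measurable (unit_ivl \<Otimes>\<^sub>M unit_ivl)" by measurable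
    ultimately have "(\<lambda>z. l2_fun v (fst z) * l2_fun p (snd z) * (if fst z \<le> snd z then 1 else 0))
        \<in> borel_measurable (unit_ivl \<Otimes>\<^sub>M unit_ivl)" by measurable
    then show ?thesis unfolding F_def by (simp add: case_prod_beta indicator_def of_bool_def)
  qed
  have F_int: "integrable (unit_ivl \<Otimes>\<^sub>M unit_ivl) (\<lambda>(x, y). F x y)"
  proof (rule unit_sq.Fubini_integrable[OF F_meas])
    have "(\<lambda>x. \<integral>y. norm (F x y) \<partial>unit_ivl) = (\<lambda>x. \<bar>l2_fun v x\<bar> * (\<integral>y. \<bar>l2_fun p y\<bar> * indicator {x..} y \<partial>unit_ivl))"
      by (simp add: F_def abs_mult mult.assoc)
    moreover have "integrable unit_ivl (\<lambda>x. \<bar>l2_fun v x\<bar> * (\<integral>y. \<bar>l2_fun p y\<bar> * indicator {x..} y \<partial>unit_ivl))"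
    proof (rule Bochner_Integration.integrable_bound[where f = "\<lambda>x. \<bar>l2_fun v x\<bar> * (\<integral>y. \<bar>l2_fun p y\<bar> \<partial>unit_ivl)"])
      show "integrable unit_ivl (\<lambda>x. \<bar>l2_fun v x\<bar> * (\<integral>y. \<bar>l2_fun p y\<bar> \<partial>unit_ivl))" using int_v by simp
      have "(\<lambda>x. \<integral>y. norm (F x y) \<partial>unit_ivl) \<in> borel_measurable unit_ivl"
        using F_meas by (intro unit_ivl.borel_measurable_lebesgue_integral) (simp add: split_def)
      then show "(\<lambda>x. \<bar>l2_fun v x\<bar> * (\<integral>y. \<bar>l2_fun p y\<bar> * indicator {x..} y \<partial>unit_ivl)) \<in> borel_measurable unit_ivl"
        by (simp add: F_def abs_mult mult.assoc)
      have "(\<integral>y. \<bar>l2_fun p y\<bar> * indicator {x..} y \<partial>unit_ivl) \<le> (\<integral>y. \<bar>l2_fun p y\<bar> \<partial>unit_ivl)" for x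
      proof (rule integral_mono)
        show "integrable unit_ivl (\<lambda>y. \<bar>l2_fun p y\<bar> * indicator {x..} y)"
          by (intro L2_mult_integrable L2_abs l2_fun_L2 indicator_L2) auto
        show "integrable unit_ivl (\<lambda>y. \<bar>l2_fun p y\<bar>)" using int_p by simp
        show "\<bar>l2_fun p y\<bar> * indicator {x..} y \<le> \<bar>l2_fun p y\<bar>" for y by (simp add: indicator_def)
      qed
      moreover have "0 \<le> (\<integral>y. \<bar>l2_fun p y\<bar> * indicator {x..} y \<partial>unit_ivl)" for x by simp
      ultimately show "AE x in unit_ivl. norm (\<bar>l2_fun v x\<bar> * (\<integral>y. \<bar>l2_fun p y\<bar> * indicator {x..} y \<partial>unit_ivl))
          \<le> norm (\<bar>l2_fun v x\<bar> * (\<integral>y. \<bar>l2_fun p y\<bar> \<partial>unit_ivl))"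
        by (intro always_eventually allI) (auto simp: abs_mult intro!: mult_left_mono)
    qed
    ultimately show "integrable unit_ivl (\<lambda>x. \<integral>y. norm (case (x, y) of (x, y) \<Rightarrow> F x y) \<partial>unit_ivl)" by simp
    show "AE x in unit_ivl. integrable unit_ivl (\<lambda>y. case (x, y) of (x, y) \<Rightarrow> F x y)"
      using int1 by (intro always_eventually allI) (simp add: F_def mult.assoc)
  qed
  have eq1: "prim p x * l2_fun v x = (\<integral>y. l2_fun v x * l2_fun p y * indicator {..x} y \<partial>unit_ivl)" for x
    unfolding prim_eq_integral mult.assoc by (simp add: mult.commute[of _ "l2_fun v x"])
  have 1: "inner (vol p) v = (\<integral>x. (\<integral>y. l2_fun v x * l2_fun p y * indicator {..x} y \<partial>unit_ivl) \<partial>unit_ivl)"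
    unfolding eq1[symmetric] by (intro inner_l2_AE[OF l2_fun_vol]) (auto intro: L2_measurable prim_L2)
  have eq2: "l2_fun p y * prim v y = (\<integral>x. F x y \<partial>unit_ivl)" for y
  proof -
    have "F x y = l2_fun p y * (l2_fun v x * indicator {..y} x)" for x
      by (simp add: F_def indicator_def)
    then show ?thesis by (simp add: prim_eq_integral)
  qed
  have "inner p (vol v) = (\<integral>y. l2_fun p y * prim v y \<partial>unit_ivl)"
    unfolding vol_def by (rule inner_l2_of_right[OF prim_L2])
  also have "\<dots> = (\<integral>x. (\<integral>y. F x y \<partial>unit_ivl) \<partial>unit_ivl)"
    unfolding eq2 by (rule unit_sq.Fubini_integral[OF F_int])
  finally have 2: "inner p (vol v) = (\<integral>x. (\<integral>y. F x y \<partial>unit_ivl) \<partial>unit_ivl)" .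
  have sum: "(\<integral>y. l2_fun v x * l2_fun p y * indicator {..x} y \<partial>unit_ivl) + (\<integral>y. F x y \<partial>unit_ivl) = l2_fun v x * prim p 1" for x
  proof -
    have "(\<integral>y. l2_fun v x * l2_fun p y * indicator {..x} y \<partial>unit_ivl) + (\<integral>y. F x y \<partial>unit_ivl)
        = (\<integral>y. l2_fun v x * l2_fun p y * indicator {..x} y + F x y \<partial>unit_ivl)"
      using int1 by (intro Bochner_Integration.integral_add[symmetric]) (auto simp: F_def mult.assoc)
    also have "\<dots> = (\<integral>y. l2_fun v x * l2_fun p y \<partial>unit_ivl)"
      using AE_unit_ivl_neq[of x]
      by (intro integral_cong_AE) (auto simp: F_def indicator_def elim: eventually_mono)
    also have "(\<integral>y. l2_fun p y \<partial>unit_ivl) = prim p 1"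
      unfolding prim_eq_integral by (intro Bochner_Integration.integral_cong) (auto simp: indicator_def)
    then have "(\<integral>y. l2_fun v x * l2_fun p y \<partial>unit_ivl) = l2_fun v x * prim p 1" by simp
    finally show ?thesis .
  qed
  have i1: "integrable unit_ivl (\<lambda>x. \<integral>y. l2_fun v x * l2_fun p y * indicator {..x} y \<partial>unit_ivl)"
  proof -
    have "integrable unit_ivl (\<lambda>x. l2_fun v x * prim p x)" by (intro L2_mult_integrable l2_fun_L2 prim_L2)
    then show ?thesis by (simp add: prim_eq_integral mult.assoc)
  qed
  have i2: "integrable unit_ivl (\<lambda>x. \<integral>y. F x y \<partial>unit_ivl)"
    using unit_sq.integrable_fst'[OF F_int] by simp
  have "inner (vol p) v + inner p (vol v) = (\<integral>x. l2_fun v x * prim p 1 \<partial>unit_ivl)"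
    unfolding 1 2 by (subst Bochner_Integration.integral_add[OF i1 i2, symmetric]) (simp only: sum)
  also have "\<dots> = prim v 1 * prim p 1"
  proof -
    have "(\<integral>x. l2_fun v x \<partial>unit_ivl) = prim v 1"
      unfolding prim_eq_integral by (intro Bochner_Integration.integral_cong) (auto simp: indicator_def)
    then show ?thesis by simp
  qed
  finally show ?thesis by (simp add: mult.commute)
qed

text \<open>The integral of u vanishes on half lines, hence on Borel sets by a Dynkin argument, and
  on Lebesgue sets modulo null sets. The sets where u is positive and where it is negative then show
  u = 0.\<close>

lemma eq_0_if_prim_eq_0:
  assumes "\<And>x. x \<in> {0..1} \<Longrightarrow> prim u x = 0"
  shows "u = 0"
proof -
  define I where "I A = (\<integral>x. l2_fun u x * indicator A x \<partial>unit_ivl)" for A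
  have int: "integrable unit_ivl (\<lambda>x. l2_fun u x * indicator A x)" if "A \<in> sets borel" for A
    by (intro L2_mult_integrable l2_fun_L2 indicator_L2 that)
  have I_UNIV: "I UNIV = 0"
    using assms[of 1] unfolding I_def prim_eq_integral
    by (subst Bochner_Integration.integral_cong[OF refl, where g = "\<lambda>t. l2_fun u t * indicator {..1} t"]) auto
  have I_atMost: "I {..x} = 0" for x
  proof -
    consider "x < 0" | "x \<in> {0..1}" | "x > 1" by fastforce
    then show ?thesis
    proof cases
      case 1
      have "I {..x} = (\<integral>x. 0 \<partial>unit_ivl)" unfolding I_def
        using 1 by (intro Bochner_Integration.integral_cong) (auto simp: indicator_def)
      then show ?thesis by simp
    next
      case 2
      with assms show ?thesis by (simp add: I_def prim_eq_integral)
    next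
      case 3
      have "I {..x} = I UNIV" unfolding I_def
        using 3 by (intro Bochner_Integration.integral_cong) (auto simp: indicator_def)
      then show ?thesis using I_UNIV by simp
    qed
  qed
  have I_borel: "I A = 0" if "A \<in> sets borel" for A
  proof -
    have "Int_stable (range (\<lambda>a :: real. {..a}))" by (auto simp: Int_stable_def)
    moreover have "range (\<lambda>a :: real. {..a}) \<subseteq> Pow UNIV" by simp
    moreover have "A \<in> sigma_sets UNIV (range (\<lambda>a. {..a}))"
      using that unfolding borel_eq_atMost by simp
    ultimately show ?thesis
    proof (induction rule: sigma_sets_induct_disjoint)
      case (basic A)
      then show ?case using I_atMost by auto
    next
      case empty
      then show ?case by (simp add: I_def)
    next
      case (compl A)
      then have A: "A \<in> sets borel" unfolding borel_eq_atMost by simp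
      have "I (UNIV - A) = (\<integral>x. l2_fun u x * indicator UNIV x - l2_fun u x * indicator A x \<partial>unit_ivl)"
        unfolding I_def by (intro Bochner_Integration.integral_cong) (auto simp: indicator_def)
      also have "\<dots> = I UNIV - I A" unfolding I_def by (intro Bochner_Integration.integral_diff int A) auto
      finally show ?case using compl I_UNIV by simp
    next
      case (union A)
      then have A: "A i \<in> sets borel" for i unfolding borel_eq_atMost by auto
      have "(\<lambda>n. I (\<Union>i<n. A i)) \<longlonglongrightarrow> I (\<Union>i. A i)"
        unfolding I_def
      proof (rule integral_dominated_convergence[where w = "\<lambda>x. \<bar>l2_fun u x\<bar>"])
        show "AE x in unit_ivl. (\<lambda>n. l2_fun u x * indicator (\<Union>i<n. A i) x) \<longlonglongrightarrow> l2_fun u x * indicator (\<Union>i. A i) x"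
          by (intro always_eventually allI tendsto_intros LIMSEQ_indicator_UN)
        show "integrable unit_ivl (\<lambda>x. \<bar>l2_fun u x\<bar>)" using L2_integrable[OF l2_fun_L2] by simp
        show "(\<lambda>x. l2_fun u x * indicator (\<Union>i. A i) x) \<in> borel_measurable unit_ivl"
          using int[of "\<Union>i. A i"] A by auto
        show "(\<lambda>x. l2_fun u x * indicator (\<Union>i<n. A i) x) \<in> borel_measurable unit_ivl" for n
          using int[of "\<Union>i<n. A i"] A by auto
        show "AE x in unit_ivl. norm (l2_fun u x * indicator (\<Union>i<n. A i) x) \<le> \<bar>l2_fun u x\<bar>" for n
          by (intro always_eventually allI) (auto simp: indicator_def abs_mult)
      qed
      moreover have "I (\<Union>i<n. A i) = 0" for n
      proof (induction n)
        case 0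
        then show ?case by (simp add: I_def)
      next
        case (Suc n)
        have "A n \<inter> A i = {}" if "i < n" for i
          using union(1) that unfolding disjoint_family_on_def by (metis UNIV_I less_irrefl)
        then have disj: "A n \<inter> (\<Union>i<n. A i) = {}" by blast
        have "I (\<Union>i<Suc n. A i) = (\<integral>x. l2_fun u x * indicator (\<Union>i<n. A i) x + l2_fun u x * indicator (A n) x \<partial>unit_ivl)"
          unfolding I_def using disj by (intro Bochner_Integration.integral_cong) (auto simp: indicator_def less_Suc_eq)
        also have "\<dots> = I (\<Union>i<n. A i) + I (A n)"
          unfolding I_def using A by (intro Bochner_Integration.integral_add int) auto
        finally show ?case using Suc union by simp
      qed
      ultimately show ?case using LIMSEQ_unique tendsto_const by (metis (no_types, lifting) ext)
    qed
  qed
  have I_lebesgue: "I A = 0" if A: "A \<in> sets lebesgue" for A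
  proof -
    obtain S N N' where S: "A = S \<union> N" "N \<subseteq> N'" "N' \<in> null_sets lborel" "S \<in> sets lborel"
      using A by (rule sets_completionE)
    have "AE x in lebesgue. x \<notin> N'" using S(3) by (intro AE_not_in null_sets_completionI)
    then have ae: "AE x in unit_ivl. x \<notin> N'" unfolding AE_unit_ivl_iff by eventually_elim simp
    have "I A = I S" unfolding I_def
    proof (rule integral_cong_AE)
      show "(\<lambda>x. l2_fun u x * indicator A x) \<in> borel_measurable unit_ivl"
        by (intro borel_measurable_times l2_fun_measurable measurable_restrict_space1) (use A in simp)
      show "(\<lambda>x. l2_fun u x * indicator S x) \<in> borel_measurable unit_ivl" using int[of S] S(4) by auto
      show "AE x in unit_ivl. l2_fun u x * indicator A x = l2_fun u x * indicator S x"
        using ae by eventually_elim (use S(1,2) in \<open>auto simp: indicator_def\<close>)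
    qed
    with I_borel S(4) show ?thesis by simp
  qed
  have nonpos: "AE x in unit_ivl. s * l2_fun u x \<le> 0" if "s = 1 \<or> s = -1" for s
  proof -
    define A where "A = {x \<in> {0<..<1}. s * l2_fun u x > 0}"
    have "{x \<in> space unit_ivl. s * l2_fun u x > 0} \<in> sets unit_ivl" by measurable
    then have "A \<in> sets unit_ivl" by (simp add: A_def)
    then have "A \<in> sets lebesgue" by (simp add: sets_restrict_space_iff)
    then have "(\<integral>x. s * (l2_fun u x * indicator A x) \<partial>unit_ivl) = 0" using I_lebesgue by (simp add: I_def)
    moreover have "integrable unit_ivl (\<lambda>x. s * (l2_fun u x * indicator A x))"
      using integrable_mult_indicator[OF \<open>A \<in> sets unit_ivl\<close> L2_integrable[OF l2_fun_L2[of u]]]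
      by (simp add: mult.commute)
    moreover have "0 \<le> s * (l2_fun u x * indicator A x)" for x
      by (auto simp: A_def indicator_def)
    ultimately have "AE x in unit_ivl. s * (l2_fun u x * indicator A x) = 0"
      by (subst (asm) integral_nonneg_eq_0_iff_AE) auto
    moreover have "AE x in unit_ivl. x \<in> {0<..<1}" by (rule AE_unit_ivl_I) simp
    ultimately show ?thesis
      by eventually_elim (auto simp: A_def indicator_def split: if_splits)
  qed
  have "AE x in unit_ivl. l2_fun u x \<le> 0" "AE x in unit_ivl. 0 \<le> l2_fun u x"
    using nonpos[of 1] nonpos[of "-1"] by simp_all
  then show "u = 0" unfolding l2_eq_iff
    using l2_fun_zero by eventually_elim simp
qed

section \<open>The cone of nondecreasing functions and its polar\<close>

definition mono_cone :: "l2 set" where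
  "mono_cone = {u. nondecreasing_ae (l2_fun u)}"

text \<open>By \<open>polarD\<close> and \<open>polarI\<close> these are exactly the q whose
  primitive is nonnegative and returns to 0 at 1, a condition that can be checked pointwise.\<close>

definition polar :: "l2 set" where
  "polar = {q. \<forall>m\<in>mono_cone. inner q m \<le> 0}"

lemma null_set_avoid:
  assumes "AE x in unit_ivl. P x" "0 \<le> a" "a < b" "b \<le> 1"
  obtains x where "a < x" "x < b" "P x"
proof (rule ccontr)
  assume neg: "\<not> thesis"
  have "AE x in unit_ivl. x \<notin> {a<..<b}"
    using assms(1) by eventually_elim (use that neg in auto)
  then have "AE x in lebesgue. x \<notin> {a<..<b}"
    unfolding AE_unit_ivl_iff by eventually_elim (use assms in auto)
  then have "{a<..<b} \<in> null_sets lebesgue"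
    by (subst AE_iff_null_sets) auto
  then have "emeasure lebesgue {a<..<b} = 0" by (rule null_setsD1)
  then show False using assms by simp
qed

text \<open>A form that speaks of w itself on a set of full measure, without a second function, and
  so survives limits almost everywhere. Conversely, the supremum of w over the good points to the
  left is a monotone representative.\<close>

lemma nondecreasing_ae_iff:
  "nondecreasing_ae w \<longleftrightarrow> (\<exists>P. (AE x in unit_ivl. P x) \<and> (\<forall>x y. 0 < x \<longrightarrow> x \<le> y \<longrightarrow> y < 1 \<longrightarrow> P x \<longrightarrow> P y \<longrightarrow> w x \<le> w y))"
proof
  assume "nondecreasing_ae w"
  then obtain r where r: "mono_on {0<..<1} r" "AE x in unit_ivl. w x = r x" by (auto simp: nondecreasing_ae_def)
  then show "\<exists>P. (AE x in unit_ivl. P x) \<and> (\<forall>x y. 0 < x \<longrightarrow> x \<le> y \<longrightarrow> y < 1 \<longrightarrow> P x \<longrightarrow> P y \<longrightarrow> w x \<le> w y)"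
    by (intro exI[of _ "\<lambda>x. w x = r x"]) (auto intro!: mono_onD[OF r(1)])
next
  assume "\<exists>P. (AE x in unit_ivl. P x) \<and> (\<forall>x y. 0 < x \<longrightarrow> x \<le> y \<longrightarrow> y < 1 \<longrightarrow> P x \<longrightarrow> P y \<longrightarrow> w x \<le> w y)"
  then obtain P where P: "AE x in unit_ivl. P x"
    and mono: "\<And>x y. 0 < x \<Longrightarrow> x \<le> y \<Longrightarrow> y < 1 \<Longrightarrow> P x \<Longrightarrow> P y \<Longrightarrow> w x \<le> w y" by blast
  define D where "D x = {y. 0 < y \<and> y \<le> x \<and> P y}" for x
  define r where "r x = Sup (w ` D x)" for x
  have ne: "D x \<noteq> {}" if x: "0 < x" "x < 1" for x
  proof -
    obtain y where "0 < y" "y < x" "P y" using null_set_avoid[OF P, of 0 x] x by auto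
    then have "y \<in> D x" by (simp add: D_def)
    then show ?thesis by blast
  qed
  have bdd: "bdd_above (w ` D x)" if x: "0 < x" "x < 1" for x
  proof -
    obtain z where z: "x < z" "z < 1" "P z" using null_set_avoid[OF P, of x 1] x by auto
    show ?thesis
      by (rule bdd_aboveI[of _ "w z"]) (use z in \<open>auto simp: D_def intro!: mono\<close>)
  qed
  have "mono_on {0<..<1} r"
  proof (rule mono_onI)
    fix x y :: real assume "x \<in> {0<..<1}" "y \<in> {0<..<1}" "x \<le> y"
    then show "r x \<le> r y" unfolding r_def
      using ne bdd by (intro cSup_subset_mono) (auto simp: D_def)
  qed
  moreover have "AE x in unit_ivl. w x = r x"
  proof -
    have "AE x in unit_ivl. 0 < x \<and> x < 1" by (rule AE_unit_ivl_I) simp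
    then show ?thesis using P
    proof eventually_elim
      case (elim x)
      have "Sup (w ` D x) = w x"
        by (rule cSup_eq_maximum) (use elim in \<open>auto simp: D_def intro!: mono\<close>)
      then show ?case by (simp add: r_def)
    qed
  qed
  ultimately show "nondecreasing_ae w" by (auto simp: nondecreasing_ae_def)
qed

lemma nondecreasing_ae_cong:
  assumes "AE x in unit_ivl. v x = w x"
  shows "nondecreasing_ae v \<longleftrightarrow> nondecreasing_ae w"
proof -
  have "nondecreasing_ae f" if g: "nondecreasing_ae g" and fg: "AE x in unit_ivl. f x = g x" for f g
  proof -
    obtain r where r: "mono_on {0<..<1} r" "AE x in unit_ivl. g x = r x" using g by (auto simp: nondecreasing_ae_def)
    have "AE x in unit_ivl. f x = r x" using fg r(2) by eventually_elim simp
    with r(1) show ?thesis by (auto simp: nondecreasing_ae_def)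
  qed
  moreover have "AE x in unit_ivl. w x = v x" using assms by eventually_elim simp
  ultimately show ?thesis using assms by blast
qed

lemma l2_of_mono_cone_iff: "f \<in> L2 \<Longrightarrow> l2_of f \<in> mono_cone \<longleftrightarrow> nondecreasing_ae f"
  by (simp add: mono_cone_def nondecreasing_ae_cong[OF l2_fun_of])

lemma l2_of_mono_coneI: "f \<in> L2 \<Longrightarrow> mono_on {0<..<1} f \<Longrightarrow> l2_of f \<in> mono_cone"
  by (auto simp: l2_of_mono_cone_iff nondecreasing_ae_def)

lemma mono_coneE:
  assumes "m \<in> mono_cone"
  obtains r where "mono_on {0<..<1} r" "AE x in unit_ivl. l2_fun m x = r x"
  using assms by (auto simp: mono_cone_def nondecreasing_ae_def)

lemma mono_cone_add:
  assumes "u \<in> mono_cone" "v \<in> mono_cone"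
  shows "u + v \<in> mono_cone"
proof -
  obtain r where r: "mono_on {0<..<1} r" "AE x in unit_ivl. l2_fun u x = r x" using assms(1) by (rule mono_coneE)
  obtain s where s: "mono_on {0<..<1} s" "AE x in unit_ivl. l2_fun v x = s x" using assms(2) by (rule mono_coneE)
  have "AE x in unit_ivl. l2_fun (u + v) x = r x + s x"
    using l2_fun_add[of u v] r(2) s(2) by eventually_elim simp
  moreover have "mono_on {0<..<1} (\<lambda>x. r x + s x)"
    using r(1) s(1) by (auto simp: mono_on_def intro!: add_mono)
  ultimately show ?thesis by (auto simp: mono_cone_def nondecreasing_ae_def)
qed

lemma mono_cone_scaleR:
  assumes "u \<in> mono_cone" "c \<ge> 0"
  shows "c *\<^sub>R u \<in> mono_cone"
proof -
  obtain r where r: "mono_on {0<..<1} r" "AE x in unit_ivl. l2_fun u x = r x" using assms(1) by (rule mono_coneE)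
  have "AE x in unit_ivl. l2_fun (c *\<^sub>R u) x = c * r x"
    using l2_fun_scaleR[of c u] r(2) by eventually_elim simp
  moreover have "mono_on {0<..<1} (\<lambda>x. c * r x)"
    using r(1) assms(2) by (auto simp: mono_on_def intro!: mult_left_mono)
  ultimately show ?thesis by (auto simp: mono_cone_def nondecreasing_ae_def)
qed

lemma scaleR_one_mono_cone: "c *\<^sub>R one \<in> mono_cone"
proof -
  have "c *\<^sub>R one = l2_of (\<lambda>_. c * 1)" unfolding one_def by (rule l2_of_scaleR[OF L2_const, symmetric])
  then show ?thesis by (auto intro!: l2_of_mono_coneI L2_const mono_onI)
qed

lemma zero_mono_cone: "0 \<in> mono_cone"
  using scaleR_one_mono_cone[of 0] by simp

lemma convex_mono_cone: "convex mono_cone"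
  unfolding convex_def by (auto intro!: mono_cone_add mono_cone_scaleR)

text \<open>A convergent sequence has an almost everywhere convergent subsequence, and the form of
  monotonicity in \<open>nondecreasing_ae_iff\<close> passes to pointwise limits.\<close>

lemma closed_mono_cone: "closed mono_cone"
  unfolding closed_sequential_limits
proof (intro allI impI, elim conjE)
  fix u v assume u: "\<forall>n. u n \<in> mono_cone" and lim: "u \<longlonglongrightarrow> v"
  obtain r where r: "AE x in unit_ivl. (\<lambda>n. l2_fun (u (r n)) x) \<longlonglongrightarrow> l2_fun v x"
    using l2_tendsto_subseq_AE[OF lim] by metis
  have "\<forall>n. \<exists>P. (AE x in unit_ivl. P x) \<and> (\<forall>x y. 0 < x \<longrightarrow> x \<le> y \<longrightarrow> y < 1 \<longrightarrow> P x \<longrightarrow> P y \<longrightarrow> l2_fun (u n) x \<le> l2_fun (u n) y)"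
    using u unfolding mono_cone_def nondecreasing_ae_iff by blast
  then obtain P where P: "\<And>n. AE x in unit_ivl. P n x"
    "\<And>n x y. 0 < x \<Longrightarrow> x \<le> y \<Longrightarrow> y < 1 \<Longrightarrow> P n x \<Longrightarrow> P n y \<Longrightarrow> l2_fun (u n) x \<le> l2_fun (u n) y" by metis
  define Q where "Q x \<longleftrightarrow> (\<lambda>n. l2_fun (u (r n)) x) \<longlonglongrightarrow> l2_fun v x \<and> (\<forall>n. P n x)" for x
  have "AE x in unit_ivl. \<forall>n. P n x" using P(1) by (simp add: AE_all_countable)
  with r have "AE x in unit_ivl. Q x" by eventually_elim (simp add: Q_def)
  moreover have "l2_fun v x \<le> l2_fun v y" if "0 < x" "x \<le> y" "y < 1" "Q x" "Q y" for x y
    using that by (intro LIMSEQ_le[of "\<lambda>n. l2_fun (u (r n)) x" _ "\<lambda>n. l2_fun (u (r n)) y"])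
      (auto simp: Q_def intro!: P(2))
  ultimately have "nondecreasing_ae (l2_fun v)" unfolding nondecreasing_ae_iff by blast
  then show "v \<in> mono_cone" by (simp add: mono_cone_def)
qed

lemma one_minus_step_mono_cone: "one - step x \<in> mono_cone"
proof -
  have "one - step x = l2_of (\<lambda>t. 1 - indicator {..x} t)"
    unfolding one_def step_def by (rule l2_of_diff[symmetric]) (auto intro: L2_const indicator_L2)
  moreover have "mono_on {0<..<1} (\<lambda>t. 1 - indicator {..x} t :: real)"
    by (auto simp: mono_on_def indicator_def)
  ultimately show ?thesis
    by (auto intro!: l2_of_mono_coneI L2_diff L2_const indicator_L2)
qed

text \<open>The tests are the constants 1 and -1 and the indicator of the points above x, all
  nondecreasing.\<close>

lemma polarD:
  assumes "q \<in> polar"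
  shows polar_prim_1: "prim q 1 = 0" and polar_prim_nonneg: "0 \<le> prim q x"
proof -
  have "inner q (1 *\<^sub>R one) \<le> 0" "inner q ((-1) *\<^sub>R one) \<le> 0"
    using assms scaleR_one_mono_cone unfolding polar_def by blast+
  then show 1: "prim q 1 = 0" by (simp add: prim_1)
  have "inner q (one - step x) \<le> 0" using assms one_minus_step_mono_cone unfolding polar_def by blast
  with 1 show "0 \<le> prim q x" by (simp add: prim_1 inner_diff_right) (simp add: prim_def)
qed

text \<open>Link to the gauge integral, in which the second mean value theorem is stated.\<close>

lemma prim_integral:
  assumes "0 \<le> a" "a \<le> b" "b \<le> 1"
  shows "l2_fun u integrable_on {a..b}" "integral {a..b} (l2_fun u) = prim u b - prim u a"
proof -
  define g where "g t = l2_fun u t * indicator {a<..b} t" for t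
  have g: "integrable unit_ivl g"
    unfolding g_def by (intro L2_mult_integrable l2_fun_L2 indicator_L2) auto
  have "(g has_integral (\<integral>t. g t \<partial>unit_ivl)) {0<..<1}"
    by (rule has_integral_integral_lebesgue_on) (use g in auto)
  also have "(\<integral>t. g t \<partial>unit_ivl) = prim u b - prim u a"
    using assms by (simp add: prim_diff_eq_integral g_def)
  finally have "((\<lambda>t. if t \<in> {0<..<1} then g t else 0) has_integral (prim u b - prim u a)) UNIV"
    unfolding has_integral_restrict_UNIV .
  then have "((\<lambda>t. if t \<in> {a..b} then l2_fun u t else 0) has_integral (prim u b - prim u a)) UNIV"
    by (rule has_integral_spike[of "{0, 1, a}", rotated -1]) (use assms in \<open>auto simp: g_def indicator_def\<close>)
  then have "(l2_fun u has_integral (prim u b - prim u a)) {a..b}"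
    unfolding has_integral_restrict_UNIV .
  then show "l2_fun u integrable_on {a..b}" "integral {a..b} (l2_fun u) = prim u b - prim u a"
    by (auto simp: has_integral_integrable integral_unique)
qed

text \<open>For bounded monotone r this is the second mean value theorem with end values -B and B:
  some c gives <q,r> = -2B \<open>prim q c\<close>. Truncation and dominated convergence reach the
  unbounded case.\<close>

lemma polarI:
  assumes nonneg: "\<And>x. x \<in> {0..1} \<Longrightarrow> 0 \<le> prim q x" and total: "prim q 1 = 0"
  shows "q \<in> polar"
proof -
  have bounded: "inner q (l2_of r) \<le> 0" if r: "mono_on {0<..<1} r" "r \<in> L2" "\<And>x. \<bar>r x\<bar> \<le> B" for r B
  proof -
    define g where "g x = (if x \<le> 0 then - B else if x \<ge> 1 then B else r x)" for x
    have "g x \<le> g y" if "0 \<le> x" "x \<le> y" "y \<le> 1" for x y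
      using that mono_onD[OF r(1), of x y] r(3)[of x] r(3)[of y]
      by (auto simp: g_def abs_le_iff)
    then obtain c where c: "c \<in> {0..1}" and
      I: "((\<lambda>x. g x * l2_fun q x) has_integral (g 0 * integral {0..c} (l2_fun q) + g 1 * integral {c..1} (l2_fun q))) {0..1}"
      using second_mean_value_theorem_full[OF prim_integral(1)[of 0 1 q], of g] by auto
    have "B \<ge> 0" using r(3)[of 0] by simp
    have "inner q (l2_of r) = (\<integral>x. l2_fun q x * r x \<partial>unit_ivl)" by (rule inner_l2_of_right[OF r(2)])
    also have "\<dots> = integral {0<..<1} (\<lambda>x. l2_fun q x * r x)"
      by (rule lebesgue_integral_eq_integral) (auto intro!: L2_mult_integrable l2_fun_L2 r)
    also have "\<dots> = integral {0<..<1} (\<lambda>x. g x * l2_fun q x)"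
      by (intro Henstock_Kurzweil_Integration.integral_cong) (auto simp: g_def)
    also have "\<dots> = integral {0..1} (\<lambda>x. g x * l2_fun q x)"
      by (rule integral_open_interval_real[symmetric])
    also have "\<dots> = g 0 * integral {0..c} (l2_fun q) + g 1 * integral {c..1} (l2_fun q)"
      using I by (rule integral_unique)
    also have "\<dots> = - 2 * B * prim q c"
      using c total by (simp add: prim_integral g_def prim_0)
    also have "\<dots> \<le> 0" using nonneg[OF c] \<open>B \<ge> 0\<close> by (simp add: mult_nonneg_nonneg)
    finally show ?thesis .
  qed
  have "inner q m \<le> 0" if m: "m \<in> mono_cone" for m
  proof -
    obtain r where r: "mono_on {0<..<1} r" "AE x in unit_ivl. l2_fun m x = r x" using m by (rule mono_coneE)
    define s where "s n x = max (- real n) (min (real n) (r x))" for n x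
    have mono: "mono_on {0<..<1} (s n)" for n
    proof (rule mono_onI)
      fix x y :: real assume "x \<in> {0<..<1}" "y \<in> {0<..<1}" "x \<le> y"
      then have "r x \<le> r y" by (rule mono_onD[OF r(1)])
      then show "s n x \<le> s n y" by (auto simp: s_def max_def min_def)
    qed
    have bound: "\<bar>s n x\<bar> \<le> real n" for n x by (auto simp: s_def)
    have s_L2: "s n \<in> L2" for n
      by (rule L2_bounded[OF mono_on_unit_measurable[OF mono] bound])
    have "inner q (l2_of (s n)) \<le> 0" for n
      by (rule bounded[OF mono s_L2 bound])
    moreover have "(\<lambda>n. inner q (l2_of (s n))) \<longlonglongrightarrow> inner q m"
      unfolding inner_l2_of_right[OF s_L2] unfolding inner_l2_def
    proof (rule integral_dominated_convergence[where w = "\<lambda>x. \<bar>l2_fun q x * l2_fun m x\<bar>"])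
      show "integrable unit_ivl (\<lambda>x. \<bar>l2_fun q x * l2_fun m x\<bar>)"
        by (intro Bochner_Integration.integrable_abs L2_mult_integrable l2_fun_L2)
      show "(\<lambda>x. l2_fun q x * s n x) \<in> borel_measurable unit_ivl" for n
        by (intro borel_measurable_times l2_fun_measurable L2_measurable s_L2)
      show "AE x in unit_ivl. (\<lambda>n. l2_fun q x * s n x) \<longlonglongrightarrow> l2_fun q x * l2_fun m x"
        using r(2)
      proof eventually_elim
        case (elim x)
        obtain N :: nat where N: "\<bar>r x\<bar> \<le> real N" using real_arch_simple by blast
        have "s n x = r x" if "n \<ge> N" for n
          using N that by (auto simp: s_def max_def min_def)
        then have "(\<lambda>n. s n x) \<longlonglongrightarrow> r x"
          by (intro tendsto_eventually) (auto simp: eventually_sequentially)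
        then show ?case unfolding elim by (intro tendsto_intros)
      qed
      show "AE x in unit_ivl. norm (l2_fun q x * s n x) \<le> \<bar>l2_fun q x * l2_fun m x\<bar>" for n
        using r(2)
      proof eventually_elim
        case (elim x)
        have "\<bar>s n x\<bar> \<le> \<bar>r x\<bar>" by (auto simp: s_def)
        then show ?case unfolding elim by (simp add: abs_mult mult_left_mono)
      qed
    qed measurable
    ultimately show ?thesis by (intro LIMSEQ_le_const2) auto
  qed
  then show ?thesis by (simp add: polar_def)
qed

lemma AE_in_unit_ivl: "AE x in unit_ivl. x \<in> {0<..<1}"
  by (rule AE_unit_ivl_I) simp

lemma prim_of_step:
  assumes "0 \<le> a" "a \<le> 1" "0 \<le> x" "x \<le> 1"
  shows "inner (step a) (step x) = min a x"
  using prim_step[OF assms] by (simp add: prim_def)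

text \<open>A tent under the graph of \<open>prim q\<close> is an admissible test in both directions.\<close>

lemma constant_where_prim_pos:
  assumes q: "q \<in> polar" and m: "m \<in> mono_cone" "inner q m = 0"
    and r: "mono_on {0<..<1} r" "AE x in unit_ivl. l2_fun m x = r x"
    and ab: "0 \<le> a" "b \<le> 1" and pos: "\<And>x. a < x \<Longrightarrow> x < b \<Longrightarrow> 0 < prim q x"
    and xy: "a < x" "x \<le> y" "y < b"
  shows "r x = r y"
proof -
  define e where "e = min (x - a) (b - y) / 2"
  have e: "e > 0" "a < x - e" "y + e < b" using xy by (auto simp: e_def min_def field_simps)
  obtain z where z: "z \<in> {x - e..y + e}" "\<And>t. t \<in> {x - e..y + e} \<Longrightarrow> prim q z \<le> prim q t"
  proof -
    have "continuous_on {x - e..y + e} (prim q)"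
      by (rule continuous_on_subset[OF prim_continuous]) (use e ab in auto)
    then show ?thesis
      using continuous_attains_inf[of "{x - e..y + e}" "prim q"] xy e that by force
  qed
  define \<delta> where "\<delta> = prim q z"
  have \<delta>: "\<delta> > 0" using pos[of z] z(1) e by (auto simp: \<delta>_def)
  \<comment> \<open>The primitive of g is a trapezoid: 0 outside [x - e, y + e], equal to e on
    [x, y], linear in between. Scaled by \<delta>/e it stays below \<open>prim q\<close>, as
    \<delta> is the minimum of \<open>prim q\<close> there.\<close>
  define g where "g = (step x - step (x - e)) - (step (y + e) - step y)"
  have prim_g: "prim g t = min x t - min (x - e) t - min (y + e) t + min y t" if "t \<in> {0..1}" for t
    using that xy e ab by (simp add: g_def prim_def inner_diff_left prim_of_step)
  have g_bounds: "0 \<le> prim g t" "prim g t \<le> e" "t \<notin> {x - e..y + e} \<Longrightarrow> prim g t = 0" if "t \<in> {0..1}" for t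
    using prim_g[OF that] xy e by (auto simp: min_def)
  have g_polar: "g \<in> polar"
    by (rule polarI) (use g_bounds prim_g[of 1] xy e ab in \<open>auto simp: min_def\<close>)
  have "q - (\<delta> / e) *\<^sub>R g \<in> polar"
  proof (rule polarI)
    fix t :: real assume t: "t \<in> {0..1}"
    show "0 \<le> prim (q - (\<delta> / e) *\<^sub>R g) t"
    proof (cases "t \<in> {x - e..y + e}")
      case True
      have "\<delta> / e * prim g t \<le> \<delta> / e * e" using g_bounds(2)[OF t] \<delta> e(1) by (intro mult_left_mono) auto
      also have "\<dots> \<le> prim q t" using z(2)[OF True] e(1) by (simp add: \<delta>_def)
      finally show ?thesis by (simp add: prim_diff prim_scaleR)
    next
      case False
      then show ?thesis using g_bounds(3)[OF t] polar_prim_nonneg[OF q] by (simp add: prim_diff prim_scaleR)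
    qed
  next
    show "prim (q - (\<delta> / e) *\<^sub>R g) 1 = 0"
      using prim_g[of 1] xy e ab polar_prim_1[OF q] by (simp add: prim_diff prim_scaleR min_def)
  qed
  \<comment> \<open>Since <q,m> = 0, the test says that the mean of m over [x - e, x] is at least
    its mean over [y, y + e]; for a nondecreasing m this forces equal values at x and y.\<close>
  then have "inner (q - (\<delta> / e) *\<^sub>R g) m \<le> 0" using m(1) unfolding polar_def by blast
  then have "0 \<le> \<delta> / e * inner g m" using m(2) by (simp add: inner_diff_left)
  moreover have "0 < \<delta> / e" using \<delta> e(1) by simp
  ultimately have "0 \<le> inner g m" using mult_pos_neg[of "\<delta> / e" "inner g m"] by (meson not_less)
  moreover have "inner g m = (prim m x - prim m (x - e)) - (prim m (y + e) - prim m y)"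
    unfolding g_def prim_def by (simp only: inner_diff_left inner_commute[of m])
  ultimately have "prim m (y + e) - prim m y \<le> prim m x - prim m (x - e)" by simp
  moreover have "prim m x - prim m (x - e) \<le> r x * (x - (x - e))"
  proof (rule prim_diff_le)
    show "AE t in unit_ivl. x - e < t \<and> t < x \<longrightarrow> l2_fun m t \<le> r x"
      using r(2) AE_in_unit_ivl
      by eventually_elim (use xy e ab in \<open>auto intro!: mono_onD[OF r(1)]\<close>)
  qed (use xy e ab in auto)
  moreover have "r y * ((y + e) - y) \<le> prim m (y + e) - prim m y"
  proof (rule prim_diff_ge)
    show "AE t in unit_ivl. y < t \<and> t < y + e \<longrightarrow> r y \<le> l2_fun m t"
      using r(2) AE_in_unit_ivl
      by eventually_elim (use xy e ab in \<open>auto intro!: mono_onD[OF r(1)]\<close>)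
  qed (use xy e ab in auto)
  ultimately have "r y * e \<le> r x * e" by simp
  then have "r y \<le> r x" using e(1) by simp
  moreover have "r x \<le> r y" by (rule mono_onD[OF r(1)]) (use xy ab in auto)
  ultimately show ?thesis by simp
qed

section \<open>Isotonic regression\<close>

definition iso :: "l2 \<Rightarrow> l2" where
  "iso w = (SOME m. m \<in> mono_cone \<and> (\<forall>q\<in>mono_cone. inner (w - m) (q - m) \<le> 0))"

lemma iso_props:
  shows iso_mono_cone: "iso w \<in> mono_cone"
    and iso_variational: "q \<in> mono_cone \<Longrightarrow> inner (w - iso w) (q - iso w) \<le> 0"
proof -
  obtain m where "m \<in> mono_cone" "\<And>q. q \<in> mono_cone \<Longrightarrow> inner (w - m) (q - m) \<le> 0"
    by (rule hilbert_nearest_point[OF closed_mono_cone convex_mono_cone, of w]) (use zero_mono_cone in auto)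
  then have "\<exists>m. m \<in> mono_cone \<and> (\<forall>q\<in>mono_cone. inner (w - m) (q - m) \<le> 0)" by blast
  then have "iso w \<in> mono_cone \<and> (\<forall>q\<in>mono_cone. inner (w - iso w) (q - iso w) \<le> 0)"
    unfolding iso_def by (rule someI_ex)
  then show "iso w \<in> mono_cone" "q \<in> mono_cone \<Longrightarrow> inner (w - iso w) (q - iso w) \<le> 0" by auto
qed

text \<open>A cone contains 0 and twice the projection; these two tests give opposite
  inequalities.\<close>

lemma iso_orthogonal: "inner (w - iso w) (iso w) = 0"
proof -
  have "2 *\<^sub>R iso w \<in> mono_cone" by (intro mono_cone_scaleR iso_mono_cone) simp
  from iso_variational[OF this, of w] have "inner (w - iso w) (iso w) \<le> 0"
    by (simp add: inner_diff_right)
  moreover from iso_variational[OF zero_mono_cone, of w] have "0 \<le> inner (w - iso w) (iso w)" by simp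
  ultimately show ?thesis by simp
qed

lemma iso_polar: "w - iso w \<in> polar"
  unfolding polar_def using iso_variational[of _ w] iso_orthogonal[of w] by (simp add: inner_diff_right)

lemma inner_polar_le: "q \<in> polar \<Longrightarrow> m \<in> mono_cone \<Longrightarrow> inner q m \<le> 0"
  by (simp add: polar_def)

text \<open>Moreau's characterization: a splitting of w into orthogonal elements of the cone and its
  polar is the one given by the projection.\<close>

lemma iso_eqI:
  assumes "m \<in> mono_cone" "w - m \<in> polar" "inner (w - m) m = 0"
  shows "iso w = m"
proof -
  have "inner (m - iso w) (m - iso w) = inner (w - iso w) m - inner (w - iso w) (iso w) - inner (w - m) m + inner (w - m) (iso w)"
    by (simp add: inner_diff_left inner_diff_right inner_commute)
  also have "\<dots> \<le> 0"
    using inner_polar_le[OF iso_polar assms(1), of w] iso_orthogonal[of w] assms(3)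
      inner_polar_le[OF assms(2) iso_mono_cone, of w] by simp
  finally have "m - iso w = 0" by (meson inner_eq_zero_iff inner_ge_zero order_antisym)
  then show ?thesis by simp
qed

text \<open>Firm nonexpansiveness of projections: the cross term between the two differences is
  nonnegative. The fixed point map in \<open>gen_range\<close> relies on it.\<close>

lemma id_minus_iso_nonexpansive: "norm ((v - iso v) - (w - iso w)) \<le> norm (v - w)"
proof (rule power2_le_imp_le)
  define a where "a = (v - iso v) - (w - iso w)"
  define b where "b = iso v - iso w"
  have "inner a b = - inner (v - iso v) (iso w - iso v) - inner (w - iso w) (iso v - iso w)"
    by (simp add: a_def b_def inner_diff_left inner_diff_right)
  then have "0 \<le> inner a b"
    using iso_variational[OF iso_mono_cone, of v w] iso_variational[OF iso_mono_cone, of w v] by simp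
  moreover have "v - w = a + b" by (simp add: a_def b_def)
  ultimately show "(norm a)\<^sup>2 \<le> (norm (v - w))\<^sup>2"
    by (simp add: power2_norm_eq_inner inner_add_left inner_add_right inner_commute)
qed simp

lemma AE_le_continuous:
  assumes "continuous_on {0..1} f" "continuous_on {0..1} g" "AE x in unit_ivl. f x \<le> (g x :: real)"
    and "x \<in> {0..1}"
  shows "f x \<le> g x"
proof (rule ccontr)
  assume "\<not> f x \<le> g x"
  then have pos: "f x - g x > 0" by simp
  have "continuous_on {0..1} (\<lambda>x. f x - g x)" by (intro continuous_intros assms)
  then obtain d where d: "d > 0" "\<And>y. y \<in> {0..1} \<Longrightarrow> dist y x < d \<Longrightarrow> dist (f y - g y) (f x - g x) < f x - g x"
    using pos assms(4) unfolding continuous_on_iff by metis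
  define a where "a = max 0 (x - d)"
  define b where "b = min 1 (x + d)"
  have "0 \<le> a" "a < b" "b \<le> 1" using assms(4) d(1) by (auto simp: a_def b_def max_def min_def)
  then obtain y where y: "a < y" "y < b" "f y \<le> g y" using null_set_avoid[OF assms(3)] by blast
  then have "y \<in> {0..1}" "dist y x < d" by (auto simp: a_def b_def dist_real_def)
  from d(2)[OF this] y(3) show False by (simp add: dist_real_def abs_real_def split: if_splits)
qed

lemma AE_eq_continuous:
  assumes "continuous_on {0..1} f" "continuous_on {0..1} g" "AE x in unit_ivl. f x = (g x :: real)"
    and "x \<in> {0..1}"
  shows "f x = g x"
proof (rule antisym)
  show "f x \<le> g x" by (rule AE_le_continuous[OF assms(1,2) _ assms(4)]) (use assms(3) in eventually_elim, simp)
  show "g x \<le> f x" by (rule AE_le_continuous[OF assms(2,1) _ assms(4)]) (use assms(3) in eventually_elim, simp)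
qed

lemma vol_eq_0D: "vol y = 0 \<Longrightarrow> y = 0"
proof (rule eq_0_if_prim_eq_0)
  fix x :: real assume "vol y = 0" and x: "x \<in> {0..1}"
  then have "AE x in unit_ivl. l2_fun 0 x = prim y x" using l2_fun_vol[of y] by simp
  then have "AE x in unit_ivl. prim y x = 0" using l2_fun_zero by eventually_elim simp
  from AE_eq_continuous[OF prim_continuous _ this x] show "prim y x = 0" by simp
qed

section \<open>The generator\<close>

text \<open>With \<open>\<phi> = vol p\<close>, a pair \<open>(u, p)\<close> in \<open>gen\<close> satisfies \<open>p = \<phi>'\<close> for some \<open>\<phi> \<ge> 0\<close> vanishing at both ends,
  \<open>u + vol \<phi>\<close> is nondecreasing and constant where \<open>\<phi> > 0\<close>, hence \<open>\<phi>\<close> is the negative part of \<open>u'\<close>.\<close>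

definition gen :: "(l2 \<times> l2) set" where
  "gen = {(u, p). p \<in> polar \<and> u + vol (vol p) \<in> mono_cone \<and> inner p (u + vol (vol p)) = 0}"

lemma polar_vol: "p \<in> polar \<Longrightarrow> inner p (vol v) = - inner (vol p) v"
  using integration_by_parts[of p v] by (simp add: polar_prim_1)

lemma gen_inner:
  assumes "(u, p) \<in> gen"
  shows "inner p u = (norm (vol p))\<^sup>2"
  using assms polar_vol[of p "vol p"] unfolding gen_def
  by (simp add: inner_add_right power2_norm_eq_inner)

text \<open>By \<open>gen_inner\<close> <p,u> = |vol p|^2, while testing p against the nondecreasing
  v + vol (vol q) gives <p,v> <= <vol p, vol q>, and symmetrically. What remains is at least |vol p
  - vol q|^2.\<close>

lemma gen_accretive:
  assumes "(u, p) \<in> gen" "(v, q) \<in> gen"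
  shows "0 \<le> inner (p - q) (u - v)"
proof -
  have pq: "p \<in> polar" "q \<in> polar" using assms by (auto simp: gen_def)
  have "inner p (v + vol (vol q)) \<le> 0" "inner q (u + vol (vol p)) \<le> 0"
    using assms pq by (auto simp: gen_def intro!: inner_polar_le)
  then have "inner p v \<le> inner (vol p) (vol q)" "inner q u \<le> inner (vol p) (vol q)"
    using polar_vol[OF pq(1), of "vol q"] polar_vol[OF pq(2), of "vol p"] inner_commute[of "vol q" "vol p"]
    by (simp_all add: inner_add_right)
  moreover have "inner (p - q) (u - v) = (norm (vol p))\<^sup>2 + (norm (vol q))\<^sup>2 - inner p v - inner q u"
    using gen_inner[OF assms(1)] gen_inner[OF assms(2)] by (simp add: inner_diff_left inner_diff_right)
  moreover have "(norm (vol p))\<^sup>2 + (norm (vol q))\<^sup>2 - 2 * inner (vol p) (vol q) = (norm (vol p - vol q))\<^sup>2"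
    by (simp add: power2_norm_eq_inner inner_diff_left inner_diff_right inner_commute)
  moreover have "0 \<le> (norm (vol p - vol q))\<^sup>2" by simp
  ultimately show ?thesis by linarith
qed

text \<open>With \<phi> = vol p and g = w + vol \<phi>, the conditions say that 2p = g - iso g, a
  fixed point equation for \<phi>. Neither \<open>vol\<close> nor the identity minus
  \<open>iso\<close> expands distances, so the step 2 leaves the contraction factor 1/2.\<close>

lemma gen_range: "\<exists>u p. (u, p) \<in> gen \<and> u + 2 *\<^sub>R p = w"
proof -
  define R where "R g = g - iso g" for g
  define F where "F \<phi> = (1 / 2) *\<^sub>R vol (R (w + vol \<phi>))" for \<phi>
  have "dist (F x) (F y) \<le> 1 / 2 * dist x y" for x y
  proof -
    have "norm (F x - F y) = 1 / 2 * norm (vol (R (w + vol x) - R (w + vol y)))"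
      by (simp add: F_def vol_diff flip: scaleR_right_diff_distrib)
    also have "norm (vol (R (w + vol x) - R (w + vol y))) \<le> norm (R (w + vol x) - R (w + vol y))" by (rule norm_vol_le)
    also have "\<dots> \<le> norm ((w + vol x) - (w + vol y))" unfolding R_def by (rule id_minus_iso_nonexpansive)
    also have "(w + vol x) - (w + vol y) = vol (x - y)" by (simp add: vol_diff)
    also have "norm (vol (x - y)) \<le> norm (x - y)" by (rule norm_vol_le)
    finally show ?thesis by (simp add: dist_norm)
  qed
  then have "\<exists>!\<phi>. F \<phi> = \<phi>" by (intro banach_fix_type[of "1 / 2"]) auto
  then obtain \<phi> where \<phi>: "F \<phi> = \<phi>" by blast
  define g where "g = w + vol \<phi>"
  define p where "p = (1 / 2) *\<^sub>R (g - iso g)"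
  define u where "u = w - 2 *\<^sub>R p"
  have "p \<in> polar" using iso_polar[of g] by (auto simp: p_def polar_def)
  have "vol p = \<phi>" using \<phi> by (simp add: F_def R_def p_def g_def vol_scaleR)
  then have "u + vol (vol p) = iso g" by (simp add: u_def p_def g_def)
  moreover have "inner p (iso g) = 0" using iso_orthogonal[of g] by (simp add: p_def)
  ultimately have "(u, p) \<in> gen" using \<open>p \<in> polar\<close> iso_mono_cone[of g] by (simp add: gen_def)
  then show ?thesis by (intro exI[of _ u] exI[of _ p]) (simp add: u_def)
qed

interpretation gen: m_accretive gen
proof
  show "\<exists>h>0. \<forall>w. \<exists>u p. (u, p) \<in> gen \<and> u + h *\<^sub>R p = w"
    using gen_range by (intro exI[of _ 2]) simp
qed (rule gen_accretive)

text \<open>Testing p with z + vol v, and then Young's inequality, bound <p, z - u> by |v|^2; as z -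
  u = h p, the resolvents approach z at rate sqrt h.\<close>

lemma closure_domain_gen:
  assumes "z + vol v \<in> mono_cone"
  shows "z \<in> closure (fst ` gen)"
proof -
  have *: "(norm (z - gen.J h z))\<^sup>2 \<le> h * (norm v)\<^sup>2" if "h > 0" for h
  proof -
    define u where "u = gen.J h z"
    define p where "p = gen.yosida h z"
    have up: "(u, p) \<in> gen" "z - u = h *\<^sub>R p"
      using gen.J_yosida[OF that, of z] gen.J_add_yosida[OF that, of z] unfolding u_def p_def
      by (auto simp: algebra_simps)
    then have p: "p \<in> polar" by (simp add: gen_def)
    have "inner p (z - u) \<le> inner (vol p) v - (norm (vol p))\<^sup>2"
      using inner_polar_le[OF p assms] polar_vol[OF p, of v] gen_inner[OF up(1)]
      by (simp add: inner_add_right inner_diff_right)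
    also have "\<dots> \<le> (norm v)\<^sup>2"
    proof -
      have "inner (vol p) v \<le> norm (vol p) * norm v" by (rule norm_cauchy_schwarz)
      moreover have "2 * (norm (vol p) * norm v) \<le> (norm (vol p))\<^sup>2 + (norm v)\<^sup>2"
        using sum_squares_bound[of "norm (vol p)" "norm v"] by (simp add: mult.assoc)
      moreover have "0 \<le> norm (vol p) * norm v" by simp
      ultimately show ?thesis using zero_le_power2[of "norm v"] by linarith
    qed
    finally have "h * inner p (z - u) \<le> h * (norm v)\<^sup>2" using that by (intro mult_left_mono) auto
    moreover have "(norm (z - u))\<^sup>2 = h * inner p (z - u)"
      unfolding power2_norm_eq_inner by (metis inner_scaleR_left up(2))
    ultimately show ?thesis unfolding u_def by simp
  qed
  show ?thesis unfolding closure_approachable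
  proof (intro allI impI)
    fix e :: real assume "e > 0"
    define h where "h = e\<^sup>2 / ((norm v)\<^sup>2 + 1)"
    have pos: "(norm v)\<^sup>2 + 1 > 0" by (simp add: add_nonneg_pos)
    then have "h > 0" using \<open>e > 0\<close> by (simp add: h_def)
    have "(norm (z - gen.J h z))\<^sup>2 \<le> h * (norm v)\<^sup>2" by (rule *[OF \<open>h > 0\<close>])
    also have "\<dots> < h * ((norm v)\<^sup>2 + 1)" using \<open>h > 0\<close> by simp
    also have "\<dots> = e\<^sup>2" using pos by (simp add: h_def)
    finally have "norm (z - gen.J h z) < e" by (rule power_less_imp_less_base) (use \<open>e > 0\<close> in simp)
    moreover have "gen.J h z \<in> fst ` gen" using gen.J_yosida[OF \<open>h > 0\<close>, of z] by force
    ultimately show "\<exists>y\<in>fst ` gen. dist y z < e"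
      by (intro bexI[of _ "gen.J h z"]) (simp_all add: dist_norm norm_minus_commute[of _ z])
  qed
qed

text \<open>Constants plus the range of \<open>vol\<close> lie in the closure of the domain by
  \<open>closure_domain_gen\<close>. They are dense: y orthogonal to them has
  \<open>prim y 1 = 0\<close>, and integration by parts then makes \<open>vol y\<close> orthogonal
  to everything.\<close>

lemma dense_domain_gen: "closure (fst ` gen) = UNIV"
proof -
  define X where "X = range (\<lambda>(c, v). c *\<^sub>R one + vol v)"
  have X_sub: "X \<subseteq> closure (fst ` gen)"
  proof
    fix z assume "z \<in> X"
    then obtain c v where z: "z = c *\<^sub>R one + vol v" by (auto simp: X_def)
    have "z + vol (- v) = c *\<^sub>R one" using vol_scaleR[of "-1" v] by (simp add: z)
    then show "z \<in> closure (fst ` gen)"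
      using closure_domain_gen[of z "- v"] scaleR_one_mono_cone by simp
  qed
  have X_lin: "a *\<^sub>R x + b *\<^sub>R y \<in> X" if "x \<in> X" "y \<in> X" for a b x y
  proof -
    obtain c v d w where "x = c *\<^sub>R one + vol v" "y = d *\<^sub>R one + vol w" using \<open>x \<in> X\<close> \<open>y \<in> X\<close> by (auto simp: X_def)
    then have "a *\<^sub>R x + b *\<^sub>R y = (a * c + b * d) *\<^sub>R one + vol (a *\<^sub>R v + b *\<^sub>R w)"
      by (simp add: vol_add vol_scaleR algebra_simps)
    then show ?thesis unfolding X_def by (intro image_eqI[of _ _ "(a * c + b * d, a *\<^sub>R v + b *\<^sub>R w)"]) auto
  qed
  have "convex X" unfolding convex_def using X_lin by blast
  have "0 \<in> X" unfolding X_def using vol_scaleR[of 0 0] by (intro image_eqI[of _ _ "(0, 0)"]) auto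
  have "w \<in> closure X" for w
  proof -
    obtain p where p: "p \<in> closure X" "\<And>q. q \<in> closure X \<Longrightarrow> inner (w - p) (q - p) \<le> 0"
    proof (rule hilbert_nearest_point[of "closure X" w])
      show "closure X \<noteq> {}" using \<open>0 \<in> X\<close> closure_subset by blast
    qed (use \<open>convex X\<close> convex_closure in auto)
    have orth: "inner (w - p) x = 0" if "x \<in> X" for x
    proof -
      have plus: "p + s *\<^sub>R x \<in> closure X" for s
      proof -
        obtain f where f: "\<And>n. f n \<in> X" "f \<longlonglongrightarrow> p" using p(1) unfolding closure_sequential by blast
        have "(\<lambda>n. f n + s *\<^sub>R x) \<longlonglongrightarrow> p + s *\<^sub>R x" by (intro tendsto_intros f)
        moreover have "f n + s *\<^sub>R x \<in> X" for n using X_lin[OF f(1) that, of 1 n s] by simp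
        ultimately show ?thesis unfolding closure_sequential
          by (intro exI[of _ "\<lambda>n. f n + s *\<^sub>R x"]) auto
      qed
      from p(2)[OF plus[of 1]] p(2)[OF plus[of "-1"]] show ?thesis by simp
    qed
    define y where "y = w - p"
    have "one \<in> X" unfolding X_def using vol_scaleR[of 0 0] by (intro image_eqI[of _ _ "(1, 0)"]) auto
    then have y1: "prim y 1 = 0" using orth by (simp add: y_def prim_1)
    have "vol v \<in> X" for v unfolding X_def by (intro image_eqI[of _ _ "(0, v)"]) auto
    then have "inner y (vol v) = 0" for v using orth by (simp add: y_def)
    then have "inner (vol y) v = 0" for v using integration_by_parts[of y v] y1 by simp
    then have "vol y = 0" using inner_eq_zero_iff by blast
    then have "y = 0" by (rule vol_eq_0D)
    then show ?thesis using p(1) by (simp add: y_def)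
  qed
  moreover have "closure X \<subseteq> closure (fst ` gen)" using X_sub by (rule closure_minimal) simp
  ultimately show ?thesis by blast
qed

interpretation gen: dense_m_accretive gen
  by unfold_locales (rule dense_domain_gen)

section \<open>The limit of the semigroup\<close>

text \<open>Where \<open>prim (u - c)\<close> is negative, \<open>prim p\<close> is positive, so \<open>u\<close> is nonincreasing there and \<open>prim (u - c)\<close> is
  concave between two zeros.\<close>

lemma gen_comparison:
  assumes up: "(u, p) \<in> gen" and c: "c \<in> mono_cone" and h: "h > 0"
    and z: "(u + h *\<^sub>R p) - c \<in> polar"
  shows "u - c \<in> polar"
proof (rule polarI)
  have p: "p \<in> polar" and mc: "u + vol (vol p) \<in> mono_cone" and orth: "inner p (u + vol (vol p)) = 0"
    using up by (auto simp: gen_def)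
  define T where "T = prim (u - c)"
  have T_eq: "T x = prim ((u + h *\<^sub>R p) - c) x - h * prim p x" for x
    by (simp add: T_def prim_diff prim_add prim_scaleR)
  \<comment> \<open>Hence \<open>prim p\<close> is positive wherever T is negative, and u + vol (vol
    p) is constant on intervals where this happens.\<close>
  have T_ge: "- h * prim p x \<le> T x" for x using polar_prim_nonneg[OF z, of x] by (simp add: T_eq)
  have T1: "T 1 = 0" using polar_prim_1[OF z] polar_prim_1[OF p] by (simp add: T_eq)
  then show "prim (u - c) 1 = 0" by (simp add: T_def)
  have T0: "T 0 = 0" by (simp add: T_def prim_0)
  have T_cont: "continuous_on {0..1} T" unfolding T_def by (rule prim_continuous)
  obtain r where r: "mono_on {0<..<1} r" "AE x in unit_ivl. l2_fun (u + vol (vol p)) x = r x" using mc by (rule mono_coneE)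
  obtain s where s: "mono_on {0<..<1} s" "AE x in unit_ivl. l2_fun c x = s x" using c by (rule mono_coneE)
  fix x0 :: real assume "x0 \<in> {0..1}"
  show "0 \<le> prim (u - c) x0"
  proof (rule ccontr)
    assume "\<not> 0 \<le> prim (u - c) x0"
    then have neg: "T x0 < 0" by (simp add: T_def)
    define L where "L = {x \<in> {0..x0}. 0 \<le> T x}"
    define R where "R = {x \<in> {x0..1}. 0 \<le> T x}"
    have cl: "closed L" "closed R"
    proof -
      have "continuous_on {0..x0} T" "continuous_on {x0..1} T"
        using \<open>x0 \<in> {0..1}\<close> by (auto intro: continuous_on_subset[OF T_cont])
      then show "closed L" "closed R"
        using continuous_closed_preimage[of "{0..x0}" T "{0..}"] continuous_closed_preimage[of "{x0..1}" T "{0..}"]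
        by (auto simp: L_def R_def vimage_def Int_def)
    qed
    have ne: "0 \<in> L" "1 \<in> R" using T0 T1 \<open>x0 \<in> {0..1}\<close> by (auto simp: L_def R_def)
    have bd: "bdd_above L" "bdd_below R" by (auto simp: L_def R_def bdd_above_def bdd_below_def)
    define a where "a = Sup L"
    define b where "b = Inf R"
    have "a \<in> L" unfolding a_def using cl ne bd by (intro closed_contains_Sup) auto
    have "b \<in> R" unfolding b_def using cl ne bd by (intro closed_contains_Inf) auto
    have ab: "0 \<le> a" "a < x0" "x0 < b" "b \<le> 1" "0 \<le> T a" "0 \<le> T b"
      using \<open>a \<in> L\<close> \<open>b \<in> R\<close> neg by (auto simp: L_def R_def less_le)
    have T_neg: "T x < 0" if "a < x" "x < b" for x
    proof (rule ccontr)
      assume "\<not> T x < 0"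
      then have "x \<in> L \<or> x \<in> R" using that ab by (auto simp: L_def R_def)
      then show False using cSup_upper[OF _ bd(1), of x] cInf_lower[OF _ bd(2), of x] that by (auto simp: a_def b_def)
    qed
    have p_pos: "0 < prim p x" if "a < x" "x < b" for x
    proof -
      have "0 < h * prim p x" using T_ge[of x] T_neg[OF that] by simp
      then show ?thesis using h by (simp add: zero_less_mult_iff)
    qed
    have r_const: "r x = r x0" if "a < x" "x < b" for x
    proof (cases "x \<le> x0")
      case True
      show ?thesis by (rule constant_where_prim_pos[OF p mc orth r ab(1,4) p_pos that(1) True ab(3)])
    next
      case False
      then show ?thesis
        using constant_where_prim_pos[OF p mc orth r ab(1,4) p_pos ab(2) _ that(2)] by simp
    qed
    \<comment> \<open>On (a, b) this is a nonincreasing representative of u - c: a constant minus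
      two nondecreasing functions.\<close>
    define k where "k x = r x0 - prim (vol p) x - s x" for x
    have prim_mono: "prim (vol p) x \<le> prim (vol p) y" if "0 \<le> x" "x \<le> y" "y \<le> 1" for x y
    proof -
      have "0 * (y - x) \<le> prim (vol p) y - prim (vol p) x"
      proof (rule prim_diff_ge[OF that])
        show "AE t in unit_ivl. x < t \<and> t < y \<longrightarrow> 0 \<le> l2_fun (vol p) t"
          using l2_fun_vol[of p] by eventually_elim (simp add: polar_prim_nonneg[OF p])
      qed
      then show ?thesis by simp
    qed
    have k_mono: "k y \<le> k x" if "a < x" "x \<le> y" "y < b" for x y
      using prim_mono[of x y] mono_onD[OF s(1), of x y] that ab by (auto simp: k_def)
    have k_eq: "AE x in unit_ivl. a < x \<and> x < b \<longrightarrow> l2_fun (u - c) x = k x"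
      using r(2) s(2) l2_fun_diff[of u c] l2_fun_add[of u "vol (vol p)"] l2_fun_vol[of "vol p"]
    proof eventually_elim
      case (elim x)
      show ?case
      proof
        assume "a < x \<and> x < b"
        then have "r x = r x0" using r_const by simp
        then show "l2_fun (u - c) x = k x" using elim by (simp add: k_def)
      qed
    qed
    \<comment> \<open>T falls from T a >= 0 to T x0 < 0, so the density is already negative at x0;
      being nonincreasing it stays negative, and T cannot return to T b >= 0.\<close>
    have "k x0 * (x0 - a) \<le> T x0 - T a" unfolding T_def
    proof (rule prim_diff_ge)
      show "AE x in unit_ivl. a < x \<and> x < x0 \<longrightarrow> k x0 \<le> l2_fun (u - c) x"
        using k_eq by eventually_elim (use k_mono[of _ x0] ab in auto)
    qed (use ab in auto)
    also have "\<dots> < 0" using neg ab by simp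
    finally have "k x0 < 0" using ab by (simp add: mult_less_0_iff)
    have "T b - T x0 \<le> k x0 * (b - x0)" unfolding T_def
    proof (rule prim_diff_le)
      show "AE x in unit_ivl. x0 < x \<and> x < b \<longrightarrow> l2_fun (u - c) x \<le> k x0"
        using k_eq by eventually_elim (use k_mono[of x0] ab in auto)
    qed (use ab in auto)
    also have "\<dots> < 0" using \<open>k x0 < 0\<close> ab by (simp add: mult_less_0_iff)
    finally show False using neg ab by simp
  qed
qed

text \<open>The two relations between z and c = iso w say that c is also the projection of z; they
  persist for the resolvent. The decay follows from |u - c|^2 <= |u - m|^2 = |vol (vol p)|^2 <= |vol
  p|^2 <= <p, u - c>, where m = u + vol (vol p) competes with c in the cone.\<close>

lemma J_gen_contracts_to_iso:
  assumes z: "z - iso w \<in> polar" "inner (z - iso w) (iso w) = 0" and h: "h > 0"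
  defines "u \<equiv> gen.J h z"
  shows "u - iso w \<in> polar" "inner (u - iso w) (iso w) = 0" "(1 + h) * norm (u - iso w) \<le> norm (z - iso w)"
proof -
  define c where "c = iso w"
  define p where "p = gen.yosida h z"
  have c: "c \<in> mono_cone" by (simp add: c_def iso_mono_cone)
  have up: "(u, p) \<in> gen" unfolding u_def p_def by (rule gen.J_yosida[OF h])
  have z_eq: "u + h *\<^sub>R p = z" unfolding u_def p_def by (rule gen.J_add_yosida[OF h])
  have p: "p \<in> polar" and mc: "u + vol (vol p) \<in> mono_cone" using up by (auto simp: gen_def)
  have 1: "u - c \<in> polar" by (rule gen_comparison[OF up c h]) (use z(1) in \<open>simp add: z_eq c_def\<close>)
  \<comment> \<open>Both terms are nonpositive and their sum is 0, so both vanish.\<close>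
  have "0 = inner (u - c) c + h * inner p c"
    using z(2) unfolding z_eq[symmetric] c_def by (simp add: inner_diff_left inner_add_left)
  moreover have "h * inner p c \<le> 0" using inner_polar_le[OF p c] h by (simp add: mult_le_0_iff)
  ultimately have 2: "inner (u - c) c = 0" using inner_polar_le[OF 1 c] by simp
  define m where "m = u + vol (vol p)"
  have "(norm (u - c))\<^sup>2 \<le> (norm (u - m))\<^sup>2"
  proof -
    have "u - m = (u - c) + (c - m)" by simp
    then have "(norm (u - m))\<^sup>2 = (norm (u - c))\<^sup>2 + 2 * inner (u - c) (c - m) + (norm (c - m))\<^sup>2"
      by (simp only: power2_norm_eq_inner inner_add_left inner_add_right inner_commute)
    moreover have "0 \<le> inner (u - c) (c - m)" using 2 inner_polar_le[OF 1 mc] by (simp add: inner_diff_right m_def)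
    ultimately show ?thesis by simp
  qed
  also have "norm (u - m) = norm (vol (vol p))" by (simp add: m_def)
  also have "(norm (vol (vol p)))\<^sup>2 \<le> (norm (vol p))\<^sup>2" by (intro power_mono norm_vol_le) simp
  also have "\<dots> \<le> inner p (u - c)"
    using gen_inner[OF up] inner_polar_le[OF p c] by (simp add: inner_diff_right)
  finally have pu: "(norm (u - c))\<^sup>2 \<le> inner p (u - c)" .
  have "(1 + h) * (norm (u - c))\<^sup>2 \<le> (norm (u - c))\<^sup>2 + h * inner p (u - c)"
    using mult_left_mono[OF pu, of h] h by (simp add: distrib_right)
  also have "\<dots> = inner (z - c) (u - c)"
    unfolding z_eq[symmetric] by (simp add: power2_norm_eq_inner inner_add_left inner_diff_left)
  also have "\<dots> \<le> norm (z - c) * norm (u - c)" by (rule norm_cauchy_schwarz)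
  finally have "((1 + h) * norm (u - c)) * norm (u - c) \<le> norm (z - c) * norm (u - c)"
    by (simp add: power2_eq_square mult.assoc)
  then have 3: "(1 + h) * norm (u - c) \<le> norm (z - c)"
    by (cases "norm (u - c) = 0") (auto dest: mult_right_le_imp_le)
  show "u - iso w \<in> polar" "inner (u - iso w) (iso w) = 0" "(1 + h) * norm (u - iso w) \<le> norm (z - iso w)"
    using 1 2 3 by (simp_all add: c_def)
qed

text \<open>Bernoulli's inequality replaces the factor (1 + h)^n by 1 + nh, a function of the
  elapsed time alone, so the bound passes to the limit: the distance decays at least like 1/(1 +
  t).\<close>

lemma S_gen_tendsto_iso: "((\<lambda>t. gen.S t w) \<longlongrightarrow> iso w) at_top"
proof -
  have step: "(gen.J h ^^ n) w - iso w \<in> polar \<and> inner ((gen.J h ^^ n) w - iso w) (iso w) = 0 \<and>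
      (1 + real n * h) * norm ((gen.J h ^^ n) w - iso w) \<le> norm (w - iso w)" if h: "h > 0" for h n
  proof -
    have "(gen.J h ^^ n) w - iso w \<in> polar \<and> inner ((gen.J h ^^ n) w - iso w) (iso w) = 0 \<and>
      (1 + h) ^ n * norm ((gen.J h ^^ n) w - iso w) \<le> norm (w - iso w)"
    proof (induction n)
      case 0
      then show ?case by (simp add: iso_polar iso_orthogonal)
    next
      case (Suc n)
      define z where "z = (gen.J h ^^ n) w"
      have z: "z - iso w \<in> polar" "inner (z - iso w) (iso w) = 0" "(1 + h) ^ n * norm (z - iso w) \<le> norm (w - iso w)"
        using Suc by (auto simp: z_def)
      note J = J_gen_contracts_to_iso[OF z(1,2) h]
      have "(1 + h) ^ Suc n * norm (gen.J h z - iso w) = (1 + h) ^ n * ((1 + h) * norm (gen.J h z - iso w))"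
        by (simp add: mult_ac)
      also have "\<dots> \<le> (1 + h) ^ n * norm (z - iso w)" using J(3) h by (intro mult_left_mono) auto
      also note z(3)
      finally show ?case using J(1,2) by (simp add: z_def)
    qed
    moreover have "(1 + real n * h) \<le> (1 + h) ^ n" using Bernoulli_inequality[of h n] h by simp
    ultimately show ?thesis using mult_right_mono[of "1 + real n * h" "(1 + h) ^ n" "norm ((gen.J h ^^ n) w - iso w)"] by auto
  qed
  have bound: "(1 + t) * norm (gen.S t w - iso w) \<le> norm (w - iso w)" if t: "t \<ge> 0" for t
  proof (rule LIMSEQ_le_const2)
    show "(\<lambda>k. (1 + real (nat \<lfloor>t * 2 ^ k\<rfloor>) * (1 / 2) ^ k) * norm (gen.euler k t w - iso w))
        \<longlonglongrightarrow> (1 + t) * norm (gen.S t w - iso w)"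
      by (intro tendsto_intros gen.dyadic_floor_tendsto gen.S_tendsto t)
    show "\<exists>N. \<forall>k\<ge>N. (1 + real (nat \<lfloor>t * 2 ^ k\<rfloor>) * (1 / 2) ^ k) * norm (gen.euler k t w - iso w) \<le> norm (w - iso w)"
      using step[of "(1 / 2) ^ _"] unfolding gen.euler_def by auto
  qed
  have "((\<lambda>t. norm (w - iso w) / (1 + t)) \<longlongrightarrow> 0) at_top"
    by (intro tendsto_divide_0[OF tendsto_const] filterlim_at_top_imp_at_infinity filterlim_tendsto_add_at_top[OF tendsto_const] filterlim_ident)
  moreover have "\<forall>\<^sub>F t in at_top. norm (gen.S t w - iso w) \<le> norm (w - iso w) / (1 + t)"
    using eventually_ge_at_top[of 0] by eventually_elim (use bound in \<open>simp add: field_simps\<close>)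
  ultimately have "((\<lambda>t. gen.S t w - iso w) \<longlongrightarrow> 0) at_top" by (rule Lim_null_comparison[rotated])
  then show ?thesis by (rule LIM_zero_cancel)
qed

section \<open>Test functions\<close>

text \<open>Smoothness up to a finite order supports induction through \<open>diff_upto_Suc\<close>;
  test functions satisfy it at every order.\<close>

definition diff_upto :: "nat \<Rightarrow> (real \<Rightarrow> real) \<Rightarrow> bool" where
  "diff_upto n f \<longleftrightarrow> (\<forall>k\<le>n. \<forall>x. (deriv ^^ k) f field_differentiable (at x))"

lemma diff_upto_0: "diff_upto 0 f \<longleftrightarrow> (\<forall>x. f field_differentiable (at x))"
  by (simp add: diff_upto_def)

lemma diff_upto_Suc: "diff_upto (Suc n) f \<longleftrightarrow> (\<forall>x. f field_differentiable (at x)) \<and> diff_upto n (deriv f)"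
proof -
  have "diff_upto (Suc n) f \<longleftrightarrow> (\<forall>x. (deriv ^^ 0) f field_differentiable (at x)) \<and>
      (\<forall>k\<le>n. \<forall>x. (deriv ^^ Suc k) f field_differentiable (at x))"
    unfolding diff_upto_def by (metis Suc_le_mono le0 old.nat.exhaust)
  then show ?thesis by (simp only: diff_upto_def funpow_Suc_right o_apply funpow_0)
qed

lemma diff_upto_imp_diff: "diff_upto n f \<Longrightarrow> f field_differentiable (at x)"
  by (cases n) (simp_all add: diff_upto_0 diff_upto_Suc)

lemma diff_upto_mono: "diff_upto (Suc n) f \<Longrightarrow> diff_upto n f"
  by (simp add: diff_upto_def)

lemma diff_upto_const: "diff_upto n (\<lambda>_. c)"
proof (induction n arbitrary: c)
  case (Suc n)
  have "deriv (\<lambda>_. c) = (\<lambda>_. 0)" by (rule ext) simp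
  with Suc show ?case by (simp add: diff_upto_Suc)
qed (simp add: diff_upto_0)

lemma diff_upto_add:
  assumes "diff_upto n f" "diff_upto n g"
  shows "diff_upto n (\<lambda>x. f x + g x)"
  using assms
proof (induction n arbitrary: f g)
  case (Suc n)
  then have fg: "\<And>x. f field_differentiable (at x)" "\<And>x. g field_differentiable (at x)"
    by (auto simp: diff_upto_Suc)
  then have "deriv (\<lambda>x. f x + g x) = (\<lambda>x. deriv f x + deriv g x)" by (intro ext deriv_add)
  with Suc fg show ?case by (auto simp: diff_upto_Suc intro!: field_differentiable_add)
qed (auto simp: diff_upto_0 intro!: field_differentiable_add)

lemma diff_upto_mult:
  assumes "diff_upto n f" "diff_upto n g"
  shows "diff_upto n (\<lambda>x. f x * g x)"
  using assms
proof (induction n arbitrary: f g)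
  case (Suc n)
  then have fg: "\<And>x. f field_differentiable (at x)" "\<And>x. g field_differentiable (at x)"
    by (auto simp: diff_upto_Suc)
  then have "deriv (\<lambda>x. f x * g x) = (\<lambda>x. f x * deriv g x + deriv f x * g x)" by (intro ext deriv_mult)
  moreover have "diff_upto n f" "diff_upto n g" using Suc.prems by (auto intro: diff_upto_mono)
  ultimately show ?case using Suc fg by (auto simp: diff_upto_Suc intro!: field_differentiable_mult diff_upto_add)
qed (auto simp: diff_upto_0 intro!: field_differentiable_mult)

lemma has_derivative_affine_arg:
  assumes "\<And>x. f field_differentiable (at x)"
  shows "((\<lambda>x. f (c * x + d)) has_real_derivative deriv f (c * x + d) * c) (at (x :: real))"
proof (rule DERIV_chain'[where f = "\<lambda>x. c * x + d" and g = f])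
  show "((\<lambda>x. c * x + d) has_real_derivative c) (at x)" by (auto intro!: derivative_eq_intros)
  show "(f has_real_derivative deriv f (c * x + d)) (at (c * x + d))"
    using assms by (simp add: DERIV_deriv_iff_field_differentiable)
qed

lemma diff_upto_affine:
  assumes "diff_upto n f"
  shows "diff_upto n (\<lambda>x. f (c * x + d))"
  using assms
proof (induction n arbitrary: f)
  case 0
  then show ?case
    using has_derivative_affine_arg[of f] unfolding diff_upto_0 field_differentiable_def by blast
next
  case (Suc n)
  then have f: "\<And>x. f field_differentiable (at x)" by (auto simp: diff_upto_Suc)
  have "deriv (\<lambda>x. f (c * x + d)) = (\<lambda>x. deriv f (c * x + d) * c)"
    by (intro ext DERIV_imp_deriv has_derivative_affine_arg f)
  moreover have "(\<lambda>x. f (c * x + d)) field_differentiable (at x)" for x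
    using has_derivative_affine_arg[OF f] unfolding field_differentiable_def by blast
  ultimately show ?case using Suc by (auto simp: diff_upto_Suc intro!: diff_upto_mult diff_upto_const)
qed

section \<open>Smooth bump functions\<close>

definition exp_flat :: "real poly \<Rightarrow> real \<Rightarrow> real" where
  "exp_flat p x = (if x \<le> 0 then 0 else poly p (1 / x) * exp (- (1 / x)))"

lemma poly_div_exp_tendsto_0: "((\<lambda>x. poly p x * exp (- x)) \<longlongrightarrow> (0 :: real)) at_top"
proof -
  have "((\<lambda>x. \<Sum>i\<le>degree p. coeff p i * (x ^ i / exp x)) \<longlongrightarrow> (\<Sum>i\<le>degree p. coeff p i * 0)) at_top"
    by (intro tendsto_intros tendsto_power_div_exp_0)
  moreover have "poly p x * exp (- x) = (\<Sum>i\<le>degree p. coeff p i * (x ^ i / exp x))" for x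
    unfolding poly_altdef sum_distrib_right by (simp add: exp_minus field_simps)
  ultimately show ?thesis by simp
qed

text \<open>A polynomial in 1/x in front of exp(-1/x) closes the family under differentiation: the
  new polynomial is X^2 (p - p'), because the derivative of 1/x is -1/x^2.\<close>

lemma exp_flat_deriv: "(exp_flat p has_real_derivative exp_flat ([:0, 0, 1:] * (p - pderiv p)) x) (at x)"
proof -
  consider "x < 0" | "x > 0" | "x = 0" by linarith
  then show ?thesis
  proof cases
    case 1
    have "((\<lambda>_. 0 :: real) has_real_derivative 0) (at x)" by simp
    then have "(exp_flat p has_real_derivative 0) (at x)"
      by (rule has_field_derivative_transform_within_open[where S = "{..<0}"]) (use 1 in \<open>auto simp: exp_flat_def\<close>)
    then show ?thesis using 1 by (simp add: exp_flat_def)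
  next
    case 2
    have "((\<lambda>x. poly p (1 / x) * exp (- (1 / x))) has_real_derivative
        poly (pderiv p) (1 / x) * (- 1 / x\<^sup>2) * exp (- (1 / x)) + poly p (1 / x) * (exp (- (1 / x)) * (1 / x\<^sup>2))) (at x)"
      using 2 by (auto intro!: derivative_eq_intros DERIV_chain'[OF _ poly_DERIV] simp: power2_eq_square field_simps)
    also have "poly (pderiv p) (1 / x) * (- 1 / x\<^sup>2) * exp (- (1 / x)) + poly p (1 / x) * (exp (- (1 / x)) * (1 / x\<^sup>2))
        = exp_flat ([:0, 0, 1:] * (p - pderiv p)) x"
      using 2 by (simp add: exp_flat_def power2_eq_square field_simps)
    finally have "((\<lambda>x. poly p (1 / x) * exp (- (1 / x))) has_real_derivative exp_flat ([:0, 0, 1:] * (p - pderiv p)) x) (at x)" .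
    then show ?thesis
      by (rule has_field_derivative_transform_within_open[where S = "{0<..}"]) (use 2 in \<open>auto simp: exp_flat_def\<close>)
  next
    case 3
    have "((\<lambda>h. (exp_flat p (0 + h) - exp_flat p 0) / h) \<longlongrightarrow> 0) (at 0)"
    proof (rule filterlim_split_at)
      have "\<forall>\<^sub>F h in at_left 0. (exp_flat p (0 + h) - exp_flat p 0) / h = 0"
        unfolding eventually_at_left_field by (intro exI[of _ "-1"]) (auto simp: exp_flat_def)
      then show "((\<lambda>h. (exp_flat p (0 + h) - exp_flat p 0) / h) \<longlongrightarrow> 0) (at_left 0)"
        by (rule tendsto_eventually)
      have "((\<lambda>h. poly ([:0, 1:] * p) (inverse h) * exp (- inverse h)) \<longlongrightarrow> 0) (at_right 0)"
        using filterlim_compose[OF poly_div_exp_tendsto_0 filterlim_inverse_at_top_right] .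
      moreover have "\<forall>\<^sub>F h in at_right 0. poly ([:0, 1:] * p) (inverse h) * exp (- inverse h) = (exp_flat p (0 + h) - exp_flat p 0) / h"
        unfolding eventually_at_right_field by (intro exI[of _ 1]) (auto simp: exp_flat_def field_simps)
      ultimately show "((\<lambda>h. (exp_flat p (0 + h) - exp_flat p 0) / h) \<longlongrightarrow> 0) (at_right 0)"
        by (rule Lim_transform_eventually)
    qed
    then show ?thesis using 3 by (simp add: DERIV_def exp_flat_def)
  qed
qed

lemma diff_upto_exp_flat: "diff_upto n (exp_flat p)"
proof (induction n arbitrary: p)
  case 0
  then show ?case using exp_flat_deriv by (auto simp: diff_upto_0 field_differentiable_def)
next
  case (Suc n)
  have "deriv (exp_flat p) = exp_flat ([:0, 0, 1:] * (p - pderiv p))"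
    by (intro ext DERIV_imp_deriv exp_flat_deriv)
  then show ?case using Suc exp_flat_deriv unfolding diff_upto_Suc field_differentiable_def by metis
qed

lemma test_function_iff:
  "test_function f \<longleftrightarrow> (\<forall>n. diff_upto n f) \<and> (\<exists>a b. 0 < a \<and> b < 1 \<and> (\<forall>x. x \<notin> {a..b} \<longrightarrow> f x = 0))"
  unfolding test_function_def diff_upto_def by blast

text \<open>The factor n + 1 steepens both flanks, so that the bumps converge pointwise to the
  indicator of (a, b).\<close>

definition bump :: "nat \<Rightarrow> real \<Rightarrow> real \<Rightarrow> real \<Rightarrow> real" where
  "bump n a b x = exp_flat 1 (real (Suc n) * (x - a)) * exp_flat 1 (real (Suc n) * (b - x))"

lemma test_function_bump:
  assumes "0 < a" "b < 1"
  shows "test_function (bump n a b)"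
proof -
  have "diff_upto m (bump n a b)" for m
  proof -
    have "diff_upto m (\<lambda>x. exp_flat 1 (real (Suc n) * x + - (real (Suc n) * a)) * exp_flat 1 (- real (Suc n) * x + real (Suc n) * b))"
      by (intro diff_upto_mult diff_upto_affine diff_upto_exp_flat)
    moreover have "bump n a b = (\<lambda>x. exp_flat 1 (real (Suc n) * x + - (real (Suc n) * a)) * exp_flat 1 (- real (Suc n) * x + real (Suc n) * b))"
    proof
      fix x
      have "real (Suc n) * (x - a) = real (Suc n) * x + - (real (Suc n) * a)"
        "real (Suc n) * (b - x) = - real (Suc n) * x + real (Suc n) * b" by (simp_all add: algebra_simps)
      then show "bump n a b x = exp_flat 1 (real (Suc n) * x + - (real (Suc n) * a)) * exp_flat 1 (- real (Suc n) * x + real (Suc n) * b)"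
        by (simp only: bump_def)
    qed
    ultimately show ?thesis by simp
  qed
  moreover have "bump n a b x = 0" if "x \<notin> {a..b}" for x
    using that by (auto simp: bump_def exp_flat_def mult_le_0_iff not_le)
  ultimately show ?thesis using assms unfolding test_function_iff by blast
qed

lemma bump_bounds: "0 \<le> bump n a b x" "bump n a b x \<le> 1"
proof -
  have "0 \<le> exp_flat 1 y \<and> exp_flat 1 y \<le> 1" for y by (auto simp: exp_flat_def)
  then show "0 \<le> bump n a b x" "bump n a b x \<le> 1" unfolding bump_def by (auto intro: mult_le_one)
qed

lemma bump_tendsto: "(\<lambda>n. bump n a b x) \<longlonglongrightarrow> indicator {a<..<b} x"
proof (cases "x \<in> {a<..<b}")
  case True
  have "(\<lambda>n. 1 / (real (Suc n) * c)) \<longlonglongrightarrow> 0" for c :: real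
  proof -
    have "(\<lambda>n. 1 / c * (1 / real (Suc n))) \<longlonglongrightarrow> 1 / c * 0" by (intro tendsto_intros LIMSEQ_Suc[OF lim_1_over_n])
    then show ?thesis by (simp add: mult.commute)
  qed
  then have "(\<lambda>n. exp (- (1 / (real (Suc n) * (x - a)))) * exp (- (1 / (real (Suc n) * (b - x))))) \<longlonglongrightarrow> exp (- 0) * exp (- 0)"
    by (intro tendsto_intros)
  moreover have "bump n a b x = exp (- (1 / (real (Suc n) * (x - a)))) * exp (- (1 / (real (Suc n) * (b - x))))" for n
  proof -
    have "real (Suc n) * (x - a) > 0" "real (Suc n) * (b - x) > 0" using True by simp_all
    then show ?thesis unfolding bump_def exp_flat_def by simp
  qed
  ultimately show ?thesis using True by simp
next
  case False
  then have "bump n a b x = 0" for n by (auto simp: bump_def exp_flat_def mult_le_0_iff)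
  then show ?thesis using False by simp
qed

lemma test_function_continuous: "test_function f \<Longrightarrow> continuous_on A f"
  unfolding test_function_iff
  by (intro continuous_at_imp_continuous_on ballI field_differentiable_imp_continuous_at diff_upto_imp_diff) auto

lemma test_function_L2: "test_function f \<Longrightarrow> f \<in> L2"
  by (intro continuous_on_unit_L2 test_function_continuous)

text \<open>In the limit of bumps, u integrates to 0 over intervals inside (0, 1), so its primitive
  is constant there and, by continuity and its value at 0, zero.\<close>

lemma test_functions_total:
  assumes "\<And>\<psi>. test_function \<psi> \<Longrightarrow> inner u (l2_of \<psi>) = 0"
  shows "u = 0"
proof -
  have *: "prim u b = prim u a" if "0 < a" "a < b" "b < 1" for a b
  proof -
    have "(\<lambda>n. \<integral>x. l2_fun u x * bump n a b x \<partial>unit_ivl) \<longlonglongrightarrow> (\<integral>x. l2_fun u x * indicator {a<..<b} x \<partial>unit_ivl)"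
    proof (rule integral_dominated_convergence[where w = "\<lambda>x. \<bar>l2_fun u x\<bar>"])
      show "integrable unit_ivl (\<lambda>x. \<bar>l2_fun u x\<bar>)" using L2_integrable[OF l2_fun_L2] by simp
      show "AE x in unit_ivl. norm (l2_fun u x * bump n a b x) \<le> \<bar>l2_fun u x\<bar>" for n
        using bump_bounds by (intro always_eventually allI) (simp add: abs_mult mult_left_le)
      show "(\<lambda>x. l2_fun u x * bump n a b x) \<in> borel_measurable unit_ivl" for n
        using that by (intro borel_measurable_times l2_fun_measurable L2_measurable test_function_L2 test_function_bump) auto
      show "(\<lambda>x. l2_fun u x * indicator {a<..<b} x) \<in> borel_measurable unit_ivl" by measurable
      show "AE x in unit_ivl. (\<lambda>n. l2_fun u x * bump n a b x) \<longlonglongrightarrow> l2_fun u x * indicator {a<..<b} x"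
        by (intro always_eventually allI tendsto_intros bump_tendsto)
    qed
    moreover have "(\<integral>x. l2_fun u x * bump n a b x \<partial>unit_ivl) = 0" for n
    proof -
      have "test_function (bump n a b)" using that by (intro test_function_bump)
      from assms[OF this] inner_l2_of_right[OF test_function_L2[OF this], of u] show ?thesis by simp
    qed
    ultimately have "(\<integral>x. l2_fun u x * indicator {a<..<b} x \<partial>unit_ivl) = 0"
      using LIMSEQ_unique tendsto_const by (metis (no_types, lifting) ext)
    moreover have "(\<integral>x. l2_fun u x * indicator {a<..<b} x \<partial>unit_ivl) = (\<integral>x. l2_fun u x * indicator {a<..b} x \<partial>unit_ivl)"
      using AE_unit_ivl_neq[of b] by (intro integral_cong_AE) (auto elim: eventually_mono simp: indicator_def)
    ultimately show ?thesis using prim_diff_eq_integral[of a b u] that by simp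
  qed
  have const: "prim u x = prim u (1 / 2)" if "x \<in> {0<..<1}" for x
  proof -
    consider "x < 1 / 2" | "1 / 2 < x" | "x = 1 / 2" by linarith
    then show ?thesis
    proof cases
      case 1
      then show ?thesis using *[of x "1 / 2"] that by simp
    next
      case 2
      then show ?thesis using *[of "1 / 2" x] that by simp
    next
      case 3
      then show ?thesis by (rule arg_cong)
    qed
  qed
  have all: "prim u x = prim u (1 / 2)" if "x \<in> {0..1}" for x
    by (rule AE_eq_continuous[OF prim_continuous continuous_on_const _ that]) (rule AE_unit_ivl_I, rule const, simp)
  have "prim u x = 0" if "x \<in> {0..1}" for x using all[OF that] all[of 0] by (simp add: prim_0)
  then show ?thesis by (rule eq_0_if_prim_eq_0)
qed

lemma test_function_deriv:
  assumes "test_function \<psi>"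
  shows "(\<psi> has_real_derivative deriv \<psi> x) (at x)" "continuous_on A (deriv \<psi>)" "\<psi> 0 = 0" "\<psi> 1 = 0"
proof -
  have d: "diff_upto n \<psi>" for n using assms by (simp add: test_function_iff)
  show "(\<psi> has_real_derivative deriv \<psi> x) (at x)"
    using diff_upto_imp_diff[OF d] by (simp add: DERIV_deriv_iff_field_differentiable)
  have "diff_upto 0 (deriv \<psi>)" using d[of "Suc 0"] by (simp add: diff_upto_Suc)
  then show "continuous_on A (deriv \<psi>)"
    by (intro continuous_at_imp_continuous_on ballI field_differentiable_imp_continuous_at diff_upto_imp_diff)
  obtain a b where "0 < a" "b < 1" "\<forall>x. x \<notin> {a..b} \<longrightarrow> \<psi> x = 0" using assms unfolding test_function_iff by blast
  then show "\<psi> 0 = 0" "\<psi> 1 = 0" by auto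
qed

lemma prim_continuous_fun:
  assumes "continuous_on {0..1} f" "x \<in> {0..1}"
  shows "prim (l2_of f) x = integral {0..x} f"
proof -
  have L2: "f \<in> L2" by (rule continuous_on_unit_L2[OF assms(1)])
  have "prim (l2_of f) x = (\<integral>t. f t * indicator {..x} t \<partial>unit_ivl)"
    unfolding prim_eq_integral using l2_fun_of[OF L2] L2_measurable[OF L2]
    by (intro integral_cong_AE) (auto elim: eventually_mono intro!: borel_measurable_times)
  also have "\<dots> = integral {0<..<1} (\<lambda>t. f t * indicator {..x} t)"
    by (rule lebesgue_integral_eq_integral) (auto intro!: L2_mult_integrable L2 indicator_L2)
  also have "\<dots> = integral {0..1} (\<lambda>t. f t * indicator {..x} t)"
    by (rule integral_open_interval_real[symmetric])
  also have "\<dots> = integral {0..1} (\<lambda>t. if t \<in> {0..x} then f t else 0)"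
    by (intro Henstock_Kurzweil_Integration.integral_cong) (auto simp: indicator_def)
  also have "\<dots> = integral {0..x} f"
    using assms by (subst integral_restrict_Int) (auto simp: Int_absorb1)
  finally show ?thesis .
qed

lemma prim_deriv:
  assumes "\<And>x. x \<in> {0..1} \<Longrightarrow> (F has_real_derivative f x) (at x within {0..1})" "continuous_on {0..1} f" "x \<in> {0..1}"
  shows "prim (l2_of f) x = F x - F 0"
proof -
  have "(f has_integral (F x - F 0)) {0..x}"
  proof (rule fundamental_theorem_of_calculus)
    fix t assume "t \<in> {0..x}"
    then have "(F has_real_derivative f t) (at t within {0..x})"
      using assms(3) by (intro has_field_derivative_subset[OF assms(1)]) auto
    then show "(F has_vector_derivative f t) (at t within {0..x})"
      by (simp add: has_real_derivative_iff_has_vector_derivative)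
  qed (use assms in auto)
  then show ?thesis using prim_continuous_fun[OF assms(2,3)] by (simp add: integral_unique)
qed

lemma vol_test_function_deriv:
  assumes "test_function \<psi>"
  shows "vol (l2_of (deriv \<psi>)) = l2_of \<psi>" "prim (l2_of (deriv \<psi>)) 1 = 0"
proof -
  have prim: "prim (l2_of (deriv \<psi>)) x = \<psi> x" if "x \<in> {0..1}" for x
    using prim_deriv[of \<psi> "deriv \<psi>" x] test_function_deriv[OF assms] that
    by (auto intro: has_field_derivative_at_within)
  then show "prim (l2_of (deriv \<psi>)) 1 = 0" using test_function_deriv(4)[OF assms] by simp
  show "vol (l2_of (deriv \<psi>)) = l2_of \<psi>" unfolding vol_def
    by (subst l2_of_eq_iff) (auto intro!: prim_L2 test_function_L2 assms AE_unit_ivl_I prim)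
qed

lemma deriv_test_function_L2: "test_function \<psi> \<Longrightarrow> deriv \<psi> \<in> L2"
  by (intro continuous_on_unit_L2 test_function_deriv(2))

lemma has_weak_deriv_l2:
  assumes "w \<in> L2" "v \<in> L2"
  shows "has_weak_deriv w v \<longleftrightarrow>
    (\<forall>\<psi>. test_function \<psi> \<longrightarrow> inner (l2_of w) (l2_of (deriv \<psi>)) = - inner (l2_of v) (l2_of \<psi>))"
  unfolding has_weak_deriv_def
  using inner_l2_of[OF assms(1) deriv_test_function_L2] inner_l2_of[OF assms(2) test_function_L2]
  by (auto simp: l2_inner_def)

lemma inner_vol_deriv:
  assumes "test_function \<psi>"
  shows "inner (c *\<^sub>R one + vol v) (l2_of (deriv \<psi>)) = - inner v (l2_of \<psi>)"
proof -
  have "inner (vol v) (l2_of (deriv \<psi>)) = - inner v (l2_of \<psi>)"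
    using integration_by_parts[of v "l2_of (deriv \<psi>)"] vol_test_function_deriv[OF assms] by simp
  moreover have "inner one (l2_of (deriv \<psi>)) = 0"
    using vol_test_function_deriv(2)[OF assms] by (simp add: prim_1 inner_commute)
  ultimately show ?thesis by (simp add: inner_add_left)
qed

text \<open>The integral from 0 vanishes left of the support trivially and right of it because the
  total is 0, so the primitive has the same compact support.\<close>

lemma test_function_primitive:
  assumes \<kappa>: "test_function \<kappa>" and total: "integral {0..1} \<kappa> = 0"
  obtains \<psi> where "test_function \<psi>" "deriv \<psi> = \<kappa>"
proof
  obtain a b where ab: "0 < a" "b < 1" "\<And>x. x \<notin> {a..b} \<Longrightarrow> \<kappa> x = 0"
    using \<kappa> unfolding test_function_iff by blast
  define \<psi> where "\<psi> x = integral {0..x} \<kappa>" for x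
  have int: "\<kappa> integrable_on {c..d}" for c d
    by (rule integrable_continuous_real[OF test_function_continuous[OF \<kappa>]])
  have z1: "\<psi> x = 0" if "x < a" for x
  proof -
    have "\<psi> x = integral {0..x} (\<lambda>_. 0)" unfolding \<psi>_def
      by (rule Henstock_Kurzweil_Integration.integral_cong) (use that ab in auto)
    then show ?thesis by simp
  qed
  have z2: "\<psi> x = 0" if "x > b" for x
  proof (cases "x \<le> 1")
    case True
    show ?thesis
    proof (cases "x < 0")
      case False
      have "integral {0..x} \<kappa> + integral {x..1} \<kappa> = integral {0..1} \<kappa>"
        using False True int by (intro Henstock_Kurzweil_Integration.integral_combine) auto
      moreover have "integral {x..1} \<kappa> = integral {x..1} (\<lambda>_. 0)"
        by (rule Henstock_Kurzweil_Integration.integral_cong) (use that ab in auto)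
      ultimately show ?thesis using total by (simp add: \<psi>_def)
    qed (simp add: \<psi>_def)
  next
    case False
    have "integral {0..1} \<kappa> + integral {1..x} \<kappa> = integral {0..x} \<kappa>"
      using False int by (intro Henstock_Kurzweil_Integration.integral_combine) auto
    moreover have "integral {1..x} \<kappa> = integral {1..x} (\<lambda>_. 0)"
      by (rule Henstock_Kurzweil_Integration.integral_cong) (use ab in auto)
    ultimately show ?thesis using total by (simp add: \<psi>_def)
  qed
  have D: "(\<psi> has_real_derivative \<kappa> x) (at x)" for x
  proof (cases "x < a")
    case True
    have "((\<lambda>_. 0 :: real) has_real_derivative 0) (at x)" by simp
    then have "(\<psi> has_real_derivative 0) (at x)"
      by (rule has_field_derivative_transform_within_open[where S = "{..<a}"]) (use True z1 in auto)
    then show ?thesis using ab(3)[of x] True by simp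
  next
    case False
    then have "x > 0" using ab by simp
    have "(\<psi> has_real_derivative \<kappa> x) (at x within {0..x + 1})"
      unfolding \<psi>_def using \<open>x > 0\<close> by (intro integral_has_real_derivative test_function_continuous[OF \<kappa>]) auto
    then show ?thesis using \<open>x > 0\<close> by (subst (asm) at_within_Icc_at) auto
  qed
  then show deriv: "deriv \<psi> = \<kappa>" by (intro ext DERIV_imp_deriv)
  have "diff_upto n \<psi>" for n
  proof -
    have "diff_upto (Suc n) \<psi>" unfolding diff_upto_Suc deriv
      using \<kappa> D by (auto simp: test_function_iff field_differentiable_def)
    then show ?thesis by (rule diff_upto_mono)
  qed
  moreover have "\<forall>x. x \<notin> {a..b} \<longrightarrow> \<psi> x = 0" using z1 z2 by auto
  ultimately show "test_function \<psi>" unfolding test_function_iff using ab(1,2) by blast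
qed

lemma test_function_lincomb:
  assumes "test_function f" "test_function g"
  shows "test_function (\<lambda>x. f x + c * g x)"
proof -
  obtain a b where ab: "0 < a" "b < 1" "\<And>x. x \<notin> {a..b} \<Longrightarrow> f x = 0" using assms(1) unfolding test_function_iff by blast
  obtain a' b' where ab': "0 < a'" "b' < 1" "\<And>x. x \<notin> {a'..b'} \<Longrightarrow> g x = 0" using assms(2) unfolding test_function_iff by blast
  have "diff_upto n (\<lambda>x. f x + c * g x)" for n
    using assms by (intro diff_upto_add diff_upto_mult diff_upto_const) (auto simp: test_function_iff)
  moreover have "f x + c * g x = 0" if "x \<notin> {min a a'..max b b'}" for x
  proof -
    have "x \<notin> {a..b}" "x \<notin> {a'..b'}" using that by (auto simp: min_def max_def split: if_splits)
    then show ?thesis using ab(3) ab'(3) by simp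
  qed
  ultimately show ?thesis unfolding test_function_iff using ab ab' by (intro conjI allI exI[of _ "min a a'"] exI[of _ "max b b'"]) auto
qed

lemma inner_one_test: "test_function \<eta> \<Longrightarrow> inner one (l2_of \<eta>) = integral {0..1} \<eta>"
  using prim_continuous_fun[OF test_function_continuous, of \<eta> 1] by (simp add: prim_1 inner_commute)

text \<open>The lemma of du Bois-Reymond: after subtraction of \<open>vol (l2_of v)\<close> the weak
  derivative is 0, and any test function minus a suitable multiple of one fixed bump is the
  derivative of a test function; so the remainder pairs with test functions like a constant.\<close>

lemma weak_deriv_characterization:
  assumes "w \<in> L2" "v \<in> L2"
  shows "has_weak_deriv w v \<longleftrightarrow> (\<exists>c. l2_of w = c *\<^sub>R one + vol (l2_of v))"
proof
  assume "\<exists>c. l2_of w = c *\<^sub>R one + vol (l2_of v)"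
  then show "has_weak_deriv w v" unfolding has_weak_deriv_l2[OF assms] using inner_vol_deriv by auto
next
  assume weak: "has_weak_deriv w v"
  define y where "y = l2_of w - vol (l2_of v)"
  have y_orth: "inner y (l2_of (deriv \<psi>)) = 0" if "test_function \<psi>" for \<psi>
    using weak that inner_vol_deriv[OF that, of 0 "l2_of v"] unfolding has_weak_deriv_l2[OF assms]
    by (simp add: y_def inner_diff_left)
  define \<beta> where "\<beta> = bump 0 (1 / 4) (3 / 4)"
  have \<beta>: "test_function \<beta>" unfolding \<beta>_def by (rule test_function_bump) auto
  define I where "I = integral {0..1} \<beta>"
  have "I \<noteq> 0"
  proof
    assume "I = 0"
    then have "(\<beta> has_integral 0) {0..1}"
      using integrable_continuous_real[OF test_function_continuous[OF \<beta>]] unfolding I_def by (simp add: has_integral_integrable_integral)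
    then have "\<beta> (1 / 2) = 0"
      using has_integral_0_cbox_imp_0[of 0 1 \<beta> "1 / 2"] test_function_continuous[OF \<beta>, of "{0..1}"] bump_bounds
      by (auto simp: \<beta>_def)
    then show False by (simp add: \<beta>_def bump_def exp_flat_def)
  qed
  define c where "c = inner y (l2_of \<beta>) / I"
  have "y - c *\<^sub>R one = 0"
  proof (rule test_functions_total)
    fix \<eta> assume \<eta>: "test_function \<eta>"
    define s where "s = integral {0..1} \<eta> / I"
    have k: "test_function (\<lambda>x. \<eta> x + (- s) * \<beta> x)" by (rule test_function_lincomb[OF \<eta> \<beta>])
    have "integral {0..1} (\<lambda>x. \<eta> x + (- s) * \<beta> x) = integral {0..1} \<eta> + integral {0..1} (\<lambda>x. (- s) * \<beta> x)"
      by (intro Henstock_Kurzweil_Integration.integral_add integrable_continuous_real continuous_intros test_function_continuous \<eta> \<beta>)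
    also have "\<dots> = 0" using \<open>I \<noteq> 0\<close> by (simp add: s_def I_def)
    finally obtain \<psi> where \<psi>: "test_function \<psi>" "deriv \<psi> = (\<lambda>x. \<eta> x + (- s) * \<beta> x)"
      using test_function_primitive[OF k] by blast
    have "l2_of (deriv \<psi>) = l2_of \<eta> + (- s) *\<^sub>R l2_of \<beta>"
      unfolding \<psi>(2) by (subst l2_of_add) (auto intro!: test_function_L2 \<eta> \<beta> L2_scale L2_uminus simp: l2_of_scaleR[OF test_function_L2[OF \<beta>], of "- s", simplified])
    with y_orth[OF \<psi>(1)] have "inner y (l2_of \<eta>) = s * inner y (l2_of \<beta>)" by (simp add: inner_diff_right)
    moreover have "inner one (l2_of \<eta>) = s * I" using inner_one_test[OF \<eta>] \<open>I \<noteq> 0\<close> by (simp add: s_def)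
    ultimately show "inner (y - c *\<^sub>R one) (l2_of \<eta>) = 0" using \<open>I \<noteq> 0\<close> by (simp add: inner_diff_left c_def)
  qed
  then have "l2_of w = c *\<^sub>R one + vol (l2_of v)" by (simp add: y_def algebra_simps)
  then show "\<exists>c. l2_of w = c *\<^sub>R one + vol (l2_of v)" ..
qed

section \<open>The energy and its subdifferential\<close>

text \<open>Uniqueness of the weak derivative: if two candidates differ by x, then
  \<open>vol x\<close> is constant, so \<open>prim x\<close> is constant and equal to its value 0 at
  0.\<close>

lemma weak_deriv_eq:
  assumes "w \<in> L2" "l2_of w = c *\<^sub>R one + vol v"
  shows "w \<in> H1" "l2_of (weak_deriv w) = v"
proof -
  have "has_weak_deriv w (l2_fun v)"
    unfolding weak_deriv_characterization[OF assms(1) l2_fun_L2] using assms(2) by (auto simp: l2_of_fun)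
  then have ex: "\<exists>v. v \<in> L2 \<and> has_weak_deriv w v" using l2_fun_L2 by blast
  then show "w \<in> H1" using assms(1) by (auto simp: H1_def)
  have "weak_deriv w \<in> L2 \<and> has_weak_deriv w (weak_deriv w)"
    unfolding weak_deriv_def by (rule someI_ex[OF ex])
  then obtain d where "weak_deriv w \<in> L2" "l2_of w = d *\<^sub>R one + vol (l2_of (weak_deriv w))"
    using weak_deriv_characterization[OF assms(1)] by blast
  with assms(2) have eq: "vol (v - l2_of (weak_deriv w)) = (d - c) *\<^sub>R one"
    by (simp add: vol_diff algebra_simps)
  define x where "x = v - l2_of (weak_deriv w)"
  have ae: "AE t in unit_ivl. prim x t = d - c"
    using l2_fun_vol[of x] l2_fun_scaleR[of "d - c" one] l2_fun_one unfolding x_def eq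
    by eventually_elim simp
  have "prim x t = d - c" if "t \<in> {0..1}" for t
    by (rule AE_eq_continuous[OF prim_continuous continuous_on_const ae that])
  from this[of 0] this have "prim x t = 0" if "t \<in> {0..1}" for t using that by (simp add: prim_0)
  then have "x = 0" by (rule eq_0_if_prim_eq_0)
  then show "l2_of (weak_deriv w) = v" by (simp add: x_def)
qed

lemma H1_obtain:
  assumes "w \<in> H1"
  obtains c v where "l2_of w = c *\<^sub>R one + vol v"
proof -
  obtain v where "w \<in> L2" "v \<in> L2" "has_weak_deriv w v" using assms by (auto simp: H1_def)
  then show ?thesis using that unfolding weak_deriv_characterization[OF \<open>w \<in> L2\<close> \<open>v \<in> L2\<close>] by auto
qed

lemma dirichlet_eq:
  assumes "w \<in> L2" "l2_of w = c *\<^sub>R one + vol v"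
  shows "dirichlet w = 1 / 2 * (norm v)\<^sup>2"
proof -
  have "\<exists>v. v \<in> L2 \<and> has_weak_deriv w v" using weak_deriv_eq(1)[OF assms] by (auto simp: H1_def)
  then have "weak_deriv w \<in> L2 \<and> has_weak_deriv w (weak_deriv w)"
    unfolding weak_deriv_def by (rule someI_ex)
  then have "weak_deriv w \<in> L2" ..
  from inner_l2_of[OF this this] have "(norm v)\<^sup>2 = (\<integral>x. weak_deriv w x * weak_deriv w x \<partial>unit_ivl)"
    unfolding weak_deriv_eq(2)[OF assms] power2_norm_eq_inner l2_inner_def .
  then show ?thesis by (simp only: dirichlet_def power2_eq_square)
qed

text \<open>v is minus the weak derivative of the nonincreasing part. The mean zero condition fixes
  the constant of integration, so minimizing over decompositions becomes finding the element of
  least norm in a closed convex set.\<close>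

definition slopes :: "l2 \<Rightarrow> l2 set" where
  "slopes u = {v. u + vol v \<in> mono_cone \<and> vol v \<in> mono_cone}"

lemma nonincreasing_ae_iff: "nonincreasing_ae w \<longleftrightarrow> nondecreasing_ae (\<lambda>x. - w x)"
proof
  assume "nonincreasing_ae w"
  then obtain r where r: "antimono_on {0<..<1} r" "AE x in unit_ivl. w x = r x" by (auto simp: nonincreasing_ae_def)
  have "mono_on {0<..<1} (\<lambda>x. - r x)" using r(1) by (auto simp: monotone_on_def)
  moreover have "AE x in unit_ivl. - w x = - r x" using r(2) by eventually_elim simp
  ultimately show "nondecreasing_ae (\<lambda>x. - w x)" unfolding nondecreasing_ae_def by blast
next
  assume "nondecreasing_ae (\<lambda>x. - w x)"
  then obtain r where r: "mono_on {0<..<1} r" "AE x in unit_ivl. - w x = r x" by (auto simp: nondecreasing_ae_def)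
  have "antimono_on {0<..<1} (\<lambda>x. - r x)" using r(1) by (auto simp: monotone_on_def)
  moreover have "AE x in unit_ivl. w x = - r x" using r(2) by eventually_elim simp
  ultimately show "nonincreasing_ae w" unfolding nonincreasing_ae_def by blast
qed

lemma l2_of_uminus: "f \<in> L2 \<Longrightarrow> l2_of (\<lambda>x. - f x) = - l2_of f"
  using l2_of_scaleR[of f "-1"] by simp

lemma mono_cone_add_const: "u \<in> mono_cone \<Longrightarrow> u + c *\<^sub>R one \<in> mono_cone"
  by (intro mono_cone_add scaleR_one_mono_cone)

lemma decomps_imp_slope:
  assumes "w \<in> L2" "(w1, w2) \<in> decomps w"
  obtains v where "v \<in> slopes (l2_of w)" "dirichlet w2 = 1 / 2 * (norm v)\<^sup>2"
proof -
  have *: "w1 \<in> L2" "w2 \<in> H1" "nondecreasing_ae w1" "nonincreasing_ae w2" "AE x in unit_ivl. w x = w1 x + w2 x"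
    using assms(2) by (auto simp: decomps_def)
  have w2: "w2 \<in> L2" using *(2) by (simp add: H1_def)
  obtain c v where cv: "l2_of w2 = c *\<^sub>R one + vol v" using *(2) by (rule H1_obtain)
  have "l2_of w = l2_of (\<lambda>x. w1 x + w2 x)" using assms(1) * w2 by (subst l2_of_eq_iff) (auto intro: L2_add)
  then have w: "l2_of w = l2_of w1 + l2_of w2" using l2_of_add[OF *(1) w2] by simp
  have "l2_of w1 \<in> mono_cone" using * by (simp add: l2_of_mono_cone_iff)
  moreover have "l2_of w + vol (- v) = l2_of w1 + c *\<^sub>R one"
    using vol_scaleR[of "-1" v] by (simp add: w cv)
  ultimately have 1: "l2_of w + vol (- v) \<in> mono_cone" by (simp add: mono_cone_add_const)
  have "- l2_of w2 \<in> mono_cone"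
    using *(4) w2 unfolding nonincreasing_ae_iff
    by (simp add: l2_of_uminus[symmetric] l2_of_mono_cone_iff L2_uminus)
  moreover have "vol (- v) = - l2_of w2 + c *\<^sub>R one" using vol_scaleR[of "-1" v] by (simp add: cv)
  ultimately have 2: "vol (- v) \<in> mono_cone" using mono_cone_add_const by metis
  have "dirichlet w2 = 1 / 2 * (norm (- v))\<^sup>2" using dirichlet_eq[OF w2 cv] by simp
  with 1 2 show ?thesis using that by (simp add: slopes_def)
qed

lemma slope_imp_decomps:
  assumes "w \<in> L2" "v \<in> slopes (l2_of w)"
  obtains w1 w2 where "(w1, w2) \<in> decomps w" "dirichlet w2 = 1 / 2 * (norm v)\<^sup>2"
proof -
  \<comment> \<open>The mean of \<open>vol v\<close>, which gives the nonincreasing part mean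
    0.\<close>
  define c where "c = prim (vol v) 1"
  define u2 where "u2 = c *\<^sub>R one + vol (- v)"
  define w2 where "w2 = l2_fun u2"
  define w1 where "w1 = l2_fun (l2_of w - u2)"
  have vm: "vol (- v) = - vol v" using vol_scaleR[of "-1" v] by simp
  have L2: "w1 \<in> L2" "w2 \<in> L2" by (simp_all add: w1_def w2_def l2_fun_L2)
  have of2: "l2_of w2 = c *\<^sub>R one + vol (- v)" by (simp add: w2_def u2_def l2_of_fun)
  have H1: "w2 \<in> H1" by (rule weak_deriv_eq(1)[OF L2(2) of2])
  have D: "dirichlet w2 = 1 / 2 * (norm v)\<^sup>2" using dirichlet_eq[OF L2(2) of2] by simp
  have "l2_of w1 = (l2_of w + vol v) + (- c) *\<^sub>R one" by (simp add: w1_def u2_def l2_of_fun vm)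
  also have "\<dots> \<in> mono_cone" using assms(2) by (intro mono_cone_add_const) (simp add: slopes_def)
  finally have n1: "nondecreasing_ae w1" using L2(1) by (simp add: l2_of_mono_cone_iff)
  have "l2_of (\<lambda>x. - w2 x) = vol v + (- c) *\<^sub>R one" by (simp add: l2_of_uminus L2(2) of2 vm)
  also have "\<dots> \<in> mono_cone" using assms(2) by (intro mono_cone_add_const) (simp add: slopes_def)
  finally have n2: "nonincreasing_ae w2" unfolding nonincreasing_ae_iff
    using L2(2) by (simp add: l2_of_mono_cone_iff L2_uminus)
  have "(\<integral>x. w2 x \<partial>unit_ivl) = inner u2 one"
    unfolding one_def w2_def by (subst inner_l2_of_right) (auto intro: L2_const)
  also have "\<dots> = 0"
    using norm_one by (simp add: u2_def inner_diff_left vm c_def prim_1 norm_eq_1)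
  finally have mean: "(\<integral>x. w2 x \<partial>unit_ivl) = 0" .
  have "AE x in unit_ivl. w x = w1 x + w2 x"
    using l2_fun_diff[of "l2_of w" u2] l2_fun_of[OF assms(1)] unfolding w1_def w2_def by eventually_elim simp
  with L2 H1 n1 n2 mean have "(w1, w2) \<in> decomps w" by (simp add: decomps_def)
  with D show ?thesis using that by blast
qed

lemma vol_tendsto: "(f \<longlonglongrightarrow> l) \<Longrightarrow> (\<lambda>n. vol (f n)) \<longlonglongrightarrow> vol l"
proof -
  assume "f \<longlonglongrightarrow> l"
  then have "(\<lambda>n. norm (f n - l)) \<longlonglongrightarrow> 0" by (simp add: LIM_zero_iff tendsto_norm_zero_iff)
  then have "(\<lambda>n. vol (f n) - vol l) \<longlonglongrightarrow> 0"
    by (rule Lim_null_comparison[rotated]) (use norm_vol_le in \<open>auto simp flip: vol_diff\<close>)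
  then show ?thesis by (simp add: LIM_zero_iff)
qed

text \<open>The projection of 0; the set is closed because \<open>vol\<close> is continuous and the
  cone is closed.\<close>

lemma least_slope:
  assumes "slopes u \<noteq> {}"
  obtains v where "v \<in> slopes u" "\<And>q. q \<in> slopes u \<Longrightarrow> norm v \<le> norm q"
proof -
  have convex: "convex (slopes u)"
    unfolding convex_def
  proof (intro ballI allI impI)
    fix x y and a b :: real assume *: "x \<in> slopes u" "y \<in> slopes u" "0 \<le> a" "0 \<le> b" "a + b = 1"
    have "u + vol (a *\<^sub>R x + b *\<^sub>R y) = a *\<^sub>R (u + vol x) + b *\<^sub>R (u + vol y)"
      using *(5) by (simp add: vol_add vol_scaleR algebra_simps flip: scaleR_left_distrib)
    then show "a *\<^sub>R x + b *\<^sub>R y \<in> slopes u"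
      using * by (auto simp: slopes_def vol_add vol_scaleR intro!: mono_cone_add mono_cone_scaleR)
  qed
  have "closed (slopes u)"
    unfolding closed_sequential_limits
  proof (intro allI impI, elim conjE)
    fix f l assume f: "\<forall>n. f n \<in> slopes u" and lim: "f \<longlonglongrightarrow> l"
    have "(\<lambda>n. u + vol (f n)) \<longlonglongrightarrow> u + vol l" by (intro tendsto_intros vol_tendsto lim)
    then have "u + vol l \<in> mono_cone" by (rule closed_sequentially[OF closed_mono_cone, rotated]) (use f in \<open>auto simp: slopes_def\<close>)
    moreover have "vol l \<in> mono_cone"
      by (rule closed_sequentially[OF closed_mono_cone _ vol_tendsto[OF lim]]) (use f in \<open>auto simp: slopes_def\<close>)
    ultimately show "l \<in> slopes u" by (simp add: slopes_def)
  qed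
  then obtain v where v: "v \<in> slopes u" "\<And>q. q \<in> slopes u \<Longrightarrow> inner (0 - v) (q - v) \<le> 0"
    using hilbert_nearest_point[OF _ convex assms, of 0] by blast
  have "norm v \<le> norm q" if "q \<in> slopes u" for q
  proof -
    have "norm v * norm v \<le> inner v q" using v(2)[OF that] by (simp add: inner_diff_right power2_norm_eq_inner[symmetric] power2_eq_square)
    also have "\<dots> \<le> norm v * norm q" by (rule norm_cauchy_schwarz)
    finally show ?thesis by (cases "v = 0") auto
  qed
  with v(1) show ?thesis using that by blast
qed

lemma decomposable_iff: "w \<in> L2 \<Longrightarrow> w \<in> decomposable \<longleftrightarrow> slopes (l2_of w) \<noteq> {}"
proof
  assume w: "w \<in> L2" and "w \<in> decomposable"
  then obtain w1 w2 where "(w1, w2) \<in> decomps w" by (auto simp: decomposable_def)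
  then show "slopes (l2_of w) \<noteq> {}" by (rule decomps_imp_slope[OF w]) auto
next
  assume w: "w \<in> L2" and "slopes (l2_of w) \<noteq> {}"
  then obtain v where "v \<in> slopes (l2_of w)" by blast
  then show "w \<in> decomposable"
    by (rule slope_imp_decomps[OF w]) (use w in \<open>auto simp: decomposable_def\<close>)
qed

text \<open>The \<open>arg_min\<close> in \<open>opt_decomp\<close> denotes a minimizer only once
  one exists; it comes from the least slope.\<close>

lemma energy_minus_finite:
  assumes "w \<in> L2" "slopes (l2_of w) \<noteq> {}"
  shows "\<exists>v\<in>slopes (l2_of w). energy_minus w = ereal (1 / 2 * (norm v)\<^sup>2) \<and>
    (\<forall>q\<in>slopes (l2_of w). norm v \<le> norm q)"
proof -
  obtain v where v: "v \<in> slopes (l2_of w)" "\<And>q. q \<in> slopes (l2_of w) \<Longrightarrow> norm v \<le> norm q"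
    using least_slope[OF assms(2)] by blast
  define F where "F = (\<lambda>(w1 :: real \<Rightarrow> real, w2). dirichlet w2)"
  obtain w1 w2 where w12: "(w1, w2) \<in> decomps w" "dirichlet w2 = 1 / 2 * (norm v)\<^sup>2"
    using slope_imp_decomps[OF assms(1) v(1)] .
  have lower: "1 / 2 * (norm v)\<^sup>2 \<le> F p" if p_in: "p \<in> decomps w" for p
  proof -
    obtain p1 p2 where p: "p = (p1, p2)" by (cases p)
    with p_in have "(p1, p2) \<in> decomps w" by simp
    then obtain q where "q \<in> slopes (l2_of w)" "dirichlet p2 = 1 / 2 * (norm q)\<^sup>2"
      by (rule decomps_imp_slope[OF assms(1)])
    with v(2)[of q] show ?thesis by (simp add: F_def p power_mono)
  qed
  have "is_arg_min F (\<lambda>p. p \<in> decomps w) (w1, w2)"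
    unfolding is_arg_min_def using w12 lower by (force simp: F_def)
  then have "is_arg_min F (\<lambda>p. p \<in> decomps w) (opt_decomp w)"
    unfolding opt_decomp_def F_def[symmetric] arg_min_def by (rule someI)
  then have opt: "opt_decomp w \<in> decomps w" "\<not> F (w1, w2) < F (opt_decomp w)"
    using w12(1) unfolding is_arg_min_def by auto
  have "F (opt_decomp w) = 1 / 2 * (norm v)\<^sup>2"
    using opt(2) lower[OF opt(1)] w12(2) by (simp add: F_def)
  moreover have "F (opt_decomp w) = dirichlet (snd (opt_decomp w))" by (simp add: F_def case_prod_beta)
  ultimately have "energy_minus w = ereal (1 / 2 * (norm v)\<^sup>2)"
    using decomposable_iff[OF assms(1)] assms(2) by (simp add: energy_minus_def)
  with v show ?thesis by blast
qed

lemma vol_vol_mono_cone: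
  assumes "p \<in> polar"
  shows "vol (vol p) \<in> mono_cone"
proof -
  have "mono_on {0<..<1} (prim (vol p))"
  proof (rule mono_onI)
    fix x y :: real assume xy: "x \<in> {0<..<1}" "y \<in> {0<..<1}" "x \<le> y"
    have "0 * (y - x) \<le> prim (vol p) y - prim (vol p) x"
    proof (rule prim_diff_ge)
      show "AE t in unit_ivl. x < t \<and> t < y \<longrightarrow> 0 \<le> l2_fun (vol p) t"
        using l2_fun_vol[of p] by eventually_elim (simp add: polar_prim_nonneg[OF assms])
    qed (use xy in auto)
    then show "prim (vol p) x \<le> prim (vol p) y" by simp
  qed
  then show ?thesis unfolding vol_def[of "vol p"] by (intro l2_of_mono_coneI prim_L2)
qed

text \<open>The slope \<open>vol q\<close> is admissible for u, so the energy there is at most |vol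
  q|^2 / 2. For a competitor z with slope y, testing q gives <q,z> <= <vol q, y>, and Young's
  inequality together with <q,u> = |vol q|^2 closes the estimate.\<close>

lemma gen_imp_subdifferential:
  assumes "w \<in> L2" "p \<in> L2" "(l2_of w, l2_of p) \<in> gen"
  shows "p \<in> subdifferential energy_minus w"
proof -
  define u where "u = l2_of w"
  define q where "q = l2_of p"
  have uq: "(u, q) \<in> gen" using assms(3) by (simp add: u_def q_def)
  then have q: "q \<in> polar" and m: "u + vol (vol q) \<in> mono_cone" by (auto simp: gen_def)
  have s: "vol q \<in> slopes u" using m vol_vol_mono_cone[OF q] by (simp add: slopes_def)
  then have "slopes (l2_of w) \<noteq> {}" by (auto simp: u_def)
  then obtain v where "v \<in> slopes (l2_of w)" "energy_minus w = ereal (1 / 2 * (norm v)\<^sup>2)"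
    "\<And>q. q \<in> slopes (l2_of w) \<Longrightarrow> norm v \<le> norm q"
    using energy_minus_finite[OF assms(1)] by metis
  with s have v: "energy_minus w = ereal (1 / 2 * (norm v)\<^sup>2)" "norm v \<le> norm (vol q)" by (auto simp: u_def)
  have "energy_minus w + ereal (l2_inner p (\<lambda>x. z x - w x)) \<le> energy_minus z" if z: "z \<in> L2" for z
  proof (cases "slopes (l2_of z) = {}")
    case True
    then have "energy_minus z = \<infinity>" using decomposable_iff[OF z] by (simp add: energy_minus_def)
    then show ?thesis by simp
  next
    case False
    obtain y where y: "y \<in> slopes (l2_of z)" "energy_minus z = ereal (1 / 2 * (norm y)\<^sup>2)"
      using energy_minus_finite[OF z False] by metis
    have "l2_inner p (\<lambda>x. z x - w x) = inner q (l2_of z) - inner q u"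
      using inner_l2_of[OF assms(2) L2_diff[OF z assms(1)]]
      by (simp add: l2_of_diff[OF z assms(1)] u_def q_def inner_diff_right)
    moreover have "inner q (l2_of z) \<le> inner (vol q) y"
      using inner_polar_le[OF q, of "l2_of z + vol y"] y(1) polar_vol[OF q, of y]
      by (simp add: slopes_def inner_add_right)
    moreover have "2 * inner (vol q) y \<le> (norm (vol q))\<^sup>2 + (norm y)\<^sup>2"
      using norm_cauchy_schwarz[of "vol q" y] sum_squares_bound[of "norm (vol q)" "norm y"] by simp
    moreover have "(norm v)\<^sup>2 \<le> (norm (vol q))\<^sup>2" using v(2) by (simp add: power_mono)
    ultimately have "1 / 2 * (norm v)\<^sup>2 + l2_inner p (\<lambda>x. z x - w x) \<le> 1 / 2 * (norm y)\<^sup>2"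
      using gen_inner[OF uq] by linarith
    then show ?thesis by (simp add: v y)
  qed
  then show ?thesis using assms v(1) by (simp add: subdifferential_def)
qed

text \<open>Adding two subgradient inequalities shows that any subgradient is monotone against all
  pairs of \<open>gen\<close>; maximality puts it into \<open>gen\<close>.\<close>

lemma subdifferential_iff_gen:
  assumes "w \<in> L2" "p \<in> L2"
  shows "p \<in> subdifferential energy_minus w \<longleftrightarrow> (l2_of w, l2_of p) \<in> gen"
proof
  assume sub: "p \<in> subdifferential energy_minus w"
  show "(l2_of w, l2_of p) \<in> gen"
  proof (rule gen.maximal)
    fix v q assume vq: "(v, q) \<in> gen"
    have L2: "l2_fun v \<in> L2" "l2_fun q \<in> L2" by (rule l2_fun_L2)+
    have sub': "l2_fun q \<in> subdifferential energy_minus (l2_fun v)"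
      by (rule gen_imp_subdifferential[OF L2]) (simp add: l2_of_fun vq)
    obtain a where a: "energy_minus w = ereal a" using sub by (cases "energy_minus w") (auto simp: subdifferential_def)
    obtain b where b: "energy_minus (l2_fun v) = ereal b"
      using sub' by (cases "energy_minus (l2_fun v)") (auto simp: subdifferential_def)
    have "energy_minus w + ereal (l2_inner p (\<lambda>x. l2_fun v x - w x)) \<le> energy_minus (l2_fun v)"
      "energy_minus (l2_fun v) + ereal (l2_inner (l2_fun q) (\<lambda>x. w x - l2_fun v x)) \<le> energy_minus w"
      using sub sub' assms(1) L2 by (auto simp: subdifferential_def)
    then have "l2_inner p (\<lambda>x. l2_fun v x - w x) + l2_inner (l2_fun q) (\<lambda>x. w x - l2_fun v x) \<le> 0"
      by (simp add: a b)
    moreover have "l2_inner p (\<lambda>x. l2_fun v x - w x) = inner (l2_of p) (v - l2_of w)"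
      using inner_l2_of[OF assms(2) L2_diff[OF L2(1) assms(1)]] by (simp add: l2_of_diff[OF L2(1) assms(1)] l2_of_fun)
    moreover have "l2_inner (l2_fun q) (\<lambda>x. w x - l2_fun v x) = inner q (l2_of w - v)"
      using inner_l2_of[OF L2(2) L2_diff[OF assms(1) L2(1)]] by (simp add: l2_of_diff[OF assms(1) L2(1)] l2_of_fun)
    ultimately show "0 \<le> inner (l2_of p - q) (l2_of w - v)"
      by (simp add: inner_diff_left inner_diff_right)
  qed
qed (rule gen_imp_subdifferential[OF assms])

section \<open>The flow and its limit\<close>

lemma has_l2_deriv_iff:
  assumes "\<And>s. u s \<in> L2" "p \<in> L2"
  shows "has_l2_deriv u p t \<longleftrightarrow>
    ((\<lambda>h. (1 / h) *\<^sub>R (l2_of (u (t + h)) - l2_of (u t))) \<longlongrightarrow> l2_of p) (at 0)"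
proof -
  have "l2_dist (\<lambda>x. (u (t + h) x - u t x) / h) p = norm ((1 / h) *\<^sub>R (l2_of (u (t + h)) - l2_of (u t)) - l2_of p)" for h
  proof -
    have d: "(\<lambda>x. u (t + h) x - u t x) \<in> L2" by (intro L2_diff assms)
    have "(\<lambda>x. (u (t + h) x - u t x) / h) = (\<lambda>x. (1 / h) * (u (t + h) x - u t x))" by (simp add: divide_inverse mult.commute)
    then show ?thesis
      using l2_dist_eq[OF L2_scale[OF d, of "1 / h"] assms(2)]
      by (simp only: l2_of_scaleR[OF d] l2_of_diff[OF assms(1) assms(1)])
  qed
  then show ?thesis using assms(2) unfolding has_l2_deriv_def
    by (simp only: tendsto_norm_zero_iff LIM_zero_iff simp_thms)
qed

text \<open>Existence is what gives content to the choice in \<open>flow\<close>.\<close>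

lemma generated_semigroup_exists: "generated_semigroup energy_minus (\<lambda>t w. l2_fun (gen.S t (l2_of w)))"
  unfolding generated_semigroup_def
proof (intro conjI ballI allI impI)
  fix w assume w: "w \<in> L2"
  show "l2_fun (gen.S t (l2_of w)) \<in> L2" for t by (rule l2_fun_L2)
  show "AE x in unit_ivl. l2_fun (gen.S 0 (l2_of w)) x = w x"
    using l2_fun_of[OF w] by (simp add: gen.S_0)
  show "l2_dist (l2_fun (gen.S t (l2_of v))) (l2_fun (gen.S t (l2_of w))) \<le> l2_dist v w" if "t \<ge> 0" "v \<in> L2" for t v
    using gen.S_nonexpansive[OF that(1)] by (simp add: l2_dist_eq l2_fun_L2 l2_of_fun that w)
  show "AE x in unit_ivl. l2_fun (gen.S (s + t) (l2_of w)) x = l2_fun (gen.S s (l2_of (l2_fun (gen.S t (l2_of w))))) x"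
    if "s \<ge> 0" "t \<ge> 0" for s t by (simp add: l2_of_fun gen.S_add[OF that])
  show "((\<lambda>s. l2_dist (l2_fun (gen.S s (l2_of w))) (l2_fun (gen.S t (l2_of w)))) \<longlongrightarrow> 0) (at t within {0..})"
    if "t \<ge> 0" for t using gen.S_continuous[OF that, of "l2_of w"] by (simp add: l2_dist_eq l2_fun_L2 l2_of_fun)
  assume "subdifferential energy_minus w \<noteq> {}"
  then obtain p where p: "p \<in> subdifferential energy_minus w" by blast
  then have "p \<in> L2" by (simp add: subdifferential_def)
  with p w have wp: "(l2_of w, l2_of p) \<in> gen" by (simp add: subdifferential_iff_gen)
  show "\<exists>L. \<forall>s\<ge>0. \<forall>t\<ge>0. l2_dist (l2_fun (gen.S s (l2_of w))) (l2_fun (gen.S t (l2_of w))) \<le> L * \<bar>s - t\<bar>"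
    using gen.S_lipschitz[OF wp] by (intro exI[of _ "norm (l2_of p)"]) (simp add: l2_dist_eq l2_fun_L2 l2_of_fun)
  obtain N where N: "countable N" "\<And>t. t > 0 \<Longrightarrow> t \<notin> N \<Longrightarrow>
      ((\<lambda>h. (1 / h) *\<^sub>R (gen.S (t + h) (l2_of w) - gen.S t (l2_of w))) \<longlongrightarrow> - gen.least (gen.S t (l2_of w))) (at 0)"
    using gen.S_differentiable[OF wp] by blast
  have "AE t in lebesgue. t \<notin> N"
    using countable_imp_null_set_lborel[OF N(1)] by (intro AE_not_in null_sets_completionI)
  then show "AE t in lebesgue. t > 0 \<longrightarrow>
      (\<exists>p. has_l2_deriv (\<lambda>s. l2_fun (gen.S s (l2_of w))) p t \<and>
        (\<lambda>x. - p x) \<in> subdifferential energy_minus (l2_fun (gen.S t (l2_of w))))"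
  proof eventually_elim
    case (elim t)
    show ?case
    proof
      assume t: "t > 0"
      define q where "q = gen.least (gen.S t (l2_of w))"
      define p where "p = l2_fun (- q)"
      have "has_l2_deriv (\<lambda>s. l2_fun (gen.S s (l2_of w))) p t"
        using N(2)[OF t elim] unfolding p_def by (subst has_l2_deriv_iff) (auto simp: l2_fun_L2 l2_of_fun q_def)
      moreover have "(\<lambda>x. - p x) \<in> subdifferential energy_minus (l2_fun (gen.S t (l2_of w)))"
        using gen.S_domain(1)[OF wp, of t] t
        by (subst subdifferential_iff_gen) (auto simp: l2_fun_L2 L2_uminus l2_of_uminus l2_of_fun p_def q_def)
      ultimately show "\<exists>p. has_l2_deriv (\<lambda>s. l2_fun (gen.S s (l2_of w))) p t \<and>
        (\<lambda>x. - p x) \<in> subdifferential energy_minus (l2_fun (gen.S t (l2_of w)))" by blast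
    qed
  qed
qed

text \<open>The semigroup axioms transfer to the quotient, where
  \<open>subdifferential_iff_gen\<close> and the uniqueness theorem for \<open>gen\<close> identify
  the chosen flow.\<close>

lemma flow_eq:
  assumes "w \<in> L2" "t \<ge> 0"
  shows "flow t w \<in> L2" "l2_of (flow t w) = gen.S t (l2_of w)"
proof -
  have gs: "generated_semigroup energy_minus flow"
    unfolding flow_def using someI[of "generated_semigroup energy_minus", OF generated_semigroup_exists] .
  have flow_L2: "flow t w \<in> L2" if "t \<ge> 0" "w \<in> L2" for t w
  proof -
    have "\<forall>t\<ge>0. \<forall>w\<in>L2. flow t w \<in> L2"
      using gs unfolding generated_semigroup_def by (elim conjE) assumption
    with that show ?thesis by blast
  qed
  have flow_nonexp: "norm (l2_of (flow t v) - l2_of (flow t w)) \<le> norm (l2_of v - l2_of w)"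
    if "t \<ge> 0" "v \<in> L2" "w \<in> L2" for t v w
  proof -
    have "\<forall>t\<ge>0. \<forall>v\<in>L2. \<forall>w\<in>L2. l2_dist (flow t v) (flow t w) \<le> l2_dist v w"
      using gs unfolding generated_semigroup_def by (elim conjE) assumption
    with that have "l2_dist (flow t v) (flow t w) \<le> l2_dist v w" by blast
    then show ?thesis by (simp add: l2_dist_eq flow_L2 that)
  qed
  show "flow t w \<in> L2" by (rule flow_L2[OF assms(2,1)])
  \<comment> \<open>Nothing is known of the flow at negative times, hence the default 0; derivatives
    at positive times look at small increments and do not see it.\<close>
  define T where "T t u = (if t \<ge> 0 then l2_of (flow t (l2_fun u)) else 0)" for t u
  have T: "T t (l2_of w) = gen.S t (l2_of w)"
  proof (rule gen.S_unique[where T = T])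
    show "norm (T t x - T t y) \<le> norm (x - y)" if "t \<ge> 0" for t x y
      using flow_nonexp[OF that l2_fun_L2 l2_fun_L2, of x y] that by (simp add: T_def l2_of_fun)
    show "T 0 w = w" for w
    proof -
      have "\<forall>w\<in>L2. AE x in unit_ivl. flow 0 w x = w x"
        using gs unfolding generated_semigroup_def by (elim conjE) assumption
      then have "AE x in unit_ivl. flow 0 (l2_fun w) x = l2_fun w x" using l2_fun_L2 by blast
      then have "l2_of (flow 0 (l2_fun w)) = l2_of (l2_fun w)"
        by (subst l2_of_eq_iff) (auto intro: flow_L2 l2_fun_L2)
      then show ?thesis by (simp add: T_def l2_of_fun)
    qed
    fix w p assume wp: "(w, p) \<in> gen"
    then have "l2_fun p \<in> subdifferential energy_minus (l2_fun w)"
      by (subst subdifferential_iff_gen) (auto simp: l2_fun_L2 l2_of_fun)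
    then have *: "\<exists>L. \<forall>s\<ge>0. \<forall>t\<ge>0. l2_dist (flow s (l2_fun w)) (flow t (l2_fun w)) \<le> L * \<bar>s - t\<bar>"
      "AE t in lebesgue. t > 0 \<longrightarrow> (\<exists>p. has_l2_deriv (\<lambda>s. flow s (l2_fun w)) p t \<and>
         (\<lambda>x. - p x) \<in> subdifferential energy_minus (flow t (l2_fun w)))"
    proof -
      have "\<forall>w\<in>L2. subdifferential energy_minus w \<noteq> {} \<longrightarrow>
        (\<exists>L. \<forall>s\<ge>0. \<forall>t\<ge>0. l2_dist (flow s w) (flow t w) \<le> L * \<bar>s - t\<bar>) \<and>
        (AE t in lebesgue. t > 0 \<longrightarrow>
           (\<exists>p. has_l2_deriv (\<lambda>s. flow s w) p t \<and> (\<lambda>x. - p x) \<in> subdifferential energy_minus (flow t w)))"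
        using gs unfolding generated_semigroup_def by (elim conjE) assumption
      moreover assume "l2_fun p \<in> subdifferential energy_minus (l2_fun w)"
      ultimately show "\<exists>L. \<forall>s\<ge>0. \<forall>t\<ge>0. l2_dist (flow s (l2_fun w)) (flow t (l2_fun w)) \<le> L * \<bar>s - t\<bar>"
        "AE t in lebesgue. t > 0 \<longrightarrow> (\<exists>p. has_l2_deriv (\<lambda>s. flow s (l2_fun w)) p t \<and>
         (\<lambda>x. - p x) \<in> subdifferential energy_minus (flow t (l2_fun w)))"
        using l2_fun_L2[of w] by auto
    qed
    show "\<exists>L. \<forall>s\<ge>0. \<forall>t\<ge>0. norm (T s w - T t w) \<le> L * \<bar>s - t\<bar>"
      using *(1) by (auto simp: T_def l2_dist_eq flow_L2 l2_fun_L2)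
    show "AE t in lebesgue. t > 0 \<longrightarrow>
      (\<exists>q. ((\<lambda>h. (1 / h) *\<^sub>R (T (t + h) w - T t w)) \<longlongrightarrow> - q) (at 0) \<and> (T t w, q) \<in> gen)"
      using *(2)
    proof eventually_elim
      case (elim t)
      show ?case
      proof
        assume t: "t > 0"
        then obtain p where p: "has_l2_deriv (\<lambda>s. flow s (l2_fun w)) p t"
          "(\<lambda>x. - p x) \<in> subdifferential energy_minus (flow t (l2_fun w))" using elim by blast
        have p_L2: "p \<in> L2" using p(1) by (simp add: has_l2_deriv_def)
        have gen: "(T t w, - l2_of p) \<in> gen"
          using p(2) t by (subst (asm) subdifferential_iff_gen)
            (auto simp: flow_L2 l2_fun_L2 L2_uminus p_L2 l2_of_uminus T_def)
        have "((\<lambda>h. l2_dist (\<lambda>x. (flow (t + h) (l2_fun w) x - flow t (l2_fun w) x) / h) p) \<longlongrightarrow> 0) (at 0)"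
          using p(1) by (simp add: has_l2_deriv_def)
        moreover have "\<forall>\<^sub>F h in at 0. l2_dist (\<lambda>x. (flow (t + h) (l2_fun w) x - flow t (l2_fun w) x) / h) p
            = norm ((1 / h) *\<^sub>R (T (t + h) w - T t w) - l2_of p)"
        proof -
          have "((\<lambda>h. t + h) \<longlongrightarrow> t + 0) (at 0)" by (intro tendsto_intros)
          then have "\<forall>\<^sub>F h in at 0. 0 < t + h" by (rule order_tendstoD) (use t in simp)
          then show ?thesis
          proof eventually_elim
            case (elim h)
            have L2: "flow (t + h) (l2_fun w) \<in> L2" "flow t (l2_fun w) \<in> L2" using elim t by (auto intro: flow_L2 l2_fun_L2)
            have d: "(\<lambda>x. flow (t + h) (l2_fun w) x - flow t (l2_fun w) x) \<in> L2" by (intro L2_diff L2)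
            have "(\<lambda>x. (flow (t + h) (l2_fun w) x - flow t (l2_fun w) x) / h)
                = (\<lambda>x. (1 / h) * (flow (t + h) (l2_fun w) x - flow t (l2_fun w) x))" by (simp add: divide_inverse mult.commute)
            then show ?case
              using l2_dist_eq[OF L2_scale[OF d, of "1 / h"] p_L2] elim t
              by (simp only: l2_of_scaleR[OF d] l2_of_diff[OF L2] T_def less_imp_le if_True)
          qed
        qed
        ultimately have "((\<lambda>h. norm ((1 / h) *\<^sub>R (T (t + h) w - T t w) - l2_of p)) \<longlongrightarrow> 0) (at 0)"
          by (rule Lim_transform_eventually)
        then have "((\<lambda>h. (1 / h) *\<^sub>R (T (t + h) w - T t w)) \<longlongrightarrow> - (- l2_of p)) (at 0)"
          by (simp only: tendsto_norm_zero_iff LIM_zero_iff minus_minus)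
        with gen show "\<exists>q. ((\<lambda>h. (1 / h) *\<^sub>R (T (t + h) w - T t w)) \<longlongrightarrow> - q) (at 0) \<and> (T t w, q) \<in> gen" by blast
      qed
    qed
  qed (rule assms(2))
  \<comment> \<open>\<open>flow\<close> acts on functions, not classes: equivalent arguments have
    distance 0, so nonexpansiveness makes their images equivalent.\<close>
  have "norm (l2_of (flow t w) - l2_of (flow t (l2_fun (l2_of w)))) \<le> 0"
    using flow_nonexp[OF assms(2) assms(1) l2_fun_L2, of "l2_of w"] by (simp add: l2_of_fun)
  with T assms(2) show "l2_of (flow t w) = gen.S t (l2_of w)" by (simp add: T_def)
qed

lemma flow_limit_eq:
  assumes "w \<in> L2"
  shows "flow_limit w \<in> L2" "l2_of (flow_limit w) = iso (l2_of w)"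
proof -
  have conv: "((\<lambda>t. l2_dist (flow t w) v) \<longlongrightarrow> 0) at_top \<longleftrightarrow> l2_of v = iso (l2_of w)" if v: "v \<in> L2" for v
  proof -
    have "((\<lambda>t. l2_dist (flow t w) v) \<longlongrightarrow> 0) at_top \<longleftrightarrow> ((\<lambda>t. norm (gen.S t (l2_of w) - l2_of v)) \<longlongrightarrow> 0) at_top"
      by (rule tendsto_cong, rule eventually_mono[OF eventually_ge_at_top[of 0]])
         (simp add: l2_dist_eq flow_eq assms v)
    also have "\<dots> \<longleftrightarrow> ((\<lambda>t. gen.S t (l2_of w)) \<longlongrightarrow> l2_of v) at_top"
      by (simp only: tendsto_norm_zero_iff LIM_zero_iff)
    also have "\<dots> \<longleftrightarrow> l2_of v = iso (l2_of w)"
      using S_gen_tendsto_iso[of "l2_of w"] tendsto_unique[OF trivial_limit_at_top_linorder] by metis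
    finally show ?thesis .
  qed
  have "\<exists>v. v \<in> L2 \<and> ((\<lambda>t. l2_dist (flow t w) v) \<longlongrightarrow> 0) at_top"
    using conv[OF l2_fun_L2, of "iso (l2_of w)"] l2_fun_L2 l2_of_fun by blast
  then have "flow_limit w \<in> L2 \<and> ((\<lambda>t. l2_dist (flow t w) (flow_limit w)) \<longlongrightarrow> 0) at_top"
    unfolding flow_limit_def by (rule someI_ex)
  then show "flow_limit w \<in> L2" "l2_of (flow_limit w) = iso (l2_of w)" using conv by auto
qed

section \<open>Isotonic regression of Lipschitz functions\<close>

definition lip01 :: "real \<Rightarrow> (real \<Rightarrow> real) \<Rightarrow> bool" where
  "lip01 L w \<longleftrightarrow> (\<forall>x\<in>{0..1}. \<forall>y\<in>{0..1}. \<bar>w x - w y\<bar> \<le> L * \<bar>x - y\<bar>)"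

lemma lip01D: "lip01 L w \<Longrightarrow> x \<in> {0..1} \<Longrightarrow> y \<in> {0..1} \<Longrightarrow> \<bar>w x - w y\<bar> \<le> L * \<bar>x - y\<bar>"
  by (simp add: lip01_def)

lemma lip01_nonneg: "lip01 L w \<Longrightarrow> 0 \<le> L"
  using lip01D[of L w 0 1] by simp

lemma lip01_continuous: "lip01 L w \<Longrightarrow> continuous_on {0..1} w"
  by (rule lipschitz_on_continuous_on[of L]) (auto simp: lipschitz_on_def lip01_nonneg dist_real_def dest: lip01D)

lemma lip01_L2: "lip01 L w \<Longrightarrow> w \<in> L2"
  by (rule continuous_on_unit_L2[OF lip01_continuous])

lemma positive_component:
  assumes cont: "continuous_on {0..1} (T :: real \<Rightarrow> real)" and "T 0 = 0" "T 1 = 0"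
    and nonneg: "\<And>x. x \<in> {0..1} \<Longrightarrow> 0 \<le> T x" and x0: "x0 \<in> {0..1}" "0 < T x0"
  obtains a b where "0 \<le> a" "a < x0" "x0 < b" "b \<le> 1" "T a = 0" "T b = 0" "\<And>x. a < x \<Longrightarrow> x < b \<Longrightarrow> 0 < T x"
proof -
  define L where "L = {x \<in> {0..x0}. T x \<le> 0}"
  define R where "R = {x \<in> {x0..1}. T x \<le> 0}"
  have cl: "closed L" "closed R"
  proof -
    have "continuous_on {0..x0} T" "continuous_on {x0..1} T"
      using x0 by (auto intro: continuous_on_subset[OF cont])
    then show "closed L" "closed R"
      using continuous_closed_preimage[of "{0..x0}" T "{..0}"] continuous_closed_preimage[of "{x0..1}" T "{..0}"]
      by (auto simp: L_def R_def vimage_def Int_def)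
  qed
  have ne: "0 \<in> L" "1 \<in> R" using assms by (auto simp: L_def R_def)
  have bd: "bdd_above L" "bdd_below R" by (auto simp: L_def R_def bdd_above_def bdd_below_def)
  define a where "a = Sup L"
  define b where "b = Inf R"
  have "a \<in> L" unfolding a_def using cl ne bd by (intro closed_contains_Sup) auto
  have "b \<in> R" unfolding b_def using cl ne bd by (intro closed_contains_Inf) auto
  have ab: "0 \<le> a" "a < x0" "x0 < b" "b \<le> 1"
    using \<open>a \<in> L\<close> \<open>b \<in> R\<close> x0 by (auto simp: L_def R_def less_le)
  have "T a = 0" "T b = 0"
    using \<open>a \<in> L\<close> \<open>b \<in> R\<close> nonneg[of a] nonneg[of b] ab x0 by (auto simp: L_def R_def)
  moreover have "0 < T x" if "a < x" "x < b" for x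
  proof (rule ccontr)
    assume "\<not> 0 < T x"
    then have "x \<in> L \<or> x \<in> R" using that ab by (auto simp: L_def R_def)
    then show False using cSup_upper[OF _ bd(1), of x] cInf_lower[OF _ bd(2), of x] that by (auto simp: a_def b_def)
  qed
  ultimately show ?thesis using that ab by blast
qed

text \<open>Let T be the primitive of w - iso w, nonnegative and 0 at both ends. Each z lies in an
  interval [a, b] between zeros of T, reduced to a point if T z = 0, inside which r is constant, and
  w b <= r z <= w a. For x < y either both share a constancy interval, or the end points b1 and a2
  separate them and the Lipschitz bound of w applies there.\<close>

lemma iso_lipschitz:
  assumes lip: "lip01 L w" and r: "mono_on {0<..<1} r" "AE x in unit_ivl. l2_fun (iso (l2_of w)) x = r x"
    and xy: "0 < x" "x < y" "y < 1"
  shows "r y - r x \<le> L * (y - x)"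
proof -
  define q where "q = l2_of w - iso (l2_of w)"
  define T where "T = prim q"
  note w_L2 = lip01_L2[OF lip]
  note L0 = lip01_nonneg[OF lip]
  have q: "q \<in> polar" unfolding q_def by (rule iso_polar)
  have T: "continuous_on {0..1} T" "T 0 = 0" "T 1 = 0" "\<And>x. 0 \<le> T x"
    unfolding T_def using prim_continuous prim_0 polar_prim_1[OF q] polar_prim_nonneg[OF q] by auto
  have q_eq: "AE t in unit_ivl. l2_fun q t = w t - r t"
    using l2_fun_diff[of "l2_of w" "iso (l2_of w)"] l2_fun_of[OF w_L2] r(2)
    unfolding q_def by eventually_elim simp
  \<comment> \<open>Otherwise the density w - r would be at most -e on (a, a + e), and T, which
    vanishes at a, would become negative. Of the margin (2L + 1) e, one L e absorbs the variation of
    w and the rest is at least e.\<close>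
  have right: "\<exists>t. a < t \<and> t < a + e \<and> r t \<le> w a + (2 * L + 1) * e"
    if a: "0 \<le> a" "T a = 0" and e: "0 < e" "a + e \<le> 1" for a e
  proof (rule ccontr)
    assume neg: "\<not> ?thesis"
    have "T (a + e) - T a \<le> (- e) * (a + e - a)"
      unfolding T_def
    proof (rule prim_diff_le)
      show "AE t in unit_ivl. a < t \<and> t < a + e \<longrightarrow> l2_fun q t \<le> - e"
        using q_eq
      proof eventually_elim
        case (elim t)
        show ?case
        proof
          assume t: "a < t \<and> t < a + e"
          then have "r t > w a + (2 * L + 1) * e" using neg by (auto simp: not_le)
          moreover have "w t - w a \<le> L * e"
          proof -
            have "w t - w a \<le> L * \<bar>t - a\<bar>" using lip01D[OF lip, of t a] t a e by auto
            also have "\<dots> \<le> L * e" using t L0 by (intro mult_left_mono) auto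
            finally show ?thesis .
          qed
          moreover have "0 \<le> L * e" using L0 e by simp
          moreover have "(2 * L + 1) * e = 2 * (L * e) + e" by (simp add: algebra_simps)
          ultimately show "l2_fun q t \<le> - e" using elim by linarith
        qed
      qed
    qed (use a e in auto)
    then have "T (a + e) \<le> - (e * e)" using a by simp
    then have "T (a + e) < 0" using mult_pos_pos[OF e(1) e(1)] by linarith
    then show False using T(4)[of "a + e"] by simp
  qed
  have left: "\<exists>t. b - e < t \<and> t < b \<and> w b - (2 * L + 1) * e \<le> r t"
    if b: "b \<le> 1" "T b = 0" and e: "0 < e" "0 \<le> b - e" for b e
  proof (rule ccontr)
    assume neg: "\<not> ?thesis"
    have "e * (b - (b - e)) \<le> T b - T (b - e)"
      unfolding T_def
    proof (rule prim_diff_ge)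
      show "AE t in unit_ivl. b - e < t \<and> t < b \<longrightarrow> e \<le> l2_fun q t"
        using q_eq
      proof eventually_elim
        case (elim t)
        show ?case
        proof
          assume t: "b - e < t \<and> t < b"
          then have "r t < w b - (2 * L + 1) * e" using neg by (auto simp: not_le)
          moreover have "w b - w t \<le> L * e"
          proof -
            have "w b - w t \<le> L * \<bar>b - t\<bar>" using lip01D[OF lip, of b t] t b e by auto
            also have "\<dots> \<le> L * e" using t L0 by (intro mult_left_mono) auto
            finally show ?thesis .
          qed
          moreover have "0 \<le> L * e" using L0 e by simp
          moreover have "(2 * L + 1) * e = 2 * (L * e) + e" by (simp add: algebra_simps)
          ultimately show "e \<le> l2_fun q t" using elim by linarith
        qed
      qed
    qed (use b e in auto)
    then have "T (b - e) \<le> - (e * e)" using b by simp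
    then have "T (b - e) < 0" using mult_pos_pos[OF e(1) e(1)] by linarith
    then show False using T(4)[of "b - e"] by simp
  qed
  have comp: "\<exists>a b. 0 \<le> a \<and> a \<le> z \<and> z \<le> b \<and> b \<le> 1 \<and> T a = 0 \<and> T b = 0 \<and>
      (\<forall>t. a < t \<and> t < b \<longrightarrow> 0 < T t \<and> r t = r z) \<and> (T z = 0 \<longrightarrow> a = z \<and> b = z) \<and> (T z \<noteq> 0 \<longrightarrow> a < z \<and> z < b) \<and>
      w b \<le> r z \<and> r z \<le> w a" if z: "0 < z" "z < 1" for z
  proof -
    obtain a b where ab: "0 \<le> a" "a \<le> z" "z \<le> b" "b \<le> 1" "T a = 0" "T b = 0"
      "\<And>t. a < t \<Longrightarrow> t < b \<Longrightarrow> 0 < T t" "T z = 0 \<Longrightarrow> a = z \<and> b = z" "T z \<noteq> 0 \<Longrightarrow> a < z \<and> z < b"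
    proof (cases "T z = 0")
      case True
      then show ?thesis using that[of z z] z by auto
    next
      case False
      then have "0 < T z" using T(4)[of z] by simp
      then obtain a b where "0 \<le> a" "a < z" "z < b" "b \<le> 1" "T a = 0" "T b = 0" "\<And>x. a < x \<Longrightarrow> x < b \<Longrightarrow> 0 < T x"
        using positive_component[OF T(1,2,3) T(4), of z] z by auto
      then show ?thesis using that[of a b] False by auto
    qed
    have const: "r t = r z" if t: "a < t" "t < b" for t
    proof (cases "T z = 0")
      case True
      then show ?thesis using ab(8) t by auto
    next
      case False
      have c: "r s = r u" if "a < s" "s \<le> u" "u < b" for s u
        by (rule constant_where_prim_pos[OF q iso_mono_cone _ r ab(1,4) _ that])
           (use iso_orthogonal ab(7) in \<open>auto simp: q_def T_def\<close>)
      show ?thesis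
      proof (cases "t \<le> z")
        case True
        show ?thesis by (rule c[OF t(1) True]) (use ab(9)[OF False] in simp)
      next
        case False
        then have "r z = r t" by (intro c t) (use ab(9)[OF \<open>T z \<noteq> 0\<close>] in simp_all)
        then show ?thesis by simp
      qed
    qed
    have upper: "r z \<le> w a"
    proof (rule field_le_epsilon)
      fix \<epsilon> :: real assume "\<epsilon> > 0"
      define e where "e = min ((1 - a)) (\<epsilon> / (2 * L + 1))"
      have "a < 1" using ab(2) z(2) by simp
      then have e: "0 < e" "a + e \<le> 1" using \<open>\<epsilon> > 0\<close> L0 by (simp_all add: e_def)
      have "(2 * L + 1) * e \<le> (2 * L + 1) * (\<epsilon> / (2 * L + 1))" using L0 by (intro mult_left_mono) (simp_all add: e_def)
      also have "\<dots> = \<epsilon>" using L0 by simp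
      finally have e_le: "(2 * L + 1) * e \<le> \<epsilon>" .
      obtain t where t: "a < t" "t < a + e" "r t \<le> w a + (2 * L + 1) * e" using right[OF ab(1,5) e] by blast
      have "r z \<le> r t"
      proof (cases "t < b")
        case True
        with t show ?thesis by (intro eq_refl const[symmetric]) simp_all
      next
        case False
        then show ?thesis using t(1,2) ab(1,3) z e by (intro mono_onD[OF r(1)]) simp_all
      qed
      then show "r z \<le> w a + \<epsilon>" using t(3) e_le by linarith
    qed
    have lower: "w b \<le> r z"
    proof (rule field_le_epsilon)
      fix \<epsilon> :: real assume "\<epsilon> > 0"
      define e where "e = min b (\<epsilon> / (2 * L + 1))"
      have "0 < b" using ab(3) z(1) by simp
      then have e: "0 < e" "0 \<le> b - e" using \<open>\<epsilon> > 0\<close> L0 by (simp_all add: e_def)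
      have "(2 * L + 1) * e \<le> (2 * L + 1) * (\<epsilon> / (2 * L + 1))" using L0 by (intro mult_left_mono) (simp_all add: e_def)
      also have "\<dots> = \<epsilon>" using L0 by simp
      finally have e_le: "(2 * L + 1) * e \<le> \<epsilon>" .
      obtain t where t: "b - e < t" "t < b" "w b - (2 * L + 1) * e \<le> r t" using left[OF ab(4,6) e] by blast
      have "r t \<le> r z"
      proof (cases "a < t")
        case True
        with t show ?thesis by (intro eq_refl const) simp_all
      next
        case False
        then show ?thesis using t(1,2) ab(2) z e by (intro mono_onD[OF r(1)]) simp_all
      qed
      then show "w b \<le> r z + \<epsilon>" using t(3) e_le by linarith
    qed
    show ?thesis
    proof (intro exI conjI allI impI)
      show "0 \<le> a" "a \<le> z" "z \<le> b" "b \<le> 1" "T a = 0" "T b = 0" "w b \<le> r z" "r z \<le> w a"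
        by (fact ab upper lower)+
      fix t assume "a < t \<and> t < b"
      then show "0 < T t" "r t = r z" using ab(7) const by blast+
    next
      assume "T z = 0"
      then show "a = z" "b = z" using ab(8) by auto
    next
      assume "T z \<noteq> 0"
      then show "a < z" "z < b" using ab(9) by auto
    qed
  qed
  obtain a1 b1 where 1: "0 \<le> a1" "a1 \<le> x" "x \<le> b1" "b1 \<le> 1" "T a1 = 0" "T b1 = 0"
      "\<And>t. a1 < t \<Longrightarrow> t < b1 \<Longrightarrow> 0 < T t \<and> r t = r x" "T x = 0 \<longrightarrow> a1 = x \<and> b1 = x" "T x \<noteq> 0 \<longrightarrow> a1 < x \<and> x < b1"
      "w b1 \<le> r x" using comp[of x] xy by auto
  obtain a2 b2 where 2: "0 \<le> a2" "a2 \<le> y" "y \<le> b2" "b2 \<le> 1" "T a2 = 0" "T b2 = 0"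
      "\<And>t. a2 < t \<Longrightarrow> t < b2 \<Longrightarrow> 0 < T t \<and> r t = r y" "T y = 0 \<longrightarrow> a2 = y \<and> b2 = y" "T y \<noteq> 0 \<longrightarrow> a2 < y \<and> y < b2"
      "r y \<le> w a2" using comp[of y] xy by auto
  show ?thesis
  proof (cases "b1 \<le> a2")
    case True
    have "r y - r x \<le> w a2 - w b1" using 1 2 by linarith
    also have "\<dots> \<le> L * \<bar>a2 - b1\<bar>" using lip01D[OF lip, of a2 b1] 1 2 xy by auto
    also have "\<dots> \<le> L * (y - x)" using True 1 2 L0 by (intro mult_left_mono) auto
    finally show ?thesis .
  next
    case False
    \<comment> \<open>The end points are zeros of T, while T is positive inside either interval; so
      no end point of one lies inside the other.\<close>
    have "a2 \<le> a1" using 1(7)[of a2] 2(5) False by fastforce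
    have "b2 \<le> b1" using 2(7)[of b1] 1(6) False by fastforce
    have "r y = r x"
    proof (cases "T x = 0")
      case True
      then have "b1 = x" using 1(8) by blast
      with \<open>b2 \<le> b1\<close> 2(3) xy(2) show ?thesis by linarith
    next
      case Fx: False
      then have "a1 < x" using 1(9) by blast
      then have "a2 < x" using \<open>a2 \<le> a1\<close> by linarith
      moreover have "x < b2" using 2(3) xy(2) by linarith
      ultimately have "r x = r y" using 2(7) by blast
      then show ?thesis by simp
    qed
    then show ?thesis using L0 xy by simp
  qed
qed

lemma flow_limit_cont_lip01:
  assumes lip: "lip01 L w"
  shows "lip01 L (flow_limit_cont w)" "l2_of (flow_limit_cont w) = iso (l2_of w)"
proof -
  note w_L2 = lip01_L2[OF lip]
  note L0 = lip01_nonneg[OF lip]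
  obtain r where r: "mono_on {0<..<1} r" "AE x in unit_ivl. l2_fun (iso (l2_of w)) x = r x"
    using iso_mono_cone by (rule mono_coneE)
  have r_lip: "r x \<le> r y + L * \<bar>x - y\<bar>" if "x \<in> {0<..<1}" "y \<in> {0<..<1}" for x y
  proof (cases "y < x")
    case True
    then show ?thesis using iso_lipschitz[OF lip r, of y x] that by auto
  next
    case False
    then have "r x \<le> r y" using that by (intro mono_onD[OF r(1)]) auto
    then show ?thesis using L0 by (simp add: add_increasing2)
  qed
  \<comment> \<open>McShane's formula extends r from the open interval to [0, 1] with the same
    Lipschitz constant.\<close>
  define c where "c x = (INF t\<in>{0<..<1}. r t + L * \<bar>x - t\<bar>)" for x
  have bdd: "bdd_below ((\<lambda>t. r t + L * \<bar>x - t\<bar>) ` {0<..<1})" for x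
  proof (rule bdd_belowI2[where m = "r (1 / 2) - L"])
    fix t :: real assume t: "t \<in> {0<..<1}"
    have "r (1 / 2) \<le> r t + L * \<bar>1 / 2 - t\<bar>" using r_lip[of "1 / 2" t] t by simp
    also have "L * \<bar>1 / 2 - t\<bar> \<le> L * 1" using t L0 by (intro mult_left_mono) auto
    moreover have "0 \<le> L * \<bar>x - t\<bar>" using L0 by simp
    ultimately show "r (1 / 2) - L \<le> r t + L * \<bar>x - t\<bar>" by linarith
  qed
  have c_le: "c x \<le> c y + L * \<bar>x - y\<bar>" for x y
  proof -
    have "c x - L * \<bar>x - y\<bar> \<le> c y"
      unfolding c_def[of y]
    proof (rule cINF_greatest)
      fix t :: real assume t: "t \<in> {0<..<1}"
      have "c x \<le> r t + L * \<bar>x - t\<bar>" unfolding c_def by (rule cINF_lower[OF bdd t])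
      also have "L * \<bar>x - t\<bar> \<le> L * (\<bar>x - y\<bar> + \<bar>y - t\<bar>)" using L0 by (intro mult_left_mono) auto
      finally show "c x - L * \<bar>x - y\<bar> \<le> r t + L * \<bar>y - t\<bar>" by (simp add: distrib_left)
    qed auto
    then show ?thesis by simp
  qed
  have c_lip: "lip01 L c" unfolding lip01_def
  proof (intro ballI)
    fix x y show "\<bar>c x - c y\<bar> \<le> L * \<bar>x - y\<bar>"
      using c_le[of x y] c_le[of y x] by (simp add: abs_le_iff abs_minus_commute)
  qed
  have c_eq: "c x = r x" if x: "x \<in> {0<..<1}" for x
  proof (rule antisym)
    show "c x \<le> r x" using cINF_lower[OF bdd x, of x] by (simp add: c_def)
    show "r x \<le> c x" unfolding c_def by (rule cINF_greatest) (use x r_lip in auto)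
  qed
  have c_iso: "l2_of c = iso (l2_of w)" unfolding l2_eq_iff
    using l2_fun_of[OF lip01_L2[OF c_lip]] r(2) AE_in_unit_ivl by eventually_elim (simp add: c_eq)
  note fl = flow_limit_eq[OF w_L2]
  have ae: "AE x in unit_ivl. c x = flow_limit w x"
    using l2_of_eq_iff[OF lip01_L2[OF c_lip] fl(1)] fl(2) c_iso by simp
  define F where "F = flow_limit_cont w"
  have F: "continuous_on {0..1} F \<and> (AE x in unit_ivl. F x = flow_limit w x)"
    unfolding F_def flow_limit_cont_def by (rule someI[of _ c]) (use ae lip01_continuous[OF c_lip] in auto)
  have "F x = c x" if "x \<in> {0..1}" for x
  proof (rule AE_eq_continuous[OF _ lip01_continuous[OF c_lip] _ that])
    show "continuous_on {0..1} F" using F by simp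
    show "AE x in unit_ivl. F x = c x" using F ae by (auto elim: eventually_elim2)
  qed
  then show "lip01 L (flow_limit_cont w)" using c_lip unfolding lip01_def F_def[symmetric] by simp
  have "l2_of F = l2_of (flow_limit w)"
    using F continuous_on_unit_L2[of F] fl(1) by (subst l2_of_eq_iff) auto
  then show "l2_of (flow_limit_cont w) = iso (l2_of w)" using fl(2) by (simp add: F_def)
qed

section \<open>Order properties of the regression\<close>

definition pos_part :: "l2 \<Rightarrow> l2" where
  "pos_part u = l2_of (\<lambda>x. max 0 (l2_fun u x))"

lemma pos_part_L2: "(\<lambda>x. max 0 (l2_fun u x)) \<in> L2"
  by (rule L2_max[OF L2_const l2_fun_L2])

lemma l2_fun_pos_part: "AE x in unit_ivl. l2_fun (pos_part u) x = max 0 (l2_fun u x)"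
  unfolding pos_part_def by (rule l2_fun_of[OF pos_part_L2])

text \<open>The two functions are the pointwise maximum and minimum, so this says that the cone is a
  lattice.\<close>

lemma pos_part_cone:
  assumes "u \<in> mono_cone" "v \<in> mono_cone"
  shows "u + pos_part (v - u) \<in> mono_cone" "v - pos_part (v - u) \<in> mono_cone"
proof -
  obtain r where r: "mono_on {0<..<1} r" "AE x in unit_ivl. l2_fun u x = r x" using assms(1) by (rule mono_coneE)
  obtain s where s: "mono_on {0<..<1} s" "AE x in unit_ivl. l2_fun v x = s x" using assms(2) by (rule mono_coneE)
  have "AE x in unit_ivl. l2_fun (u + pos_part (v - u)) x = max (r x) (s x)"
    using l2_fun_add[of u "pos_part (v - u)"] l2_fun_pos_part[of "v - u"] l2_fun_diff[of v u] r(2) s(2)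
    by eventually_elim (simp add: max_def)
  moreover have "mono_on {0<..<1} (\<lambda>x. max (r x) (s x))"
    using r(1) s(1) unfolding mono_on_def by (meson max.mono)
  ultimately show "u + pos_part (v - u) \<in> mono_cone" by (auto simp: mono_cone_def nondecreasing_ae_def)
  have "AE x in unit_ivl. l2_fun (v - pos_part (v - u)) x = min (r x) (s x)"
    using l2_fun_diff[of v "pos_part (v - u)"] l2_fun_pos_part[of "v - u"] l2_fun_diff[of v u] r(2) s(2)
    by eventually_elim (simp add: max_def min_def)
  moreover have "mono_on {0<..<1} (\<lambda>x. min (r x) (s x))"
    using r(1) s(1) unfolding mono_on_def by (meson min.mono)
  ultimately show "v - pos_part (v - u) \<in> mono_cone" by (auto simp: mono_cone_def nondecreasing_ae_def)
qed

lemma inner_pos_part_self: "inner u (pos_part u) = (norm (pos_part u))\<^sup>2"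
proof -
  have "inner u (pos_part u) = (\<integral>x. l2_fun u x * max 0 (l2_fun u x) \<partial>unit_ivl)"
    unfolding pos_part_def by (rule inner_l2_of_right[OF pos_part_L2])
  also have "\<dots> = (\<integral>x. max 0 (l2_fun u x) * max 0 (l2_fun u x) \<partial>unit_ivl)"
    by (intro Bochner_Integration.integral_cong) (auto simp: max_def)
  also have "\<dots> = inner (pos_part u) (pos_part u)"
    unfolding pos_part_def using inner_l2_of[OF pos_part_L2 pos_part_L2] by (simp add: l2_inner_def)
  finally show ?thesis by (simp add: power2_norm_eq_inner)
qed

lemma inner_pos_part_le: "inner u (pos_part v) \<le> inner (pos_part u) (pos_part v)"
proof -
  have "inner u (pos_part v) = (\<integral>x. l2_fun u x * max 0 (l2_fun v x) \<partial>unit_ivl)"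
    unfolding pos_part_def by (rule inner_l2_of_right[OF pos_part_L2])
  also have "\<dots> \<le> (\<integral>x. max 0 (l2_fun u x) * max 0 (l2_fun v x) \<partial>unit_ivl)"
    by (intro integral_mono L2_mult_integrable l2_fun_L2 pos_part_L2 mult_right_mono) auto
  also have "\<dots> = inner (pos_part u) (pos_part v)"
    unfolding pos_part_def using inner_l2_of[OF pos_part_L2 pos_part_L2] by (simp add: l2_inner_def)
  finally show ?thesis .
qed

text \<open>Projections onto a convex cone that is a lattice contract the positive part of differences.\<close>

lemma iso_pos_part_contraction: "norm (pos_part (iso w - iso v)) \<le> norm (pos_part (w - v))"
proof -
  define n where "n = pos_part (iso w - iso v)"
  have "inner (v - iso v) ((iso v + n) - iso v) \<le> 0" "inner (w - iso w) ((iso w - n) - iso w) \<le> 0"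
    unfolding n_def by (intro iso_variational pos_part_cone iso_mono_cone)+
  then have "inner (iso w - iso v) n \<le> inner (w - v) n" by (simp add: inner_diff_left)
  also have "\<dots> \<le> inner (pos_part (w - v)) n" unfolding n_def by (rule inner_pos_part_le)
  also have "\<dots> \<le> norm (pos_part (w - v)) * norm n" by (rule norm_cauchy_schwarz)
  also have "inner (iso w - iso v) n = norm n * norm n"
    unfolding n_def inner_pos_part_self by (simp add: power2_eq_square)
  finally show ?thesis unfolding n_def[symmetric] by (cases "norm n = 0") (auto dest: mult_right_le_imp_le)
qed

lemma pos_part_eq_0_iff: "pos_part u = 0 \<longleftrightarrow> (AE x in unit_ivl. l2_fun u x \<le> 0)"
proof -
  have "pos_part u = 0 \<longleftrightarrow> (AE x in unit_ivl. max 0 (l2_fun u x) = 0)"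
    unfolding pos_part_def zero_l2_def by (rule l2_of_eq_iff[OF pos_part_L2 L2_const])
  moreover have "max 0 y = 0 \<longleftrightarrow> y \<le> 0" for y :: real by (simp add: max_def)
  ultimately show ?thesis by (simp only:)
qed

lemma norm_pos_part_diff:
  assumes "f \<in> L2" "g \<in> L2"
  shows "(norm (pos_part (l2_of f - l2_of g)))\<^sup>2 = (\<integral>x. (max 0 (f x - g x))\<^sup>2 \<partial>unit_ivl)"
proof -
  have "AE x in unit_ivl. (l2_fun (pos_part (l2_of f - l2_of g)) x)\<^sup>2 = (max 0 (f x - g x))\<^sup>2"
    using l2_fun_pos_part[of "l2_of f - l2_of g"] l2_fun_diff[of "l2_of f" "l2_of g"] l2_fun_of[OF assms(1)] l2_fun_of[OF assms(2)]
    by eventually_elim simp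
  then show ?thesis unfolding norm_l2_sq
    by (intro integral_cong_AE) (use L2_measurable[OF L2_diff[OF assms]] in auto)
qed

lemma flow_limit_cont_contraction:
  assumes "lip01 L v" "lip01 L' w"
  shows "(\<integral>x. (max 0 (flow_limit_cont w x - flow_limit_cont v x))\<^sup>2 \<partial>unit_ivl) \<le> (\<integral>x. (max 0 (w x - v x))\<^sup>2 \<partial>unit_ivl)"
proof -
  note v = flow_limit_cont_lip01[OF assms(1)]
  note w = flow_limit_cont_lip01[OF assms(2)]
  have "(norm (pos_part (iso (l2_of w) - iso (l2_of v))))\<^sup>2 \<le> (norm (pos_part (l2_of w - l2_of v)))\<^sup>2"
    by (intro power_mono iso_pos_part_contraction) simp
  then show ?thesis
    unfolding v(2)[symmetric] w(2)[symmetric]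
    by (simp add: norm_pos_part_diff lip01_L2[OF assms(1)] lip01_L2[OF assms(2)] lip01_L2[OF v(1)] lip01_L2[OF w(1)])
qed

lemma iso_add_const: "iso (w + c *\<^sub>R one) = iso w + c *\<^sub>R one"
proof (rule iso_eqI)
  show "iso w + c *\<^sub>R one \<in> mono_cone" by (intro mono_cone_add_const iso_mono_cone)
  show "w + c *\<^sub>R one - (iso w + c *\<^sub>R one) \<in> polar" using iso_polar[of w] by simp
  have "inner (w - iso w) one = 0" using polar_prim_1[OF iso_polar[of w]] by (simp add: prim_1)
  then show "inner (w + c *\<^sub>R one - (iso w + c *\<^sub>R one)) (iso w + c *\<^sub>R one) = 0"
    using iso_orthogonal[of w] by (simp add: inner_add_right)
qed

lemma iso_const: "iso (c *\<^sub>R one) = c *\<^sub>R one"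
  by (rule iso_eqI) (auto simp: scaleR_one_mono_cone polar_def)

text \<open>Order preservation combined with invariance under constants, that is nonexpansiveness
  for the supremum norm in one-sided form. It later bounds the variation across parallel lines of
  the cube.\<close>

lemma flow_limit_cont_le:
  assumes v: "lip01 L v" and w: "lip01 L' w" and le: "\<And>x. x \<in> {0..1} \<Longrightarrow> w x \<le> v x + c" and x: "x \<in> {0..1}"
  shows "flow_limit_cont w x \<le> flow_limit_cont v x + c"
proof -
  note fv = flow_limit_cont_lip01[OF v]
  note fw = flow_limit_cont_lip01[OF w]
  define V where "V = l2_of v + c *\<^sub>R one"
  have "AE t in unit_ivl. l2_fun (l2_of w - V) t \<le> 0"
    using l2_fun_diff[of "l2_of w" V] l2_fun_add[of "l2_of v" "c *\<^sub>R one"] l2_fun_scaleR[of c one] l2_fun_one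
      l2_fun_of[OF lip01_L2[OF v]] l2_fun_of[OF lip01_L2[OF w]] AE_in_unit_ivl
    unfolding V_def by eventually_elim (use le in force)
  then have "pos_part (l2_of w - V) = 0" by (simp add: pos_part_eq_0_iff)
  then have "pos_part (iso (l2_of w) - iso V) = 0" using iso_pos_part_contraction[of "l2_of w" V] by simp
  then have ae: "AE t in unit_ivl. l2_fun (iso (l2_of w) - iso V) t \<le> 0" by (simp add: pos_part_eq_0_iff)
  have V: "iso V = l2_of (flow_limit_cont v) + c *\<^sub>R one" unfolding V_def iso_add_const fv(2) ..
  have "AE t in unit_ivl. flow_limit_cont w t \<le> flow_limit_cont v t + c"
    using ae l2_fun_diff[of "iso (l2_of w)" "iso V"] l2_fun_add[of "l2_of (flow_limit_cont v)" "c *\<^sub>R one"]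
      l2_fun_scaleR[of c one] l2_fun_one l2_fun_of[OF lip01_L2[OF fv(1)]] l2_fun_of[OF lip01_L2[OF fw(1)]]
    unfolding V fw(2)[symmetric] by eventually_elim simp
  then show ?thesis
    by (intro AE_le_continuous[OF lip01_continuous[OF fw(1)] _ _ x] continuous_intros lip01_continuous[OF fv(1)])
qed

lemma lip01_const: "0 \<le> L \<Longrightarrow> lip01 L (\<lambda>_. c)"
  by (simp add: lip01_def)

lemma flow_limit_cont_const:
  assumes "x \<in> {0..1}"
  shows "flow_limit_cont (\<lambda>_. c) x = c"
proof -
  note f = flow_limit_cont_lip01[OF lip01_const[of 0 c, OF order_refl]]
  have "l2_of (\<lambda>_. c) = c *\<^sub>R one" using l2_of_scaleR[OF L2_const[of 1], of c] by (simp add: one_def)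
  then have "l2_of (flow_limit_cont (\<lambda>_. c)) = l2_of (\<lambda>_. c)" using f(2) iso_const by simp
  then have "AE t in unit_ivl. flow_limit_cont (\<lambda>_. c) t = c"
    by (simp add: l2_of_eq_iff lip01_L2[OF f(1)] L2_const)
  then show ?thesis by (intro AE_eq_continuous[OF lip01_continuous[OF f(1)] _ _ assms]) auto
qed

lemma flow_limit_cont_bounds:
  assumes w: "lip01 L w" and b: "\<And>x. x \<in> {0..1} \<Longrightarrow> lo \<le> w x \<and> w x \<le> hi" and x: "x \<in> {0..1}"
  shows "lo \<le> flow_limit_cont w x" "flow_limit_cont w x \<le> hi"
  using flow_limit_cont_le[OF w lip01_const[OF order_refl, of lo], of 0 x]
    flow_limit_cont_le[OF lip01_const[OF order_refl, of hi] w, of 0 x] b x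
  by (simp_all add: flow_limit_cont_const)

section \<open>Almost everywhere differentiability of Lipschitz functions\<close>

text \<open>In the form of a Vitali cover: the lower derivate of f over intervals containing the
  point is at most a on E.\<close>

definition covered :: "(real \<Rightarrow> real) \<Rightarrow> real \<Rightarrow> real set \<Rightarrow> bool" where
  "covered f a E \<longleftrightarrow> (\<forall>x\<in>E. \<forall>\<delta>>0. \<exists>u v. u < v \<and> x \<in> {u..v} \<and> v - u < \<delta> \<and> f v - f u \<le> a * (v - u))"

text \<open>Disjoint covering intervals within an open set U barely larger than E exhaust E up to a
  null set, whose image is null since f is Lipschitz. The image of each interval is at most a times
  as long.\<close>

lemma emeasure_image_le_if_covered:
  fixes f g :: "real \<Rightarrow> real"
  assumes mono: "strict_mono f" and inv: "\<And>x. g (f x) = x" "\<And>y. f (g y) = y" and g: "continuous_on UNIV g"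
    and lip: "\<And>x y. \<bar>f x - f y\<bar> \<le> K * \<bar>x - y\<bar>"
    and E: "E \<in> sets borel" and cov: "covered f a E" and a: "0 \<le> a"
  shows "emeasure lborel (f ` E) \<le> ennreal a * emeasure lborel E"
proof -
  have image: "f ` A \<in> sets borel" if "A \<in> sets borel" for A
  proof -
    have "f ` A = g -` A" using inv by (auto simp: image_iff) (metis inv(2))
    moreover have "g -` A \<inter> space borel \<in> sets borel"
      by (rule measurable_sets[OF borel_measurable_continuous_onI[OF g] that])
    ultimately show ?thesis by simp
  qed
  have image_ivl: "f ` {u..v} = {f u..f v}" for u v
  proof -
    have "f u \<le> y \<longleftrightarrow> u \<le> g y" "y \<le> f v \<longleftrightarrow> g y \<le> v" for y
      using strict_mono_less_eq[OF mono, of u "g y"] strict_mono_less_eq[OF mono, of "g y" v] inv(2)[of y] by auto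
    moreover have "f ` {u..v} = g -` {u..v}" using inv by (auto simp: image_iff) (metis atLeastAtMost_iff inv(2))
    ultimately show ?thesis by auto
  qed
  have "emeasure lborel (f ` E) \<le> ennreal a * emeasure lborel E + ennreal \<epsilon>" if "\<epsilon> > 0" for \<epsilon>
  proof -
    define e where "e = \<epsilon> / (a + 1)"
    have "e > 0" using that a by (simp add: e_def)
    obtain U where U: "open U" "E \<subseteq> U" "emeasure lborel (U - E) < ennreal e"
      using outer_regular_lborel[OF E \<open>e > 0\<close>] .
    define I where "I = {(u, v). u < v \<and> {u..v} \<subseteq> U \<and> f v - f u \<le> a * (v - u)}"
    define m where "m = (\<lambda>(u, v). (u + v) / 2 :: real)"
    define r where "r = (\<lambda>(u, v). (v - u) / 2 :: real)"
    have cb: "cball (m i) (r i) = {fst i..snd i}" for i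
      by (cases i) (auto simp: m_def r_def cball_eq_atLeastAtMost field_simps)
    have rpos: "0 < r i" if "i \<in> I" for i using that by (auto simp: I_def r_def)
    have fine: "\<exists>i. i \<in> I \<and> x \<in> cball (m i) (r i) \<and> r i < d" if x: "x \<in> E" and d: "0 < d" for x d
    proof -
      obtain \<rho> where \<rho>: "\<rho> > 0" "ball x \<rho> \<subseteq> U" using U x by (meson open_contains_ball subsetD)
      obtain u v where uv: "u < v" "x \<in> {u..v}" "v - u < min d \<rho>" "f v - f u \<le> a * (v - u)"
        using cov x d \<rho>(1) unfolding covered_def by (metis min_less_iff_conj)
      have "{u..v} \<subseteq> ball x \<rho>" using uv by (auto simp: dist_real_def)
      then have "(u, v) \<in> I" using uv \<rho> by (auto simp: I_def)
      moreover have "r (u, v) < d" using uv by (auto simp: r_def)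
      moreover have "x \<in> cball (m (u, v)) (r (u, v))" unfolding cb using uv(2) by simp
      ultimately show ?thesis by blast
    qed
    obtain C where C: "countable C" "C \<subseteq> I" "pairwise (\<lambda>i j. disjnt (cball (m i) (r i)) (cball (m j) (r j))) C"
      "negligible (E - (\<Union>i\<in>C. cball (m i) (r i)))"
      using Vitali_covering_theorem_cballs[of I r E m, OF rpos fine] by blast
    define X where "X i = {fst i..snd i :: real}" for i
    define Z where "Z = E - (\<Union>i\<in>C. X i)"
    have Z: "Z \<in> sets borel" unfolding Z_def X_def using E C(1) by (intro sets.Diff sets.countable_UN'') auto
    have "negligible (f ` Z)"
      by (rule negligible_lipschitz_image_real[of _ _ K]) (use C(4) lip in \<open>auto simp: Z_def X_def cb\<close>)
    then have Z0: "emeasure lborel (f ` Z) = 0"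
      using image[OF Z] by (simp add: negligible_iff_null_sets null_sets_completion_iff null_setsD1)
    have disj: "disjoint_family_on X C"
      using C(3) by (auto simp: disjoint_family_on_def pairwise_def disjnt_def cb X_def)
    have "f ` E \<subseteq> f ` Z \<union> (\<Union>i\<in>C. f ` X i)" by (auto simp: Z_def)
    then have "emeasure lborel (f ` E) \<le> emeasure lborel (f ` Z \<union> (\<Union>i\<in>C. f ` X i))"
      using image[OF Z] C(1) by (intro emeasure_mono sets.Un sets.countable_UN'') (auto simp: X_def image_ivl)
    also have "\<dots> \<le> emeasure lborel (f ` Z) + emeasure lborel (\<Union>i\<in>C. f ` X i)"
      using image[OF Z] C(1) by (intro emeasure_subadditive sets.countable_UN'') (auto simp: X_def image_ivl)
    also have "emeasure lborel (\<Union>i\<in>C. f ` X i) = (\<integral>\<^sup>+ i. emeasure lborel (f ` X i) \<partial>count_space C)"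
    proof (rule emeasure_UN_countable)
      show "disjoint_family_on (\<lambda>i. f ` X i) C"
        using disj strict_mono_imp_inj_on[OF mono, of UNIV] unfolding disjoint_family_on_def
        by (metis image_Int image_empty inj_on_subset subset_UNIV)
    qed (use C(1) in \<open>auto simp: X_def image_ivl\<close>)
    also have "\<dots> \<le> (\<integral>\<^sup>+ i. ennreal a * emeasure lborel (X i) \<partial>count_space C)"
    proof (rule nn_integral_mono)
      fix i assume "i \<in> space (count_space C)"
      then have i: "fst i < snd i" "f (snd i) - f (fst i) \<le> a * (snd i - fst i)" using C(2) by (auto simp: I_def)
      have "f (fst i) < f (snd i)" using strict_monoD[OF mono i(1)] .
      then have "emeasure lborel (f ` X i) = ennreal (f (snd i) - f (fst i))" by (simp add: X_def image_ivl)
      also have "\<dots> \<le> ennreal (a * (snd i - fst i))" using i(2) by (rule ennreal_leI)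
      also have "\<dots> = ennreal a * emeasure lborel (X i)" using i(1) a by (simp add: X_def ennreal_mult)
      finally show "emeasure lborel (f ` X i) \<le> ennreal a * emeasure lborel (X i)" .
    qed
    also have "\<dots> = ennreal a * (\<integral>\<^sup>+ i. emeasure lborel (X i) \<partial>count_space C)"
      by (rule nn_integral_cmult) simp
    also have "(\<integral>\<^sup>+ i. emeasure lborel (X i) \<partial>count_space C) = emeasure lborel (\<Union>i\<in>C. X i)"
    proof (rule emeasure_UN_countable[symmetric])
      show "disjoint_family_on X C" by (rule disj)
    qed (use C(1) in \<open>auto simp: X_def\<close>)
    also have "\<dots> \<le> emeasure lborel U"
    proof (rule emeasure_mono)
      have "X i \<subseteq> U" if "i \<in> I" for i using that by (cases i) (simp add: X_def I_def)
      then show "(\<Union>i\<in>C. X i) \<subseteq> U" using C(2) by blast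
    qed (use U(1) in simp)
    also have "\<dots> \<le> emeasure lborel E + emeasure lborel (U - E)"
      using emeasure_subadditive[of E lborel "U - E"] E U by (simp add: Un_absorb1)
    also have "\<dots> \<le> emeasure lborel E + ennreal e" using U(3) by (intro add_left_mono less_imp_le)
    finally have "emeasure lborel (f ` E) \<le> ennreal a * (emeasure lborel E + ennreal e)"
      by (simp add: Z0 mult_left_mono)
    also have "\<dots> = ennreal a * emeasure lborel E + ennreal (a * e)" using a \<open>e > 0\<close> by (simp add: distrib_left ennreal_mult)
    also have "\<dots> \<le> ennreal a * emeasure lborel E + ennreal \<epsilon>"
      using a that by (intro add_left_mono ennreal_leI) (simp add: e_def field_simps)
    finally show ?thesis .
  qed
  then show ?thesis by (rule ennreal_le_epsilon)
qed

text \<open>A union of open intervals, which makes the exceptional sets Borel. Applied to f(t) - a t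
  and to b t - f(t) it expresses short intervals with slope below a and above b.\<close>

definition flat_at :: "(real \<Rightarrow> real) \<Rightarrow> nat \<Rightarrow> real set" where
  "flat_at f n = (\<Union>{{u<..<v} |u v. u < v \<and> v - u < 1 / real (Suc n) \<and> f v < f u})"

lemma open_flat_at: "open (flat_at f n)"
  unfolding flat_at_def by auto

text \<open>A strict drop survives a small enlargement of the interval by continuity; so the point
  may also be an end point, as it is for difference quotients.\<close>

lemma flat_atI:
  assumes f: "continuous_on UNIV f" and uv: "u < v" "x \<in> {u..v}" "v - u < 1 / real (Suc n)" "f v < f u"
  shows "x \<in> flat_at f n"
proof -
  have lim: "((\<lambda>e. f (v + e) - f (u - e)) \<longlongrightarrow> f (v + 0) - f (u - 0)) (at_right 0)"
    using f by (intro tendsto_intros isCont_tendsto_compose[of _ f]) (auto simp: continuous_on_eq_continuous_at)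
  have "\<forall>\<^sub>F e in at_right 0. f (v + e) - f (u - e) < 0"
    by (rule order_tendstoD(2)[OF lim]) (use uv in simp)
  moreover have "((\<lambda>e. (v + e) - (u - e)) \<longlongrightarrow> (v + 0) - (u - 0)) (at_right 0)" by (intro tendsto_intros)
  then have "\<forall>\<^sub>F e in at_right 0. (v + e) - (u - e) < 1 / real (Suc n)"
    by (rule order_tendstoD(2)) (use uv in simp)
  moreover have "\<forall>\<^sub>F e in at_right 0. (0 :: real) < e" by (simp add: eventually_at_right_less)
  ultimately have "\<forall>\<^sub>F e in at_right 0. f (v + e) - f (u - e) < 0 \<and> (v + e) - (u - e) < 1 / real (Suc n) \<and> 0 < e"
    by eventually_elim simp
  then obtain e where "f (v + e) - f (u - e) < 0" "(v + e) - (u - e) < 1 / real (Suc n)" "0 < e"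
    using eventually_happens'[OF trivial_limit_at_right_real] by blast
  then have "\<exists>u' v'. {u - e<..<v + e} = {u'<..<v'} \<and> u' < v' \<and> v' - u' < 1 / real (Suc n) \<and> f v' < f u'"
    by (intro exI[of _ "u - e"] exI[of _ "v + e"]) (use uv in auto)
  moreover have "x \<in> {u - e<..<v + e}" using uv \<open>0 < e\<close> by auto
  ultimately show ?thesis unfolding flat_at_def by blast
qed

text \<open>Where derivates below a and above b coexist, the covering lemma applies to f with rate a
  and to its inverse with rate 1/b, so |E| <= (a/b) |E| and E is null. Countably many rational pairs
  a < b exhaust the points without a derivative.\<close>

lemma bilipschitz_AE_differentiable:
  fixes f :: "real \<Rightarrow> real"
  assumes lower: "\<And>x y. x \<le> y \<Longrightarrow> y - x \<le> f y - f x" and upper: "\<And>x y. x \<le> y \<Longrightarrow> f y - f x \<le> K * (y - x)"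
  shows "AE x in lborel. x \<in> {0<..<1} \<longrightarrow> (\<exists>D. (f has_real_derivative D) (at x))"
proof -
  have mono: "strict_mono f"
  proof (rule strict_monoI)
    fix x y :: real assume "x < y" then show "f x < f y" using lower[of x y] by simp
  qed
  have K: "0 \<le> K" using lower[of 0 1] upper[of 0 1] by simp
  have lip: "\<bar>f x - f y\<bar> \<le> K * \<bar>x - y\<bar>" for x y
    using lower[of x y] upper[of x y] lower[of y x] upper[of y x] by (cases "x \<le> y") auto
  have "K-lipschitz_on UNIV f" using lip K by (auto simp: lipschitz_on_def dist_real_def)
  then have cont: "continuous_on UNIV f" by (rule lipschitz_on_continuous_on)
  have surj: "\<exists>x. f x = y" for y
  proof -
    define M where "M = \<bar>y - f 0\<bar> + 1"
    have M: "0 \<le> M" "y - f 0 \<le> M" "f 0 - y \<le> M" by (auto simp: M_def)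
    then have "y \<le> f M" "f (- M) \<le> y" using lower[of 0 M] lower[of "- M" 0] by auto
    then show ?thesis using IVT'[of f "- M" y M] continuous_on_subset[OF cont, of "{- M..M}"] M by auto
  qed
  define g where "g = inv f"
  have inv: "g (f x) = x" "f (g y) = y" for x y
  proof -
    have "surj f" unfolding surj_def using surj by metis
    then show "g (f x) = x" "f (g y) = y"
      unfolding g_def using inv_f_f[OF strict_mono_imp_inj_on[OF mono]] surj_f_inv_f by auto
  qed
  have g_lip: "\<bar>g x - g y\<bar> \<le> 1 * \<bar>x - y\<bar>" for x y
    using lower[of "g x" "g y"] lower[of "g y" "g x"] inv(2)[of x] inv(2)[of y] by (cases "g x \<le> g y") auto
  then have "1-lipschitz_on UNIV g" by (auto simp: lipschitz_on_def dist_real_def)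
  then have g_cont: "continuous_on UNIV g" by (rule lipschitz_on_continuous_on)
  have g_mono: "strict_mono g"
  proof (rule strict_monoI)
    fix x y :: real assume "x < y"
    then show "g x < g y" using strict_mono_less[OF mono, of "g x" "g y"] inv by simp
  qed
  define lowf where "lowf a = (\<lambda>t. f t - a * t)" for a
  define upf where "upf b = (\<lambda>t. b * t - f t)" for b
  have conts: "continuous_on UNIV (lowf a)" "continuous_on UNIV (upf a)" for a
    unfolding lowf_def upf_def by (intro continuous_intros cont)+
  define E where "E a b = {0<..<1} \<inter> (\<Inter>n. flat_at (lowf a) n \<inter> flat_at (upf b) n)" for a b
  have E_borel: "E a b \<in> sets borel" for a b
    unfolding E_def by (intro sets.Int sets.countable_INT'') (auto intro: borel_open open_flat_at)
  have null: "emeasure lborel (E a b) = 0" if ab: "0 < a" "a < b" for a b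
  proof -
    have small: "\<exists>n. 1 / real (Suc n) < \<delta>" if "\<delta> > 0" for \<delta> :: real using nat_approx_posE[OF that] by metis
    have "covered f a (E a b)"
      unfolding covered_def
    proof (intro ballI allI impI)
      fix x \<delta> :: real assume x: "x \<in> E a b" and "\<delta> > 0"
      obtain n where n: "1 / real (Suc n) < \<delta>" using small[OF \<open>\<delta> > 0\<close>] by blast
      have "x \<in> flat_at (lowf a) n" using x by (auto simp: E_def)
      then obtain u v where "x \<in> {u<..<v}" "u < v" "v - u < 1 / real (Suc n)" "lowf a v < lowf a u"
        unfolding flat_at_def by blast
      then show "\<exists>u v. u < v \<and> x \<in> {u..v} \<and> v - u < \<delta> \<and> f v - f u \<le> a * (v - u)"
        using n by (intro exI[of _ u] exI[of _ v]) (auto simp: lowf_def right_diff_distrib)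
    qed
    then have 1: "emeasure lborel (f ` E a b) \<le> ennreal a * emeasure lborel (E a b)"
      using ab by (intro emeasure_image_le_if_covered[OF mono inv g_cont lip E_borel]) auto
    have fE: "f ` E a b \<in> sets borel"
    proof -
      have "f ` E a b = g -` E a b" using inv by (auto simp: image_iff) (metis inv(2))
      moreover have "g -` E a b \<inter> space borel \<in> sets borel"
        by (rule measurable_sets[OF borel_measurable_continuous_onI[OF g_cont] E_borel])
      ultimately show ?thesis by simp
    qed
    have "covered g (1 / b) (f ` E a b)"
      unfolding covered_def
    proof (intro ballI allI impI)
      fix y \<delta> :: real assume "y \<in> f ` E a b" and "\<delta> > 0"
      then obtain x where x: "x \<in> E a b" "y = f x" by blast
      have "\<delta> / (K + 1) > 0" using \<open>\<delta> > 0\<close> K by simp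
      then obtain n where n: "1 / real (Suc n) < \<delta> / (K + 1)" using small by blast
      have "x \<in> flat_at (upf b) n" using x by (auto simp: E_def)
      then obtain u v where uv: "x \<in> {u<..<v}" "u < v" "v - u < 1 / real (Suc n)" "upf b v < upf b u"
        unfolding flat_at_def by blast
      have "f v - f u \<le> K * (v - u)" using upper uv by simp
      also have "\<dots> \<le> (K + 1) * (v - u)" using uv by (intro mult_right_mono) auto
      also have "\<dots> < \<delta>"
        using less_trans[OF uv(3) n] K by (simp add: pos_less_divide_eq mult.commute)
      finally have "f v - f u < \<delta>" .
      moreover have "b * (v - u) < f v - f u" using uv(4) by (simp add: upf_def right_diff_distrib)
      then have "v - u \<le> 1 / b * (f v - f u)" using ab by (simp add: field_simps)
      moreover have "f u < f v" "f u < y" "y < f v" using uv x strict_monoD[OF mono] by auto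
      ultimately show "\<exists>u v. u < v \<and> y \<in> {u..v} \<and> v - u < \<delta> \<and> g v - g u \<le> 1 / b * (v - u)"
        by (intro exI[of _ "f u"] exI[of _ "f v"]) (auto simp: inv)
    qed
    then have "emeasure lborel (g ` f ` E a b) \<le> ennreal (1 / b) * emeasure lborel (f ` E a b)"
      using ab by (intro emeasure_image_le_if_covered[OF g_mono inv(2,1) cont g_lip fE]) auto
    also have "g ` f ` E a b = E a b" using inv by (auto simp: image_image)
    also have "ennreal (1 / b) * emeasure lborel (f ` E a b) \<le> ennreal (1 / b) * (ennreal a * emeasure lborel (E a b))"
      by (intro mult_left_mono 1) simp
    also have "\<dots> = ennreal (a / b) * emeasure lborel (E a b)"
      using ab by (simp add: ennreal_mult[symmetric] mult.assoc[symmetric])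
    finally have le: "emeasure lborel (E a b) \<le> ennreal (a / b) * emeasure lborel (E a b)" .
    have "emeasure lborel (E a b) \<le> emeasure lborel {0<..<1::real}"
      by (rule emeasure_mono) (auto simp: E_def)
    then obtain m where m: "emeasure lborel (E a b) = ennreal m" "0 \<le> m"
      by (cases "emeasure lborel (E a b)") (auto simp: top_unique)
    have "ennreal (a / b * m) = ennreal (a / b) * ennreal m" using ab m by (intro ennreal_mult) auto
    then have "ennreal m \<le> ennreal (a / b * m)" using le unfolding m(1) by (simp only:)
    then have "m \<le> a / b * m" by (rule ennreal_le_iff[THEN iffD1, rotated]) (use ab m in simp)
    then have "m * (b - a) \<le> 0" using ab by (simp add: field_simps)
    then have "m = 0" using ab m(2) by (simp add: mult_le_0_iff)
    then show ?thesis using m by simp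
  qed
  define N where "N = (\<Union>p\<in>(\<rat> \<times> \<rat>) \<inter> {(a, b). 0 < a \<and> a < b}. E (fst p) (snd p))"
  have "N \<in> null_sets lborel"
    unfolding N_def
  proof (rule null_sets_UN')
    show "countable ((\<rat> \<times> \<rat>) \<inter> {(a :: real, b :: real). 0 < a \<and> a < b})"
      by (intro countable_Int1 countable_SIGMA) (auto simp: countable_rat)
  qed (use null E_borel in \<open>auto simp: null_sets_def\<close>)
  then have "AE x in lborel. x \<notin> N" by (rule AE_not_in)
  then show ?thesis
  proof eventually_elim
    case (elim x)
    show ?case
    proof
      assume x: "x \<in> {0<..<1}"
      \<comment> \<open>D, the infimum of the rational rates that arbitrarily short intervals around
        x undercut, is the candidate for the derivative.\<close>
      define A where "A = {a \<in> \<rat>. 0 < a \<and> (\<forall>n. x \<in> flat_at (lowf a) n)}"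
      define D where "D = Inf A"
      have bdd: "bdd_below A" by (rule bdd_belowI[of _ 0]) (auto simp: A_def)
      have ne: "A \<noteq> {}"
      proof -
        obtain m :: nat where "K + 1 < real m" using reals_Archimedean2 by blast
        then obtain c where c: "c \<in> \<rat>" "K + 1 < c" using Rats_of_nat by blast
        have "x \<in> flat_at (lowf c) n" for n
        proof (rule flat_atI[OF conts(1)])
          define h where "h = 1 / (2 * real (Suc n))"
          show "x < x + h" "x \<in> {x..x + h}" "x + h - x < 1 / real (Suc n)" by (auto simp: h_def field_simps)
          have "f (x + h) - f x \<le> K * h" using upper[of x "x + h"] by (simp add: h_def)
          also have "\<dots> < c * h" using c by (intro mult_strict_right_mono) (auto simp: h_def)
          finally show "lowf c (x + h) < lowf c x" by (simp add: lowf_def distrib_left)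
        qed
        then have "c \<in> A" using c K by (simp add: A_def)
        then show ?thesis by blast
      qed
      have quot: "(f (x + h) - f x) / h = (f v - f u) / (v - u) \<and> u < v \<and> x \<in> {u..v} \<and> v - u = \<bar>h\<bar>"
        if "h \<noteq> 0" "u = min x (x + h)" "v = max x (x + h)" for h u v
      proof (cases "h > 0")
        case True
        then show ?thesis using that by simp
      next
        case False
        then have uv: "u = x + h" "v = x" "h < 0" using that by auto
        have "(f (x + h) - f x) / h = - (f (x + h) - f x) / - h" by (simp only: minus_divide_divide)
        then show ?thesis using uv by simp
      qed
      have "((\<lambda>h. (f (x + h) - f x) / h) \<longlongrightarrow> D) (at 0)"
      proof (rule order_tendstoI)
        fix b' assume "D < b'"
        then obtain a where a: "a \<in> A" "a < b'" using cInf_less_iff[OF ne bdd, of b'] by (auto simp: D_def)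
        then obtain b where b: "b \<in> \<rat>" "a < b" "b < b'" using Rats_dense_in_real by blast
        have "(a, b) \<in> (\<rat> \<times> \<rat>) \<inter> {(a, b). 0 < a \<and> a < b}" using a(1) b by (simp add: A_def)
        then have "E a b \<subseteq> N" unfolding N_def using UN_upper[of "(a, b)" _ "\<lambda>p. E (fst p) (snd p)"] by (simp only: fst_conv snd_conv)
        then have "x \<notin> E a b" using elim by blast
        then obtain n where n: "x \<notin> flat_at (upf b) n" using x a by (auto simp: E_def A_def)
        have "\<forall>\<^sub>F h in at 0. \<bar>h\<bar> < 1 / real (Suc n)"
          by (rule order_tendstoD(2)[OF tendsto_rabs_zero[OF tendsto_ident_at]]) simp
        moreover have "\<forall>\<^sub>F h in at 0. h \<noteq> (0 :: real)" by (simp add: eventually_at_filter)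
        ultimately show "\<forall>\<^sub>F h in at 0. (f (x + h) - f x) / h < b'"
        proof eventually_elim
          case (elim h)
          define u where "u = min x (x + h)"
          define v where "v = max x (x + h)"
          have q: "(f (x + h) - f x) / h = (f v - f u) / (v - u)" "u < v" "x \<in> {u..v}" "v - u = \<bar>h\<bar>"
            using quot[OF elim(2) u_def v_def] by auto
          have "\<not> upf b v < upf b u" using flat_atI[OF conts(2) q(2,3), of n b] n q(4) elim(1) by auto
          then have "f v - f u \<le> b * (v - u)" by (simp add: upf_def right_diff_distrib)
          then have "(f v - f u) / (v - u) \<le> b" using q(2) by (simp add: divide_le_eq)
          then show ?case using q(1) b by simp
        qed
      next
        fix a' assume "a' < D"
        have "0 \<le> D" unfolding D_def by (rule cInf_greatest[OF ne]) (auto simp: A_def)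
        show "\<forall>\<^sub>F h in at 0. a' < (f (x + h) - f x) / h"
        proof (cases "a' < 0")
          case True
          have "\<forall>\<^sub>F h in at 0. h \<noteq> (0 :: real)" by (simp add: eventually_at_filter)
          then show ?thesis
          proof eventually_elim
            case (elim h)
            define u where "u = min x (x + h)"
            define v where "v = max x (x + h)"
            have q: "(f (x + h) - f x) / h = (f v - f u) / (v - u)" "u < v"
              using quot[OF elim u_def v_def] by auto
            have "0 \<le> (f v - f u) / (v - u)" using lower[of u v] q(2) by simp
            then show ?case using q(1) True by simp
          qed
        next
          case False
          obtain a where a: "a \<in> \<rat>" "a' < a" "a < D" using Rats_dense_in_real[OF \<open>a' < D\<close>] by blast
          then have "a \<notin> A" using cInf_lower[OF _ bdd, of a] by (auto simp: D_def)
          then obtain n where n: "x \<notin> flat_at (lowf a) n" using a False by (auto simp: A_def)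
          have "\<forall>\<^sub>F h in at 0. \<bar>h\<bar> < 1 / real (Suc n)"
            by (rule order_tendstoD(2)[OF tendsto_rabs_zero[OF tendsto_ident_at]]) simp
          moreover have "\<forall>\<^sub>F h in at 0. h \<noteq> (0 :: real)" by (simp add: eventually_at_filter)
          ultimately show ?thesis
          proof eventually_elim
            case (elim h)
            define u where "u = min x (x + h)"
            define v where "v = max x (x + h)"
            have q: "(f (x + h) - f x) / h = (f v - f u) / (v - u)" "u < v" "x \<in> {u..v}" "v - u = \<bar>h\<bar>"
              using quot[OF elim(2) u_def v_def] by auto
            have "\<not> lowf a v < lowf a u" using flat_atI[OF conts(1) q(2,3), of n a] n q(4) elim(1) by auto
            then have "a * (v - u) \<le> f v - f u" by (simp add: lowf_def right_diff_distrib)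
            then have "a \<le> (f v - f u) / (v - u)" using q(2) by (simp add: le_divide_eq)
            then show ?case using q(1) a by simp
          qed
        qed
      qed
      then show "\<exists>D. (f has_real_derivative D) (at x)" by (auto simp: DERIV_def)
    qed
  qed
qed

definition clamp01 :: "real \<Rightarrow> real" where
  "clamp01 x = max 0 (min 1 x)"

lemma clamp01: "clamp01 x \<in> {0..1}" "x \<in> {0..1} \<Longrightarrow> clamp01 x = x"
  by (auto simp: clamp01_def)

lemma clamp01_lip: "\<bar>clamp01 x - clamp01 y\<bar> \<le> \<bar>x - y\<bar>"
  by (auto simp: clamp01_def max_def min_def)

lemma lip01_clamp: "lip01 L w \<Longrightarrow> \<bar>w (clamp01 x) - w (clamp01 y)\<bar> \<le> L * \<bar>x - y\<bar>"
  by (rule order_trans[OF lip01D[OF _ clamp01(1) clamp01(1)] mult_left_mono[OF clamp01_lip lip01_nonneg]])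

lemma lip01_AE_differentiable:
  assumes lip: "lip01 L w"
  shows "AE x in lborel. x \<in> {0<..<1} \<longrightarrow> (\<exists>D. (w has_real_derivative D) (at x))"
proof -
  \<comment> \<open>The linear term puts all slopes between 1 and 2L + 1 without affecting
    differentiability; clamping extends w to the line.\<close>
  define f where "f x = w (clamp01 x) + (L + 1) * x" for x
  have bounds: "y - x \<le> f y - f x" "f y - f x \<le> (2 * L + 1) * (y - x)" if "x \<le> y" for x y
  proof -
    have "\<bar>w (clamp01 y) - w (clamp01 x)\<bar> \<le> L * (y - x)" using lip01_clamp[OF lip, of y x] that by simp
    moreover have "f y - f x = (w (clamp01 y) - w (clamp01 x)) + L * (y - x) + (y - x)" by (simp add: f_def algebra_simps)
    moreover have "(2 * L + 1) * (y - x) = 2 * (L * (y - x)) + (y - x)" by (simp add: algebra_simps)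
    ultimately show "y - x \<le> f y - f x" "f y - f x \<le> (2 * L + 1) * (y - x)" by linarith+
  qed
  have "AE x in lborel. x \<in> {0<..<1} \<longrightarrow> (\<exists>D. (f has_real_derivative D) (at x))"
    by (rule bilipschitz_AE_differentiable) (use bounds in auto)
  then show ?thesis
  proof eventually_elim
    case (elim x)
    show ?case
    proof
      assume x: "x \<in> {0<..<1}"
      then obtain D where "(f has_real_derivative D) (at x)" using elim by blast
      then have "((\<lambda>x. f x - (L + 1) * x) has_real_derivative D - (L + 1)) (at x)"
        by (auto intro!: derivative_eq_intros)
      then have "(w has_real_derivative D - (L + 1)) (at x)"
        by (rule has_field_derivative_transform_within_open[where S = "{0<..<1}"])
           (use x in \<open>auto simp: f_def clamp01(2)\<close>)
      then show "\<exists>D. (w has_real_derivative D) (at x)" ..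
    qed
  qed
qed

section \<open>Transport on the line\<close>

abbreviation ivl01 :: "real measure" where
  "ivl01 \<equiv> restrict_space lborel {0..1}"

lemma space_ivl01 [simp]: "space ivl01 = {0..1}"
  by (simp add: space_restrict_space)

lemma borel_measurable_ivl01: "borel_measurable ivl01 = borel_measurable (restrict_space borel {0..1})"
  by (rule measurable_cong_sets) (simp_all add: sets_restrict_space)

text \<open>Passes from the closed interval with Borel sets, as used on the cube, to the open
  interval with Lebesgue sets, as used for the flow.\<close>

lemma nn_integral_ivl01:
  assumes "f \<in> borel_measurable ivl01"
  shows "(\<integral>\<^sup>+x. f x \<partial>ivl01) = (\<integral>\<^sup>+x. f x \<partial>unit_ivl)"
proof -
  have m: "(\<lambda>x. f x * indicator {0..1} x) \<in> borel_measurable borel"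
    using assms by (subst (asm) borel_measurable_restrict_space_iff_ennreal) auto
  have "(\<integral>\<^sup>+x. f x \<partial>ivl01) = (\<integral>\<^sup>+x. f x * indicator {0..1} x \<partial>lborel)"
    by (rule nn_integral_restrict_space) simp
  also have "\<dots> = (\<integral>\<^sup>+x. f x * indicator {0..1} x \<partial>lebesgue)"
    by (rule nn_integral_completion[symmetric])
  also have "\<dots> = (\<integral>\<^sup>+x. f x * indicator {0<..<1} x \<partial>lebesgue)"
  proof (rule nn_integral_cong_AE)
    have "AE x in lebesgue. x \<notin> {0, 1 :: real}"
      by (rule AE_not_in) (auto simp: negligible_iff_null_sets[symmetric])
    then show "AE x in lebesgue. f x * indicator {0..1} x = f x * indicator {0<..<1} x"
      by eventually_elim (auto simp: indicator_def)
  qed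
  also have "\<dots> = (\<integral>\<^sup>+x. f x \<partial>unit_ivl)"
    by (rule nn_integral_restrict_space[symmetric]) simp
  finally show ?thesis .
qed

lemma continuous_ivl01: "continuous_on {0..1} f \<Longrightarrow> f \<in> borel_measurable ivl01"
  for f :: "real \<Rightarrow> real"
  unfolding borel_measurable_ivl01 by (rule borel_measurable_continuous_on_restrict)

lemma continuous_ivl01_ennreal: "continuous_on {0..1} f \<Longrightarrow> (\<lambda>x. ennreal (f x)) \<in> borel_measurable ivl01"
  for f :: "real \<Rightarrow> real"
  by (rule measurable_compose[OF continuous_ivl01 measurable_ennreal])

lemma AE_ivl01I:
  assumes "AE x in lborel. x \<in> {0<..<1} \<longrightarrow> P x"
  shows "AE x in ivl01. P x"
proof -
  have "AE x in lborel. x \<noteq> 0 \<and> x \<noteq> (1 :: real)"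
    using AE_lborel_singleton[of 0] AE_lborel_singleton[of 1] by eventually_elim simp
  with assms have "AE x in lborel. x \<in> {0..1} \<longrightarrow> P x" by eventually_elim auto
  then show ?thesis by (subst AE_restrict_space_iff) auto
qed

text \<open>The step is cut off at the end point 1 while the divisor is kept, so that for Lipschitz
  w the quotient is continuous and bounded by the Lipschitz constant on all of [0, 1].\<close>

definition dquot :: "nat \<Rightarrow> (real \<Rightarrow> real) \<Rightarrow> real \<Rightarrow> real" where
  "dquot n w x = real (Suc n) * (w (min 1 (x + 1 / real (Suc n))) - w x)"

lemma dquot_continuous:
  assumes "lip01 L w"
  shows "continuous_on {0..1} (dquot n w)"
proof -
  have "continuous_on {0..1} (\<lambda>x. w (min 1 (x + 1 / real (Suc n))))"
    by (rule continuous_on_compose2[OF lip01_continuous[OF assms]]) (auto intro!: continuous_intros)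
  then show ?thesis unfolding dquot_def by (intro continuous_intros lip01_continuous[OF assms])
qed

lemma dquot_bound:
  assumes "lip01 L w" "x \<in> {0..1}"
  shows "\<bar>dquot n w x\<bar> \<le> L"
proof -
  have "\<bar>w (min 1 (x + 1 / real (Suc n))) - w x\<bar> \<le> L * \<bar>min 1 (x + 1 / real (Suc n)) - x\<bar>"
    using assms(2) by (intro lip01D[OF assms(1)]) auto
  also have "\<dots> \<le> L * (1 / real (Suc n))"
    using assms(2) lip01_nonneg[OF assms(1)] by (intro mult_left_mono) (auto simp: min_def)
  finally have "real (Suc n) * \<bar>w (min 1 (x + 1 / real (Suc n))) - w x\<bar> \<le> real (Suc n) * (L * (1 / real (Suc n)))"
    by (intro mult_left_mono) auto
  then show ?thesis by (simp add: dquot_def abs_mult)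
qed

lemma dquot_tendsto:
  assumes "x \<in> {0<..<1}" "(w has_real_derivative D) (at x)"
  shows "(\<lambda>n. dquot n w x) \<longlonglongrightarrow> D"
proof -
  have lim: "(\<lambda>n. 1 / real (Suc n)) \<longlonglongrightarrow> 0" by (rule LIMSEQ_Suc[OF lim_1_over_n])
  have "filterlim (\<lambda>n. 1 / real (Suc n)) (at 0) sequentially"
    using lim by (intro filterlim_atI) auto
  then have "(\<lambda>n. (w (x + 1 / real (Suc n)) - w x) / (1 / real (Suc n))) \<longlonglongrightarrow> D"
    using assms(2) unfolding DERIV_def by (rule filterlim_compose[rotated])
  moreover have "\<forall>\<^sub>F n in sequentially. 1 / real (Suc n) < 1 - x"
    by (rule order_tendstoD(2)[OF lim]) (use assms in simp)
  then have "\<forall>\<^sub>F n in sequentially. (w (x + 1 / real (Suc n)) - w x) / (1 / real (Suc n)) = dquot n w x"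
    by eventually_elim (simp add: dquot_def mult.commute)
  ultimately show ?thesis by (rule Lim_transform_eventually)
qed

text \<open>The integral of a difference quotient of w is a difference of two difference quotients
  of the primitive W, which converge to w x and w 0. With dominated convergence this yields the
  fundamental theorem of calculus for Lipschitz functions.\<close>

lemma integral_dquot_tendsto:
  assumes lip: "lip01 L w" and x: "x \<in> {0..1}"
  shows "(\<lambda>n. integral {0..x} (dquot n w)) \<longlonglongrightarrow> w x - w 0"
proof -
  define c where "c t = w (clamp01 t)" for t
  have "L-lipschitz_on UNIV c"
    using lip01_clamp[OF lip] lip01_nonneg[OF lip] by (auto simp: lipschitz_on_def dist_real_def c_def)
  then have c: "continuous_on A c" for A using lipschitz_on_continuous_on continuous_on_subset by blast
  \<comment> \<open>Starting at -1 makes 0 an interior point, where W has a two-sided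
    derivative.\<close>
  define W where "W t = integral {-1..t} c" for t
  have W: "(W has_real_derivative c t) (at t)" if "-1 < t" for t
  proof -
    have "(W has_real_derivative c t) (at t within {-1..t + 1})"
      unfolding W_def using that by (intro integral_has_real_derivative c) auto
    then show ?thesis using that by (subst (asm) at_within_Icc_at) auto
  qed
  have eq: "integral {0..x} (dquot n w) = (W (x + h) - W x) / h - (W (0 + h) - W 0) / h"
    if h: "h = 1 / real (Suc n)" for n h
  proof -
    have "h > 0" using h by simp
    have 1: "((\<lambda>t. c (t + h)) has_integral W (x + h) - W (0 + h)) {0..x}"
    proof (rule fundamental_theorem_of_calculus)
      fix t assume t: "t \<in> {0..x}"
      have "((\<lambda>t. W (t + h)) has_real_derivative c (t + h)) (at t)"
        using W[of "t + h"] t \<open>h > 0\<close> unfolding DERIV_shift by simp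
      then show "((\<lambda>t. W (t + h)) has_vector_derivative c (t + h)) (at t within {0..x})"
        by (simp add: has_real_derivative_iff_has_vector_derivative has_vector_derivative_at_within)
    qed (use x in auto)
    have 2: "(c has_integral W x - W 0) {0..x}"
    proof (rule fundamental_theorem_of_calculus)
      fix t assume t: "t \<in> {0..x}"
      then show "(W has_vector_derivative c t) (at t within {0..x})"
        using W[of t] by (simp add: has_real_derivative_iff_has_vector_derivative has_vector_derivative_at_within)
    qed (use x in auto)
    have "((\<lambda>t. real (Suc n) * (c (t + h) - c t)) has_integral
        real (Suc n) * ((W (x + h) - W (0 + h)) - (W x - W 0))) {0..x}"
      by (intro has_integral_mult_right has_integral_diff 1 2)
    then have "(dquot n w has_integral real (Suc n) * ((W (x + h) - W (0 + h)) - (W x - W 0))) {0..x}"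
      by (rule has_integral_eq[rotated]) (use x h in \<open>auto simp: dquot_def c_def clamp01_def\<close>)
    then have "integral {0..x} (dquot n w) = real (Suc n) * ((W (x + h) - W (0 + h)) - (W x - W 0))"
      by (rule integral_unique)
    also have "real (Suc n) = 1 / h" using h by simp
    finally show ?thesis by (simp add: diff_divide_distrib)
  qed
  have "filterlim (\<lambda>n. 1 / real (Suc n)) (at 0) sequentially"
    using LIMSEQ_Suc[OF lim_1_over_n] by (intro filterlim_atI) auto
  then have quot: "(\<lambda>n. (W (t + 1 / real (Suc n)) - W t) / (1 / real (Suc n))) \<longlonglongrightarrow> c t" if "-1 < t" for t
    using W[OF that] unfolding DERIV_def by (rule filterlim_compose[rotated])
  have "(\<lambda>n. (W (x + 1 / real (Suc n)) - W x) / (1 / real (Suc n)) - (W (0 + 1 / real (Suc n)) - W 0) / (1 / real (Suc n)))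
      \<longlonglongrightarrow> c x - c 0"
    using x by (intro tendsto_diff quot) auto
  then have "(\<lambda>n. integral {0..x} (dquot n w)) \<longlonglongrightarrow> c x - c 0"
    by (simp only: eq[OF refl])
  then show ?thesis using x by (simp add: c_def clamp01(2))
qed

lemma vol_mono_coneI:
  assumes "AE x in unit_ivl. 0 \<le> l2_fun u x"
  shows "vol u \<in> mono_cone"
proof -
  have "mono_on {0<..<1} (prim u)"
  proof (rule mono_onI)
    fix x y :: real assume xy: "x \<in> {0<..<1}" "y \<in> {0<..<1}" "x \<le> y"
    have "0 * (y - x) \<le> prim u y - prim u x"
      by (rule prim_diff_ge) (use xy assms in \<open>auto elim: eventually_mono\<close>)
    then show "prim u x \<le> prim u y" by simp
  qed
  then show ?thesis unfolding vol_def by (intro l2_of_mono_coneI prim_L2)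
qed

text \<open>For q = w - iso w, orthogonality and the test w + vol v give |q|^2 = <q,w> <= <vol q, v>
  <= |q| |v|, and |vol q| <= |q|.\<close>

lemma iso_defect_le:
  assumes "w + vol v \<in> mono_cone"
  shows "norm (vol (w - iso w)) \<le> norm v"
proof -
  define q where "q = w - iso w"
  have q: "q \<in> polar" unfolding q_def by (rule iso_polar)
  have "norm q * norm q = inner q w"
    using iso_orthogonal[of w] by (simp add: q_def inner_diff_right power2_norm_eq_inner[symmetric] power2_eq_square[symmetric])
      (simp add: power2_norm_eq_inner inner_diff_right)
  also have "\<dots> \<le> inner (vol q) v"
    using inner_polar_le[OF q assms] polar_vol[OF q, of v] by (simp add: inner_add_right)
  also have "\<dots> \<le> norm (vol q) * norm v" by (rule norm_cauchy_schwarz)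
  also have "\<dots> \<le> norm q * norm v" by (intro mult_right_mono norm_vol_le) simp
  finally have "norm q \<le> norm v" by (cases "q = 0") auto
  with norm_vol_le[of q] show ?thesis unfolding q_def by simp
qed

text \<open>The correction V is the negative part of the derivative of w, so w + vol V is
  nondecreasing and \<open>iso_defect_le\<close> applies. Fatou's lemma leaves the right side as a
  lower limit of difference quotient energies, the form that is controlled under rearrangement in
  other directions.\<close>

lemma line_energy:
  assumes lip: "lip01 L w"
  defines "p \<equiv> flow_limit_cont w"
  shows "(\<integral>\<^sup>+x. ennreal ((integral {0..x} w - integral {0..x} p)\<^sup>2) \<partial>ivl01)
      \<le> liminf (\<lambda>n. \<integral>\<^sup>+x. ennreal ((max 0 (- dquot n w x))\<^sup>2) \<partial>ivl01)"
proof -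
  note L0 = lip01_nonneg[OF lip]
  note p = flow_limit_cont_lip01[OF lip, folded p_def]
  have dq_meas: "dquot n w \<in> borel_measurable unit_ivl" for n
    by (rule continuous_on_unit_measurable[OF dquot_continuous[OF lip]])
  \<comment> \<open>Almost everywhere the derivative of w, and measurable by construction as a limit
    of continuous functions.\<close>
  define v where "v x = lim (\<lambda>n. dquot n w x)" for x
  have v_meas: "v \<in> borel_measurable unit_ivl"
    unfolding v_def by (rule borel_measurable_lim_metric[OF dq_meas])
  have conv: "AE x in unit_ivl. (\<lambda>n. dquot n w x) \<longlonglongrightarrow> v x"
  proof -
    have "AE x in lebesgue. x \<in> {0<..<1} \<longrightarrow> (\<exists>D. (w has_real_derivative D) (at x))"
      using lip01_AE_differentiable[OF lip] by (rule AE_completion)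
    then have "AE x in unit_ivl. \<exists>D. (w has_real_derivative D) (at x)" unfolding AE_unit_ivl_iff .
    then show ?thesis using AE_in_unit_ivl
    proof eventually_elim
      case (elim x)
      then obtain D where "(w has_real_derivative D) (at x)" by blast
      from dquot_tendsto[OF elim(2) this] show ?case unfolding v_def by (simp add: limI)
    qed
  qed
  have v_bound: "AE x in unit_ivl. \<bar>v x\<bar> \<le> \<bar>L\<bar>"
    using conv AE_in_unit_ivl
  proof eventually_elim
    case (elim x)
    have "\<bar>v x\<bar> \<le> L"
      by (rule LIMSEQ_le_const2[OF tendsto_rabs[OF elim(1)]]) (use dquot_bound[OF lip, of x] elim(2) in auto)
    then show ?case using L0 by simp
  qed
  have v_L2: "v \<in> L2" by (rule L2_bound[OF v_meas L2_const v_bound])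
  have prim_v: "prim (l2_of v) x = w x - w 0" if x: "x \<in> {0..1}" for x
  proof -
    have "(\<lambda>n. \<integral>t. dquot n w t * indicator {..x} t \<partial>unit_ivl) \<longlonglongrightarrow> (\<integral>t. v t * indicator {..x} t \<partial>unit_ivl)"
    proof (rule integral_dominated_convergence[where w = "\<lambda>_. L"])
      show "AE t in unit_ivl. (\<lambda>n. dquot n w t * indicator {..x} t) \<longlonglongrightarrow> v t * indicator {..x} t"
        using conv by eventually_elim (intro tendsto_intros)
      show "AE t in unit_ivl. norm (dquot n w t * indicator {..x} t) \<le> L" for n
        using dquot_bound[OF lip] L0 by (intro AE_unit_ivl_I) (auto simp: abs_mult indicator_def)
    qed (use v_meas dq_meas in auto)
    moreover have "(\<integral>t. dquot n w t * indicator {..x} t \<partial>unit_ivl) = integral {0..x} (dquot n w)" for n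
    proof -
      note L2 = continuous_on_unit_L2[OF dquot_continuous[OF lip]]
      have "(\<integral>t. dquot n w t * indicator {..x} t \<partial>unit_ivl) = prim (l2_of (dquot n w)) x"
        unfolding prim_def step_def using inner_l2_of[OF L2 indicator_L2] by (simp add: l2_inner_def)
      then show ?thesis using prim_continuous_fun[OF dquot_continuous[OF lip] x] by simp
    qed
    moreover have "(\<integral>t. v t * indicator {..x} t \<partial>unit_ivl) = prim (l2_of v) x"
      unfolding prim_def step_def using inner_l2_of[OF v_L2 indicator_L2] by (simp add: l2_inner_def)
    ultimately show ?thesis using integral_dquot_tendsto[OF lip x] LIMSEQ_unique by auto
  qed
  define V where "V = l2_of (\<lambda>x. max 0 (- v x))"
  have V_L2: "(\<lambda>x. max 0 (- v x)) \<in> L2" by (intro L2_max L2_const L2_uminus v_L2)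
  have w_eq: "l2_of w = w 0 *\<^sub>R one + vol (l2_of v)"
    unfolding l2_eq_iff
    using l2_fun_of[OF lip01_L2[OF lip]] l2_fun_add[of "w 0 *\<^sub>R one" "vol (l2_of v)"] l2_fun_scaleR[of "w 0" one]
      l2_fun_one l2_fun_vol[of "l2_of v"] AE_in_unit_ivl
    by eventually_elim (simp add: prim_v)
  have "vol (l2_of v + V) \<in> mono_cone"
  proof (rule vol_mono_coneI)
    show "AE x in unit_ivl. 0 \<le> l2_fun (l2_of v + V) x"
      using l2_fun_add[of "l2_of v" V] l2_fun_of[OF v_L2] l2_fun_of[OF V_L2] unfolding V_def
      by eventually_elim simp
  qed
  then have "l2_of w + vol V \<in> mono_cone"
    using mono_cone_add_const[of "vol (l2_of v + V)" "w 0"] by (simp add: w_eq vol_add add_ac)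
  then have le: "norm (vol (l2_of w - iso (l2_of w))) \<le> norm V" by (rule iso_defect_le)
  define q where "q = l2_of w - iso (l2_of w)"
  have prim_q: "prim q x = integral {0..x} w - integral {0..x} p" if "x \<in> {0..1}" for x
    using that p(2)[symmetric] prim_continuous_fun[OF lip01_continuous[OF lip]] prim_continuous_fun[OF lip01_continuous[OF p(1)]]
    by (simp add: q_def prim_diff)
  have "(\<integral>\<^sup>+x. ennreal ((integral {0..x} w - integral {0..x} p)\<^sup>2) \<partial>ivl01) = (\<integral>\<^sup>+x. ennreal ((prim q x)\<^sup>2) \<partial>ivl01)"
    by (intro nn_integral_cong) (simp add: prim_q)
  also have "\<dots> = (\<integral>\<^sup>+x. ennreal ((prim q x)\<^sup>2) \<partial>unit_ivl)"
    by (intro nn_integral_ivl01 continuous_ivl01_ennreal continuous_intros prim_continuous)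
  also have "\<dots> = (\<integral>\<^sup>+x. ennreal ((l2_fun (vol q) x)\<^sup>2) \<partial>unit_ivl)"
    using l2_fun_vol[of q] by (intro nn_integral_cong_AE) (auto elim: eventually_mono)
  also have "\<dots> = ennreal ((norm (vol q))\<^sup>2)"
    unfolding norm_l2_sq by (rule nn_integral_eq_integral[OF L2_square_integrable[OF l2_fun_L2]]) simp
  also have "\<dots> \<le> ennreal ((norm V)\<^sup>2)" using le unfolding q_def by (intro ennreal_leI power_mono) auto
  also have "\<dots> = (\<integral>\<^sup>+x. ennreal ((l2_fun V x)\<^sup>2) \<partial>unit_ivl)"
    unfolding norm_l2_sq by (rule nn_integral_eq_integral[OF L2_square_integrable[OF l2_fun_L2], symmetric]) simp
  also have "\<dots> = (\<integral>\<^sup>+x. liminf (\<lambda>n. ennreal ((max 0 (- dquot n w x))\<^sup>2)) \<partial>unit_ivl)"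
  proof (rule nn_integral_cong_AE)
    show "AE x in unit_ivl. ennreal ((l2_fun V x)\<^sup>2) = liminf (\<lambda>n. ennreal ((max 0 (- dquot n w x))\<^sup>2))"
      using conv l2_fun_of[OF V_L2]
    proof eventually_elim
      case (elim x)
      have "(\<lambda>n. ennreal ((max 0 (- dquot n w x))\<^sup>2)) \<longlonglongrightarrow> ennreal ((max 0 (- v x))\<^sup>2)"
        by (intro tendsto_ennrealI tendsto_intros elim)
      then have "liminf (\<lambda>n. ennreal ((max 0 (- dquot n w x))\<^sup>2)) = ennreal ((max 0 (- v x))\<^sup>2)"
        by (intro lim_imp_Liminf) auto
      then show ?case using elim(2) by (simp add: V_def)
    qed
  qed
  also have "\<dots> \<le> liminf (\<lambda>n. \<integral>\<^sup>+x. ennreal ((max 0 (- dquot n w x))\<^sup>2) \<partial>unit_ivl)"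
    by (intro nn_integral_liminf measurable_compose[OF _ measurable_ennreal] continuous_on_unit_measurable
      continuous_intros dquot_continuous[OF lip])
  also have "(\<lambda>n. \<integral>\<^sup>+x. ennreal ((max 0 (- dquot n w x))\<^sup>2) \<partial>unit_ivl) = (\<lambda>n. \<integral>\<^sup>+x. ennreal ((max 0 (- dquot n w x))\<^sup>2) \<partial>ivl01)"
    by (intro ext nn_integral_ivl01[symmetric] continuous_ivl01_ennreal continuous_intros dquot_continuous[OF lip])
  finally show ?thesis .
qed

lemma line_contraction:
  assumes "lip01 L v" "lip01 L' w"
  shows "(\<integral>\<^sup>+x. ennreal ((max 0 (flow_limit_cont w x - flow_limit_cont v x))\<^sup>2) \<partial>ivl01)
      \<le> (\<integral>\<^sup>+x. ennreal ((max 0 (w x - v x))\<^sup>2) \<partial>ivl01)"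
proof -
  have eq: "(\<integral>\<^sup>+x. ennreal ((max 0 (g x - f x))\<^sup>2) \<partial>ivl01) = ennreal (\<integral>x. (max 0 (g x - f x))\<^sup>2 \<partial>unit_ivl)"
    if f: "continuous_on {0..1} f" and g: "continuous_on {0..1} g" for f g :: "real \<Rightarrow> real"
  proof -
    have c: "continuous_on {0..1} (\<lambda>x. max 0 (g x - f x))" by (intro continuous_intros f g)
    have "(\<integral>\<^sup>+x. ennreal ((max 0 (g x - f x))\<^sup>2) \<partial>ivl01) = (\<integral>\<^sup>+x. ennreal ((max 0 (g x - f x))\<^sup>2) \<partial>unit_ivl)"
      by (intro nn_integral_ivl01 continuous_ivl01_ennreal continuous_intros f g)
    also have "\<dots> = ennreal (\<integral>x. (max 0 (g x - f x))\<^sup>2 \<partial>unit_ivl)"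
      by (rule nn_integral_eq_integral[OF L2_square_integrable[OF continuous_on_unit_L2[OF c]]]) simp
    finally show ?thesis .
  qed
  have c: "continuous_on {0..1} v" "continuous_on {0..1} w" "continuous_on {0..1} (flow_limit_cont v)" "continuous_on {0..1} (flow_limit_cont w)"
    using assms flow_limit_cont_lip01(1)[OF assms(1)] flow_limit_cont_lip01(1)[OF assms(2)] lip01_continuous by blast+
  show ?thesis unfolding eq[OF c(1,2)] eq[OF c(3,4)] by (intro ennreal_leI flow_limit_cont_contraction[OF assms])
qed

lemma flow_limit_cont_integral_le:
  assumes lip: "lip01 L w" and x: "x \<in> {0..1}"
  shows "integral {0..x} (flow_limit_cont w) \<le> integral {0..x} w"
    "integral {0..1} (flow_limit_cont w) = integral {0..1} w"
proof -
  note p = flow_limit_cont_lip01[OF lip]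
  define q where "q = l2_of w - iso (l2_of w)"
  have q: "q \<in> polar" unfolding q_def by (rule iso_polar)
  have prim_q: "prim q x = integral {0..x} w - integral {0..x} (flow_limit_cont w)" if "x \<in> {0..1}" for x
    using that p(2)[symmetric] prim_continuous_fun[OF lip01_continuous[OF lip]] prim_continuous_fun[OF lip01_continuous[OF p(1)]]
    by (simp add: q_def prim_diff)
  show "integral {0..x} (flow_limit_cont w) \<le> integral {0..x} w" using polar_prim_nonneg[OF q, of x] prim_q[OF x] by simp
  show "integral {0..1} (flow_limit_cont w) = integral {0..1} w" using polar_prim_1[OF q] prim_q[of 1] by simp
qed

section \<open>The monotone transport map between two densities\<close>

definition tmap :: "(real \<Rightarrow> real) \<Rightarrow> (real \<Rightarrow> real) \<Rightarrow> real \<Rightarrow> real" where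
  "tmap w p s = (SOME y. y \<in> {0..1} \<and> integral {0..y} p = integral {0..s} w)"

text \<open>The lower bound makes both distribution functions strictly increasing, so that the
  choice in \<open>tmap\<close> is unique; the order of the distribution functions makes the map
  move points to the right.\<close>

locale line_transport =
  fixes w p :: "real \<Rightarrow> real" and lo :: real
  assumes w: "continuous_on {0..1} w" and p: "continuous_on {0..1} p" and lo: "0 < lo"
    and w_lo: "\<And>x. x \<in> {0..1} \<Longrightarrow> lo \<le> w x" and p_lo: "\<And>x. x \<in> {0..1} \<Longrightarrow> lo \<le> p x"
    and le: "\<And>x. x \<in> {0..1} \<Longrightarrow> integral {0..x} p \<le> integral {0..x} w"
    and total: "integral {0..1} p = integral {0..1} w"
begin

lemma integral_diff_ge:
  assumes f: "continuous_on {0..1} (f :: real \<Rightarrow> real)" "\<And>x. x \<in> {0..1} \<Longrightarrow> lo \<le> f x" and ab: "0 \<le> a" "a \<le> b" "b \<le> (1 :: real)"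
  shows "integral {0..b} f - integral {0..a} f = integral {a..b} f" "lo * (b - a) \<le> integral {a..b} f"
proof -
  have int: "f integrable_on {c..d}" if "0 \<le> c" "d \<le> 1" for c d
    by (rule integrable_continuous_real[OF continuous_on_subset[OF f(1)]]) (use that in auto)
  have "integral {0..a} f + integral {a..b} f = integral {0..b} f"
    using ab int by (intro Henstock_Kurzweil_Integration.integral_combine) auto
  then show "integral {0..b} f - integral {0..a} f = integral {a..b} f" by simp
  have "integral {a..b} (\<lambda>_. lo) \<le> integral {a..b} f"
    using ab int f(2) by (intro integral_le) auto
  then show "lo * (b - a) \<le> integral {a..b} f" using ab by (simp add: mult.commute)
qed

lemma integral_less_iff:
  assumes f: "continuous_on {0..1} (f :: real \<Rightarrow> real)" "\<And>x. x \<in> {0..1} \<Longrightarrow> lo \<le> f x" and ab: "a \<in> {0..1}" "b \<in> {0..1}"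
  shows "integral {0..a} f < integral {0..b} f \<longleftrightarrow> a < b"
proof -
  have less: "integral {0..a} f < integral {0..b} f" if "0 \<le> a" "a < b" "b \<le> 1" for a b :: real
  proof -
    have "0 < lo * (b - a)" using lo that by simp
    then show ?thesis using integral_diff_ge[OF f, of a b] that by simp
  qed
  show ?thesis using less[of a b] less[of b a] ab by (cases a b rule: linorder_cases) auto
qed

lemma integral_le_iff:
  assumes f: "continuous_on {0..1} (f :: real \<Rightarrow> real)" "\<And>x. x \<in> {0..1} \<Longrightarrow> lo \<le> f x" and ab: "a \<in> {0..1}" "b \<in> {0..1}"
  shows "integral {0..a} f \<le> integral {0..b} f \<longleftrightarrow> a \<le> b"
  using integral_less_iff[OF f ab(2,1)] by linarith

lemma tmap:
  assumes s: "s \<in> {0..1}"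
  shows "tmap w p s \<in> {0..1}" "integral {0..tmap w p s} p = integral {0..s} w"
proof -
  have "continuous_on {0..1} (\<lambda>y. integral {0..y} p)"
    by (rule indefinite_integral_continuous_1[OF integrable_continuous_real[OF p]])
  moreover have "integral {0..s} w \<le> integral {0..1} p"
    using integral_le_iff[OF w w_lo, of s 1] s total by simp
  moreover have "0 \<le> integral {0..s} w"
    using integral_le_iff[OF w w_lo, of 0 s] s by simp
  ultimately obtain y where "0 \<le> y" "y \<le> 1" "integral {0..y} p = integral {0..s} w"
    using IVT'[of "\<lambda>y. integral {0..y} p" 0 "integral {0..s} w" 1] by auto
  then have "\<exists>y. y \<in> {0..1} \<and> integral {0..y} p = integral {0..s} w" by auto
  then have "tmap w p s \<in> {0..1} \<and> integral {0..tmap w p s} p = integral {0..s} w"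
    unfolding tmap_def by (rule someI_ex)
  then show "tmap w p s \<in> {0..1}" "integral {0..tmap w p s} p = integral {0..s} w" by auto
qed

lemma tmap_greater_iff:
  assumes "s \<in> {0..1}" "c \<in> {0..1}"
  shows "c < tmap w p s \<longleftrightarrow> integral {0..c} p < integral {0..s} w"
  using integral_less_iff[OF p p_lo assms(2) tmap(1)[OF assms(1)]] tmap(2)[OF assms(1)] by simp

lemma tmap_ge:
  assumes s: "s \<in> {0..1}"
  shows "s \<le> tmap w p s"
  using integral_le_iff[OF p p_lo s tmap(1)[OF s]] tmap(2)[OF s] le[OF s] by simp

text \<open>The p-mass between s and its image equals the excess of the w-mass over the p-mass on
  [0, s], and the density p is at least \<open>lo\<close>.\<close>

lemma tmap_displacement:
  assumes s: "s \<in> {0..1}"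
  shows "tmap w p s - s \<le> (integral {0..s} w - integral {0..s} p) / lo"
proof -
  have "lo * (tmap w p s - s) \<le> integral {0..s} w - integral {0..s} p"
    using integral_diff_ge[OF p p_lo, of s "tmap w p s"] tmap[OF s] tmap_ge[OF s] s by simp
  then show ?thesis using lo by (simp add: pos_le_divide_eq mult.commute)
qed

lemma nn_integral_Ioi:
  assumes f: "continuous_on {0..1} (f :: real \<Rightarrow> real)" "\<And>x. x \<in> {0..1} \<Longrightarrow> lo \<le> f x" and c: "c \<in> {0..1}"
  shows "(\<integral>\<^sup>+x. ennreal (f x) * indicator {c<..} x \<partial>ivl01) = ennreal (integral {c..1} f)"
proof -
  define g where "g x = indicator {c..1} x * f (clamp01 x)" for x
  have "continuous_on UNIV (\<lambda>x. f (clamp01 x))"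
  proof (rule continuous_on_compose2[OF f(1)])
    show "continuous_on UNIV clamp01" unfolding clamp01_def by (intro continuous_intros)
  qed (use clamp01(1) in auto)
  then have g_meas: "g \<in> borel_measurable borel"
    unfolding g_def by (intro borel_measurable_times[OF borel_measurable_indicator borel_measurable_continuous_onI]) simp_all
  have "(\<integral>\<^sup>+x. ennreal (f x) * indicator {c<..} x \<partial>ivl01) = (\<integral>\<^sup>+x. ennreal (f x) * indicator {c<..} x * indicator {0..1} x \<partial>lborel)"
    by (rule nn_integral_restrict_space) simp
  also have "\<dots> = (\<integral>\<^sup>+x. ennreal (g x) \<partial>lborel)"
  proof (rule nn_integral_cong_AE)
    show "AE x in lborel. ennreal (f x) * indicator {c<..} x * indicator {0..1} x = ennreal (g x)"
      using AE_lborel_singleton[of c] by eventually_elim (use c in \<open>auto simp: g_def indicator_def clamp01(2)\<close>)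
  qed
  also have "\<dots> = ennreal (integral {c..1} f)"
  proof (rule nn_integral_has_integral_lborel[OF g_meas])
    show "0 \<le> g x" for x using f(2)[OF clamp01(1), of x] lo by (auto simp: g_def indicator_def)
    have "(f has_integral integral {c..1} f) {c..1}"
      by (rule integrable_integral, rule integrable_continuous_real[OF continuous_on_subset[OF f(1)]]) (use c in auto)
    then have "((\<lambda>x. if x \<in> {c..1} then f x else 0) has_integral integral {c..1} f) UNIV"
      unfolding has_integral_restrict_UNIV .
    then show "(g has_integral integral {c..1} f) UNIV"
      by (rule has_integral_eq[rotated]) (use c in \<open>auto simp: g_def indicator_def clamp01(2)\<close>)
  qed
  finally show ?thesis .
qed

lemma tmap_mono: "s \<in> {0..1} \<Longrightarrow> t \<in> {0..1} \<Longrightarrow> s \<le> t \<Longrightarrow> tmap w p s \<le> tmap w p t"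
  using integral_le_iff[OF p p_lo tmap(1) tmap(1), of s t] tmap(2)[of s] tmap(2)[of t] integral_le_iff[OF w w_lo, of s t]
  by simp

lemma tmap_measurable: "tmap w p \<in> borel_measurable ivl01"
proof -
  have "mono_on {0..1} (tmap w p)" by (intro mono_onI tmap_mono)
  then have "tmap w p \<in> borel_measurable (restrict_space borel {0..1})" by (rule borel_measurable_mono_on_fnc)
  then show ?thesis unfolding borel_measurable_ivl01 .
qed

text \<open>The image measures on the line agree once they agree on half lines above c: for c in [0,
  1) the map exceeds c exactly above the point \<sigma> where the w-mass reaches the p-mass of
  [0, c].\<close>

lemma tmap_push:
  assumes h: "h \<in> borel_measurable ivl01"
  shows "(\<integral>\<^sup>+s. ennreal (w s) * h (tmap w p s) \<partial>ivl01) = (\<integral>\<^sup>+y. ennreal (p y) * h y \<partial>ivl01)"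
proof -
  have wm: "w \<in> borel_measurable ivl01" and pm: "p \<in> borel_measurable ivl01" by (intro continuous_ivl01 w p)+
  have id: "(\<lambda>x. x) \<in> borel_measurable ivl01" by (intro continuous_ivl01 continuous_intros)
  define M1 where "M1 = distr (density ivl01 (\<lambda>s. ennreal (w s))) borel (tmap w p)"
  define M2 where "M2 = distr (density ivl01 (\<lambda>s. ennreal (p s))) borel (\<lambda>y. y)"
  have wm': "(\<lambda>s. ennreal (w s)) \<in> borel_measurable ivl01" and pm': "(\<lambda>s. ennreal (p s)) \<in> borel_measurable ivl01"
    using wm pm by measurable
  have i1: "(\<integral>\<^sup>+y. k y \<partial>M1) = (\<integral>\<^sup>+s. ennreal (w s) * k (tmap w p s) \<partial>ivl01)" if "k \<in> borel_measurable borel" for k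
  proof -
    have "(\<integral>\<^sup>+y. k y \<partial>M1) = (\<integral>\<^sup>+s. k (tmap w p s) \<partial>density ivl01 (\<lambda>s. ennreal (w s)))"
      unfolding M1_def using that tmap_measurable by (intro nn_integral_distr) auto
    also have "\<dots> = (\<integral>\<^sup>+s. ennreal (w s) * k (tmap w p s) \<partial>ivl01)"
      by (rule nn_integral_density[OF wm' measurable_compose[OF tmap_measurable that]])
    finally show ?thesis .
  qed
  have i2: "(\<integral>\<^sup>+y. k y \<partial>M2) = (\<integral>\<^sup>+s. ennreal (p s) * k s \<partial>ivl01)" if "k \<in> borel_measurable borel" for k
  proof -
    have "(\<integral>\<^sup>+y. k y \<partial>M2) = (\<integral>\<^sup>+s. k s \<partial>density ivl01 (\<lambda>s. ennreal (p s)))"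
      unfolding M2_def using that id by (intro nn_integral_distr) auto
    also have "\<dots> = (\<integral>\<^sup>+s. ennreal (p s) * k s \<partial>ivl01)"
      by (rule nn_integral_density[OF pm' measurable_compose[OF id that]])
    finally show ?thesis .
  qed
  have e1: "emeasure M1 {c<..} = (\<integral>\<^sup>+s. ennreal (w s) * indicator {c<..} (tmap w p s) \<partial>ivl01)"
    and e2: "emeasure M2 {c<..} = (\<integral>\<^sup>+s. ennreal (p s) * indicator {c<..} s \<partial>ivl01)" for c
    using i1[of "indicator {c<..}"] i2[of "indicator {c<..}"] by (simp_all add: M1_def M2_def)
  have ae0: "AE s in ivl01. 0 < s" by (rule AE_ivl01I) auto
  have total': "(\<integral>\<^sup>+s. ennreal (f s) \<partial>ivl01) = ennreal (integral {0..1} f)"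
    if "continuous_on {0..1} f" "\<And>x. x \<in> {0..1} \<Longrightarrow> lo \<le> f x" for f
  proof -
    have "(\<integral>\<^sup>+s. ennreal (f s) \<partial>ivl01) = (\<integral>\<^sup>+s. ennreal (f s) * indicator {0<..} s \<partial>ivl01)"
      using ae0 by (intro nn_integral_cong_AE) (auto elim: eventually_mono)
    also have "\<dots> = ennreal (integral {0..1} f)" by (rule nn_integral_Ioi[OF that]) auto
    finally show ?thesis .
  qed
  have key: "emeasure M1 {c<..} = emeasure M2 {c<..} \<and> emeasure M1 {c<..} < \<infinity>" for c
  proof -
    consider "c < 0" | "1 \<le> c" | "0 \<le> c" "c < 1" by linarith
    then show ?thesis
    proof cases
      case 1
      have "emeasure M1 {c<..} = (\<integral>\<^sup>+s. ennreal (w s) \<partial>ivl01)"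
        unfolding e1
      proof (rule nn_integral_cong)
        fix s assume "s \<in> space ivl01"
        then have "c < tmap w p s" using tmap(1)[of s] 1 by simp
        then show "ennreal (w s) * indicator {c<..} (tmap w p s) = ennreal (w s)" by simp
      qed
      moreover have "emeasure M2 {c<..} = (\<integral>\<^sup>+s. ennreal (p s) \<partial>ivl01)"
        unfolding e2 using 1 by (intro nn_integral_cong) (simp add: indicator_def)
      ultimately show ?thesis using total'[OF w w_lo] total'[OF p p_lo] total by simp
    next
      case 2
      have "emeasure M1 {c<..} = (\<integral>\<^sup>+s. 0 \<partial>ivl01)"
        unfolding e1
      proof (rule nn_integral_cong)
        fix s assume "s \<in> space ivl01"
        then have "\<not> c < tmap w p s" using tmap(1)[of s] 2 by simp
        then show "ennreal (w s) * indicator {c<..} (tmap w p s) = 0" by simp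
      qed
      moreover have "emeasure M2 {c<..} = (\<integral>\<^sup>+s. 0 \<partial>ivl01)"
        unfolding e2 using 2 by (intro nn_integral_cong) (simp add: indicator_def)
      ultimately show ?thesis by simp
    next
      case 3
      then have c: "c \<in> {0..1}" by simp
      have "continuous_on {0..1} (\<lambda>y. integral {0..y} w)"
        by (rule indefinite_integral_continuous_1[OF integrable_continuous_real[OF w]])
      moreover have "integral {0..c} p \<le> integral {0..1} w"
        using integral_le_iff[OF p p_lo, of c 1] c total by simp
      moreover have "0 \<le> integral {0..c} p"
        using integral_le_iff[OF p p_lo, of 0 c] c by simp
      ultimately obtain \<sigma> where \<sigma>: "0 \<le> \<sigma>" "\<sigma> \<le> 1" "integral {0..\<sigma>} w = integral {0..c} p"
        using IVT'[of "\<lambda>y. integral {0..y} w" 0 "integral {0..c} p" 1] by auto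
      have "emeasure M1 {c<..} = (\<integral>\<^sup>+s. ennreal (w s) * indicator {\<sigma><..} s \<partial>ivl01)"
        unfolding e1
      proof (rule nn_integral_cong)
        fix s assume "s \<in> space ivl01"
        then have s: "s \<in> {0..1}" by simp
        have "c < tmap w p s \<longleftrightarrow> \<sigma> < s"
          using tmap_greater_iff[OF s c] integral_less_iff[OF w w_lo, of \<sigma> s] \<sigma> s by simp
        then show "ennreal (w s) * indicator {c<..} (tmap w p s) = ennreal (w s) * indicator {\<sigma><..} s"
          by (simp add: indicator_def)
      qed
      also have "\<dots> = ennreal (integral {\<sigma>..1} w)" using \<sigma> by (intro nn_integral_Ioi[OF w w_lo]) auto
      also have "integral {\<sigma>..1} w = integral {c..1} p"
        using integral_diff_ge(1)[OF w w_lo, of \<sigma> 1] integral_diff_ge(1)[OF p p_lo, of c 1] \<sigma> c total by simp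
      also have "ennreal (integral {c..1} p) = emeasure M2 {c<..}"
        unfolding e2 by (rule nn_integral_Ioi[OF p p_lo c, symmetric])
      finally have "emeasure M1 {c<..} = emeasure M2 {c<..}" .
      moreover have "emeasure M2 {c<..} = ennreal (integral {c..1} p)"
        unfolding e2 by (rule nn_integral_Ioi[OF p p_lo c])
      then have "emeasure M2 {c<..} < \<infinity>" by simp
      ultimately show ?thesis by simp
    qed
  qed
  have "sets M1 = sets borel" "sets M2 = sets borel" by (simp_all add: M1_def M2_def)
  then have "M1 = M2" by (rule measure_eqI_lessThan) (metis key)+
  \<comment> \<open>h is a test function on the interval only; clamping extends it to the line,
    where the two measures live.\<close>
  define k where "k y = h (clamp01 y)" for y
  have "clamp01 \<in> borel \<rightarrow>\<^sub>M ivl01"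
  proof (rule measurable_restrict_space2)
    show "clamp01 \<in> borel \<rightarrow>\<^sub>M lborel"
      unfolding clamp01_def by (simp add: measurable_lborel1)
  qed (use clamp01(1) in auto)
  then have k: "k \<in> borel_measurable borel" unfolding k_def using h by (rule measurable_compose)
  have "(\<integral>\<^sup>+s. ennreal (w s) * h (tmap w p s) \<partial>ivl01) = (\<integral>\<^sup>+s. ennreal (w s) * k (tmap w p s) \<partial>ivl01)"
    by (intro nn_integral_cong) (simp add: k_def clamp01(2)[OF tmap(1)])
  also have "\<dots> = (\<integral>\<^sup>+s. ennreal (p s) * k s \<partial>ivl01)" using i1[OF k] i2[OF k] \<open>M1 = M2\<close> by simp
  also have "\<dots> = (\<integral>\<^sup>+y. ennreal (p y) * h y \<partial>ivl01)"
    by (intro nn_integral_cong) (simp add: k_def clamp01(2))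
  finally show ?thesis .
qed

end

section \<open>Fubini on the cube\<close>

lemma space_cube_measure [simp]: "space (cube_measure d) = cube d"
  by (simp add: cube_measure_def cube_def space_PiM)

lemma cube_coord: "x \<in> cube d \<Longrightarrow> i \<in> {1..d} \<Longrightarrow> x i \<in> {0..1}"
  unfolding cube_def by (rule PiE_mem)

lemma cube_upd: "x \<in> cube d \<Longrightarrow> k \<in> {1..d} \<Longrightarrow> s \<in> {0..1} \<Longrightarrow> x(k := s) \<in> cube d"
  unfolding cube_def by (auto simp: PiE_iff extensional_def)

lemma emeasure_ivl01: "emeasure ivl01 {0..1} = 1"
  by (simp add: emeasure_restrict_space)

lemma sigma_finite_ivl01: "sigma_finite_measure ivl01"
  using finite_measureI[of ivl01] by (simp add: emeasure_ivl01 finite_measure_def)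

interpretation ivl01: product_sigma_finite "\<lambda>_ :: nat. ivl01"
  by (rule product_sigma_finite.intro[OF sigma_finite_ivl01])

lemma coord_measurable:
  assumes "i \<in> {1..d}"
  shows "(\<lambda>x. x i) \<in> cube_measure d \<rightarrow>\<^sub>M ivl01"
  unfolding cube_measure_def by (rule measurable_component_singleton[OF assms])

lemma upd_measurable:
  assumes k: "k \<in> {1..d}" and f: "f \<in> N \<rightarrow>\<^sub>M cube_measure d" and g: "g \<in> N \<rightarrow>\<^sub>M ivl01"
  shows "(\<lambda>x. (f x)(k := g x)) \<in> N \<rightarrow>\<^sub>M cube_measure d"
  using assms unfolding cube_measure_def by (intro measurable_fun_upd[where J = "{1..d}"]) auto

lemma line_measurable:
  assumes k: "k \<in> {1..d}" and x: "x \<in> cube d" and h: "h \<in> cube_measure d \<rightarrow>\<^sub>M N"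
  shows "(\<lambda>s. h (x(k := s))) \<in> ivl01 \<rightarrow>\<^sub>M N"
  by (rule measurable_compose[OF upd_measurable[OF k] h]) (use x in auto)

lemma nn_integral_line_measurable:
  assumes k: "k \<in> {1..d}" and h: "h \<in> borel_measurable (cube_measure d)"
  shows "(\<lambda>x. \<integral>\<^sup>+s. h (x(k := s)) \<partial>ivl01) \<in> borel_measurable (cube_measure d)"
proof (rule sigma_finite_measure.borel_measurable_nn_integral[OF sigma_finite_ivl01])
  have "(\<lambda>z. (fst z)(k := snd z)) \<in> cube_measure d \<Otimes>\<^sub>M ivl01 \<rightarrow>\<^sub>M cube_measure d"
    by (rule upd_measurable[OF k]) auto
  from measurable_compose[OF this h]
  show "case_prod (\<lambda>x s. h (x(k := s))) \<in> borel_measurable (cube_measure d \<Otimes>\<^sub>M ivl01)"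
    by (simp add: case_prod_beta')
qed

text \<open>The outer integral still runs over the whole cube, where the replaced coordinate
  contributes a factor 1. All later statements thereby stay on a single space.\<close>

lemma nn_integral_line:
  assumes k: "k \<in> {1..d}" and h: "h \<in> borel_measurable (cube_measure d)"
  shows "(\<integral>\<^sup>+x. h x \<partial>cube_measure d) = (\<integral>\<^sup>+x. (\<integral>\<^sup>+s. h (x(k := s)) \<partial>ivl01) \<partial>cube_measure d)"
proof -
  define R where "R = PiM ({1..d} - {k}) (\<lambda>_. ivl01)"
  have ins: "cube_measure d = PiM (insert k ({1..d} - {k})) (\<lambda>_. ivl01)"
    using k by (simp add: cube_measure_def insert_absorb)
  have fub: "(\<integral>\<^sup>+x. u x \<partial>cube_measure d) = (\<integral>\<^sup>+x. (\<integral>\<^sup>+s. u (x(k := s)) \<partial>ivl01) \<partial>R)"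
    if "u \<in> borel_measurable (cube_measure d)" for u :: "(nat \<Rightarrow> real) \<Rightarrow> ennreal"
    using that unfolding ins R_def by (intro ivl01.product_nn_integral_insert) auto
  show ?thesis
    unfolding fub[OF h] fub[OF nn_integral_line_measurable[OF k h]]
    by (simp add: emeasure_ivl01)
qed

lemma nn_integral_line_mono:
  assumes k: "k \<in> {1..d}"
    and u: "u \<in> borel_measurable (cube_measure d)" and v: "v \<in> borel_measurable (cube_measure d)"
    and le: "\<And>x. x \<in> cube d \<Longrightarrow> (\<integral>\<^sup>+s. u (x(k := s)) \<partial>ivl01) \<le> (\<integral>\<^sup>+s. v (x(k := s)) \<partial>ivl01)"
  shows "(\<integral>\<^sup>+x. u x \<partial>cube_measure d) \<le> (\<integral>\<^sup>+x. v x \<partial>cube_measure d)"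
  unfolding nn_integral_line[OF k u] nn_integral_line[OF k v]
  by (rule nn_integral_mono) (simp add: le)

text \<open>Fubini for the complement. Measurability of A cannot be read off its sections, which is
  why the points of differentiability get a Borel description below.\<close>

lemma AE_line:
  assumes k: "k \<in> {1..d}" and A: "A \<in> sets (cube_measure d)"
    and ae: "\<And>x. x \<in> cube d \<Longrightarrow> AE s in ivl01. x(k := s) \<in> A"
  shows "AE x in cube_measure d. x \<in> A"
proof -
  define B where "B = cube d - A"
  have B: "B \<in> sets (cube_measure d)" unfolding B_def using sets.compl_sets[OF A] by simp
  then have Bm: "indicator B \<in> borel_measurable (cube_measure d)" by simp
  have "emeasure (cube_measure d) B = (\<integral>\<^sup>+x. (\<integral>\<^sup>+s. indicator B (x(k := s)) \<partial>ivl01) \<partial>cube_measure d)"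
    using B nn_integral_line[OF k, of "indicator B"] by simp
  also have "\<dots> = (\<integral>\<^sup>+x. 0 \<partial>cube_measure d)"
  proof (rule nn_integral_cong)
    fix x assume "x \<in> space (cube_measure d)"
    then have x: "x \<in> cube d" by simp
    have "(\<integral>\<^sup>+s. indicator B (x(k := s)) \<partial>ivl01) = (\<integral>\<^sup>+s. 0 \<partial>ivl01)"
      by (rule nn_integral_cong_AE, rule eventually_mono[OF ae[OF x]]) (simp add: B_def)
    then show "(\<integral>\<^sup>+s. indicator B (x(k := s)) \<partial>ivl01) = (0 :: ennreal)" by simp
  qed
  finally have "B \<in> null_sets (cube_measure d)" using B by (auto simp: null_sets_def)
  then have "AE x in cube_measure d. x \<notin> B" by (rule AE_not_in)
  moreover have "AE x in cube_measure d. x \<in> cube d" by (rule AE_I2) simp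
  ultimately show ?thesis by eventually_elim (simp add: B_def)
qed

section \<open>Lipschitz functions on the cube\<close>

text \<open>The \<open>\<ell>\<^sup>1\<close> form of the Lipschitz condition makes the constant stable under \<^const>\<open>mono_step\<close>.\<close>

definition lip1 :: "nat \<Rightarrow> real \<Rightarrow> ((nat \<Rightarrow> real) \<Rightarrow> real) \<Rightarrow> bool" where
  "lip1 d L f \<longleftrightarrow> 0 \<le> L \<and> (\<forall>x\<in>cube d. \<forall>y\<in>cube d. \<bar>f x - f y\<bar> \<le> L * (\<Sum>i=1..d. \<bar>x i - y i\<bar>))"

lemma lip1D: "lip1 d L f \<Longrightarrow> x \<in> cube d \<Longrightarrow> y \<in> cube d \<Longrightarrow> \<bar>f x - f y\<bar> \<le> L * (\<Sum>i=1..d. \<bar>x i - y i\<bar>)"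
  by (simp add: lip1_def)

lemma lip1_nonneg: "lip1 d L f \<Longrightarrow> 0 \<le> L"
  by (simp add: lip1_def)

lemma lipschitz_cube_lip1:
  assumes "lipschitz_cube d f"
  obtains L where "lip1 d L f"
proof -
  obtain L where L: "\<And>x y. x \<in> cube d \<Longrightarrow> y \<in> cube d \<Longrightarrow> \<bar>f x - f y\<bar> \<le> L * euclid_dist d x y"
    using assms unfolding lipschitz_cube_def by blast
  have "lip1 d \<bar>L\<bar> f"
    unfolding lip1_def
  proof (intro conjI ballI)
    fix x y assume "x \<in> cube d" "y \<in> cube d"
    then have "\<bar>f x - f y\<bar> \<le> L * euclid_dist d x y" by (rule L)
    also have "\<dots> \<le> \<bar>L\<bar> * euclid_dist d x y" by (intro mult_right_mono) (simp_all add: euclid_dist_def)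
    also have "\<dots> \<le> \<bar>L\<bar> * (\<Sum>i=1..d. \<bar>x i - y i\<bar>)"
      unfolding euclid_dist_def by (intro mult_left_mono L2_set_le_sum_abs) simp
    finally show "\<bar>f x - f y\<bar> \<le> \<bar>L\<bar> * (\<Sum>i=1..d. \<bar>x i - y i\<bar>)" .
  qed simp
  then show ?thesis by (rule that)
qed

lemma sum_abs_upd:
  fixes x y :: "nat \<Rightarrow> real"
  assumes "k \<in> {1..d}"
  shows "(\<Sum>i=1..d. \<bar>(x(k := s)) i - (y(k := t)) i\<bar>) = \<bar>s - t\<bar> + (\<Sum>i\<in>{1..d} - {k}. \<bar>x i - y i\<bar>)"
  using assms by (subst sum.remove[of _ k]) auto

lemma sum_abs_split:
  fixes x y :: "nat \<Rightarrow> real"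
  assumes "k \<in> {1..d}"
  shows "(\<Sum>i=1..d. \<bar>x i - y i\<bar>) = \<bar>x k - y k\<bar> + (\<Sum>i\<in>{1..d} - {k}. \<bar>x i - y i\<bar>)"
  using assms by (subst sum.remove[of _ k]) auto

lemma lip1_upd:
  assumes f: "lip1 d L f" and k: "k \<in> {1..d}" and xy: "x \<in> cube d" "y \<in> cube d" and st: "s \<in> {0..1}" "t \<in> {0..1}"
  shows "\<bar>f (x(k := s)) - f (y(k := t))\<bar> \<le> L * (\<bar>s - t\<bar> + (\<Sum>i\<in>{1..d} - {k}. \<bar>x i - y i\<bar>))"
  using lip1D[OF f cube_upd[OF xy(1) k st(1)] cube_upd[OF xy(2) k st(2)]] unfolding sum_abs_upd[OF k] .

lemma lip1_line: "lip1 d L f \<Longrightarrow> k \<in> {1..d} \<Longrightarrow> x \<in> cube d \<Longrightarrow> lip01 L (\<lambda>s. f (x(k := s)))"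
  using lip1_upd[of d L f k x x] by (auto simp: lip01_def)

definition cube_proj :: "nat \<Rightarrow> (nat \<Rightarrow> real) \<Rightarrow> (nat \<Rightarrow> real)" where
  "cube_proj d z = restrict (\<lambda>i. clamp01 (z i)) {1..d}"

lemma cube_proj: "cube_proj d z \<in> cube d" "z \<in> cube d \<Longrightarrow> cube_proj d z = z"
  using clamp01(1) by (auto simp: cube_proj_def cube_def PiE_iff clamp01(2) fun_eq_iff extensional_def)

text \<open>Continuity in the product topology, whose Borel sets are those of the product
  sigma-algebra; this is how Lipschitz functions on the cube become measurable. The projection
  extends them to the whole space.\<close>

lemma lip1_continuous:
  assumes f: "lip1 d L f"
  shows "continuous_on UNIV (\<lambda>z. f (cube_proj d z))"
  unfolding continuous_on_def
proof
  fix z0 :: "nat \<Rightarrow> real"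
  have "((\<lambda>z. f (cube_proj d z) - f (cube_proj d z0)) \<longlongrightarrow> 0) (at z0)"
  proof (rule Lim_null_comparison)
    have "\<bar>f (cube_proj d z) - f (cube_proj d z0)\<bar> \<le> L * (\<Sum>i=1..d. \<bar>z i - z0 i\<bar>)" for z
    proof -
      have "\<bar>f (cube_proj d z) - f (cube_proj d z0)\<bar> \<le> L * (\<Sum>i=1..d. \<bar>cube_proj d z i - cube_proj d z0 i\<bar>)"
        by (rule lip1D[OF f cube_proj(1) cube_proj(1)])
      also have "\<dots> \<le> L * (\<Sum>i=1..d. \<bar>z i - z0 i\<bar>)"
        by (intro mult_left_mono sum_mono) (simp_all add: cube_proj_def clamp01_lip lip1_nonneg[OF f])
      finally show ?thesis .
    qed
    then show "\<forall>\<^sub>F z in at z0. norm (f (cube_proj d z) - f (cube_proj d z0)) \<le> L * (\<Sum>i=1..d. \<bar>z i - z0 i\<bar>)"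
      by (simp add: always_eventually)
    have "continuous_on UNIV (\<lambda>z. L * (\<Sum>i=1..d. \<bar>z i - z0 i\<bar>))"
      by (intro continuous_intros continuous_on_product_coordinates)
    then have "((\<lambda>z. L * (\<Sum>i=1..d. \<bar>z i - z0 i\<bar>)) \<longlongrightarrow> L * (\<Sum>i=1..d. \<bar>z0 i - z0 i\<bar>)) (at z0)"
      unfolding continuous_on_def by blast
    then show "((\<lambda>z. L * (\<Sum>i=1..d. \<bar>z i - z0 i\<bar>)) \<longlongrightarrow> 0) (at z0)" by simp
  qed
  then show "((\<lambda>z. f (cube_proj d z)) \<longlongrightarrow> f (cube_proj d z0)) (at z0)" by (rule LIM_zero_cancel)
qed

lemma id_cube_borel: "(\<lambda>x. x) \<in> cube_measure d \<rightarrow>\<^sub>M (borel :: (nat \<Rightarrow> real) measure)"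
proof -
  have "(\<lambda>x i. x i) \<in> cube_measure d \<rightarrow>\<^sub>M PiM UNIV (\<lambda>_ :: nat. borel :: real measure)"
  proof (rule measurable_PiM_single')
    fix i :: nat
    show "(\<lambda>x. x i) \<in> borel_measurable (cube_measure d)"
    proof (cases "i \<in> {1..d}")
      case True
      have "(\<lambda>s. s) \<in> borel_measurable ivl01" by (intro continuous_ivl01 continuous_intros)
      with coord_measurable[OF True] show ?thesis by (rule measurable_compose)
    next
      case False
      then have "x i = undefined" if "x \<in> space (cube_measure d)" for x
        using that by (simp add: cube_def PiE_iff extensional_def)
      then show ?thesis by (subst measurable_cong[where g = "\<lambda>_. undefined"]) auto
    qed
  qed auto
  then show ?thesis by (simp add: measurable_cong_sets[OF refl sets_PiM_equal_borel])
qed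

lemma lip1_measurable:
  assumes "lip1 d L f"
  shows "f \<in> borel_measurable (cube_measure d)"
proof -
  have "(\<lambda>x. f (cube_proj d x)) \<in> borel_measurable (cube_measure d)"
    by (rule measurable_compose[OF id_cube_borel borel_measurable_continuous_onI[OF lip1_continuous[OF assms]]])
  then show ?thesis by (rule measurable_cong[THEN iffD1, rotated]) (simp add: cube_proj(2))
qed

text \<open>Integrals along lines with a moving upper limit are again Lipschitz, which settles their
  measurability; L comes from varying the line and B from varying the limit.\<close>

lemma lip1_line_integral:
  assumes f: "lip1 d L f" and k: "k \<in> {1..d}" and B: "\<And>x. x \<in> cube d \<Longrightarrow> \<bar>f x\<bar> \<le> B"
    and c: "\<And>x. x \<in> cube d \<Longrightarrow> c x \<in> {0..1}"
    and c_lip: "\<And>x y. x \<in> cube d \<Longrightarrow> y \<in> cube d \<Longrightarrow> \<bar>c x - c y\<bar> \<le> (\<Sum>i=1..d. \<bar>x i - y i\<bar>)"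
    and B0: "0 \<le> B"
  shows "lip1 d (L + B) (\<lambda>x. integral {0..c x} (\<lambda>s. f (x(k := s))))"
  unfolding lip1_def
proof (intro conjI ballI)
  show "0 \<le> L + B" using lip1_nonneg[OF f] B0 by simp
  fix x y assume x: "x \<in> cube d" and y: "y \<in> cube d"
  define S where "S = (\<Sum>i=1..d. \<bar>x i - y i\<bar>)"
  have S0: "0 \<le> S" by (simp add: S_def sum_nonneg)
  have int: "(\<lambda>s. f (u(k := s))) integrable_on {a..b}" if "u \<in> cube d" "0 \<le> a" "b \<le> 1" for u a b
    by (rule integrable_continuous_real, rule continuous_on_subset[OF lip01_continuous[OF lip1_line[OF f k that(1)]]])
      (use that in auto)
  have part: "\<bar>integral {0..a} (\<lambda>s. f (u(k := s))) - integral {0..b} (\<lambda>s. f (u(k := s)))\<bar> \<le> B * (a - b)"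
    if "u \<in> cube d" "0 \<le> b" "b \<le> a" "a \<le> 1" for u a b
  proof -
    have "integral {0..b} (\<lambda>s. f (u(k := s))) + integral {b..a} (\<lambda>s. f (u(k := s))) = integral {0..a} (\<lambda>s. f (u(k := s)))"
      using that int[OF that(1)] by (intro Henstock_Kurzweil_Integration.integral_combine) auto
    moreover have "norm (integral {b..a} (\<lambda>s. f (u(k := s)))) \<le> B * (a - b)"
      using that by (intro integral_bound continuous_on_subset[OF lip01_continuous[OF lip1_line[OF f k that(1)]]])
        (auto intro!: B cube_upd k)
    ultimately show ?thesis by simp
  qed
  have "\<bar>integral {0..c x} (\<lambda>s. f (y(k := s))) - integral {0..c y} (\<lambda>s. f (y(k := s)))\<bar> \<le> B * \<bar>c x - c y\<bar>"
    using part[OF y, of "c y" "c x"] part[OF y, of "c x" "c y"] c[OF x] c[OF y]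
    by (cases "c x \<le> c y") (auto simp: abs_minus_commute)
  also have "\<dots> \<le> B * S" unfolding S_def by (intro mult_left_mono c_lip x y B0)
  finally have 1: "\<bar>integral {0..c x} (\<lambda>s. f (y(k := s))) - integral {0..c y} (\<lambda>s. f (y(k := s)))\<bar> \<le> B * S" .
  have cont: "continuous_on {0..c x} (\<lambda>s. f (u(k := s)))" if "u \<in> cube d" for u
    using c[OF x] by (intro continuous_on_subset[OF lip01_continuous[OF lip1_line[OF f k that]]]) auto
  have "norm (integral {0..c x} (\<lambda>s. f (x(k := s)) - f (y(k := s)))) \<le> (L * S) * (c x - 0)"
  proof (rule integral_bound)
    fix s assume "s \<in> {0..c x}"
    then have s: "s \<in> {0..1}" using c[OF x] by auto
    have "\<bar>f (x(k := s)) - f (y(k := s))\<bar> \<le> L * (\<bar>s - s\<bar> + (\<Sum>i\<in>{1..d} - {k}. \<bar>x i - y i\<bar>))"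
      by (rule lip1_upd[OF f k x y s s])
    also have "\<dots> \<le> L * S"
      unfolding S_def sum_abs_split[OF k, of x y] by (intro mult_left_mono lip1_nonneg[OF f]) auto
    finally show "norm (f (x(k := s)) - f (y(k := s))) \<le> L * S" by simp
  qed (use c[OF x] cont[OF x] cont[OF y] in \<open>auto intro: continuous_on_diff\<close>)
  also have "\<dots> \<le> L * S * 1"
    using c[OF x] lip1_nonneg[OF f] S0 by (intro mult_left_mono) auto
  also have "integral {0..c x} (\<lambda>s. f (x(k := s)) - f (y(k := s)))
      = integral {0..c x} (\<lambda>s. f (x(k := s))) - integral {0..c x} (\<lambda>s. f (y(k := s)))"
    using c[OF x] int[OF x] int[OF y] by (intro Henstock_Kurzweil_Integration.integral_diff) auto
  finally have 2: "\<bar>integral {0..c x} (\<lambda>s. f (x(k := s))) - integral {0..c x} (\<lambda>s. f (y(k := s)))\<bar> \<le> L * S"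
    by simp
  from 1 2 have "\<bar>integral {0..c x} (\<lambda>s. f (x(k := s))) - integral {0..c y} (\<lambda>s. f (y(k := s)))\<bar> \<le> L * S + B * S"
    by linarith
  then show "\<bar>integral {0..c x} (\<lambda>s. f (x(k := s))) - integral {0..c y} (\<lambda>s. f (y(k := s)))\<bar>
      \<le> (L + B) * (\<Sum>i=1..d. \<bar>x i - y i\<bar>)"
    by (simp add: S_def distrib_right)
qed

section \<open>One rearrangement step\<close>

definition tstep :: "nat \<Rightarrow> ((nat \<Rightarrow> real) \<Rightarrow> real) \<Rightarrow> (nat \<Rightarrow> real) \<Rightarrow> (nat \<Rightarrow> real)" where
  "tstep k f x = x(k := tmap (\<lambda>s. f (x(k := s))) (\<lambda>s. mono_step k f (x(k := s))) (x k))"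

text \<open>The energy of the negative parts of the difference quotients in direction \<open>k\<close>. Unlike the
  Dirichlet energy of the negative part of a partial derivative, it is visibly nonincreasing under
  rearrangement in another direction, since two parallel lines are rearranged by one contraction.\<close>

definition quot_energy :: "nat \<Rightarrow> nat \<Rightarrow> nat \<Rightarrow> ((nat \<Rightarrow> real) \<Rightarrow> real) \<Rightarrow> ennreal" where
  "quot_energy d n k f = (\<integral>\<^sup>+x. ennreal ((max 0 (- dquot n (\<lambda>s. f (x(k := s))) (x k)))\<^sup>2) \<partial>cube_measure d)"

lemma quot_energy_measurable:
  assumes f: "lip1 d L f" and k: "k \<in> {1..d}"
  shows "(\<lambda>x. ennreal ((max 0 (- dquot n (\<lambda>s. f (x(k := s))) (x k)))\<^sup>2)) \<in> borel_measurable (cube_measure d)"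
proof -
  note fm = lip1_measurable[OF f]
  have "continuous_on {0..1} (\<lambda>s :: real. min 1 (s + 1 / real (Suc n)))" by (intro continuous_intros)
  then have "(\<lambda>s. min 1 (s + 1 / real (Suc n))) \<in> ivl01 \<rightarrow>\<^sub>M ivl01"
  proof (intro measurable_restrict_space2)
    assume "continuous_on {0..1} (\<lambda>s :: real. min 1 (s + 1 / real (Suc n)))"
    then show "(\<lambda>s. min 1 (s + 1 / real (Suc n))) \<in> ivl01 \<rightarrow>\<^sub>M lborel"
      using continuous_ivl01 by (simp add: measurable_lborel1)
  qed auto
  from measurable_compose[OF coord_measurable[OF k] this]
  have "(\<lambda>x. x(k := min 1 (x k + 1 / real (Suc n)))) \<in> cube_measure d \<rightarrow>\<^sub>M cube_measure d"
    by (intro upd_measurable[OF k]) auto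
  from measurable_compose[OF this fm]
  have m: "(\<lambda>x. f (x(k := min 1 (x k + 1 / real (Suc n))))) \<in> borel_measurable (cube_measure d)" .
  have "(\<lambda>x. ennreal ((max 0 (- (real (Suc n) * (f (x(k := min 1 (x k + 1 / real (Suc n)))) - f x))))\<^sup>2))
      \<in> borel_measurable (cube_measure d)"
    using m fm by measurable
  then show ?thesis by (simp add: dquot_def)
qed

locale cube_step =
  fixes d k :: nat and L lo hi :: real and f :: "(nat \<Rightarrow> real) \<Rightarrow> real"
  assumes k: "k \<in> {1..d}" and f: "lip1 d L f" and lo: "0 < lo"
    and f_bounds: "\<And>x. x \<in> cube d \<Longrightarrow> lo \<le> f x \<and> f x \<le> hi"
begin

lemma line: "x \<in> cube d \<Longrightarrow> lip01 L (\<lambda>s. f (x(k := s)))"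
  by (rule lip1_line[OF f k])

lemma step_line: "mono_step k f (x(k := s)) = flow_limit_cont (\<lambda>s. f (x(k := s))) s"
  by (simp add: mono_step_def)

text \<open>Across lines, \<open>flow_limit_cont_le\<close> bounds the change by L times the
  distance in the other coordinates; along a line the constant is kept. The same L comes out, so the
  step can be iterated.\<close>

lemma step_lip: "lip1 d L (mono_step k f)"
  unfolding lip1_def
proof (intro conjI ballI)
  show "0 \<le> L" by (rule lip1_nonneg[OF f])
  fix x y assume x: "x \<in> cube d" and y: "y \<in> cube d"
  define c where "c = L * (\<Sum>i\<in>{1..d} - {k}. \<bar>x i - y i\<bar>)"
  have diff: "\<bar>f (x(k := s)) - f (y(k := s))\<bar> \<le> c" if "s \<in> {0..1}" for s
    using lip1_upd[OF f k x y that that] by (simp add: c_def)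
  note xk = cube_coord[OF x k] and yk = cube_coord[OF y k]
  have "flow_limit_cont (\<lambda>s. f (y(k := s))) (x k) \<le> flow_limit_cont (\<lambda>s. f (x(k := s))) (x k) + c"
    by (rule flow_limit_cont_le[OF line[OF x] line[OF y] _ xk]) (use diff in \<open>simp add: abs_le_iff algebra_simps\<close>)
  moreover have "flow_limit_cont (\<lambda>s. f (x(k := s))) (x k) \<le> flow_limit_cont (\<lambda>s. f (y(k := s))) (x k) + c"
    by (rule flow_limit_cont_le[OF line[OF y] line[OF x] _ xk]) (use diff in \<open>simp add: abs_le_iff algebra_simps\<close>)
  moreover have "\<bar>flow_limit_cont (\<lambda>s. f (y(k := s))) (x k) - flow_limit_cont (\<lambda>s. f (y(k := s))) (y k)\<bar> \<le> L * \<bar>x k - y k\<bar>"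
    by (rule lip01D[OF flow_limit_cont_lip01(1)[OF line[OF y]] xk yk])
  ultimately have "\<bar>flow_limit_cont (\<lambda>s. f (x(k := s))) (x k) - flow_limit_cont (\<lambda>s. f (y(k := s))) (y k)\<bar> \<le> L * \<bar>x k - y k\<bar> + c"
    by linarith
  then show "\<bar>mono_step k f x - mono_step k f y\<bar> \<le> L * (\<Sum>i=1..d. \<bar>x i - y i\<bar>)"
    unfolding sum_abs_split[OF k, of x y] by (simp add: mono_step_def c_def distrib_left)
qed

lemma step_bounds:
  assumes x: "x \<in> cube d"
  shows "lo \<le> mono_step k f x \<and> mono_step k f x \<le> hi"
  using flow_limit_cont_bounds[OF line[OF x], of lo hi "x k"] f_bounds[OF cube_upd[OF x k]] cube_coord[OF x k]
  by (simp add: mono_step_def)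

lemma hi: "x \<in> cube d \<Longrightarrow> 0 \<le> hi"
  using f_bounds[of x] lo by simp

lemma transport:
  assumes x: "x \<in> cube d"
  shows "line_transport (\<lambda>s. f (x(k := s))) (\<lambda>s. mono_step k f (x(k := s))) lo"
proof
  show "continuous_on {0..1} (\<lambda>s. f (x(k := s)))" by (rule lip01_continuous[OF line[OF x]])
  show "continuous_on {0..1} (\<lambda>s. mono_step k f (x(k := s)))" by (rule lip01_continuous[OF lip1_line[OF step_lip k x]])
  show "0 < lo" by (rule lo)
  show "lo \<le> f (x(k := s))" if "s \<in> {0..1}" for s using f_bounds[OF cube_upd[OF x k that]] by simp
  show "lo \<le> mono_step k f (x(k := s))" if "s \<in> {0..1}" for s using step_bounds[OF cube_upd[OF x k that]] by simp
  show "integral {0..s} (\<lambda>s. mono_step k f (x(k := s))) \<le> integral {0..s} (\<lambda>s. f (x(k := s)))" if "s \<in> {0..1}" for s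
    unfolding step_line by (rule flow_limit_cont_integral_le(1)[OF line[OF x] that])
  show "integral {0..1} (\<lambda>s. mono_step k f (x(k := s))) = integral {0..1} (\<lambda>s. f (x(k := s)))"
    unfolding step_line by (rule flow_limit_cont_integral_le(2)[OF line[OF x], where x = 0]) simp
qed

lemma tstep_cube: "x \<in> cube d \<Longrightarrow> tstep k f x \<in> cube d"
  unfolding tstep_def by (rule cube_upd[OF _ k line_transport.tmap(1)[OF transport cube_coord[OF _ k]]])

lemma tstep_ge: "x \<in> cube d \<Longrightarrow> x k \<le> tstep k f x k"
  unfolding tstep_def using line_transport.tmap_ge[OF transport cube_coord[OF _ k]] by simp

definition defect :: "(nat \<Rightarrow> real) \<Rightarrow> real" where
  "defect x = integral {0..x k} (\<lambda>s. f (x(k := s))) - integral {0..x k} (\<lambda>s. mono_step k f (x(k := s)))"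

lemma line_integral_measurable:
  assumes c: "\<And>x. x \<in> cube d \<Longrightarrow> c x \<in> {0..1}"
    and c_lip: "\<And>x y. x \<in> cube d \<Longrightarrow> y \<in> cube d \<Longrightarrow> \<bar>c x - c y\<bar> \<le> (\<Sum>i=1..d. \<bar>x i - y i\<bar>)"
  shows "(\<lambda>x. integral {0..c x} (\<lambda>s. f (x(k := s)))) \<in> borel_measurable (cube_measure d)"
    "(\<lambda>x. integral {0..c x} (\<lambda>s. mono_step k f (x(k := s)))) \<in> borel_measurable (cube_measure d)"
proof -
  have B: "\<bar>f x\<bar> \<le> \<bar>hi\<bar>" "\<bar>mono_step k f x\<bar> \<le> \<bar>hi\<bar>" if "x \<in> cube d" for x
    using f_bounds[OF that] step_bounds[OF that] lo by auto
  show "(\<lambda>x. integral {0..c x} (\<lambda>s. f (x(k := s)))) \<in> borel_measurable (cube_measure d)"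
    by (rule lip1_measurable, rule lip1_line_integral[OF f k B(1) c c_lip]) auto
  show "(\<lambda>x. integral {0..c x} (\<lambda>s. mono_step k f (x(k := s)))) \<in> borel_measurable (cube_measure d)"
    by (rule lip1_measurable, rule lip1_line_integral[OF step_lip k B(2) c c_lip]) auto
qed

lemma coord_lip: "\<bar>x k - y k\<bar> \<le> (\<Sum>i=1..d. \<bar>x i - y i :: real\<bar>)"
  unfolding sum_abs_split[OF k, of x y] by (simp add: sum_nonneg)

lemma coord_integral_measurable:
  "(\<lambda>x. integral {0..x k} (\<lambda>s. f (x(k := s)))) \<in> borel_measurable (cube_measure d)"
  "(\<lambda>x. integral {0..x k} (\<lambda>s. mono_step k f (x(k := s)))) \<in> borel_measurable (cube_measure d)"
  by (rule line_integral_measurable[where c = "\<lambda>x. x k"], erule cube_coord[OF _ k], rule coord_lip)+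

lemma defect_measurable: "defect \<in> borel_measurable (cube_measure d)"
  unfolding defect_def
  by (intro borel_measurable_diff coord_integral_measurable)

text \<open>The new coordinate is a choice on each line; but the event that it exceeds c in [0, 1]
  compares two integrals along the line, both measurable in x.\<close>

lemma tstep_coord_measurable: "(\<lambda>x. tstep k f x k) \<in> borel_measurable (cube_measure d)"
proof (rule borel_measurableI_greater)
  fix c :: real
  consider "c < 0" | "c > 1" | "c \<in> {0..1}" by fastforce
  then show "{x \<in> space (cube_measure d). c < tstep k f x k} \<in> sets (cube_measure d)"
  proof cases
    case 1
    have "{x \<in> space (cube_measure d). c < tstep k f x k} = space (cube_measure d)"
      using cube_coord[OF tstep_cube k] 1 by (auto intro: less_le_trans)
    then show ?thesis by (simp only: sets.top)
  next
    case 2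
    have "\<not> c < tstep k f x k" if "x \<in> cube d" for x
      using cube_coord[OF tstep_cube[OF that] k] 2 by simp
    then have "{x \<in> space (cube_measure d). c < tstep k f x k} = {}" by auto
    then show ?thesis by (simp only: sets.empty_sets)
  next
    case 3
    have "c < tstep k f x k \<longleftrightarrow> integral {0..c} (\<lambda>s. mono_step k f (x(k := s))) < integral {0..x k} (\<lambda>s. f (x(k := s)))"
      if "x \<in> cube d" for x
      unfolding tstep_def using line_transport.tmap_greater_iff[OF transport[OF that] cube_coord[OF that k] 3] by simp
    then have "{x \<in> space (cube_measure d). c < tstep k f x k} =
      {x \<in> space (cube_measure d). integral {0..c} (\<lambda>s. mono_step k f (x(k := s))) < integral {0..x k} (\<lambda>s. f (x(k := s)))}"
      by auto
    also have "\<dots> \<in> sets (cube_measure d)"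
      by (intro borel_measurable_less coord_integral_measurable(1)
        line_integral_measurable(2)) (use 3 in \<open>auto intro: sum_nonneg\<close>)
    finally show ?thesis .
  qed
qed

lemma tstep_measurable: "tstep k f \<in> cube_measure d \<rightarrow>\<^sub>M cube_measure d"
proof -
  have "(\<lambda>x. tstep k f x k) \<in> cube_measure d \<rightarrow>\<^sub>M ivl01"
    by (rule measurable_restrict_space2)
      (use tstep_coord_measurable cube_coord[OF tstep_cube k] in \<open>auto simp: measurable_lborel1\<close>)
  then have "(\<lambda>x. x(k := tstep k f x k)) \<in> cube_measure d \<rightarrow>\<^sub>M cube_measure d"
    by (intro upd_measurable[OF k]) auto
  moreover have "tstep k f = (\<lambda>x. x(k := tstep k f x k))" by (simp add: tstep_def fun_eq_iff)
  ultimately show ?thesis by metis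
qed

lemma tstep_push:
  assumes h: "h \<in> borel_measurable (cube_measure d)"
  shows "(\<integral>\<^sup>+x. ennreal (f x) * h (tstep k f x) \<partial>cube_measure d) = (\<integral>\<^sup>+y. ennreal (mono_step k f y) * h y \<partial>cube_measure d)"
proof -
  have m1: "(\<lambda>x. ennreal (f x) * h (tstep k f x)) \<in> borel_measurable (cube_measure d)"
    using lip1_measurable[OF f] measurable_compose[OF tstep_measurable h] by measurable
  have m2: "(\<lambda>x. ennreal (mono_step k f x) * h x) \<in> borel_measurable (cube_measure d)"
    using lip1_measurable[OF step_lip] h by measurable
  show ?thesis
    unfolding nn_integral_line[OF k m1] nn_integral_line[OF k m2]
  proof (rule nn_integral_cong)
    fix x assume "x \<in> space (cube_measure d)"
    then have x: "x \<in> cube d" by simp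
    show "(\<integral>\<^sup>+s. ennreal (f (x(k := s))) * h (tstep k f (x(k := s))) \<partial>ivl01)
        = (\<integral>\<^sup>+s. ennreal (mono_step k f (x(k := s))) * h (x(k := s)) \<partial>ivl01)"
      using line_transport.tmap_push[OF transport[OF x] line_measurable[OF k x h]] by (simp add: tstep_def)
  qed
qed

text \<open>The density contributes \<open>hi\<close> and the displacement bound contributes the
  inverse square of \<open>lo\<close>; what is left is \<open>line_energy\<close> on each line,
  integrated over the lines with Fatou's lemma.\<close>

lemma tstep_cost:
  "(\<integral>\<^sup>+x. ennreal (f x) * ennreal ((tstep k f x k - x k)\<^sup>2) \<partial>cube_measure d)
    \<le> ennreal (hi / lo\<^sup>2) * liminf (\<lambda>n. quot_energy d n k f)"
proof -
  have dm: "(\<lambda>x. ennreal ((defect x)\<^sup>2)) \<in> borel_measurable (cube_measure d)"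
    using defect_measurable by measurable
  have "(\<integral>\<^sup>+x. ennreal (f x) * ennreal ((tstep k f x k - x k)\<^sup>2) \<partial>cube_measure d)
      \<le> (\<integral>\<^sup>+x. ennreal (hi / lo\<^sup>2) * ennreal ((defect x)\<^sup>2) \<partial>cube_measure d)"
  proof (rule nn_integral_mono)
    fix x assume "x \<in> space (cube_measure d)"
    then have x: "x \<in> cube d" by simp
    have "(tstep k f x k - x k)\<^sup>2 \<le> (defect x / lo)\<^sup>2"
      using line_transport.tmap_displacement[OF transport[OF x] cube_coord[OF x k]] tstep_ge[OF x]
      by (intro power_mono) (simp_all add: tstep_def defect_def)
    then have "f x * (tstep k f x k - x k)\<^sup>2 \<le> hi * (defect x / lo)\<^sup>2"
      using f_bounds[OF x] lo by (intro mult_mono) auto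
    also have "\<dots> = hi / lo\<^sup>2 * (defect x)\<^sup>2" by (simp add: power_divide)
    finally show "ennreal (f x) * ennreal ((tstep k f x k - x k)\<^sup>2) \<le> ennreal (hi / lo\<^sup>2) * ennreal ((defect x)\<^sup>2)"
      using f_bounds[OF x] lo hi[OF x] by (simp add: ennreal_mult[symmetric] ennreal_leI)
  qed
  also have "\<dots> = ennreal (hi / lo\<^sup>2) * (\<integral>\<^sup>+x. ennreal ((defect x)\<^sup>2) \<partial>cube_measure d)"
    by (rule nn_integral_cmult[OF dm])
  also have "(\<integral>\<^sup>+x. ennreal ((defect x)\<^sup>2) \<partial>cube_measure d) \<le> liminf (\<lambda>n. quot_energy d n k f)"
  proof -
    have "(\<integral>\<^sup>+x. ennreal ((defect x)\<^sup>2) \<partial>cube_measure d)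
        = (\<integral>\<^sup>+x. (\<integral>\<^sup>+s. ennreal ((defect (x(k := s)))\<^sup>2) \<partial>ivl01) \<partial>cube_measure d)"
      by (rule nn_integral_line[OF k dm])
    also have "\<dots> \<le> (\<integral>\<^sup>+x. liminf (\<lambda>n. \<integral>\<^sup>+s. ennreal ((max 0 (- dquot n (\<lambda>s. f (x(k := s))) s))\<^sup>2) \<partial>ivl01) \<partial>cube_measure d)"
    proof (rule nn_integral_mono)
      fix x assume "x \<in> space (cube_measure d)"
      then have "x \<in> cube d" by simp
      from line_energy[OF line[OF this]]
      show "(\<integral>\<^sup>+s. ennreal ((defect (x(k := s)))\<^sup>2) \<partial>ivl01)
          \<le> liminf (\<lambda>n. \<integral>\<^sup>+s. ennreal ((max 0 (- dquot n (\<lambda>s. f (x(k := s))) s))\<^sup>2) \<partial>ivl01)"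
        by (simp add: defect_def mono_step_def)
    qed
    also have "\<dots> \<le> liminf (\<lambda>n. \<integral>\<^sup>+x. (\<integral>\<^sup>+s. ennreal ((max 0 (- dquot n (\<lambda>s. f (x(k := s))) s))\<^sup>2) \<partial>ivl01) \<partial>cube_measure d)"
    proof (rule nn_integral_liminf)
      fix n
      from nn_integral_line_measurable[OF k quot_energy_measurable[OF f k, of n]]
      show "(\<lambda>x. \<integral>\<^sup>+s. ennreal ((max 0 (- dquot n (\<lambda>s. f (x(k := s))) s))\<^sup>2) \<partial>ivl01) \<in> borel_measurable (cube_measure d)"
        by simp
    qed
    also have "(\<lambda>n. \<integral>\<^sup>+x. (\<integral>\<^sup>+s. ennreal ((max 0 (- dquot n (\<lambda>s. f (x(k := s))) s))\<^sup>2) \<partial>ivl01) \<partial>cube_measure d)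
        = (\<lambda>n. quot_energy d n k f)"
    proof
      fix n
      from nn_integral_line[OF k quot_energy_measurable[OF f k, of n]]
      show "(\<integral>\<^sup>+x. (\<integral>\<^sup>+s. ennreal ((max 0 (- dquot n (\<lambda>s. f (x(k := s))) s))\<^sup>2) \<partial>ivl01) \<partial>cube_measure d)
          = quot_energy d n k f"
        unfolding quot_energy_def by simp
    qed
    finally show ?thesis .
  qed
  finally show ?thesis by (simp add: mult_left_mono)
qed

text \<open>The quotient in direction j is a multiple of the difference of f on two parallel lines
  in direction k, through x and through x shifted in coordinate j. Rearranging both lines contracts
  the positive part of this difference, by \<open>line_contraction\<close>.\<close>

lemma quot_energy_step_le:
  assumes j: "j \<in> {1..d}" "j \<noteq> k"
  shows "quot_energy d n j (mono_step k f) \<le> quot_energy d n j f"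
  unfolding quot_energy_def
proof (rule nn_integral_line_mono[OF k quot_energy_measurable[OF step_lip j(1)] quot_energy_measurable[OF f j(1)]])
  fix x assume x: "x \<in> cube d"
  define x' where "x' = x(j := min 1 (x j + 1 / real (Suc n)))"
  have x': "x' \<in> cube d" unfolding x'_def using cube_coord[OF x j(1)] by (intro cube_upd[OF x j(1)]) auto
  have eq: "(\<integral>\<^sup>+s. ennreal ((max 0 (- dquot n (\<lambda>r. g (x(k := s, j := r))) ((x(k := s)) j)))\<^sup>2) \<partial>ivl01)
      = ennreal ((real (Suc n))\<^sup>2) * (\<integral>\<^sup>+s. ennreal ((max 0 (g (x(k := s)) - g (x'(k := s))))\<^sup>2) \<partial>ivl01)"
    if g: "lip1 d L g" for g
  proof -
    have "(max 0 (- dquot n (\<lambda>r. g (x(k := s, j := r))) ((x(k := s)) j)))\<^sup>2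
        = (real (Suc n))\<^sup>2 * (max 0 (g (x(k := s)) - g (x'(k := s))))\<^sup>2" for s
    proof -
      have "x(k := s, j := x j) = x(k := s)" "x(k := s, j := min 1 (x j + 1 / real (Suc n))) = x'(k := s)"
        using j(2) by (auto simp: x'_def fun_eq_iff)
      then have "- dquot n (\<lambda>r. g (x(k := s, j := r))) ((x(k := s)) j) = real (Suc n) * (g (x(k := s)) - g (x'(k := s)))"
        using j(2) by (simp add: dquot_def algebra_simps)
      moreover have "max 0 (real (Suc n) * t) = real (Suc n) * max 0 t" for t :: real
        by (simp add: max_mult_distrib_left)
      ultimately show ?thesis by (simp only: power_mult_distrib)
    qed
    then have "(\<integral>\<^sup>+s. ennreal ((max 0 (- dquot n (\<lambda>r. g (x(k := s, j := r))) ((x(k := s)) j)))\<^sup>2) \<partial>ivl01)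
        = (\<integral>\<^sup>+s. ennreal ((real (Suc n))\<^sup>2) * ennreal ((max 0 (g (x(k := s)) - g (x'(k := s))))\<^sup>2) \<partial>ivl01)"
      by (simp only: ennreal_mult[OF zero_le_power2 zero_le_power2])
    also have "\<dots> = ennreal ((real (Suc n))\<^sup>2) * (\<integral>\<^sup>+s. ennreal ((max 0 (g (x(k := s)) - g (x'(k := s))))\<^sup>2) \<partial>ivl01)"
      by (intro nn_integral_cmult continuous_ivl01_ennreal continuous_intros lip01_continuous[OF lip1_line[OF g k]] x x')
    finally show ?thesis .
  qed
  show "(\<integral>\<^sup>+s. ennreal ((max 0 (- dquot n (\<lambda>r. mono_step k f (x(k := s, j := r))) ((x(k := s)) j)))\<^sup>2) \<partial>ivl01)
      \<le> (\<integral>\<^sup>+s. ennreal ((max 0 (- dquot n (\<lambda>r. f (x(k := s, j := r))) ((x(k := s)) j)))\<^sup>2) \<partial>ivl01)"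
    unfolding eq[OF f] eq[OF step_lip] step_line
    by (rule mult_left_mono[OF line_contraction[OF line[OF x'] line[OF x]]]) simp
qed

end

section \<open>Partial derivatives and the limit of the difference quotient energies\<close>

text \<open>Membership in \<open>diff_set d k f\<close> is the Cauchy criterion for the difference quotients of \<open>f\<close> in
  direction \<open>k\<close>. The projection makes every condition on the quotients closed in \<open>z\<close>, which is why
  the set is Borel although the increments range over all reals.\<close>

definition line_quot :: "nat \<Rightarrow> nat \<Rightarrow> ((nat \<Rightarrow> real) \<Rightarrow> real) \<Rightarrow> real \<Rightarrow> (nat \<Rightarrow> real) \<Rightarrow> real" where
  "line_quot d k f h z = (let x = cube_proj d z in (f (x(k := clamp01 (x k + h))) - f x) / h)"

definition diff_set :: "nat \<Rightarrow> nat \<Rightarrow> ((nat \<Rightarrow> real) \<Rightarrow> real) \<Rightarrow> (nat \<Rightarrow> real) set" where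
  "diff_set d k f = {z. \<forall>m. \<exists>n. \<forall>p q. p \<noteq> 0 \<longrightarrow> \<bar>p\<bar> < 1 / real (Suc n) \<longrightarrow> q \<noteq> 0 \<longrightarrow> \<bar>q\<bar> < 1 / real (Suc n) \<longrightarrow>
     \<bar>line_quot d k f p z - line_quot d k f q z\<bar> \<le> 1 / real (Suc m)}"

lemma lip1_shift:
  assumes f: "lip1 d L f" and k: "k \<in> {1..d}"
  shows "lip1 d L (\<lambda>x. f (x(k := clamp01 (x k + h))))"
  unfolding lip1_def
proof (intro conjI ballI)
  show "0 \<le> L" by (rule lip1_nonneg[OF f])
  fix x y assume x: "x \<in> cube d" and y: "y \<in> cube d"
  have "\<bar>f (x(k := clamp01 (x k + h))) - f (y(k := clamp01 (y k + h)))\<bar>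
      \<le> L * (\<bar>clamp01 (x k + h) - clamp01 (y k + h)\<bar> + (\<Sum>i\<in>{1..d} - {k}. \<bar>x i - y i\<bar>))"
    by (rule lip1_upd[OF f k x y clamp01(1) clamp01(1)])
  also have "\<dots> \<le> L * (\<Sum>i=1..d. \<bar>x i - y i\<bar>)"
    unfolding sum_abs_split[OF k, of x y]
    using clamp01_lip[of "x k + h" "y k + h"] by (intro mult_left_mono lip1_nonneg[OF f]) auto
  finally show "\<bar>f (x(k := clamp01 (x k + h))) - f (y(k := clamp01 (y k + h)))\<bar> \<le> L * (\<Sum>i=1..d. \<bar>x i - y i\<bar>)" .
qed

lemma diff_set_borel:
  assumes f: "lip1 d L f" and k: "k \<in> {1..d}"
  shows "diff_set d k f \<in> sets borel"
proof -
  have cont: "continuous_on UNIV (line_quot d k f h)" if "h \<noteq> 0" for h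
    unfolding line_quot_def Let_def
    using that by (intro continuous_intros lip1_continuous[OF f] lip1_continuous[OF lip1_shift[OF f k]]) auto
  have "closed {z. \<bar>line_quot d k f p z - line_quot d k f q z\<bar> \<le> 1 / real (Suc m)}" if "p \<noteq> 0" "q \<noteq> 0" for p q m
    using that by (intro closed_Collect_le continuous_intros cont)
  then have "closed {z. p \<noteq> 0 \<longrightarrow> \<bar>p\<bar> < 1 / real (Suc n) \<longrightarrow> q \<noteq> 0 \<longrightarrow> \<bar>q\<bar> < 1 / real (Suc n) \<longrightarrow>
      \<bar>line_quot d k f p z - line_quot d k f q z\<bar> \<le> 1 / real (Suc m)}" for m n p q
    by (cases "p \<noteq> 0 \<and> q \<noteq> 0 \<and> \<bar>p\<bar> < 1 / real (Suc n) \<and> \<bar>q\<bar> < 1 / real (Suc n)") auto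
  then have "closed {z. \<forall>p q. p \<noteq> 0 \<longrightarrow> \<bar>p\<bar> < 1 / real (Suc n) \<longrightarrow> q \<noteq> 0 \<longrightarrow> \<bar>q\<bar> < 1 / real (Suc n) \<longrightarrow>
      \<bar>line_quot d k f p z - line_quot d k f q z\<bar> \<le> 1 / real (Suc m)}" for m n
    by (intro closed_Collect_all)
  then have "{z. \<forall>p q. p \<noteq> 0 \<longrightarrow> \<bar>p\<bar> < 1 / real (Suc n) \<longrightarrow> q \<noteq> 0 \<longrightarrow> \<bar>q\<bar> < 1 / real (Suc n) \<longrightarrow>
      \<bar>line_quot d k f p z - line_quot d k f q z\<bar> \<le> 1 / real (Suc m)} \<in> sets borel" for m n
    by (rule borel_closed)
  moreover have "diff_set d k f = (\<Inter>m. \<Union>n. {z. \<forall>p q. p \<noteq> 0 \<longrightarrow> \<bar>p\<bar> < 1 / real (Suc n) \<longrightarrow> q \<noteq> 0 \<longrightarrow> \<bar>q\<bar> < 1 / real (Suc n) \<longrightarrow>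
      \<bar>line_quot d k f p z - line_quot d k f q z\<bar> \<le> 1 / real (Suc m)})"
    unfolding diff_set_def by (rule set_eqI) (simp only: INT_iff UN_iff mem_Collect_eq UNIV_I simp_thms ball_UNIV bex_UNIV)
  ultimately show ?thesis by (auto intro!: sets.countable_INT'' sets.countable_UN)
qed

lemma diff_setI:
  assumes k: "k \<in> {1..d}" and x: "x \<in> cube d" "x k \<in> {0<..<1}"
    and D: "((\<lambda>s. f (x(k := s))) has_real_derivative D) (at (x k))"
  shows "x \<in> diff_set d k f"
proof -
  have "((\<lambda>s. f (x(k := clamp01 s))) has_real_derivative D) (at (x k))"
    by (rule has_field_derivative_transform_within_open[OF D, of "{0<..<1}"]) (use x in \<open>auto simp: clamp01(2)\<close>)
  then have lim: "((\<lambda>h. line_quot d k f h x) \<longlongrightarrow> D) (at 0)"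
    unfolding DERIV_def line_quot_def using x by (simp add: cube_proj(2) clamp01(2))
  have "\<exists>n. \<forall>p q. p \<noteq> 0 \<longrightarrow> \<bar>p\<bar> < 1 / real (Suc n) \<longrightarrow> q \<noteq> 0 \<longrightarrow> \<bar>q\<bar> < 1 / real (Suc n) \<longrightarrow>
      \<bar>line_quot d k f p x - line_quot d k f q x\<bar> \<le> 1 / real (Suc m)" for m
  proof -
    define e where "e = 1 / real (Suc m) / 2"
    have "e > 0" by (simp add: e_def)
    with lim obtain \<delta> where \<delta>: "\<delta> > 0" "\<And>h. h \<noteq> 0 \<Longrightarrow> \<bar>h\<bar> < \<delta> \<Longrightarrow> \<bar>line_quot d k f h x - D\<bar> < e"
      unfolding tendsto_iff eventually_at dist_real_def by force
    obtain n where n: "1 / real (Suc n) < \<delta>" using nat_approx_posE[OF \<delta>(1)] by blast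
    have "\<bar>line_quot d k f p x - line_quot d k f q x\<bar> \<le> 1 / real (Suc m)"
      if "p \<noteq> 0" "\<bar>p\<bar> < 1 / real (Suc n)" "q \<noteq> 0" "\<bar>q\<bar> < 1 / real (Suc n)" for p q
    proof -
      have "\<bar>line_quot d k f p x - D\<bar> < e" "\<bar>line_quot d k f q x - D\<bar> < e" using \<delta>(2) that n by force+
      moreover have "e + e = 1 / real (Suc m)" unfolding e_def by (rule field_sum_of_halves)
      ultimately show ?thesis by linarith
    qed
    then show ?thesis by blast
  qed
  then show ?thesis unfolding diff_set_def by simp
qed

text \<open>The Cauchy criterion gives a limit along the increments 1/(i + 1), and a second use of
  it compares every small increment with this sequence.\<close>

lemma diff_setD:
  assumes k: "k \<in> {1..d}" and x: "x \<in> cube d" "x k \<in> {0<..<1}" and mem: "x \<in> diff_set d k f"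
  obtains D where "((\<lambda>s. f (x(k := s))) has_real_derivative D) (at (x k))"
proof -
  define r where "r h = line_quot d k f h x" for h
  have crit: "\<exists>n. \<forall>p q. p \<noteq> 0 \<longrightarrow> \<bar>p\<bar> < 1 / real (Suc n) \<longrightarrow> q \<noteq> 0 \<longrightarrow> \<bar>q\<bar> < 1 / real (Suc n) \<longrightarrow> \<bar>r p - r q\<bar> \<le> 1 / real (Suc m)" for m
    using mem unfolding diff_set_def r_def mem_Collect_eq by (rule spec)
  define a where "a i = 1 / real (Suc i)" for i
  have a: "a i \<noteq> 0" "\<bar>a i\<bar> = a i" for i by (simp_all add: a_def)
  have a_small: "a i < 1 / real (Suc n)" if "n < i" for i n
    unfolding a_def using that by (intro divide_strict_left_mono) auto
  have "Cauchy (\<lambda>i. r (a i))"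
  proof (rule metric_CauchyI)
    fix e :: real assume "e > 0"
    then obtain m where m: "1 / real (Suc m) < e" using nat_approx_posE by blast
    obtain n where n: "\<forall>p q. p \<noteq> 0 \<longrightarrow> \<bar>p\<bar> < 1 / real (Suc n) \<longrightarrow> q \<noteq> 0 \<longrightarrow> \<bar>q\<bar> < 1 / real (Suc n) \<longrightarrow> \<bar>r p - r q\<bar> \<le> 1 / real (Suc m)"
      using crit[of m] by (rule exE)
    have "dist (r (a i)) (r (a j)) < e" if "Suc n \<le> i" "Suc n \<le> j" for i j
      using n[rule_format, of "a i" "a j"] a(1)[of i] a(1)[of j] a(2)[of i] a(2)[of j] a_small[of n i] a_small[of n j] that m
      unfolding dist_real_def by linarith
    then show "\<exists>M. \<forall>i\<ge>M. \<forall>j\<ge>M. dist (r (a i)) (r (a j)) < e" by blast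
  qed
  then obtain D where D: "(\<lambda>i. r (a i)) \<longlonglongrightarrow> D" by (auto simp: Cauchy_convergent_iff convergent_def)
  have "(r \<longlongrightarrow> D) (at 0)"
  proof (rule tendstoI)
    fix e :: real assume "e > 0"
    then obtain m where m: "1 / real (Suc m) < e" using nat_approx_posE by blast
    obtain n where n: "\<forall>p q. p \<noteq> 0 \<longrightarrow> \<bar>p\<bar> < 1 / real (Suc n) \<longrightarrow> q \<noteq> 0 \<longrightarrow> \<bar>q\<bar> < 1 / real (Suc n) \<longrightarrow> \<bar>r p - r q\<bar> \<le> 1 / real (Suc m)"
      using crit[of m] by (rule exE)
    have "dist (r h) D < e" if "h \<noteq> 0" "\<bar>h\<bar> < 1 / real (Suc n)" for h
    proof -
      have "(\<lambda>i. \<bar>r h - r (a i)\<bar>) \<longlonglongrightarrow> \<bar>r h - D\<bar>" by (intro tendsto_intros D)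
      moreover have "\<bar>r h - r (a i)\<bar> \<le> 1 / real (Suc m)" if "Suc n \<le> i" for i
        using n[rule_format, OF \<open>h \<noteq> 0\<close> \<open>\<bar>h\<bar> < _\<close> a(1)[of i]] a(2)[of i] a_small[of n i] that by linarith
      ultimately have "\<bar>r h - D\<bar> \<le> 1 / real (Suc m)" by (intro LIMSEQ_le_const2[of "\<lambda>i. \<bar>r h - r (a i)\<bar>"] exI[of _ "Suc n"]) auto
      then show ?thesis using m by (simp add: dist_real_def)
    qed
    then show "\<forall>\<^sub>F h in at 0. dist (r h) D < e"
      unfolding eventually_at by (intro exI[of _ "1 / real (Suc n)"]) (simp add: dist_real_def)
  qed
  then have "((\<lambda>s. f (x(k := clamp01 s))) has_real_derivative D) (at (x k))"
    unfolding DERIV_def r_def line_quot_def using x by (simp add: cube_proj(2) clamp01(2))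
  then have "((\<lambda>s. f (x(k := s))) has_real_derivative D) (at (x k))"
    by (rule has_field_derivative_transform_within_open[of _ _ _ "{0<..<1}"]) (use x in \<open>auto simp: clamp01(2)\<close>)
  then show ?thesis by (rule that)
qed

text \<open>One-dimensional differentiability on every line, plus Fubini; \<open>diff_set\<close>
  provides the measurable set that \<open>AE_line\<close> requires.\<close>

lemma AE_partial_differentiable:
  assumes f: "lip1 d L f" and k: "k \<in> {1..d}"
  shows "AE x in cube_measure d. x k \<in> {0<..<1} \<and> (\<exists>D. ((\<lambda>s. f (x(k := s))) has_real_derivative D) (at (x k)))"
proof -
  define A where "A = {x \<in> cube d. x k \<in> {0<..<1} \<and> x \<in> diff_set d k f}"
  have A1: "{x \<in> space (cube_measure d). x k \<in> {0<..<1}} \<in> sets (cube_measure d)"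
  proof -
    have "(\<lambda>s. s) \<in> borel_measurable ivl01" by (intro continuous_ivl01 continuous_intros)
    then have "(\<lambda>x. x k) \<in> borel_measurable (cube_measure d)" using coord_measurable[OF k] by (rule measurable_compose[rotated])
    then show ?thesis by measurable
  qed
  have A2: "{x \<in> space (cube_measure d). x \<in> diff_set d k f} \<in> sets (cube_measure d)"
    using measurable_sets[OF id_cube_borel diff_set_borel[OF f k], of d] by (simp add: vimage_def Int_def conj_commute)
  have "A = {x \<in> space (cube_measure d). x k \<in> {0<..<1}} \<inter> {x \<in> space (cube_measure d). x \<in> diff_set d k f}"
    by (auto simp: A_def)
  then have A: "A \<in> sets (cube_measure d)" using A1 A2 by (simp only: sets.Int)
  have "AE x in cube_measure d. x \<in> A"
  proof (rule AE_line[OF k A])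
    fix x assume x: "x \<in> cube d"
    show "AE s in ivl01. x(k := s) \<in> A"
    proof (rule AE_ivl01I)
      show "AE s in lborel. s \<in> {0<..<1} \<longrightarrow> x(k := s) \<in> A"
        using lip01_AE_differentiable[OF lip1_line[OF f k x]]
      proof eventually_elim
        case (elim s)
        show ?case
        proof
          assume s: "s \<in> {0<..<1}"
          then obtain D where "((\<lambda>s. f (x(k := s))) has_real_derivative D) (at s)" using elim by blast
          moreover have "x(k := s) \<in> cube d" using cube_upd[OF x k, of s] s by simp
          ultimately show "x(k := s) \<in> A" using s diff_setI[OF k, of "x(k := s)" f D] by (simp add: A_def)
        qed
      qed
    qed
  qed
  then show ?thesis
  proof (rule eventually_mono)
    fix x assume "x \<in> A"
    then have x: "x \<in> cube d" "x k \<in> {0<..<1}" "x \<in> diff_set d k f" by (auto simp: A_def)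
    then show "x k \<in> {0<..<1} \<and> (\<exists>D. ((\<lambda>s. f (x(k := s))) has_real_derivative D) (at (x k)))"
      using diff_setD[OF k x] by metis
  qed
qed

text \<open>U is the limit superior of the squared quotients, measurable by construction; it stands
  in for the squared negative slope, with which it agrees almost everywhere. Quotients bounded by L
  on a set of measure 1 allow the reverse Fatou lemma.\<close>

lemma quot_energy_limit:
  assumes f: "lip1 d L f" and k: "k \<in> {1..d}"
  obtains U where "U \<in> borel_measurable (cube_measure d)"
    "AE x in cube_measure d. U x = ennreal ((neg_grad f x k)\<^sup>2)"
    "liminf (\<lambda>n. quot_energy d n k f) \<le> (\<integral>\<^sup>+x. U x \<partial>cube_measure d)"
proof -
  define u where "u n x = ennreal ((max 0 (- dquot n (\<lambda>s. f (x(k := s))) (x k)))\<^sup>2)" for n x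
  have um: "u n \<in> borel_measurable (cube_measure d)" for n
    unfolding u_def by (rule quot_energy_measurable[OF f k])
  show ?thesis
  proof
    show "(\<lambda>x. limsup (\<lambda>n. u n x)) \<in> borel_measurable (cube_measure d)"
      by (rule borel_measurable_limsup[OF um])
    show "AE x in cube_measure d. limsup (\<lambda>n. u n x) = ennreal ((neg_grad f x k)\<^sup>2)"
      using AE_partial_differentiable[OF f k]
    proof eventually_elim
      case (elim x)
      then obtain D where D: "((\<lambda>s. f (x(k := s))) has_real_derivative D) (at (x k))" and xk: "x k \<in> {0<..<1}" by blast
      have "partial_deriv k f x = D"
        unfolding partial_deriv_def
        using xk D by (intro vector_derivative_within_closed_interval)
          (auto simp: has_real_derivative_iff_has_vector_derivative[symmetric] intro: has_field_derivative_at_within)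
      then have "neg_grad f x k = - max 0 (- D)" by (simp add: neg_grad_def max_def min_def)
      moreover have "(\<lambda>n. u n x) \<longlonglongrightarrow> ennreal ((max 0 (- D))\<^sup>2)"
        unfolding u_def by (intro tendsto_ennrealI tendsto_intros dquot_tendsto[OF xk D])
      then have "limsup (\<lambda>n. u n x) = ennreal ((max 0 (- D))\<^sup>2)" by (intro lim_imp_Limsup) auto
      ultimately show ?case by simp
    qed
    have "liminf (\<lambda>n. quot_energy d n k f) \<le> limsup (\<lambda>n. quot_energy d n k f)"
      by (rule Liminf_le_Limsup) simp
    also have "\<dots> = limsup (\<lambda>n. \<integral>\<^sup>+x. u n x \<partial>cube_measure d)" by (simp add: quot_energy_def u_def)
    also have "\<dots> \<le> (\<integral>\<^sup>+x. limsup (\<lambda>n. u n x) \<partial>cube_measure d)"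
    proof (rule nn_integral_limsup[where w = "\<lambda>_. ennreal (L\<^sup>2)"])
      show "AE x in cube_measure d. u n x \<le> ennreal (L\<^sup>2)" for n
      proof (rule AE_I2)
        fix x assume "x \<in> space (cube_measure d)"
        then have x: "x \<in> cube d" by simp
        have "\<bar>dquot n (\<lambda>s. f (x(k := s))) (x k)\<bar> \<le> L" by (rule dquot_bound[OF lip1_line[OF f k x] cube_coord[OF x k]])
        then have "max 0 (- dquot n (\<lambda>s. f (x(k := s))) (x k)) \<le> L" by linarith
        then show "u n x \<le> ennreal (L\<^sup>2)" unfolding u_def by (intro ennreal_leI power_mono) auto
      qed
      have "emeasure (cube_measure d) (cube d) = 1"
        unfolding cube_measure_def cube_def
        by (subst ivl01.emeasure_PiM) (auto simp: emeasure_ivl01 sets_restrict_space)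
      then show "(\<integral>\<^sup>+x. ennreal (L\<^sup>2) \<partial>cube_measure d) < \<infinity>" by simp
    qed (use um in auto)
    finally show "liminf (\<lambda>n. quot_energy d n k f) \<le> (\<integral>\<^sup>+x. limsup (\<lambda>n. u n x) \<partial>cube_measure d)" .
  qed
qed

section \<open>The composed transport map\<close>

primrec trans_map :: "nat \<Rightarrow> ((nat \<Rightarrow> real) \<Rightarrow> real) \<Rightarrow> (nat \<Rightarrow> real) \<Rightarrow> (nat \<Rightarrow> real)" where
  "trans_map 0 f x = x"
| "trans_map (Suc k) f x = tstep (Suc k) (mono_rearr k f) (trans_map k f x)"

lemma tstep_other: "i \<noteq> k \<Longrightarrow> tstep k f x i = x i"
  by (simp add: tstep_def)

lemma trans_map_above: "k < i \<Longrightarrow> trans_map k f x i = x i"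
  by (induction k) (simp_all add: tstep_other)

lemma trans_map_below: "i \<le> k \<Longrightarrow> trans_map k f x i = trans_map i f x i"
proof (induction k)
  case (Suc k)
  then show ?case by (cases "i = Suc k") (simp_all add: tstep_other)
qed simp

locale cube_rearr =
  fixes d :: nat and L lo hi :: real and f :: "(nat \<Rightarrow> real) \<Rightarrow> real"
  assumes f: "lip1 d L f" and lo: "0 < lo" and f_bounds: "\<And>x. x \<in> cube d \<Longrightarrow> lo \<le> f x \<and> f x \<le> hi"
begin

lemma rearr: "k \<le> d \<Longrightarrow> lip1 d L (mono_rearr k f) \<and> (\<forall>x\<in>cube d. lo \<le> mono_rearr k f x \<and> mono_rearr k f x \<le> hi)"
proof (induction k)
  case 0
  then show ?case using f f_bounds by simp
next
  case (Suc k)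
  then have "cube_step d (Suc k) L lo hi (mono_rearr k f)"
    using lo by (auto simp: cube_step_def)
  from cube_step.step_lip[OF this] cube_step.step_bounds[OF this] show ?case by simp
qed

lemma cube_step: "k < d \<Longrightarrow> cube_step d (Suc k) L lo hi (mono_rearr k f)"
  using rearr[of k] lo by (auto simp: cube_step_def)

lemma trans_map_cube: "k \<le> d \<Longrightarrow> x \<in> cube d \<Longrightarrow> trans_map k f x \<in> cube d"
proof (induction k)
  case (Suc k)
  then show ?case using cube_step.tstep_cube[OF cube_step] by simp
qed simp

lemma trans_map_measurable: "k \<le> d \<Longrightarrow> trans_map k f \<in> cube_measure d \<rightarrow>\<^sub>M cube_measure d"
proof (induction k)
  case 0
  have "trans_map 0 f = (\<lambda>x. x)" by (simp add: fun_eq_iff)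
  then show ?case by simp
next
  case (Suc k)
  then have "(\<lambda>x. tstep (Suc k) (mono_rearr k f) (trans_map k f x)) \<in> cube_measure d \<rightarrow>\<^sub>M cube_measure d"
    by (intro measurable_compose[OF _ cube_step.tstep_measurable[OF cube_step]]) auto
  then show ?case by simp
qed

lemma trans_map_push:
  assumes "k \<le> d" and h: "h \<in> borel_measurable (cube_measure d)"
  shows "(\<integral>\<^sup>+x. ennreal (f x) * h (trans_map k f x) \<partial>cube_measure d) = (\<integral>\<^sup>+x. ennreal (mono_rearr k f x) * h x \<partial>cube_measure d)"
  using assms
proof (induction k arbitrary: h)
  case (Suc k)
  note step = cube_step[of k]
  have "(\<lambda>x. h (tstep (Suc k) (mono_rearr k f) x)) \<in> borel_measurable (cube_measure d)"
    using Suc.prems by (intro measurable_compose[OF cube_step.tstep_measurable[OF step]]) auto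
  from Suc.IH[OF _ this] Suc.prems cube_step.tstep_push[OF step Suc.prems(2)] show ?case by simp
qed simp

lemma trans_map_ge:
  assumes i: "i \<in> {1..d}" and x: "x \<in> cube d"
  shows "x i \<le> trans_map d f x i"
proof -
  obtain k where k: "i = Suc k" "k < d" using i by (cases i) auto
  have "trans_map k f x i \<le> trans_map i f x i"
    using cube_step.tstep_ge[OF cube_step[OF k(2)] trans_map_cube[of k x]] k x by simp
  then show ?thesis using trans_map_above[of k i f x] trans_map_below[of i d f x] k by simp
qed

text \<open>Direction k + 1 differs from each of the directions 1 to k rearranged so far, so no step
  increases the energy.\<close>

lemma quot_energy_rearr_le:
  assumes "k < d"
  shows "quot_energy d n (Suc k) (mono_rearr k f) \<le> quot_energy d n (Suc k) f"
proof -
  have "quot_energy d n (Suc k) (mono_rearr i f) \<le> quot_energy d n (Suc k) f" if "i \<le> k" for i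
    using that
  proof (induction i)
    case (Suc i)
    have "quot_energy d n (Suc k) (mono_rearr (Suc i) f) \<le> quot_energy d n (Suc k) (mono_rearr i f)"
      using cube_step.quot_energy_step_le[OF cube_step[of i], of "Suc k" n] Suc.prems assms by simp
    then show ?case using Suc by simp
  qed simp
  then show ?thesis by simp
qed

text \<open>Coordinate i is touched only in step i. The earlier steps push f onto the density
  \<open>mono_rearr k f\<close> with i = k + 1, so the cost is that of a single step for this
  density; its quotient energy is then traced back to f.\<close>

lemma coord_cost:
  assumes i: "i \<in> {1..d}"
  shows "(\<integral>\<^sup>+x. ennreal (f x) * ennreal ((trans_map d f x i - x i)\<^sup>2) \<partial>cube_measure d)
    \<le> ennreal (hi / lo\<^sup>2) * liminf (\<lambda>n. quot_energy d n i f)"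
proof -
  obtain k where ik: "i = Suc k" "k < d" using i by (cases i) auto
  interpret cube_step d i L lo hi "mono_rearr k f" unfolding ik(1) by (rule cube_step[OF ik(2)])
  define h where "h y = ennreal ((tstep i (mono_rearr k f) y i - y i)\<^sup>2)" for y
  have id: "(\<lambda>x. x i) \<in> borel_measurable (cube_measure d)"
    by (rule measurable_compose[OF coord_measurable[OF i] continuous_ivl01]) (intro continuous_intros)
  have h: "h \<in> borel_measurable (cube_measure d)"
    unfolding h_def using tstep_coord_measurable id by measurable
  have "trans_map d f x i = tstep i (mono_rearr k f) (trans_map k f x) i" for x
    using trans_map_below[of i d f x] ik by simp
  moreover have "trans_map k f x i = x i" for x using ik by (simp add: trans_map_above)
  ultimately have "(\<integral>\<^sup>+x. ennreal (f x) * ennreal ((trans_map d f x i - x i)\<^sup>2) \<partial>cube_measure d)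
      = (\<integral>\<^sup>+x. ennreal (f x) * h (trans_map k f x) \<partial>cube_measure d)"
    by (simp add: h_def)
  also have "\<dots> = (\<integral>\<^sup>+x. ennreal (mono_rearr k f x) * h x \<partial>cube_measure d)"
    using ik by (intro trans_map_push h) simp
  also have "\<dots> \<le> ennreal (hi / lo\<^sup>2) * liminf (\<lambda>n. quot_energy d n i (mono_rearr k f))"
    unfolding h_def by (rule tstep_cost)
  also have "\<dots> \<le> ennreal (hi / lo\<^sup>2) * liminf (\<lambda>n. quot_energy d n i f)"
    using quot_energy_rearr_le[OF ik(2)] unfolding ik(1)
    by (intro mult_left_mono Liminf_mono always_eventually) auto
  finally show ?thesis .
qed

lemma total_cost:
  "(\<integral>\<^sup>+x. ennreal (f x) * ennreal ((euclid_dist d x (trans_map d f x))\<^sup>2) \<partial>cube_measure d)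
    \<le> ennreal (hi / lo\<^sup>2) * (\<integral>\<^sup>+x. ennreal ((L2_set (neg_grad f x) {1..d})\<^sup>2) \<partial>cube_measure d)"
proof -
  have "\<exists>U. \<forall>i\<in>{1..d}. U i \<in> borel_measurable (cube_measure d) \<and>
      (AE x in cube_measure d. U i x = ennreal ((neg_grad f x i)\<^sup>2)) \<and>
      liminf (\<lambda>n. quot_energy d n i f) \<le> (\<integral>\<^sup>+x. U i x \<partial>cube_measure d)"
  proof (rule bchoice, rule ballI)
    fix i assume "i \<in> {1..d}"
    then obtain U where "U \<in> borel_measurable (cube_measure d)"
      "AE x in cube_measure d. U x = ennreal ((neg_grad f x i)\<^sup>2)"
      "liminf (\<lambda>n. quot_energy d n i f) \<le> (\<integral>\<^sup>+x. U x \<partial>cube_measure d)"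
      by (rule quot_energy_limit[OF f])
    then show "\<exists>U. U \<in> borel_measurable (cube_measure d) \<and>
      (AE x in cube_measure d. U x = ennreal ((neg_grad f x i)\<^sup>2)) \<and>
      liminf (\<lambda>n. quot_energy d n i f) \<le> (\<integral>\<^sup>+x. U x \<partial>cube_measure d)"
      by (intro exI[of _ U] conjI)
  qed
  then obtain U where U: "\<And>i. i \<in> {1..d} \<Longrightarrow> U i \<in> borel_measurable (cube_measure d)"
    "\<And>i. i \<in> {1..d} \<Longrightarrow> AE x in cube_measure d. U i x = ennreal ((neg_grad f x i)\<^sup>2)"
    "\<And>i. i \<in> {1..d} \<Longrightarrow> liminf (\<lambda>n. quot_energy d n i f) \<le> (\<integral>\<^sup>+x. U i x \<partial>cube_measure d)"
    by blast
  have sq: "ennreal ((L2_set g {1..d})\<^sup>2) = (\<Sum>i=1..d. ennreal ((g i)\<^sup>2))" for g :: "nat \<Rightarrow> real"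
    by (simp add: L2_set_def sum_nonneg)
  have fm: "f \<in> borel_measurable (cube_measure d)" by (rule lip1_measurable[OF f])
  have coord: "(\<lambda>x. x i) \<in> borel_measurable (cube_measure d)" if "i \<in> {1..d}" for i
    by (rule measurable_compose[OF coord_measurable[OF that] continuous_ivl01]) (intro continuous_intros)
  have T: "(\<lambda>x. trans_map d f x i) \<in> borel_measurable (cube_measure d)" if "i \<in> {1..d}" for i
    by (rule measurable_compose[OF trans_map_measurable[OF order_refl] coord[OF that]])
  have "(\<integral>\<^sup>+x. ennreal (f x) * ennreal ((euclid_dist d x (trans_map d f x))\<^sup>2) \<partial>cube_measure d)
      = (\<integral>\<^sup>+x. (\<Sum>i=1..d. ennreal (f x) * ennreal ((trans_map d f x i - x i)\<^sup>2)) \<partial>cube_measure d)"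
    unfolding euclid_dist_def sq sum_distrib_left by (simp add: power2_commute)
  also have "\<dots> = (\<Sum>i=1..d. \<integral>\<^sup>+x. ennreal (f x) * ennreal ((trans_map d f x i - x i)\<^sup>2) \<partial>cube_measure d)"
  proof (rule nn_integral_sum)
    fix i assume i: "i \<in> {1..d}"
    show "(\<lambda>x. ennreal (f x) * ennreal ((trans_map d f x i - x i)\<^sup>2)) \<in> borel_measurable (cube_measure d)"
      using fm coord[OF i] T[OF i] by measurable
  qed
  also have "\<dots> \<le> (\<Sum>i=1..d. ennreal (hi / lo\<^sup>2) * (\<integral>\<^sup>+x. U i x \<partial>cube_measure d))"
    by (intro sum_mono order_trans[OF coord_cost] mult_left_mono U(3)) auto
  also have "\<dots> = ennreal (hi / lo\<^sup>2) * (\<integral>\<^sup>+x. (\<Sum>i=1..d. U i x) \<partial>cube_measure d)"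
    by (simp only: sum_distrib_left[symmetric] nn_integral_sum[OF U(1)])
  also have "\<dots> \<le> ennreal (hi / lo\<^sup>2) * (\<integral>\<^sup>+x. ennreal ((L2_set (neg_grad f x) {1..d})\<^sup>2) \<partial>cube_measure d)"
  proof (intro mult_left_mono nn_integral_mono_AE)
    have "AE x in cube_measure d. \<forall>i\<in>{1..d}. U i x = ennreal ((neg_grad f x i)\<^sup>2)"
      by (rule AE_finite_allI) (use U(2) in auto)
    then show "AE x in cube_measure d. (\<Sum>i=1..d. U i x) \<le> ennreal ((L2_set (neg_grad f x) {1..d})\<^sup>2)"
      unfolding sq by eventually_elim (intro sum_mono, simp)
  qed simp
  finally show ?thesis .
qed

text \<open>The coupling is the image of the first measure under x -> (x, T x), with T the composed
  map; it charges only ordered pairs because each step moves its coordinate to the right.\<close>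

lemma directed_W2_sq_le_cost:
  "directed_W2_sq d (density (cube_measure d) (\<lambda>x. ennreal (f x))) (density (cube_measure d) (\<lambda>x. ennreal (mono_rearr d f x)))
    \<le> (\<integral>\<^sup>+x. ennreal (f x) * ennreal ((euclid_dist d x (trans_map d f x))\<^sup>2) \<partial>cube_measure d)"
proof -
  define M where "M = cube_measure d"
  define \<mu> where "\<mu> = density M (\<lambda>x. ennreal (f x))"
  define \<nu> where "\<nu> = density M (\<lambda>x. ennreal (mono_rearr d f x))"
  define T where "T = trans_map d f"
  define G where "G x = (x, T x)" for x
  define \<gamma> where "\<gamma> = distr \<mu> (\<mu> \<Otimes>\<^sub>M \<nu>) G"
  have sets [simp]: "sets \<mu> = sets M" "sets \<nu> = sets M" and space [simp]: "space \<mu> = cube d" "space \<nu> = cube d"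
    by (simp_all add: \<mu>_def \<nu>_def M_def)
  have fm: "(\<lambda>x. ennreal (f x)) \<in> borel_measurable M" and gm: "(\<lambda>x. ennreal (mono_rearr d f x)) \<in> borel_measurable M"
    using lip1_measurable[OF f] lip1_measurable[of d L "mono_rearr d f"] rearr[of d] unfolding M_def by auto
  have TM: "T \<in> M \<rightarrow>\<^sub>M M" unfolding T_def M_def by (rule trans_map_measurable) simp
  have T: "T \<in> \<mu> \<rightarrow>\<^sub>M \<nu>" using TM by (simp cong: measurable_cong_sets)
  have G: "G \<in> \<mu> \<rightarrow>\<^sub>M \<mu> \<Otimes>\<^sub>M \<nu>" unfolding G_def using T by (intro measurable_Pair) auto
  have coord: "(\<lambda>x. x i) \<in> borel_measurable M" if "i \<in> {1..d}" for i
    unfolding M_def by (rule measurable_compose[OF coord_measurable[OF that] continuous_ivl01]) (intro continuous_intros)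
  have fst_i: "(\<lambda>z. fst z i) \<in> borel_measurable (\<mu> \<Otimes>\<^sub>M \<nu>)" and snd_i: "(\<lambda>z. snd z i) \<in> borel_measurable (\<mu> \<Otimes>\<^sub>M \<nu>)"
    if "i \<in> {1..d}" for i
    using measurable_compose[OF measurable_fst, of "\<lambda>x. x i" \<mu> borel \<nu>] measurable_compose[OF measurable_snd, of "\<lambda>x. x i" \<nu> borel \<mu>]
      coord[OF that] by (simp_all cong: measurable_cong_sets)
  have "distr \<gamma> \<mu> fst = distr \<mu> \<mu> (fst \<circ> G)" unfolding \<gamma>_def by (rule distr_distr[OF measurable_fst G])
  also have "\<dots> = \<mu>" by (simp add: G_def comp_def)
  finally have marg1: "distr \<gamma> \<mu> fst = \<mu>" .
  have "distr \<gamma> \<nu> snd = distr \<mu> \<nu> (snd \<circ> G)" unfolding \<gamma>_def by (rule distr_distr[OF measurable_snd G])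
  also have "\<dots> = distr \<mu> \<nu> T" by (simp add: G_def comp_def)
  also have "\<dots> = \<nu>"
  proof (rule measure_eqI)
    fix A assume "A \<in> sets (distr \<mu> \<nu> T)"
    then have A: "A \<in> sets M" by simp
    then have Am: "indicator A \<in> borel_measurable M" by simp
    have "emeasure (distr \<mu> \<nu> T) A = (\<integral>\<^sup>+x. indicator A x \<partial>distr \<mu> \<nu> T)" using A by simp
    also have "\<dots> = (\<integral>\<^sup>+x. indicator A (T x) \<partial>\<mu>)" using A by (intro nn_integral_distr[OF T] borel_measurable_indicator) simp
    also have "\<dots> = (\<integral>\<^sup>+x. ennreal (f x) * indicator A (T x) \<partial>M)"
      unfolding \<mu>_def by (rule nn_integral_density[OF fm measurable_compose[OF TM Am]])
    also have "\<dots> = (\<integral>\<^sup>+x. ennreal (mono_rearr d f x) * indicator A x \<partial>M)"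
      using Am unfolding T_def M_def by (intro trans_map_push) auto
    also have "\<dots> = emeasure \<nu> A" unfolding \<nu>_def by (rule emeasure_density[OF gm A, symmetric])
    finally show "emeasure (distr \<mu> \<nu> T) A = emeasure \<nu> A" .
  qed simp
  finally have marg2: "distr \<gamma> \<nu> snd = \<nu>" .
  have \<gamma>_coupling: "\<gamma> \<in> couplings \<mu> \<nu>" unfolding couplings_def using marg1 marg2 by (simp add: \<gamma>_def)
  define N where "N = {(x, y) \<in> space \<gamma>. \<not> coord_le d x y}"
  have N_eq: "N = {z \<in> space (\<mu> \<Otimes>\<^sub>M \<nu>). \<exists>i\<in>{1..d}. snd z i < fst z i}"
    by (auto simp: N_def \<gamma>_def coord_le_def not_le split_beta)
  have N: "N \<in> sets (\<mu> \<Otimes>\<^sub>M \<nu>)" unfolding N_eq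
  proof (rule sets.sets_Collect_finite_Ex)
    fix i assume "i \<in> {1..d}"
    then show "{z \<in> space (\<mu> \<Otimes>\<^sub>M \<nu>). snd z i < fst z i} \<in> sets (\<mu> \<Otimes>\<^sub>M \<nu>)"
      by (intro borel_measurable_less fst_i snd_i)
  qed simp
  have "emeasure \<gamma> N = emeasure \<mu> (G -` N \<inter> space \<mu>)" unfolding \<gamma>_def by (rule emeasure_distr[OF G N])
  also have "G -` N \<inter> space \<mu> = {}"
  proof (rule equals0I)
    fix x assume "x \<in> G -` N \<inter> space \<mu>"
    then obtain i where "x \<in> cube d" "i \<in> {1..d}" "T x i < x i" by (auto simp: N_eq G_def)
    then show False using trans_map_ge[of i x] by (simp add: T_def)
  qed
  finally have "N \<in> null_sets \<gamma>" using N by (auto simp: null_sets_def \<gamma>_def)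
  then have "directed_W2_sq d \<mu> \<nu> \<le> (\<integral>\<^sup>+(x, y). ennreal ((euclid_dist d x y)\<^sup>2) \<partial>\<gamma>)"
    unfolding directed_W2_sq_def N_def using \<gamma>_coupling by (intro INF_lower) simp
  also have "\<dots> = (\<integral>\<^sup>+z. ennreal ((euclid_dist d (fst z) (snd z))\<^sup>2) \<partial>\<gamma>)" by (simp only: case_prod_beta')
  also have "\<dots> = (\<integral>\<^sup>+x. ennreal ((euclid_dist d x (T x))\<^sup>2) \<partial>\<mu>)"
  proof -
    have "(\<lambda>z. \<Sum>i\<in>{1..d}. (fst z i - snd z i)\<^sup>2) \<in> borel_measurable (\<mu> \<Otimes>\<^sub>M \<nu>)"
      by (intro borel_measurable_sum borel_measurable_power borel_measurable_diff fst_i snd_i)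
    then have "(\<lambda>z. ennreal ((euclid_dist d (fst z) (snd z))\<^sup>2)) \<in> borel_measurable (\<mu> \<Otimes>\<^sub>M \<nu>)"
      by (simp add: euclid_dist_def L2_set_def sum_nonneg)
    then show ?thesis unfolding \<gamma>_def by (subst nn_integral_distr[OF G]) (simp_all add: G_def)
  qed
  also have "\<dots> = (\<integral>\<^sup>+x. ennreal (f x) * ennreal ((euclid_dist d x (T x))\<^sup>2) \<partial>M)"
  proof -
    have "(\<lambda>x. \<Sum>i\<in>{1..d}. (x i - T x i)\<^sup>2) \<in> borel_measurable M"
      by (intro borel_measurable_sum borel_measurable_power borel_measurable_diff coord measurable_compose[OF TM coord])
    then have "(\<lambda>x. ennreal ((euclid_dist d x (T x))\<^sup>2)) \<in> borel_measurable M"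
      by (simp add: euclid_dist_def L2_set_def sum_nonneg)
    then show ?thesis unfolding \<mu>_def by (rule nn_integral_density[OF fm])
  qed
  finally show ?thesis unfolding \<mu>_def \<nu>_def M_def T_def .
qed

end

theorem theorem6p51:
  "\<exists>C::real. C > 0 \<and>
    (\<forall>(d::nat) (a::real) (f :: (nat \<Rightarrow> real) \<Rightarrow> real).
       d \<ge> 1 \<and> 0 < a \<and> a < 1 \<and>
       lipschitz_cube d f \<and>
       (\<forall>x\<in>cube d. 1 - a \<le> f x \<and> f x \<le> 1 + a) \<and>
       (\<integral>x. f x \<partial>cube_measure d) = 1 \<longrightarrow>
       directed_W2_sq d
         (density (cube_measure d) (\<lambda>x. ennreal (f x)))
         (density (cube_measure d) (\<lambda>x. ennreal (mono_rearr d f x)))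
       \<le> ennreal (C * (1 + a)\<^sup>2 / (1 - a) ^ 3) *
          (\<integral>\<^sup>+ x. ennreal ((L2_set (neg_grad f x) {1..d})\<^sup>2) \<partial>cube_measure d))"
proof (intro exI[of _ 1] conjI allI impI)
  fix d a and f :: "(nat \<Rightarrow> real) \<Rightarrow> real"
  assume asm: "d \<ge> 1 \<and> 0 < a \<and> a < 1 \<and> lipschitz_cube d f \<and>
    (\<forall>x\<in>cube d. 1 - a \<le> f x \<and> f x \<le> 1 + a) \<and> (\<integral>x. f x \<partial>cube_measure d) = 1"
  then obtain L where L: "lip1 d L f" using lipschitz_cube_lip1 by blast
  interpret cube_rearr d L "1 - a" "1 + a" f
    by unfold_locales (use L asm in auto)
  \<comment> \<open>\<open>total_cost\<close> has the constant hi / lo^2 = (1 + a)/(1 - a)^2; since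
    1 - a <= 1 + a, this is within the claimed bound with C = 1.\<close>
  have "(1 + a) / (1 - a)\<^sup>2 = (1 + a) * (1 - a) / (1 - a) ^ 3"
    using asm by (simp add: power2_eq_square power3_eq_cube)
  also have "\<dots> \<le> 1 * (1 + a)\<^sup>2 / (1 - a) ^ 3"
  proof (rule divide_right_mono)
    show "(1 + a) * (1 - a) \<le> 1 * (1 + a)\<^sup>2"
      unfolding power2_eq_square mult_1 using asm by (intro mult_left_mono) auto
  qed (use asm in simp)
  finally show "directed_W2_sq d (density (cube_measure d) (\<lambda>x. ennreal (f x)))
      (density (cube_measure d) (\<lambda>x. ennreal (mono_rearr d f x)))
    \<le> ennreal (1 * (1 + a)\<^sup>2 / (1 - a) ^ 3) *
      (\<integral>\<^sup>+ x. ennreal ((L2_set (neg_grad f x) {1..d})\<^sup>2) \<partial>cube_measure d)"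
    by (intro order_trans[OF order_trans[OF directed_W2_sq_le_cost total_cost]] mult_right_mono ennreal_leI) auto
qed simp

end
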